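(* Let $d\ge1$, $\frac12<\alpha<1$, and let $\Omega\subset\mathbb{R}^d$ be a bounded $C^{1,1}$ domain. Let $K_1\subset\Omega$ be compact and let $\beta\in C_c^\infty(\Omega)$ be a cut-off function with $\beta=1$ in $K_1$ and $\beta=0$ outside a small neighbourhood of $K_1$ contained in $\Omega$ (so $\operatorname{supp}\beta\subset\subset\Omega$). Then there is a constant $C$, independent of $\lambda$ and $e_\lambda$, such that for every Dirichlet eigenfunction $e_\lambda$ of $(-\Delta)^{\alpha/2}$ on $\Omega$ with eigenvalue $\lambda$, $$\big\|[\beta,(-\Delta)^{\alpha/2}]e_\lambda\big\|_{L^2(\mathbb{R}^d)}\le C\,\lambda^{1-\frac1\alpha}\,\|e_\lambda\|_{L^2(\mathbb{R}^d)}.$$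
   Context: For $0<\alpha<2$, $(-\Delta)^{\alpha/2}$ denotes the Fourier multiplier on $\mathbb{R}^d$ with symbol $|\xi|^\alpha$; pointwise, $(-\Delta)^{\alpha/2}u(x)=c_{d,\alpha}\,\mathrm{p.v.}\int_{\mathbb{R}^d}\frac{u(x)-u(y)}{|x-y|^{d+\alpha}}\,dy$ with $c_{d,\alpha}=\frac{2^\alpha\Gamma(\frac{d+\alpha}{2})}{\pi^{d/2}|\Gamma(-\frac{\alpha}{2})|}$. A Dirichlet eigenfunction of $(-\Delta)^{\alpha/2}$ on $\Omega$ with eigenvalue $\lambda$ (restricted fractional Laplacian) is a function $e_\lambda\in H^{\alpha/2}(\mathbb{R}^d)$ with $(-\Delta)^{\alpha/2}e_\lambda=\lambda e_\lambda$ in $\Omega$ and $e_\lambda=0$ in $\mathbb{R}^d\setminus\Omega$. The commutator is $[\beta,(-\Delta)^{\alpha/2}]u=\beta(-\Delta)^{\alpha/2}u-(-\Delta)^{\alpha/2}(\beta u)$. The constant $C$ may depend on $\Omega,d,\alpha,\beta$. *)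

theory Defs
  imports "HOL-Analysis.Analysis"
begin

subsection \<open>Domains of class \<open>C\<^sup>1\<^sup>,\<^sup>1\<close>\<close>

definition C11_function :: "('a::euclidean_space \<Rightarrow> real) \<Rightarrow> bool" where
  "C11_function \<gamma> \<longleftrightarrow>
     (\<exists>G L. (\<forall>x. (\<gamma> has_derivative (\<lambda>h. G x \<bullet> h)) (at x)) \<and> L-lipschitz_on UNIV G)"

text \<open>
  Near each boundary point, the domain is the region above the graph of a
  \<open>C\<^sup>1\<^sup>,\<^sup>1\<close> function in a rotated coordinate system whose last axis is the unit
  vector \<open>\<nu>\<close>. The function \<open>\<gamma>\<close> is only ever evaluated on the hyperplane orthogonal
  to \<open>\<nu>\<close>, at the projection of \<open>x\<close>; in dimension one that hyperplane is a point.
\<close>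

definition C11_domain :: "'a::euclidean_space set \<Rightarrow> bool" where
  "C11_domain \<Omega> \<longleftrightarrow> open \<Omega> \<and> connected \<Omega> \<and> \<Omega> \<noteq> {} \<and>
     (\<forall>p \<in> frontier \<Omega>. \<exists>r>0. \<exists>\<nu> \<gamma>. norm \<nu> = 1 \<and> C11_function \<gamma> \<and>
        \<Omega> \<inter> ball p r = {x \<in> ball p r. x \<bullet> \<nu> > \<gamma> (x - (x \<bullet> \<nu>) *\<^sub>R \<nu>)})"

subsection \<open>Test functions and distributions\<close>

fun C_k :: "nat \<Rightarrow> ('a::euclidean_space \<Rightarrow> 'b::real_normed_vector) \<Rightarrow> bool" where
  "C_k 0 f \<longleftrightarrow> continuous_on UNIV f"
| "C_k (Suc k) f \<longleftrightarrow> (\<forall>x. f differentiable (at x)) \<and>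
     (\<forall>i\<in>Basis. C_k k (\<lambda>x. frechet_derivative f (at x) i))"

definition test_function :: "'a::euclidean_space set \<Rightarrow> ('a \<Rightarrow> complex) \<Rightarrow> bool" where
  "test_function \<Omega> \<phi> \<longleftrightarrow> (\<forall>k. C_k k \<phi>) \<and>
     compact (closure {x. \<phi> x \<noteq> 0}) \<and> closure {x. \<phi> x \<noteq> 0} \<subseteq> \<Omega>"

text \<open>
  A distribution is given by its action on complex-valued test functions; the pairing is
  bilinear (no complex conjugation).
\<close>

type_synonym 'a distribution = "('a \<Rightarrow> complex) \<Rightarrow> complex"

definition agrees_on :: "'a::euclidean_space set \<Rightarrow> 'a distribution \<Rightarrow> ('a \<Rightarrow> complex) \<Rightarrow> bool" where
  "agrees_on \<Omega> T g \<longleftrightarrow> (\<forall>\<phi>. test_function \<Omega> \<phi> \<longrightarrow> T \<phi> = (\<integral>x. g x * \<phi> x \<partial>lborel))"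

definition smooth_mult :: "('a \<Rightarrow> complex) \<Rightarrow> 'a distribution \<Rightarrow> 'a distribution" where
  "smooth_mult \<beta> T = (\<lambda>\<phi>. T (\<lambda>x. \<beta> x * \<phi> x))"

subsection \<open>Square integrable functions and the Fourier transform\<close>

definition square_integrable :: "('a::euclidean_space \<Rightarrow> complex) \<Rightarrow> bool" where
  "square_integrable u \<longleftrightarrow>
     u \<in> borel_measurable lborel \<and> integrable lborel (\<lambda>x. (cmod (u x))\<^sup>2)"

definition L2norm :: "('a::euclidean_space \<Rightarrow> complex) \<Rightarrow> real" where
  "L2norm u = sqrt (\<integral>x. (cmod (u x))\<^sup>2 \<partial>lborel)"

definition fourier :: "('a::euclidean_space \<Rightarrow> complex) \<Rightarrow> 'a \<Rightarrow> complex" where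
  "fourier u \<xi> = (\<integral>x. cis (- (x \<bullet> \<xi>)) * u x \<partial>lborel)"

text \<open>
  The Fourier--Plancherel transform: the limit in \<open>L\<^sup>2\<close> of the Fourier integrals of the
  truncations of \<open>u\<close> to large balls. It is unique up to null sets, and \<open>fourier_L2\<close> picks a
  representative.
\<close>

definition is_fourier_L2 :: "('a::euclidean_space \<Rightarrow> complex) \<Rightarrow> ('a \<Rightarrow> complex) \<Rightarrow> bool" where
  "is_fourier_L2 u v \<longleftrightarrow> square_integrable v \<and>
     ((\<lambda>R. \<integral>\<^sup>+\<xi>. ennreal ((cmod (v \<xi> - fourier (\<lambda>x. indicator (cball 0 R) x *\<^sub>R u x) \<xi>))\<^sup>2) \<partial>lborel)
        \<longlongrightarrow> 0) at_top"

definition fourier_L2 :: "('a::euclidean_space \<Rightarrow> complex) \<Rightarrow> 'a \<Rightarrow> complex" where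
  "fourier_L2 u = (SOME v. is_fourier_L2 u v)"

definition sobolev :: "real \<Rightarrow> ('a::euclidean_space \<Rightarrow> complex) \<Rightarrow> bool" where
  "sobolev s u \<longleftrightarrow> square_integrable u \<and>
     square_integrable (\<lambda>\<xi>. (1 + (norm \<xi>)\<^sup>2) powr (s / 2) *\<^sub>R fourier_L2 u \<xi>)"

subsection \<open>The fractional Laplacian\<close>

text \<open>
  For square integrable \<open>u\<close>, \<open>frac_laplacian \<alpha> u\<close> is the distribution \<open>(-\<Delta>)\<^sup>\<alpha>\<^sup>/\<^sup>2 u\<close> whose
  Fourier transform is \<open>|\<xi>|\<^sup>\<alpha>\<close> times that of \<open>u\<close>. Its action on a test function is written
  with Parseval's formula for the bilinear pairing, which reads
  \<open>\<integral> f \<phi> = (2\<pi>)\<^sup>-\<^sup>d \<integral> F f(\<xi>) F \<phi>(-\<xi>) d\<xi>\<close> in the normalisation of \<open>fourier\<close>. The integral converges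
  absolutely because the Fourier transform of a test function decays rapidly.
\<close>

definition frac_laplacian ::
    "real \<Rightarrow> ('a::euclidean_space \<Rightarrow> complex) \<Rightarrow> 'a distribution" where
  "frac_laplacian \<alpha> u = (\<lambda>\<phi>.
     (\<integral>\<xi>. (norm \<xi> powr \<alpha>) *\<^sub>R fourier_L2 u \<xi> * fourier \<phi> (- \<xi>) \<partial>lborel) / (2 * pi) ^ DIM('a))"

definition commutator ::
    "('a::euclidean_space \<Rightarrow> complex) \<Rightarrow> real \<Rightarrow> ('a \<Rightarrow> complex) \<Rightarrow> 'a distribution" where
  "commutator \<beta> \<alpha> u = (\<lambda>\<phi>.
     smooth_mult \<beta> (frac_laplacian \<alpha> u) \<phi> - frac_laplacian \<alpha> (\<lambda>x. \<beta> x * u x) \<phi>)"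

text \<open>The zero function is not excluded here.\<close>

definition dirichlet_eigenfunction ::
    "real \<Rightarrow> 'a::euclidean_space set \<Rightarrow> real \<Rightarrow> ('a \<Rightarrow> complex) \<Rightarrow> bool" where
  "dirichlet_eigenfunction \<alpha> \<Omega> \<mu> e \<longleftrightarrow> sobolev (\<alpha> / 2) e \<and>
     agrees_on \<Omega> (frac_laplacian \<alpha> e) (\<lambda>x. complex_of_real \<mu> * e x) \<and>
     (AE x in lborel. x \<notin> \<Omega> \<longrightarrow> e x = 0)"

end

theory Submission imports Defs "HOL-Probability.Probability"
begin

text \<open>
  With \<open>K(h) = c |h|\<^sup>-\<^sup>d\<^sup>-\<^sup>\<alpha>\<close> the kernel of \<open>(-\<Delta>)\<^sup>\<alpha>\<^sup>/\<^sup>2\<close>, the commutator is the integral operator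
  \<open>u \<mapsto> \<integral> K(x - y) (\<beta>(y) - \<beta>(x)) u(y) dy\<close> (\<open>comm_op\<close>). In Fourier variables its kernel is
  \<open>(|\<eta>|\<^sup>\<alpha> - |\<xi>|\<^sup>\<alpha>) F \<beta> (\<xi> - \<eta>)\<close> up to a constant, so it is of order \<open>\<alpha> - 1\<close>. An eigenfunction with eigenvalue \<open>\<lambda>\<close>
  oscillates at frequency \<open>\<lambda>\<^sup>1\<^sup>/\<^sup>\<alpha>\<close>, and an operator of order \<open>\<alpha> - 1\<close> should gain the factor
  \<open>(\<lambda>\<^sup>1\<^sup>/\<^sup>\<alpha>)\<^sup>\<alpha>\<^sup>-\<^sup>1 = \<lambda>\<^sup>1\<^sup>-\<^sup>1\<^sup>/\<^sup>\<alpha>\<close>. The difficulty is that the equation holds inside \<open>\<Omega>\<close> only, while the operator is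
  nonlocal. The equation is therefore always tested against functions
  supported in \<open>\<Omega>\<close>, and each time the resulting bound is interpolated with one that holds for every
  square integrable function (\<open>interpolate_bound\<close>, with exponent \<open>1/\<alpha> - 1\<close>). Split \<open>e = \<zeta> e + (1 - \<zeta>) e\<close>,
  where \<open>\<zeta>\<close> is a cut-off in \<open>\<Omega>\<close> that is \<open>1\<close> near the support of \<open>\<beta>\<close>.

  Interior part. Testing with \<open>\<zeta>(x) e\<^sup>-\<^sup>i\<^sup>x\<^sup>\<xi>\<close> yields \<open>\<lambda> |F(\<zeta> e)(\<xi>)| \<le> (1 + |\<xi>|)\<^sup>\<alpha> G(\<xi>)\<close>, where \<open>G\<close> is a convolution
  of \<open>|F e|\<close> with an integrable function that also majorises \<open>|F(\<zeta> e)|\<close>. Interpolation gives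
  \<open>(1 + |\<xi>|)\<^sup>\<alpha>\<^sup>-\<^sup>1 |F(\<zeta> e)(\<xi>)| \<le> \<lambda>\<^sup>1\<^sup>-\<^sup>1\<^sup>/\<^sup>\<alpha> G(\<xi>)\<close> (\<open>eigen_negative_norm\<close>), and the commutator is bounded in terms of the
  left-hand side (\<open>comm_op_interior\<close>).

  Boundary part. On the support of \<open>\<beta>\<close> the commutator of \<open>(1 - \<zeta>) e\<close> is the pairing of \<open>e\<close> with a Lipschitz
  function, because the singularity of \<open>K\<close> is avoided; elsewhere it vanishes. Such a function need not
  vanish at the boundary. Cut it dyadically according to the distance to the boundary: a layer of thickness \<open>\<delta>\<close>
  has measure \<open>O(\<delta>)\<close> (\<open>boundary_layer_measure\<close>), hence the pairing with a piece is \<open>O(\<delta>\<^sup>1\<^sup>/\<^sup>2)\<close> by Cauchy--Schwarz and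
  \<open>O(\<lambda>\<^sup>-\<^sup>1 \<delta>\<^sup>1\<^sup>/\<^sup>2\<^sup>-\<^sup>\<alpha>)\<close> by the equation. Interpolation gives \<open>\<lambda>\<^sup>1\<^sup>-\<^sup>1\<^sup>/\<^sup>\<alpha> \<delta>\<^sup>\<alpha>\<^sup>-\<^sup>1\<^sup>/\<^sup>2\<close> (\<open>layer_piece_bound\<close>), and the sum over the
  layers converges because \<open>\<alpha> > 1/2\<close> (\<open>eigen_boundary_bound\<close>, \<open>comm_op_boundary\<close>).

  The argument needs \<open>\<lambda> > 0\<close>. For \<open>\<lambda> \<le> 0\<close> the eigenfunction vanishes: approximating it from inside, by inward
  translation and mollification, allows testing the equation with \<open>e\<close> itself, so that
  \<open>\<integral> (|\<xi>|\<^sup>\<alpha> - \<lambda>) |F e(\<xi>)|\<^sup>2 d\<xi> = 0\<close> (\<open>weak_eigen_nonpos\<close>).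

  The preparatory sections develop the Fourier transform of integrable functions through Gaussians
  (inversion and the two Plancherel inequalities), and identify the multiplier \<open>|\<xi>|\<^sup>\<alpha>\<close> with the singular integral
  on test functions (\<open>fractional_symbol\<close>, \<open>fracL_singular_integral\<close>).
\<close>

section \<open>Lebesgue measure, convolution inequalities and translations\<close>

lemma nn_integral_lborel_affine:
  fixes f :: "'a::euclidean_space \<Rightarrow> ennreal"
  assumes [measurable]: "f \<in> borel_measurable borel" and c: "c \<noteq> 0"
  shows "(\<integral>\<^sup>+x. f x \<partial>lborel) = ennreal (\<bar>c\<bar> ^ DIM('a)) * (\<integral>\<^sup>+x. f (t + c *\<^sub>R x) \<partial>lborel)"
  by (subst lborel_affine[OF c, of t])
     (simp add: nn_integral_density nn_integral_distr nn_integral_cmult)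

lemma integrable_lborel_affine:
  fixes f :: "'a::euclidean_space \<Rightarrow> 'b :: {banach, second_countable_topology}"
  assumes f: "integrable lborel f" and c: "c \<noteq> 0"
  shows "integrable lborel (\<lambda>x. f (t + c *\<^sub>R x))"
proof -
  have [measurable]: "f \<in> borel_measurable borel" using f by auto
  have "(\<integral>\<^sup>+x. ennreal (norm (f x)) \<partial>lborel) < \<infinity>" using f by (auto simp: integrable_iff_bounded)
  hence "ennreal (\<bar>c\<bar> ^ DIM('a)) * (\<integral>\<^sup>+x. ennreal (norm (f (t + c *\<^sub>R x))) \<partial>lborel) < \<infinity>"
    using nn_integral_lborel_affine[of "\<lambda>x. ennreal (norm (f x))" c t] c by simp
  hence "(\<integral>\<^sup>+x. ennreal (norm (f (t + c *\<^sub>R x))) \<partial>lborel) < \<infinity>"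
    using c by (auto simp: ennreal_mult_less_top)
  thus ?thesis by (auto simp: integrable_iff_bounded)
qed

lemma integrable_lborel_affine_iff:
  fixes f :: "'a::euclidean_space \<Rightarrow> 'b :: {banach, second_countable_topology}"
  assumes c: "c \<noteq> 0"
  shows "integrable lborel (\<lambda>x. f (t + c *\<^sub>R x)) \<longleftrightarrow> integrable lborel f"
proof
  assume "integrable lborel (\<lambda>x. f (t + c *\<^sub>R x))"
  from integrable_lborel_affine[OF this, of "1/c" "- (1/c) *\<^sub>R t"] c
  show "integrable lborel f" by (simp add: algebra_simps)
qed (use integrable_lborel_affine c in blast)

lemma integral_lborel_affine:
  fixes f :: "'a::euclidean_space \<Rightarrow> 'b :: {banach, second_countable_topology}"
  assumes c: "c \<noteq> 0"
  shows "(\<integral>x. f x \<partial>lborel) = (\<bar>c\<bar> ^ DIM('a)) *\<^sub>R (\<integral>x. f (t + c *\<^sub>R x) \<partial>lborel)"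
proof (cases "integrable lborel f")
  case True
  hence [measurable]: "f \<in> borel_measurable borel" by auto
  show ?thesis using c True
    by (subst lborel_affine[OF c, of t])
       (simp add: integral_density integral_distr integrable_lborel_affine)
next
  case False
  thus ?thesis using integrable_lborel_affine_iff[OF c, of f t]
    by (simp add: not_integrable_integral_eq)
qed

lemma nn_integral_lborel_translate:
  fixes f :: "'a::euclidean_space \<Rightarrow> ennreal"
  assumes "f \<in> borel_measurable borel"
  shows "(\<integral>\<^sup>+x. f (t + x) \<partial>lborel) = (\<integral>\<^sup>+x. f x \<partial>lborel)"
  using nn_integral_lborel_affine[OF assms, of 1 t] by simp

lemma nn_integral_lborel_reflect:
  fixes f :: "'a::euclidean_space \<Rightarrow> ennreal"
  assumes "f \<in> borel_measurable borel"
  shows "(\<integral>\<^sup>+x. f (t - x) \<partial>lborel) = (\<integral>\<^sup>+x. f x \<partial>lborel)"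
  using nn_integral_lborel_affine[OF assms, of "-1" t] by simp

lemma integral_lborel_translate:
  fixes f :: "'a::euclidean_space \<Rightarrow> 'b :: {banach, second_countable_topology}"
  shows "(\<integral>x. f (t + x) \<partial>lborel) = (\<integral>x. f x \<partial>lborel)"
  using integral_lborel_affine[of 1 f t] by simp

lemma integral_lborel_reflect:
  fixes f :: "'a::euclidean_space \<Rightarrow> 'b :: {banach, second_countable_topology}"
  shows "(\<integral>x. f (t - x) \<partial>lborel) = (\<integral>x. f x \<partial>lborel)"
  using integral_lborel_affine[of "-1" f t] by simp

lemma integrable_lborel_translate:
  fixes f :: "'a::euclidean_space \<Rightarrow> 'b :: {banach, second_countable_topology}"
  assumes "integrable lborel f" shows "integrable lborel (\<lambda>x. f (t + x))"
  using integrable_lborel_affine[OF assms, of 1 t] by simp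

lemma integrable_lborel_reflect:
  fixes f :: "'a::euclidean_space \<Rightarrow> 'b :: {banach, second_countable_topology}"
  assumes "integrable lborel f" shows "integrable lborel (\<lambda>x. f (t - x))"
  using integrable_lborel_affine[OF assms, of "-1" t] by simp

lemma young_L1:
  fixes k f :: "'a::euclidean_space \<Rightarrow> ennreal"
  assumes [measurable]: "k \<in> borel_measurable borel" "f \<in> borel_measurable borel"
  shows "(\<integral>\<^sup>+x. (\<integral>\<^sup>+y. k (x - y) * f y \<partial>lborel) \<partial>lborel)
       = (\<integral>\<^sup>+x. k x \<partial>lborel) * (\<integral>\<^sup>+y. f y \<partial>lborel)"
proof -
  have "(\<integral>\<^sup>+x. (\<integral>\<^sup>+y. k (x - y) * f y \<partial>lborel) \<partial>lborel)
      = (\<integral>\<^sup>+y. (\<integral>\<^sup>+x. k (x - y) * f y \<partial>lborel) \<partial>lborel)"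
    by (rule lborel_pair.Fubini'[symmetric]) measurable
  also have "\<dots> = (\<integral>\<^sup>+y. (\<integral>\<^sup>+x. k x \<partial>lborel) * f y \<partial>lborel)"
    using nn_integral_lborel_translate[of k "- _"]
    by (simp add: nn_integral_multc)
  also have "\<dots> = (\<integral>\<^sup>+x. k x \<partial>lborel) * (\<integral>\<^sup>+y. f y \<partial>lborel)"
    by (simp add: nn_integral_cmult)
  finally show ?thesis .
qed

text \<open>Young's inequality for \<open>L\<^sup>1 * L\<^sup>2\<close>: split \<open>k f\<close> as \<open>\<surd>k \<cdot> (\<surd>k f)\<close> and use
  Cauchy--Schwarz, which leaves the \<open>L\<^sup>1\<close> convolution of \<open>k\<close> with \<open>f\<^sup>2\<close>.\<close>

lemma young_L2:
  fixes k f :: "'a::euclidean_space \<Rightarrow> real"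
  assumes [measurable]: "k \<in> borel_measurable borel" "f \<in> borel_measurable borel"
    and k: "\<And>x. 0 \<le> k x" and f: "\<And>x. 0 \<le> f x"
  shows "(\<integral>\<^sup>+x. (\<integral>\<^sup>+y. ennreal (k (x - y) * f y) \<partial>lborel)\<^sup>2 \<partial>lborel)
       \<le> (\<integral>\<^sup>+x. ennreal (k x) \<partial>lborel)\<^sup>2 * (\<integral>\<^sup>+y. ennreal ((f y)\<^sup>2) \<partial>lborel)"
proof -
  let ?k = "\<lambda>x. ennreal (k x)"
  have "(\<integral>\<^sup>+y. ennreal (k (x - y) * f y) \<partial>lborel)\<^sup>2
      \<le> (\<integral>\<^sup>+x. ?k x \<partial>lborel) * (\<integral>\<^sup>+y. ?k (x - y) * ennreal ((f y)\<^sup>2) \<partial>lborel)" for x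
  proof -
    have "(\<integral>\<^sup>+y. ennreal (k (x - y) * f y) \<partial>lborel)
        = (\<integral>\<^sup>+y. ennreal (sqrt (k (x - y))) * ennreal (sqrt (k (x - y)) * f y) \<partial>lborel)"
      by (intro nn_integral_cong) (simp add: ennreal_mult[symmetric] k f mult.assoc[symmetric])
    also have "(\<dots>)\<^sup>2 \<le> (\<integral>\<^sup>+y. (ennreal (sqrt (k (x - y))))\<^sup>2 \<partial>lborel)
         * (\<integral>\<^sup>+y. (ennreal (sqrt (k (x - y)) * f y))\<^sup>2 \<partial>lborel)"
      by (rule Cauchy_Schwarz_nn_integral) measurable
    also have "\<dots> = (\<integral>\<^sup>+y. ?k (x - y) \<partial>lborel) * (\<integral>\<^sup>+y. ?k (x - y) * ennreal ((f y)\<^sup>2) \<partial>lborel)"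
      by (intro arg_cong2[where f="(*)"] nn_integral_cong)
         (simp_all add: ennreal_power k f power_mult_distrib ennreal_mult[symmetric])
    also have "(\<integral>\<^sup>+y. ?k (x - y) \<partial>lborel) = (\<integral>\<^sup>+x. ?k x \<partial>lborel)"
      by (rule nn_integral_lborel_reflect) measurable
    finally show ?thesis .
  qed
  hence "(\<integral>\<^sup>+x. (\<integral>\<^sup>+y. ennreal (k (x - y) * f y) \<partial>lborel)\<^sup>2 \<partial>lborel)
      \<le> (\<integral>\<^sup>+x. (\<integral>\<^sup>+x. ?k x \<partial>lborel) * (\<integral>\<^sup>+y. ?k (x - y) * ennreal ((f y)\<^sup>2) \<partial>lborel) \<partial>lborel)"
    by (intro nn_integral_mono)
  also have "\<dots> = (\<integral>\<^sup>+x. ?k x \<partial>lborel) * (\<integral>\<^sup>+x. (\<integral>\<^sup>+y. ?k (x - y) * ennreal ((f y)\<^sup>2) \<partial>lborel) \<partial>lborel)"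
    by (rule nn_integral_cmult) measurable
  also have "\<dots> = (\<integral>\<^sup>+x. ennreal (k x) \<partial>lborel)\<^sup>2 * (\<integral>\<^sup>+y. ennreal ((f y)\<^sup>2) \<partial>lborel)"
    by (subst young_L1) (simp_all add: power2_eq_square mult.assoc)
  finally show ?thesis .
qed

lemma norm_integral_le_nn_integral:
  fixes f :: "'a \<Rightarrow> 'b::{banach, second_countable_topology}"
  shows "ennreal (norm (integral\<^sup>L M f)) \<le> (\<integral>\<^sup>+x. ennreal (norm (f x)) \<partial>M)"
  by (cases "integrable M f") (auto intro: integral_norm_bound_ennreal simp: not_integrable_integral_eq)

lemma integrable_mult_bounded:
  fixes f g :: "_ \<Rightarrow> complex"
  assumes "integrable M f" "g \<in> borel_measurable M" "\<And>x. cmod (g x) \<le> B"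
  shows "integrable M (\<lambda>x. f x * g x)"
proof (rule Bochner_Integration.integrable_bound[where f="\<lambda>x. B *\<^sub>R f x"])
  show "integrable M (\<lambda>x. B *\<^sub>R f x)" using assms by simp
  show "(\<lambda>x. f x * g x) \<in> borel_measurable M" using assms by auto
  show "AE x in M. norm (f x * g x) \<le> norm (B *\<^sub>R f x)"
  proof (intro AE_I2)
    fix x have "cmod (f x) * cmod (g x) \<le> cmod (f x) * \<bar>B\<bar>"
      using assms(3)[of x] by (intro mult_left_mono) auto
    thus "norm (f x * g x) \<le> norm (B *\<^sub>R f x)" by (simp add: norm_mult mult.commute)
  qed
qed

text \<open>Fubini's theorem in the form used for oscillatory integrals: a product of two integrable
  functions, one in each variable, times a bounded coupling.\<close>

lemma fubini_bounded:
  fixes f :: "'a::euclidean_space \<Rightarrow> complex" and g :: "'b::euclidean_space \<Rightarrow> complex"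
    and h :: "'a \<Rightarrow> 'b \<Rightarrow> complex"
  assumes f: "integrable lborel f" and g: "integrable lborel g"
    and [measurable]: "case_prod h \<in> borel_measurable (borel \<Otimes>\<^sub>M borel)"
    and B: "\<And>x y. cmod (h x y) \<le> B"
  shows "(\<integral>x. (\<integral>y. f x * g y * h x y \<partial>lborel) \<partial>lborel)
       = (\<integral>y. (\<integral>x. f x * g y * h x y \<partial>lborel) \<partial>lborel)"
    and "integrable lborel (\<lambda>x. (\<integral>y. f x * g y * h x y \<partial>lborel))"
    and "integrable lborel (\<lambda>y. (\<integral>x. f x * g y * h x y \<partial>lborel))"
proof -
  have [measurable]: "f \<in> borel_measurable borel" "g \<in> borel_measurable borel"
    using f g by auto
  have 1: "integrable (lborel \<Otimes>\<^sub>M lborel) (\<lambda>(x,y). f x * g y)"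
  proof (rule lborel_pair.Fubini_integrable)
    show "integrable lborel (\<lambda>x. \<integral>y. norm ((\<lambda>(x,y). f x * g y) (x, y)) \<partial>lborel)"
      using f by (simp add: norm_mult)
    show "AE x in lborel. integrable lborel (\<lambda>y. (\<lambda>(x,y). f x * g y) (x, y))" using g by simp
  qed measurable
  have "integrable (lborel \<Otimes>\<^sub>M lborel) (\<lambda>p. (\<lambda>(x,y). f x * g y) p * case_prod h p)"
    by (rule integrable_mult_bounded[OF 1, of _ B]) (use B in \<open>auto\<close>)
  hence 2: "integrable (lborel \<Otimes>\<^sub>M lborel) (\<lambda>(x,y). f x * g y * h x y)"
    by (simp add: case_prod_beta')
  show "(\<integral>x. (\<integral>y. f x * g y * h x y \<partial>lborel) \<partial>lborel)
       = (\<integral>y. (\<integral>x. f x * g y * h x y \<partial>lborel) \<partial>lborel)"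
    using lborel_pair.Fubini_integral[OF 2] by simp
  show "integrable lborel (\<lambda>x. (\<integral>y. f x * g y * h x y \<partial>lborel))"
    using lborel_pair.integrable_fst[OF 2] .
  show "integrable lborel (\<lambda>y. (\<integral>x. f x * g y * h x y \<partial>lborel))"
    using lborel_pair.integrable_snd[OF 2] .
qed

text \<open>For an open \<open>U\<close> that contains \<open>A\<close> and exceeds it by little, the points of \<open>A\<close> that a small
  translation moves out of \<open>U\<close> form a set of vanishing measure, because \<open>U\<close> is open.\<close>

lemma L1_translation_indicator:
  fixes A :: "'a::euclidean_space set" and h :: "nat \<Rightarrow> 'a"
  assumes A[measurable]: "A \<in> sets borel" and fin: "emeasure lborel A < \<infinity>" and h: "h \<longlonglongrightarrow> 0"
  shows "(\<lambda>n. \<integral>x. \<bar>indicator A (x + h n) - indicator A x\<bar> \<partial>lborel :: real) \<longlonglongrightarrow> 0"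
proof (rule LIMSEQ_I)
  fix r :: real assume r: "0 < r"
  obtain U where U: "open U" "A \<subseteq> U" "emeasure lborel (U - A) < r/4"
    using outer_regular_lborel[OF A, of "r/4"] r by auto
  have [measurable]: "U \<in> sets borel" using U by auto
  have Ufin: "emeasure lborel U < \<infinity>"
  proof -
    have "emeasure lborel U = emeasure lborel A + emeasure lborel (U - A)"
      using U(2) by (subst plus_emeasure) (auto intro!: arg_cong[where f="emeasure lborel"])
    thus ?thesis using fin U(3) by (auto intro: less_trans)
  qed
  define V where "V n = {x \<in> A. x + h n \<notin> U}" for n
  have [measurable]: "V n \<in> sets borel" for n unfolding V_def by measurable
  have V0: "(\<lambda>n. measure lborel (V n)) \<longlonglongrightarrow> 0"
  proof -
    have "(\<lambda>n. \<integral>x. indicator (V n) x \<partial>lborel :: real) \<longlonglongrightarrow> (\<integral>x. 0 \<partial>(lborel::'a measure))"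
    proof (rule integral_dominated_convergence[where w="indicator A"])
      show "integrable lborel (indicator A :: 'a \<Rightarrow> real)" using fin by simp
      show "AE x in lborel. (\<lambda>n. indicator (V n) x :: real) \<longlonglongrightarrow> 0"
      proof (intro AE_I2)
        fix x show "(\<lambda>n. indicator (V n) x :: real) \<longlonglongrightarrow> 0"
        proof (cases "x \<in> A")
          case True
          have "(\<lambda>n. x + h n) \<longlonglongrightarrow> x" using tendsto_add[OF tendsto_const h, of x] by simp
          hence "\<forall>\<^sub>F n in sequentially. x + h n \<in> U"
            using U True by (auto dest: topological_tendstoD)
          hence "\<forall>\<^sub>F n in sequentially. indicator (V n) x = (0::real)"
            by eventually_elim (simp add: V_def)
          thus ?thesis by (rule tendsto_eventually)
        qed (simp add: V_def)
      qed
    qed (auto simp: V_def split: split_indicator)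
    thus ?thesis by simp
  qed
  have bound: "(\<integral>x. \<bar>indicator A (x + h n) - indicator A x\<bar> \<partial>lborel :: real) \<le> 2 * measure lborel (V n) + r/2" for n
  proof -
    have finV: "emeasure lborel (V n) < \<infinity>"
      using emeasure_mono[of "V n" A lborel] fin by (auto simp: V_def)
    have i1: "integrable lborel (indicator (V n) :: 'a \<Rightarrow> real)" using finV by simp
    have i2: "integrable lborel (indicator A :: 'a \<Rightarrow> real)" using fin by simp
    have i3: "integrable lborel (\<lambda>x. indicator A (x + h n) :: real)"
      using integrable_lborel_translate[OF i2, of "h n"] by (simp add: add.commute)
    have i4: "integrable lborel (indicator (U - A) :: 'a \<Rightarrow> real)"
      using less_trans[OF U(3), of \<infinity>] by (subst integrable_indicator_iff) auto
    have i5: "integrable lborel (\<lambda>x. indicator (U - A) (x + h n) :: real)"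
      using integrable_lborel_translate[OF i4, of "h n"] by (simp add: add.commute)
    \<comment> \<open>\<open>|a - b| = (a - b) + 2 (b - a)\<^sup>+\<close>, and the two integrals of the indicator agree\<close>
    have "(\<integral>x. \<bar>indicator A (x + h n) - indicator A x\<bar> \<partial>lborel :: real)
      \<le> (\<integral>x. (indicator A (x + h n) - indicator A x) + 2 * (indicator (V n) x + indicator (U-A) (x + h n)) \<partial>lborel)"
    proof (rule integral_mono)
      show "integrable lborel (\<lambda>x. \<bar>indicator A (x + h n) - indicator A x\<bar> :: real)"
        using i2 i3 by auto
      show "integrable lborel (\<lambda>x. (indicator A (x + h n) - indicator A x) + 2 * (indicator (V n) x + indicator (U-A) (x + h n)) :: real)"
        using i1 i2 i3 i5 by auto
    qed (auto simp: V_def split: split_indicator)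
    also have "\<dots> = 2 * (\<integral>x. indicator (V n) x \<partial>lborel) + 2 * (\<integral>x. indicator (U-A) (x + h n) \<partial>lborel)"
    proof -
      have "(\<integral>x. indicator A (x + h n) \<partial>lborel :: real) = (\<integral>x. indicator A x \<partial>lborel)"
        using integral_lborel_translate[of "indicator A :: 'a \<Rightarrow> real" "h n"] by (simp add: add.commute)
      thus ?thesis using i1 i2 i3 i5 by simp
    qed
    also have "(\<integral>x. indicator (U-A) (x + h n) \<partial>lborel) = measure lborel (U - A)"
      using integral_lborel_translate[of "indicator (U-A) :: 'a \<Rightarrow> real" "h n"] by (simp add: add.commute)
    also have "measure lborel (U - A) \<le> r/4"
      unfolding measure_def using U(3) r by (intro enn2real_leI) (auto intro: less_imp_le)
    finally show ?thesis by simp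
  qed
  have "\<forall>\<^sub>F n in sequentially. measure lborel (V n) < r/4"
    by (rule order_tendstoD(2)[OF V0]) (use r in simp)
  then obtain N where N: "\<And>n. n \<ge> N \<Longrightarrow> measure lborel (V n) < r/4"
    by (auto simp: eventually_sequentially)
  show "\<exists>no. \<forall>n\<ge>no. norm ((\<integral>x. \<bar>indicator A (x + h n) - indicator A x\<bar> \<partial>lborel :: real) - 0) < r"
  proof (intro exI allI impI)
    fix n assume "n \<ge> N"
    thus "norm ((\<integral>x. \<bar>indicator A (x + h n) - indicator A x\<bar> \<partial>lborel :: real) - 0) < r"
      using bound[of n] N[of n] r by simp
  qed
qed

text \<open>The functions with this property include the indicators of sets of finite measure and are closed under
  sums and \<open>L\<^sup>1\<close> limits, since translations are isometries of \<open>L\<^sup>1\<close>.\<close>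

lemma L1_translation_continuous:
  fixes f :: "'a::euclidean_space \<Rightarrow> 'b::{banach, second_countable_topology}" and h :: "nat \<Rightarrow> 'a"
  assumes f: "integrable lborel f" and h: "h \<longlonglongrightarrow> 0"
  shows "(\<lambda>n. \<integral>x. norm (f (x + h n) - f x) \<partial>lborel) \<longlonglongrightarrow> 0"
  using f
proof (induction rule: integrable_induct)
  case (base A c)
  have "norm (indicator A (x + h n) *\<^sub>R c - indicator A x *\<^sub>R c)
      = \<bar>indicator A (x + h n) - indicator A x\<bar> * norm c" for x n
    by (metis norm_scaleR scaleR_diff_left)
  moreover have "(\<lambda>n. (\<integral>x. \<bar>indicator A (x + h n) - indicator A x\<bar> \<partial>lborel) * norm c) \<longlonglongrightarrow> 0"
    using L1_translation_indicator[OF _ _ h, of A] base by (intro tendsto_mult_left_zero) auto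
  ultimately show ?case by simp
next
  case (add f g)
  have tr: "integrable lborel (\<lambda>x. u (x + h n))" if "integrable lborel u" for u :: "'a \<Rightarrow> 'b" and n
    using integrable_lborel_translate[OF that, of "h n"] by (simp add: add.commute)
  have "(\<lambda>n. \<integral>x. norm (f (x + h n) + g (x + h n) - (f x + g x)) \<partial>lborel) \<longlonglongrightarrow> 0"
  proof (rule tendsto_sandwich[OF _ _ tendsto_const])
    show "(\<lambda>n. (\<integral>x. norm (f (x + h n) - f x) \<partial>lborel) + (\<integral>x. norm (g (x + h n) - g x) \<partial>lborel)) \<longlonglongrightarrow> 0"
      using tendsto_add[OF add(3,4)] by simp
    show "\<forall>\<^sub>F n in sequentially. (\<integral>x. norm (f (x + h n) + g (x + h n) - (f x + g x)) \<partial>lborel)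
       \<le> (\<integral>x. norm (f (x + h n) - f x) \<partial>lborel) + (\<integral>x. norm (g (x + h n) - g x) \<partial>lborel)"
    proof (intro always_eventually allI)
      fix n
      have "(\<integral>x. norm (f (x + h n) + g (x + h n) - (f x + g x)) \<partial>lborel)
        \<le> (\<integral>x. norm (f (x + h n) - f x) + norm (g (x + h n) - g x) \<partial>lborel)"
      proof (rule integral_mono)
        show "norm (f (x + h n) + g (x + h n) - (f x + g x)) \<le> norm (f (x + h n) - f x) + norm (g (x + h n) - g x)" for x
          using norm_triangle_ineq[of "f (x + h n) - f x" "g (x + h n) - g x"] by (simp add: algebra_simps)
      qed (use add(1,2) tr in auto)
      thus "(\<integral>x. norm (f (x + h n) + g (x + h n) - (f x + g x)) \<partial>lborel)
       \<le> (\<integral>x. norm (f (x + h n) - f x) \<partial>lborel) + (\<integral>x. norm (g (x + h n) - g x) \<partial>lborel)"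
        using add(1,2) tr by simp
    qed
  qed auto
  thus ?case by simp
next
  case (lim f s)
  have tr: "integrable lborel (\<lambda>x. u (x + h n))" if "integrable lborel u" for u :: "'a \<Rightarrow> 'b" and n
    using integrable_lborel_translate[OF that, of "h n"] by (simp add: add.commute)
  have conv: "(\<lambda>i. \<integral>x. norm (s i x - f x) \<partial>lborel) \<longlonglongrightarrow> 0"
  proof -
    have "(\<lambda>i. \<integral>x. norm (s i x - f x) \<partial>lborel) \<longlonglongrightarrow> (\<integral>x. 0 \<partial>(lborel :: 'a measure))"
    proof (rule integral_dominated_convergence[where w="\<lambda>x. 3 * norm (f x)"])
      have [measurable]: "s i \<in> borel_measurable borel" "f \<in> borel_measurable borel" for i
        using borel_measurable_integrable[OF lim(1)[of i]] borel_measurable_integrable[OF lim(4)] by simp_all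
      show "(\<lambda>x. norm (s i x - f x)) \<in> borel_measurable lborel" for i by measurable
      show "AE x in lborel. (\<lambda>i. norm (s i x - f x)) \<longlonglongrightarrow> 0"
        using lim(2) by (intro AE_I2) (auto intro!: tendsto_norm_zero simp: LIM_zero_iff)
      show "AE x in lborel. norm (norm (s i x - f x)) \<le> 3 * norm (f x)" for i
      proof (intro AE_I2)
        fix x show "norm (norm (s i x - f x)) \<le> 3 * norm (f x)"
          using norm_triangle_ineq4[of "s i x" "f x"] lim(3)[of x i] by simp
      qed
    qed (use lim in auto)
    thus ?thesis by simp
  qed
  show ?case
  proof (rule LIMSEQ_I)
    fix r :: real assume r: "0 < r"
    obtain i where i: "(\<integral>x. norm (s i x - f x) \<partial>lborel) < r/3"
      using order_tendstoD(2)[OF conv, of "r/3"] r by (auto simp: eventually_sequentially)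
    have "\<forall>\<^sub>F n in sequentially. (\<integral>x. norm (s i (x + h n) - s i x) \<partial>lborel) < r/3"
      using order_tendstoD(2)[OF lim(5)[of i], of "r/3"] r by simp
    then obtain N where N: "\<And>n. n \<ge> N \<Longrightarrow> (\<integral>x. norm (s i (x + h n) - s i x) \<partial>lborel) < r/3"
      by (auto simp: eventually_sequentially)
    have "(\<integral>x. norm (f (x + h n) - f x) \<partial>lborel) < r" if "n \<ge> N" for n
    proof -
      have "(\<integral>x. norm (f (x + h n) - f x) \<partial>lborel)
        \<le> (\<integral>x. norm (s i (x + h n) - f (x + h n)) + norm (s i (x + h n) - s i x) + norm (s i x - f x) \<partial>lborel)"
      proof (rule integral_mono)
        show "norm (f (x + h n) - f x) \<le> norm (s i (x + h n) - f (x + h n)) + norm (s i (x + h n) - s i x) + norm (s i x - f x)" for x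
        proof -
          have "f (x + h n) - f x = (s i (x + h n) - s i x) + (s i x - f x) - (s i (x + h n) - f (x + h n))"
            by simp
          thus ?thesis
            using norm_triangle_ineq4[of "(s i (x + h n) - s i x) + (s i x - f x)" "s i (x + h n) - f (x + h n)"]
              norm_triangle_ineq[of "s i (x + h n) - s i x" "s i x - f x"] by simp
        qed
      qed (use lim tr in auto)
      also have "\<dots> = (\<integral>x. norm (s i (x + h n) - f (x + h n)) \<partial>lborel)
          + (\<integral>x. norm (s i (x + h n) - s i x) \<partial>lborel) + (\<integral>x. norm (s i x - f x) \<partial>lborel)"
        using lim tr by simp
      also have "(\<integral>x. norm (s i (x + h n) - f (x + h n)) \<partial>lborel) = (\<integral>x. norm (s i x - f x) \<partial>lborel)"
        using integral_lborel_translate[of "\<lambda>x. norm (s i x - f x)" "h n"] by (simp add: add.commute)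
      finally show ?thesis using i N[OF that] by simp
    qed
    thus "\<exists>no. \<forall>n\<ge>no. norm ((\<integral>x. norm (f (x + h n) - f x) \<partial>lborel) - 0) < r"
      by auto
  qed
qed

section \<open>Smooth functions and mollification\<close>

text \<open>\<open>C_k\<close> is phrased through \<open>frechet_derivative\<close>, which is awkward to compute with; the next two rules
  let proofs work with any derivative in the sense of \<open>has_derivative\<close>.\<close>

lemma C_k_SucI:
  assumes "\<And>x. (f has_derivative D x) (at x)" "\<And>i. i \<in> Basis \<Longrightarrow> C_k k (\<lambda>x. D x i)"
  shows "C_k (Suc k) f"
proof -
  have "frechet_derivative f (at x) = D x" for x
    using frechet_derivative_at[OF assms(1)[of x]] by simp
  thus ?thesis using assms by (auto simp: differentiable_def)
qed

lemma C_k_SucE: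
  assumes "C_k (Suc k) f"
  obtains D where "\<And>x. (f has_derivative D x) (at x)" "\<And>i. i \<in> Basis \<Longrightarrow> C_k k (\<lambda>x. D x i)"
  using assms that[of "\<lambda>x. frechet_derivative f (at x)"] by (simp add: frechet_derivative_works)

lemma C_k_Suc_imp: "C_k (Suc k) f \<Longrightarrow> C_k k f"
proof (induction k arbitrary: f)
  case 0
  thus ?case by (auto intro!: continuous_at_imp_continuous_on differentiable_imp_continuous_within)
next
  case (Suc k)
  thus ?case by (auto simp del: C_k.simps(1))
qed

lemma C_k_continuous: "C_k k f \<Longrightarrow> continuous_on UNIV f"
  by (induction k) (use C_k_Suc_imp in \<open>auto\<close>)

lemma C_k_const [simp]: "C_k k (\<lambda>x. c)"
proof (induction k arbitrary: c)
  case (Suc k)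
  show ?case by (rule C_k_SucI[of _ "\<lambda>_ _. 0"]) (use Suc in \<open>auto intro!: derivative_eq_intros\<close>)
qed simp

lemma C_k_bounded_linear:
  assumes "bounded_linear L" "C_k k f" shows "C_k k (\<lambda>x. L (f x))"
  using assms(2)
proof (induction k arbitrary: f)
  case 0
  thus ?case using bounded_linear.continuous_on[OF assms(1)] by simp
next
  case (Suc k)
  then obtain D where D: "\<And>x. (f has_derivative D x) (at x)" "\<And>i. i \<in> Basis \<Longrightarrow> C_k k (\<lambda>x. D x i)"
    by (elim C_k_SucE) blast
  show ?case
    by (rule C_k_SucI[of _ "\<lambda>x h. L (D x h)"])
       (auto intro!: bounded_linear.has_derivative[OF assms(1)] D Suc.IH)
qed

lemma C_k_add:
  assumes "C_k k f" "C_k k g" shows "C_k k (\<lambda>x. f x + g x)"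
  using assms
proof (induction k arbitrary: f g)
  case 0
  thus ?case by (auto intro: continuous_intros)
next
  case (Suc k)
  obtain D where D: "\<And>x. (f has_derivative D x) (at x)" "\<And>i. i \<in> Basis \<Longrightarrow> C_k k (\<lambda>x. D x i)"
    using Suc.prems(1) by (elim C_k_SucE) blast
  obtain E where E: "\<And>x. (g has_derivative E x) (at x)" "\<And>i. i \<in> Basis \<Longrightarrow> C_k k (\<lambda>x. E x i)"
    using Suc.prems(2) by (elim C_k_SucE) blast
  show ?case
    by (rule C_k_SucI[of _ "\<lambda>x h. D x h + E x h"])
       (use D E Suc.IH in \<open>auto intro: has_derivative_add\<close>)
qed

lemma C_k_bilinear:
  assumes "bounded_bilinear p" "C_k k f" "C_k k g" shows "C_k k (\<lambda>x. p (f x) (g x))"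
  using assms(2,3)
proof (induction k arbitrary: f g)
  case 0
  thus ?case using bounded_bilinear.continuous_on[OF assms(1)] by simp
next
  case (Suc k)
  obtain D where D: "\<And>x. (f has_derivative D x) (at x)" "\<And>i. i \<in> Basis \<Longrightarrow> C_k k (\<lambda>x. D x i)"
    using Suc.prems(1) by (elim C_k_SucE) blast
  obtain E where E: "\<And>x. (g has_derivative E x) (at x)" "\<And>i. i \<in> Basis \<Longrightarrow> C_k k (\<lambda>x. E x i)"
    using Suc.prems(2) by (elim C_k_SucE) blast
  show ?case
    by (rule C_k_SucI[of _ "\<lambda>x h. p (f x) (E x h) + p (D x h) (g x)"])
       (auto intro!: C_k_add bounded_bilinear.FDERIV[OF assms(1)] D E Suc.IH
         C_k_Suc_imp[OF Suc.prems(1)] C_k_Suc_imp[OF Suc.prems(2)])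
qed

lemmas C_k_mult = C_k_bilinear[OF bounded_bilinear_mult]

lemma C_k_affine:
  assumes "C_k k f" shows "C_k k (\<lambda>x. f (t + c *\<^sub>R x))"
  using assms
proof (induction k arbitrary: f)
  case 0
  have "continuous_on UNIV (f \<circ> (\<lambda>x. t + c *\<^sub>R x))"
    by (rule continuous_on_compose) (use 0 continuous_on_subset in \<open>auto intro!: continuous_intros\<close>)
  thus ?case by (simp add: o_def)
next
  case (Suc k)
  then obtain D where D: "\<And>x. (f has_derivative D x) (at x)" "\<And>i. i \<in> Basis \<Longrightarrow> C_k k (\<lambda>x. D x i)"
    by (elim C_k_SucE) blast
  show ?case
  proof (rule C_k_SucI[of _ "\<lambda>x h. c *\<^sub>R D (t + c *\<^sub>R x) h"])
    fix x
    have "((\<lambda>x. t + c *\<^sub>R x) has_derivative (\<lambda>h. c *\<^sub>R h)) (at x)"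
      by (auto intro!: derivative_eq_intros)
    from has_derivative_compose[OF this D(1)]
    show "((\<lambda>x. f (t + c *\<^sub>R x)) has_derivative (\<lambda>h. c *\<^sub>R D (t + c *\<^sub>R x) h)) (at x)"
      using linear_simps(5)[OF has_derivative_bounded_linear[OF D(1)]] by simp
  next
    fix i :: 'a assume "i \<in> Basis"
    from Suc.IH[OF D(2)[OF this]]
    show "C_k k (\<lambda>x. c *\<^sub>R D (t + c *\<^sub>R x) i)"
      by (rule C_k_bounded_linear[OF bounded_linear_scaleR_right])
  qed
qed

lemma C_k_inner: "C_k k (\<lambda>x. x \<bullet> v)"
proof (cases k)
  case (Suc n)
  show ?thesis unfolding Suc
    by (rule C_k_SucI[of _ "\<lambda>x h. h \<bullet> v"]) (auto intro!: derivative_eq_intros)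
qed (auto intro!: continuous_intros)

lemma C_k_cis: "C_k k (\<lambda>x. cis (x \<bullet> v))"
proof (induction k)
  case 0 thus ?case by (auto intro!: continuous_intros)
next
  case (Suc k)
  show ?case
  proof (rule C_k_SucI[of _ "\<lambda>x h. cis (x \<bullet> v) * (\<i> * of_real (h \<bullet> v))"])
    fix x show "((\<lambda>x. cis (x \<bullet> v)) has_derivative (\<lambda>h. cis (x \<bullet> v) * (\<i> * of_real (h \<bullet> v)))) (at x)"
    proof -
      have "((\<lambda>x. \<i> * complex_of_real (x \<bullet> v)) has_derivative (\<lambda>h. \<i> * complex_of_real (h \<bullet> v))) (at x)"
        by (intro has_derivative_mult_right has_derivative_of_real has_derivative_inner_left has_derivative_ident)
      from has_derivative_compose[OF this DERIV_exp[unfolded has_field_derivative_def]]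
      show ?thesis by (simp add: cis_conv_exp)
    qed
  next
    fix i :: 'a show "C_k k (\<lambda>x. cis (x \<bullet> v) * (\<i> * of_real (i \<bullet> v)))"
      using C_k_mult[OF Suc C_k_const] .
  qed
qed

subsection \<open>A smooth bump\<close>

text \<open>The derivatives of \<open>exp (- 1 / t)\<close> on \<open>t > 0\<close> are polynomials in \<open>1 / t\<close> times the function
  itself; all of them vanish to infinite order at \<open>0\<close>, so this class of functions, extended by zero,
  is closed under differentiation.\<close>

definition flat :: "real poly \<Rightarrow> real \<Rightarrow> real" where
  "flat p t = (if t > 0 then poly p (1 / t) * exp (- (1 / t)) else 0)"

lemma poly_exp_tendsto_0: "((\<lambda>x. poly p x * exp (- x)) \<longlongrightarrow> 0) (at_top :: real filter)"
proof -
  have "((\<lambda>x. \<Sum>i\<le>degree p. coeff p i * (x ^ i / exp x)) \<longlongrightarrow> (\<Sum>i\<le>degree p. coeff p i * 0)) (at_top :: real filter)"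
    by (intro tendsto_sum tendsto_mult tendsto_const tendsto_power_div_exp_0)
  thus ?thesis by (simp add: poly_altdef exp_minus divide_inverse sum_distrib_right mult.assoc)
qed

text \<open>At \<open>0\<close> the difference quotient is \<open>x p(x) exp (- x)\<close> with \<open>x = 1 / h \<rightarrow> \<infinity>\<close>; elsewhere this is the
  product rule, and the factor \<open>1 / h\<^sup>2\<close> of the inner derivative is the monomial of degree two.\<close>

lemma flat_has_derivative:
  "(flat p has_real_derivative flat (monom 1 2 * (p - pderiv p)) t) (at t)"
proof -
  consider "t > 0" | "t < 0" | "t = 0" by linarith
  thus ?thesis
  proof cases
    case 1
    have "((\<lambda>t. poly p (1 / t) * exp (- (1 / t))) has_real_derivative
        flat (monom 1 2 * (p - pderiv p)) t) (at t)"
      using 1 by (auto intro!: derivative_eq_intros simp: flat_def poly_monom field_simps power2_eq_square)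
    thus ?thesis
      by (rule DERIV_cong_ev[THEN iffD1, rotated -1])
         (use 1 in \<open>auto simp: flat_def intro: eventually_mono[OF eventually_nhds_in_open[of "{0<..}" t]]\<close>)
  next
    case 2
    have "((\<lambda>t. 0) has_real_derivative flat (monom 1 2 * (p - pderiv p)) t) (at t)"
      using 2 by (auto simp: flat_def)
    thus ?thesis
      by (rule DERIV_cong_ev[THEN iffD1, rotated -1])
         (use 2 in \<open>auto simp: flat_def intro: eventually_mono[OF eventually_nhds_in_open[of "{..<0}" t]]\<close>)
  next
    case 3
    have "((\<lambda>h. flat p h / h) \<longlongrightarrow> 0) (at_right 0)"
    proof -
      have "((\<lambda>x. poly (pCons 0 p) x * exp (- x)) \<longlongrightarrow> 0) (at_top :: real filter)"
        by (rule poly_exp_tendsto_0)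
      hence "((\<lambda>h. poly (pCons 0 p) (inverse h) * exp (- (inverse h))) \<longlongrightarrow> 0) (at_right (0::real))"
        by (rule filterlim_compose[OF _ filterlim_inverse_at_top_right])
      moreover have "\<forall>\<^sub>F h in at_right (0::real). poly (pCons 0 p) (inverse h) * exp (- (inverse h)) = flat p h / h"
        using eventually_at_right_less[of "0::real"]
        by eventually_elim (simp add: flat_def field_simps)
      ultimately show ?thesis by (rule Lim_transform_eventually)
    qed
    moreover have "((\<lambda>h. flat p h / h) \<longlongrightarrow> 0) (at_left 0)"
    proof -
      have "\<forall>\<^sub>F h in at_left (0::real). 0 = flat p h / h"
        using eventually_at_left_real[of "-1" "0::real"]
        by (auto elim!: eventually_mono simp: flat_def)
      thus ?thesis using Lim_transform_eventually[OF tendsto_const] by fast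
    qed
    ultimately have "((\<lambda>h. flat p h / h) \<longlongrightarrow> 0) (at 0)"
      by (rule filterlim_split_at[rotated])
    thus ?thesis using 3 by (simp add: DERIV_def flat_def)
  qed
qed

lemma C_k_flat: "C_k k (\<lambda>x::'a::euclidean_space. flat p (1 - x \<bullet> x))"
proof (induction k arbitrary: p)
  case 0
  have "isCont (flat p) t" for t using DERIV_isCont[OF flat_has_derivative] .
  hence "continuous_on UNIV (flat p)" by (simp add: continuous_on_eq_continuous_at)
  thus ?case by (auto intro!: continuous_on_compose2[of UNIV "flat p"] continuous_intros)
next
  case (Suc k)
  let ?q = "monom 1 2 * (p - pderiv p)"
  show ?case
  proof (rule C_k_SucI[of _ "\<lambda>x h. flat ?q (1 - x \<bullet> x) * (- 2 * (x \<bullet> h))"])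
    fix x :: 'a
    have "((\<lambda>x. 1 - x \<bullet> x) has_derivative (\<lambda>h. - 2 * (x \<bullet> h))) (at x)"
      by (auto intro!: derivative_eq_intros simp: inner_commute)
    from has_derivative_compose[OF this flat_has_derivative[unfolded has_field_derivative_def]]
    show "((\<lambda>x. flat p (1 - x \<bullet> x)) has_derivative (\<lambda>h. flat ?q (1 - x \<bullet> x) * (- 2 * (x \<bullet> h)))) (at x)" .
  next
    fix i :: 'a
    show "C_k k (\<lambda>x. flat ?q (1 - x \<bullet> x) * (- 2 * (x \<bullet> i)))"
      by (intro C_k_mult Suc C_k_const C_k_inner)
  qed
qed

subsection \<open>Test functions\<close>

lemma test_functionI:
  assumes "\<And>k. C_k k \<phi>" "\<And>x. x \<notin> S \<Longrightarrow> \<phi> x = 0" "compact S" "S \<subseteq> \<Omega>"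
  shows "test_function \<Omega> \<phi>"
proof -
  have "closure {x. \<phi> x \<noteq> 0} \<subseteq> S"
    using assms by (intro closure_minimal) (auto simp: compact_imp_closed)
  moreover from this have "compact (closure {x. \<phi> x \<noteq> 0})"
    using assms(3) by (meson bounded_subset closed_closure compact_eq_bounded_closed)
  ultimately show ?thesis using assms by (auto simp: test_function_def)
qed

lemma test_functionE:
  assumes "test_function \<Omega> \<phi>"
  obtains S where "compact S" "S \<subseteq> \<Omega>" "\<And>x. x \<notin> S \<Longrightarrow> \<phi> x = 0"
  using assms that[of "closure {x. \<phi> x \<noteq> 0}"] closure_subset[of "{x. \<phi> x \<noteq> 0}"]
  unfolding test_function_def by blast

lemma test_function_C_k: "test_function \<Omega> \<phi> \<Longrightarrow> C_k k \<phi>"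
  by (simp add: test_function_def)

lemma test_function_mono: "test_function \<Omega> \<phi> \<Longrightarrow> \<Omega> \<subseteq> \<Omega>' \<Longrightarrow> test_function \<Omega>' \<phi>"
  by (auto simp: test_function_def)

lemma test_function_UNIV: "test_function \<Omega> \<phi> \<Longrightarrow> test_function UNIV \<phi>"
  by (erule test_function_mono) simp

lemma test_function_mult:
  assumes "test_function \<Omega> \<phi>" "\<And>k. C_k k g" shows "test_function \<Omega> (\<lambda>x. g x * \<phi> x)"
  using assms(1)
  by (rule test_functionE, intro test_functionI)
     (auto intro!: C_k_mult assms test_function_C_k[OF assms(1)])

lemma test_function_add:
  assumes "test_function \<Omega> \<phi>" "test_function \<Omega> \<psi>" shows "test_function \<Omega> (\<lambda>x. \<phi> x + \<psi> x)"
proof -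
  obtain S where S: "compact S" "S \<subseteq> \<Omega>" "\<And>x. x \<notin> S \<Longrightarrow> \<phi> x = 0" using test_functionE[OF assms(1)] by blast
  obtain T where T: "compact T" "T \<subseteq> \<Omega>" "\<And>x. x \<notin> T \<Longrightarrow> \<psi> x = 0" using test_functionE[OF assms(2)] by blast
  show ?thesis
    by (rule test_functionI[where S="S \<union> T"])
       (use S T assms in \<open>auto intro!: C_k_add intro: test_function_C_k\<close>)
qed

lemma test_function_derivative:
  assumes "test_function \<Omega> \<phi>"
  obtains D where "\<And>x. (\<phi> has_derivative D x) (at x)" "\<And>i. i \<in> Basis \<Longrightarrow> test_function \<Omega> (\<lambda>x. D x i)"
proof -
  obtain S where S: "compact S" "S \<subseteq> \<Omega>" "\<And>x. x \<notin> S \<Longrightarrow> \<phi> x = 0" using test_functionE[OF assms] by blast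
  let ?D = "\<lambda>x. frechet_derivative \<phi> (at x)"
  have C: "C_k (Suc k) \<phi>" for k using test_function_C_k[OF assms] .
  have D: "(\<phi> has_derivative ?D x) (at x)" for x
    using C[of 0] by (simp add: frechet_derivative_works)
  have "?D x = (\<lambda>h. 0)" if "x \<notin> S" for x
  proof -
    have "((\<lambda>_. 0) has_derivative ?D x) (at x)"
    proof (rule has_derivative_transform_within_open[OF D])
      show "open (- S)" using S(1) by (simp add: compact_imp_closed open_Compl)
    qed (use that S in auto)
    thus ?thesis using has_derivative_unique has_derivative_const by blast
  qed
  hence "test_function \<Omega> (\<lambda>x. ?D x i)" if "i \<in> Basis" for i
    using C S that by (intro test_functionI[where S=S]) auto
  with D show ?thesis by (rule that)
qed

lemma compact_support_bounded:
  fixes f :: "'a::topological_space \<Rightarrow> 'b::real_normed_vector"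
  assumes "continuous_on UNIV f" "compact S" "\<And>x. x \<notin> S \<Longrightarrow> f x = 0"
  obtains B where "B > 0" "\<And>x. norm (f x) \<le> B"
proof -
  have "bounded (f ` S)"
    using assms by (intro compact_imp_bounded compact_continuous_image) (auto intro: continuous_on_subset)
  then obtain B where B: "B > 0" "\<And>x. x \<in> S \<Longrightarrow> norm (f x) \<le> B" by (auto simp: bounded_pos)
  show ?thesis by (rule that[OF B(1)]) (use B assms(3) in \<open>metis less_imp_le norm_zero\<close>)
qed

lemma test_function_bounded:
  assumes "test_function \<Omega> \<phi>" obtains B where "B > 0" "\<And>x. cmod (\<phi> x) \<le> B"
  using test_functionE[OF assms] compact_support_bounded C_k_continuous[OF test_function_C_k[OF assms, of 0]]
  by metis

lemma test_function_measurable: "test_function \<Omega> \<phi> \<Longrightarrow> \<phi> \<in> borel_measurable borel"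
  by (intro borel_measurable_continuous_onI C_k_continuous test_function_C_k)

lemma compact_support_integrable:
  fixes f :: "'a::euclidean_space \<Rightarrow> 'b::{banach, second_countable_topology}"
  assumes "continuous_on UNIV f" "compact S" "\<And>x. x \<notin> S \<Longrightarrow> f x = 0"
  shows "integrable lborel f"
proof -
  have "integrable lborel (\<lambda>x. indicator S x *\<^sub>R f x)"
    using assms by (intro borel_integrable_compact) (auto intro: continuous_on_subset)
  moreover have "(\<lambda>x. indicator S x *\<^sub>R f x) = f" using assms(3) by (auto split: split_indicator)
  ultimately show ?thesis by simp
qed

lemma test_function_integrable:
  assumes "test_function \<Omega> \<phi>" shows "integrable lborel \<phi>"
  using test_functionE[OF assms] compact_support_integrable C_k_continuous[OF test_function_C_k[OF assms, of 0]]
  by metis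

lemma derivative_norm_bound:
  fixes f :: "'a::euclidean_space \<Rightarrow> 'b::real_normed_vector"
  assumes "(f has_derivative D) (at x)" "\<And>i. i \<in> Basis \<Longrightarrow> norm (D i) \<le> B"
  shows "norm (D h) \<le> (real DIM('a) * B) * norm h"
proof -
  interpret bounded_linear D using has_derivative_bounded_linear[OF assms(1)] .
  have "D h = D (\<Sum>i\<in>Basis. (h \<bullet> i) *\<^sub>R i)" by (simp add: euclidean_representation)
  also have "\<dots> = (\<Sum>i\<in>Basis. (h \<bullet> i) *\<^sub>R D i)" by (simp add: sum scale)
  also have "norm \<dots> \<le> (\<Sum>i\<in>(Basis :: 'a set). norm h * B)"
    by (intro sum_norm_le) (auto intro!: mult_mono Basis_le_norm assms)
  finally show ?thesis by (simp add: mult_ac)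
qed

lemma bounded_derivative_lipschitz:
  fixes f :: "'a::euclidean_space \<Rightarrow> 'b::real_normed_vector"
  assumes D: "\<And>x. (f has_derivative D x) (at x)"
    and B: "\<And>x i. i \<in> Basis \<Longrightarrow> norm (D x i) \<le> B"
  shows "norm (f x - f y) \<le> (real DIM('a) * B) * norm (x - y)"
proof -
  have "onorm (D z) \<le> real DIM('a) * B" for z
    by (rule onorm_le) (use derivative_norm_bound[OF D B] in blast)
  thus ?thesis
    by (intro differentiable_bound[of UNIV f D]) (use D in auto)
qed

lemma test_function_lipschitz:
  assumes "test_function \<Omega> \<phi>"
  obtains L where "L > 0" "\<And>x y. cmod (\<phi> x - \<phi> y) \<le> L * norm (x - y)"
proof -
  obtain D where D: "\<And>x. (\<phi> has_derivative D x) (at x)" "\<And>i. i \<in> Basis \<Longrightarrow> test_function \<Omega> (\<lambda>x. D x i)"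
    using test_function_derivative[OF assms] by blast
  have "\<forall>i\<in>Basis. \<exists>B>0. \<forall>x. cmod (D x i) \<le> B" using test_function_bounded[OF D(2)] by metis
  then obtain B where B: "\<And>i. i \<in> Basis \<Longrightarrow> B i > 0" "\<And>i x. i \<in> Basis \<Longrightarrow> cmod (D x i) \<le> B i" by metis
  have "B i \<le> sum B Basis" if "i \<in> Basis" for i
    using that B(1) by (intro member_le_sum) (auto intro: less_imp_le)
  hence B': "cmod (D x i) \<le> sum B Basis" if "i \<in> Basis" for x i
    using B(2)[OF that] that by (meson order_trans)
  show ?thesis
  proof (rule that[of "real DIM('a) * sum B Basis"])
    show "real DIM('a) * sum B Basis > 0" using B(1) by (auto intro!: mult_pos_pos sum_pos)
  qed (use bounded_derivative_lipschitz[OF D(1) B'] in auto)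
qed

subsection \<open>Mollification\<close>

definition bump :: "'a::euclidean_space \<Rightarrow> real" where
  "bump x = flat 1 (1 - x \<bullet> x) / (\<integral>y. flat 1 (1 - y \<bullet> y) \<partial>(lborel :: 'a measure))"

definition mollifier :: "real \<Rightarrow> 'a::euclidean_space \<Rightarrow> real" where
  "mollifier \<epsilon> x = (1 / \<epsilon>) ^ DIM('a) * bump ((1 / \<epsilon>) *\<^sub>R x)"

definition mollify :: "real \<Rightarrow> ('a::euclidean_space \<Rightarrow> complex) \<Rightarrow> 'a \<Rightarrow> complex" where
  "mollify \<epsilon> u x = (\<integral>y. mollifier \<epsilon> (x - y) *\<^sub>R u y \<partial>lborel)"

lemma flat_bump_zero: "1 \<le> norm x \<Longrightarrow> flat p (1 - x \<bullet> x) = 0"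
proof -
  assume "1 \<le> norm x"
  hence "\<not> 1 - x \<bullet> x > 0" using power_mono[of 1 "norm x" 2] \<open>1 \<le> norm x\<close> by (simp add: dot_square_norm del: power_le_one_iff one_le_power)
  thus ?thesis by (simp add: flat_def)
qed

lemma flat_bump_integrable: "integrable lborel (\<lambda>x::'a::euclidean_space. flat p (1 - x \<bullet> x))"
  by (rule compact_support_integrable[where S="cball 0 1"])
     (auto intro: C_k_continuous[OF C_k_flat[of 0]] flat_bump_zero)

lemma bump_mass_pos: "(\<integral>y. flat 1 (1 - y \<bullet> y) \<partial>(lborel :: 'a::euclidean_space measure)) > 0"
proof -
  have nn: "0 \<le> flat 1 t" for t by (simp add: flat_def)
  have "(\<integral>y. flat 1 (1 - y \<bullet> y) \<partial>(lborel :: 'a measure)) \<noteq> 0"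
  proof
    assume "(\<integral>y. flat 1 (1 - y \<bullet> y) \<partial>(lborel :: 'a measure)) = 0"
    hence "AE y in (lborel :: 'a measure). flat 1 (1 - y \<bullet> y) = 0"
      using integral_nonneg_eq_0_iff_AE[OF flat_bump_integrable] nn by blast
    hence "AE y in (lborel :: 'a measure). y \<notin> ball 0 1"
    proof (rule AE_mp, intro AE_I2 impI notI)
      fix y :: 'a assume "flat 1 (1 - y \<bullet> y) = 0" "y \<in> ball 0 1"
      moreover have "(norm y)\<^sup>2 < 1" if "norm y < 1" using that by (simp add: power_less_one_iff)
      ultimately show False by (simp add: flat_def dot_square_norm split: if_splits)
    qed
    hence "emeasure lborel (ball (0::'a) 1) = 0"
      by (subst (asm) AE_iff_measurable[OF _ refl]) (auto simp: ball_def)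
    hence "measure lborel (ball (0::'a) 1) = 0" by (simp add: measure_def)
    thus False using content_ball_pos[of 1 "0::'a"] by simp
  qed
  thus ?thesis using integral_nonneg_AE[of "\<lambda>y::'a. flat 1 (1 - y \<bullet> y)" lborel] nn by (simp add: order_less_le)
qed

lemma bump_nonneg: "0 \<le> bump x"
  using bump_mass_pos[where 'a='a] by (simp add: bump_def flat_def)

lemma bump_zero: "1 \<le> norm x \<Longrightarrow> bump x = 0"
  by (simp add: bump_def flat_bump_zero)

lemma C_k_bump: "C_k k (bump :: 'a::euclidean_space \<Rightarrow> real)"
  using C_k_mult[OF C_k_flat[of k 1] C_k_const[of k "1 / (\<integral>y. flat 1 (1 - y \<bullet> y) \<partial>(lborel :: 'a measure))"]]
  by (simp add: bump_def[abs_def])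

lemma bump_integrable: "integrable lborel (bump :: 'a::euclidean_space \<Rightarrow> real)"
  unfolding bump_def[abs_def] using flat_bump_integrable[of 1] by (intro integrable_divide_zero) auto

lemma bump_integral: "(\<integral>x. bump x \<partial>(lborel :: 'a::euclidean_space measure)) = 1"
  unfolding bump_def using bump_mass_pos[where 'a='a] by simp

lemma bump_measurable [measurable]: "bump \<in> borel_measurable borel"
  using bump_integrable by auto

lemma mollifier_nonneg: "\<epsilon> > 0 \<Longrightarrow> 0 \<le> mollifier \<epsilon> x"
  by (simp add: mollifier_def bump_nonneg)

lemma mollifier_zero: "\<epsilon> > 0 \<Longrightarrow> \<epsilon> \<le> norm x \<Longrightarrow> mollifier \<epsilon> x = 0"
  by (simp add: mollifier_def bump_zero)

lemma C_k_mollifier: "C_k k (mollifier \<epsilon>)"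
  unfolding mollifier_def[abs_def]
  using C_k_mult[OF C_k_const C_k_affine[OF C_k_bump, of k 0 "1/\<epsilon>"]] by simp

lemma mollifier_integrable: "\<epsilon> > 0 \<Longrightarrow> integrable lborel (mollifier \<epsilon>)"
  using integrable_lborel_affine[OF bump_integrable, of "1/\<epsilon>" 0] by (simp add: mollifier_def[abs_def])

lemma mollifier_measurable [measurable]: "mollifier \<epsilon> \<in> borel_measurable borel"
  unfolding mollifier_def[abs_def] by measurable

lemma mollify_alt:
  assumes "\<epsilon> > 0"
  shows "mollify \<epsilon> u x = (\<integral>z. bump z *\<^sub>R u (x - \<epsilon> *\<^sub>R z) \<partial>lborel)"
  unfolding mollify_def using assms
  by (subst integral_lborel_affine[of "-\<epsilon>" _ x])
     (simp_all add: mollifier_def power_one_over mult.assoc[symmetric] flip: integral_scaleR_right)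

text \<open>Differentiation under the integral: by the bound on \<open>D\<close> the difference quotients of \<open>\<phi>\<close> are
  dominated by a constant times \<open>|u|\<close>.\<close>

lemma conv_has_derivative:
  fixes \<phi> :: "'a::euclidean_space \<Rightarrow> real" and u :: "'a \<Rightarrow> complex"
  assumes D: "\<And>x. (\<phi> has_derivative D x) (at x)"
    and D0: "\<And>i. i \<in> Basis \<Longrightarrow> continuous_on UNIV (\<lambda>x. D x i)"
    and B: "\<And>x i. i \<in> Basis \<Longrightarrow> \<bar>D x i\<bar> \<le> B" and M: "\<And>x. \<bar>\<phi> x\<bar> \<le> M"
    and u: "integrable lborel u"
  shows "((\<lambda>x. \<integral>y. \<phi> (x - y) *\<^sub>R u y \<partial>lborel) has_derivative (\<lambda>h. \<integral>y. D (x - y) h *\<^sub>R u y \<partial>lborel)) (at x)"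
proof -
  let ?B = "real DIM('a) * B"
  have [measurable]: "u \<in> borel_measurable borel" using u by auto
  have [measurable]: "\<phi> \<in> borel_measurable borel"
    using D by (intro borel_measurable_continuous_onI continuous_at_imp_continuous_on)
      (auto intro: has_derivative_continuous)
  have lin: "D x h = (\<Sum>i\<in>Basis. (h \<bullet> i) * D x i)" for x h
  proof -
    interpret bounded_linear "D x" using has_derivative_bounded_linear[OF D] .
    have "D x h = D x (\<Sum>i\<in>Basis. (h \<bullet> i) *\<^sub>R i)" by (simp add: euclidean_representation)
    thus ?thesis by (simp add: sum scale)
  qed
  have [measurable]: "(\<lambda>x. D x h) \<in> borel_measurable borel" for h
  proof -
    have "(\<lambda>x. \<Sum>i\<in>Basis. (h \<bullet> i) * D x i) \<in> borel_measurable borel"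
      by (intro borel_measurable_sum borel_measurable_times borel_measurable_const
        borel_measurable_continuous_onI D0)
    also have "(\<lambda>x. \<Sum>i\<in>Basis. (h \<bullet> i) * D x i) = (\<lambda>x. D x h)" using lin by metis
    finally show ?thesis .
  qed
  have Dh: "\<bar>D x h\<bar> \<le> ?B * norm h" for x h
    using derivative_norm_bound[OF D[of x], of B h] B by simp
  have B0: "?B \<ge> 0"
    using B[of "SOME i. i \<in> Basis" x] nonempty_Basis some_in_eq[of "Basis :: 'a set"] by fastforce
  have int: "integrable lborel (\<lambda>y. g y *\<^sub>R u y)"
    if [measurable]: "g \<in> borel_measurable borel" and g: "\<And>y. \<bar>g y\<bar> \<le> c" for g :: "'a \<Rightarrow> real" and c
    using integrable_mult_bounded[OF u, of "\<lambda>y. of_real (g y)" c] g by (simp add: scaleR_conv_of_real mult.commute)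
  have i1: "integrable lborel (\<lambda>y. \<phi> (x - y) *\<^sub>R u y)" for x by (rule int[of _ M]) (use M in auto)
  have i2: "integrable lborel (\<lambda>y. D (x - y) h *\<^sub>R u y)" for x h
    by (rule int[of _ "?B * norm h"]) (use Dh in auto)
  show ?thesis unfolding has_derivative_at
  proof (intro conjI)
    show "bounded_linear (\<lambda>h. \<integral>y. D (x - y) h *\<^sub>R u y \<partial>lborel)"
    proof (rule bounded_linear_intro[where K="?B * (\<integral>y. norm (u y) \<partial>lborel)"])
      fix h k :: 'a and r :: real
      have L: "linear (D z)" for z using has_derivative_bounded_linear[OF D] bounded_linear.linear by blast
      show "(\<integral>y. D (x - y) (h + k) *\<^sub>R u y \<partial>lborel) = (\<integral>y. D (x - y) h *\<^sub>R u y \<partial>lborel) + (\<integral>y. D (x - y) k *\<^sub>R u y \<partial>lborel)"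
        using i2 by (simp add: linear_add[OF L] scaleR_add_left)
      show "(\<integral>y. D (x - y) (r *\<^sub>R h) *\<^sub>R u y \<partial>lborel) = r *\<^sub>R (\<integral>y. D (x - y) h *\<^sub>R u y \<partial>lborel)"
        by (simp add: linear_scale[OF L] flip: integral_scaleR_right)
      have "norm (\<integral>y. D (x - y) h *\<^sub>R u y \<partial>lborel) \<le> (\<integral>y. (?B * norm h) * norm (u y) \<partial>lborel)"
        by (rule Bochner_Integration.integral_norm_bound_integral)
           (use u i2 Dh in \<open>auto intro!: mult_right_mono\<close>)
      thus "norm (\<integral>y. D (x - y) h *\<^sub>R u y \<partial>lborel) \<le> norm h * (?B * (\<integral>y. norm (u y) \<partial>lborel))"
        by (simp add: mult_ac)
    qed
    let ?Q = "\<lambda>h y. ((\<phi> (x - y + h) - \<phi> (x - y) - D (x - y) h) / norm h) *\<^sub>R u y"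
    have "((\<lambda>h. \<integral>y. ?Q h y \<partial>lborel) \<longlongrightarrow> 0) (at 0)"
      unfolding tendsto_at_iff_sequentially comp_def
    proof (intro allI impI)
      fix X :: "nat \<Rightarrow> 'a" assume X: "\<forall>i. X i \<in> UNIV - {0}" "X \<longlonglongrightarrow> 0"
      have "(\<lambda>n. \<integral>y. ?Q (X n) y \<partial>lborel) \<longlonglongrightarrow> (\<integral>y. 0 \<partial>(lborel :: 'a measure))"
      proof (rule integral_dominated_convergence[where w="\<lambda>y. (2 * ?B) * norm (u y)"])
        show "integrable lborel (\<lambda>y. (2 * ?B) * norm (u y))" using u by simp
        show "AE y in lborel. (\<lambda>n. ?Q (X n) y) \<longlonglongrightarrow> 0"
        proof (intro AE_I2)
          fix y
          have "((\<lambda>h. norm (\<phi> (x - y + h) - \<phi> (x - y) - D (x - y) h) / norm h) \<longlongrightarrow> 0) (at 0)"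
            using D[of "x - y"] unfolding has_derivative_at by blast
          hence "((\<lambda>h. (\<phi> (x - y + h) - \<phi> (x - y) - D (x - y) h) / norm h) \<longlongrightarrow> 0) (at 0)"
            by (subst tendsto_norm_zero_iff[symmetric]) (simp add: norm_divide)
          hence "(\<lambda>n. (\<phi> (x - y + X n) - \<phi> (x - y) - D (x - y) (X n)) / norm (X n)) \<longlonglongrightarrow> 0"
            using X unfolding tendsto_at_iff_sequentially comp_def by blast
          from tendsto_scaleR[OF this tendsto_const[of "u y"]] show "(\<lambda>n. ?Q (X n) y) \<longlonglongrightarrow> 0" by simp
        qed
        show "AE y in lborel. norm (?Q (X n) y) \<le> (2 * ?B) * norm (u y)" for n
        proof (intro AE_I2)
          fix y
          have "\<bar>\<phi> (x - y + X n) - \<phi> (x - y)\<bar> \<le> ?B * norm (X n)"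
            using bounded_derivative_lipschitz[OF D, of B "x - y + X n" "x - y"] B by simp
          hence "\<bar>\<phi> (x - y + X n) - \<phi> (x - y) - D (x - y) (X n)\<bar> \<le> (2 * ?B) * norm (X n)"
            using Dh[of "x - y" "X n"] by linarith
          moreover have "norm (X n) > 0" using X(1) by simp
          ultimately have "\<bar>\<phi> (x - y + X n) - \<phi> (x - y) - D (x - y) (X n)\<bar> / norm (X n) \<le> 2 * ?B"
            by (simp add: pos_divide_le_eq)
          thus "norm (?Q (X n) y) \<le> (2 * ?B) * norm (u y)"
            unfolding norm_scaleR by (intro mult_right_mono) simp_all
        qed
      qed measurable
      thus "(\<lambda>n. \<integral>y. ?Q (X n) y \<partial>lborel) \<longlonglongrightarrow> 0" by simp
    qed
    hence *: "((\<lambda>h. norm (\<integral>y. ?Q h y \<partial>lborel)) \<longlongrightarrow> 0) (at 0)" by (rule tendsto_norm_zero)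
    have eq: "(\<integral>y. ?Q h y \<partial>lborel) = ((\<integral>y. \<phi> (x + h - y) *\<^sub>R u y \<partial>lborel)
          - (\<integral>y. \<phi> (x - y) *\<^sub>R u y \<partial>lborel) - (\<integral>y. D (x - y) h *\<^sub>R u y \<partial>lborel)) /\<^sub>R norm h" for h
    proof -
      have "?Q h y = (1 / norm h) *\<^sub>R (\<phi> (x + h - y) *\<^sub>R u y - \<phi> (x - y) *\<^sub>R u y - D (x - y) h *\<^sub>R u y)" for y
      proof -
        have "x - y + h = x + h - y" by simp
        thus ?thesis
          unfolding scaleR_diff_left[symmetric] scaleR_scaleR by (simp only: divide_inverse mult.commute mult_1_left)
      qed
      thus ?thesis using i1 i2 by (simp add: divide_inverse)
    qed
    show "((\<lambda>h. norm ((\<integral>y. \<phi> (x + h - y) *\<^sub>R u y \<partial>lborel) - (\<integral>y. \<phi> (x - y) *\<^sub>R u y \<partial>lborel)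
        - (\<integral>y. D (x - y) h *\<^sub>R u y \<partial>lborel)) / norm h) \<longlongrightarrow> 0) (at 0)"
      using * unfolding eq by (simp add: divide_inverse mult.commute)
  qed
qed

lemma C_k_conv:
  fixes \<phi> :: "'a::euclidean_space \<Rightarrow> real" and u :: "'a \<Rightarrow> complex"
  assumes "\<And>k. C_k k \<phi>" "compact S" "\<And>x. x \<notin> S \<Longrightarrow> \<phi> x = 0" and u: "integrable lborel u"
  shows "C_k k (\<lambda>x. \<integral>y. \<phi> (x - y) *\<^sub>R u y \<partial>lborel)"
proof -
  let ?D = "\<lambda>\<phi> x. frechet_derivative \<phi> (at x) :: 'a \<Rightarrow> real"
  let ?c = "\<lambda>\<phi> x. \<integral>y. \<phi> (x - y) *\<^sub>R u y \<partial>lborel"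
  have z: "?D \<phi> x = (\<lambda>h. 0)" if C: "\<And>k. C_k k \<phi>" and S: "\<And>x. x \<notin> S \<Longrightarrow> \<phi> x = 0" and "x \<notin> S" for \<phi> x
  proof -
    have "(\<phi> has_derivative ?D \<phi> x) (at x)"
      using C[of "Suc 0"] by (simp add: frechet_derivative_works)
    hence "((\<lambda>_. 0) has_derivative ?D \<phi> x) (at x)"
    proof (rule has_derivative_transform_within_open)
      show "open (- S)" using assms(2) by (simp add: compact_imp_closed open_Compl)
    qed (use that in auto)
    thus ?thesis using has_derivative_unique has_derivative_const by blast
  qed
  have der: "(?c \<phi> has_derivative (\<lambda>h. \<integral>y. ?D \<phi> (x - y) h *\<^sub>R u y \<partial>lborel)) (at x)"
    if C: "\<And>k. C_k k \<phi>" and S: "\<And>x. x \<notin> S \<Longrightarrow> \<phi> x = 0" for \<phi> x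
  proof -
    have D: "(\<phi> has_derivative ?D \<phi> x) (at x)" for x
      using C[of "Suc 0"] by (simp add: frechet_derivative_works)
    have c: "continuous_on UNIV (\<lambda>x. ?D \<phi> x i)" if "i \<in> Basis" for i
      using C[of "Suc 0"] that by simp
    have "\<exists>B. \<forall>x. \<bar>?D \<phi> x i\<bar> \<le> B" if "i \<in> Basis" for i
      by (rule compact_support_bounded[OF c[OF that] assms(2)]) (use z[OF C S] in auto)
    then obtain b where b: "\<And>i x. i \<in> Basis \<Longrightarrow> \<bar>?D \<phi> x i\<bar> \<le> b i" by metis
    have "b i \<le> sum (\<lambda>i. \<bar>b i\<bar>) Basis" if "i \<in> Basis" for i
      using member_le_sum[of i Basis "\<lambda>i. \<bar>b i\<bar>"] that by force
    hence B: "\<bar>?D \<phi> x i\<bar> \<le> sum (\<lambda>i. \<bar>b i\<bar>) Basis" if "i \<in> Basis" for x i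
      using b[OF that] that by (meson order_trans)
    obtain M where M: "\<And>x. \<bar>\<phi> x\<bar> \<le> M"
      by (rule compact_support_bounded[OF C_k_continuous[OF C] assms(2)]) (use S in auto)
    show ?thesis by (rule conv_has_derivative[OF D c B M u])
  qed
  show ?thesis using assms(1,3)
  proof (induction k arbitrary: \<phi>)
    case (0 \<phi>)
    show ?case
      using der[OF 0] by (auto intro!: continuous_at_imp_continuous_on intro: has_derivative_continuous)
  next
    case (Suc k \<phi>)
    have "C_k k (?c (\<lambda>x. ?D \<phi> x i))" if "i \<in> Basis" for i :: 'a
    proof (rule Suc.IH)
      show "C_k j (\<lambda>x. ?D \<phi> x i)" for j using Suc.prems(1)[of "Suc j"] that by simp
    qed (simp add: z[OF Suc.prems])
    with C_k_SucI[OF der[OF Suc.prems]] show ?case by blast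
  qed
qed

lemma C_k_mollify:
  assumes "\<epsilon> > 0" "integrable lborel u" shows "C_k k (mollify \<epsilon> u)"
  unfolding mollify_def[abs_def]
  by (rule C_k_conv[where S="cball 0 \<epsilon>"])
     (use assms in \<open>auto intro: C_k_mollifier mollifier_zero\<close>)

lemma test_function_mollify:
  assumes "\<epsilon> > 0" "integrable lborel u" "compact S" "\<And>x. x \<notin> S \<Longrightarrow> u x = 0"
    and "\<And>x y. x \<in> S \<Longrightarrow> dist x y \<le> \<epsilon> \<Longrightarrow> y \<in> \<Omega>"
  shows "test_function \<Omega> (mollify \<epsilon> u)"
proof (rule test_functionI)
  show "C_k k (mollify \<epsilon> u)" for k using C_k_mollify assms by blast
  show "compact {x + y | x y. x \<in> S \<and> y \<in> cball 0 \<epsilon>}"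
    using assms by (intro compact_sums) auto
  show "{x + y | x y. x \<in> S \<and> y \<in> cball 0 \<epsilon>} \<subseteq> \<Omega>"
  proof safe
    fix x y :: 'a assume "x \<in> S" "y \<in> cball 0 \<epsilon>"
    thus "x + y \<in> \<Omega>" using assms(5)[of x "x + y"] by (simp add: dist_norm)
  qed
  fix x assume x: "x \<notin> {x + y | x y. x \<in> S \<and> y \<in> cball 0 \<epsilon>}"
  have "mollifier \<epsilon> (x - y) *\<^sub>R u y = 0" for y
  proof (cases "y \<in> S")
    case True
    have "\<not> norm (x - y) \<le> \<epsilon>"
    proof
      assume "norm (x - y) \<le> \<epsilon>"
      hence "y + (x - y) \<in> {x + y | x y. x \<in> S \<and> y \<in> cball 0 \<epsilon>}" using True by force
      thus False using x by simp
    qed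
    thus ?thesis using mollifier_zero[of \<epsilon> "x - y"] assms(1) by simp
  qed (simp add: assms(4))
  hence "(\<lambda>y. mollifier \<epsilon> (x - y) *\<^sub>R u y) = (\<lambda>y. 0)" by blast
  thus "mollify \<epsilon> u x = 0" by (simp add: mollify_def)
qed

text \<open>Mollifying the indicator of the \<open>2 \<delta>\<close>-neighbourhood of \<open>K\<close> at scale \<open>\<delta>\<close> leaves the value \<open>1\<close> within
  distance \<open>\<delta>\<close> of \<open>K\<close>. A full neighbourhood is needed later, where the cut-off has to be \<open>1\<close> at a
  definite distance from the support of \<open>\<beta>\<close>.\<close>

lemma smooth_cutoff:
  fixes K U :: "'a::euclidean_space set"
  assumes "compact K" "open U" "K \<subseteq> U"
  obtains \<zeta> \<delta> where "\<delta> > 0" "test_function U \<zeta>" "\<And>x y. x \<in> K \<Longrightarrow> dist x y < \<delta> \<Longrightarrow> \<zeta> y = 1"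
proof -
  obtain e where e: "e > 0" "(\<Union>x\<in>K. ball x e) \<subseteq> U"
    using compact_subset_open_imp_ball_epsilon_subset[OF assms] by blast
  define \<delta> where "\<delta> = e / 4"
  have \<delta>: "\<delta> > 0" using e by (simp add: \<delta>_def)
  define A where "A = {x + y | x y. x \<in> K \<and> y \<in> cball 0 (2 * \<delta>)}"
  have A: "compact A" unfolding A_def using assms by (intro compact_sums) auto
  have inA: "x \<in> K \<Longrightarrow> dist x y \<le> 2 * \<delta> \<Longrightarrow> y \<in> A" for x y
    unfolding A_def by (intro CollectI exI[of _ x] exI[of _ "y - x"] conjI) (simp_all add: dist_norm norm_minus_commute)
  let ?u = "\<lambda>x. complex_of_real (indicator A x)"
  have [measurable]: "A \<in> sets borel" using A by (simp add: compact_imp_closed)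
  have u: "integrable lborel ?u" using emeasure_compact_finite[OF A] by (intro integrable_of_real) auto
  have t: "test_function U (mollify \<delta> ?u)"
  proof (rule test_function_mollify[OF \<delta> u A])
    fix x y assume "x \<in> A" "dist x y \<le> \<delta>"
    then obtain k where k: "k \<in> K" "dist k x \<le> 2 * \<delta>"
      unfolding A_def by (auto simp: dist_norm)
    hence "dist k y < e" using dist_triangle[of k y x] \<open>dist x y \<le> \<delta>\<close> e(1) by (simp add: \<delta>_def)
    hence "y \<in> (\<Union>x\<in>K. ball x e)" using k(1) by (intro UN_I[of k]) auto
    thus "y \<in> U" using e(2) by blast
  qed auto
  show ?thesis
  proof (rule that[OF \<delta> t])
    fix x y assume xy: "x \<in> K" "dist x y < \<delta>"
    have "bump z *\<^sub>R ?u (y - \<delta> *\<^sub>R z) = of_real (bump z)" for z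
    proof (cases "norm z < 1")
      case True
      have "dist x (y - \<delta> *\<^sub>R z) \<le> dist x y + norm (\<delta> *\<^sub>R z)"
        using norm_triangle_ineq[of "x - y" "\<delta> *\<^sub>R z"] by (simp add: dist_norm algebra_simps)
      also have "\<dots> \<le> \<delta> + \<delta>" using xy True \<delta> by (intro add_mono) (auto simp: mult_left_le)
      finally show ?thesis using inA[OF xy(1)] by (simp add: scaleR_conv_of_real)
    qed (simp add: bump_zero)
    thus "mollify \<delta> ?u y = 1" by (simp add: mollify_alt[OF \<delta>] bump_integral)
  qed
qed

lemma lipschitz_derivative_bound:
  fixes f :: "'a::real_normed_vector \<Rightarrow> 'b::real_normed_vector"
  assumes D: "(f has_derivative D) (at x)" and L: "\<And>x y. norm (f x - f y) \<le> L * norm (x - y)"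
  shows "norm (D h) \<le> L * norm h"
proof -
  interpret bounded_linear D using has_derivative_bounded_linear[OF D] .
  have "norm (D h) / norm h \<le> L" if "h \<noteq> 0"
  proof -
    let ?k = "\<lambda>n::nat. (1 / Suc n) *\<^sub>R h"
    let ?r = "\<lambda>n. norm (f (x + ?k n) - f x - D (?k n)) / norm (?k n)"
    have "?k \<longlonglongrightarrow> 0"
      using tendsto_scaleR[OF LIMSEQ_Suc[OF lim_1_over_n] tendsto_const[of h]] by simp
    have "?r \<longlonglongrightarrow> 0"
    proof -
      have "((\<lambda>k. norm (f (x + k) - f x - D k) / norm k) \<longlongrightarrow> 0) (at 0)"
        using D unfolding has_derivative_at by blast
      moreover have "filterlim ?k (at 0) sequentially"
        using \<open>?k \<longlonglongrightarrow> 0\<close> that by (intro filterlim_atI always_eventually) simp_all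
      ultimately show ?thesis by (rule filterlim_compose)
    qed
    hence lim: "(\<lambda>n. L + ?r n) \<longlonglongrightarrow> L" using tendsto_add[OF tendsto_const[of L]] by fastforce
    have "norm (D h) / norm h \<le> L + ?r n" for n
    proof -
      have "norm (D (?k n)) \<le> norm (f (x + ?k n) - f x) + norm (f (x + ?k n) - f x - D (?k n))"
        using norm_triangle_ineq4[of "f (x + ?k n) - f x" "f (x + ?k n) - f x - D (?k n)"]
        by (simp del: scaleR_conv_of_real)
      also have "norm (f (x + ?k n) - f x) \<le> L * norm (?k n)" using L[of "x + ?k n" x] by simp
      finally have "norm (D (?k n)) / norm (?k n) \<le> (L * norm (?k n) + norm (f (x + ?k n) - f x - D (?k n))) / norm (?k n)"
        by (intro divide_right_mono) auto
      also have "\<dots> = L + ?r n"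
      proof -
        have "norm (?k n) \<noteq> 0" using that by simp
        thus ?thesis by (metis add_divide_distrib nonzero_mult_div_cancel_right)
      qed
      finally show ?thesis using that by (simp add: scaleR)
    qed
    thus ?thesis using LIMSEQ_le_const[OF lim] by blast
  qed
  thus ?thesis by (cases "h = 0") (auto simp: pos_divide_le_eq zero)
qed

lemma mollify_lipschitz:
  fixes w :: "'a::euclidean_space \<Rightarrow> complex"
  assumes e: "\<epsilon> > 0" and [measurable]: "w \<in> borel_measurable borel" and M: "\<And>x. cmod (w x) \<le> M"
    and L: "\<And>x y. cmod (w x - w y) \<le> L * norm (x - y)" and "L \<ge> 0"
  shows mollify_bound: "cmod (mollify \<epsilon> w x) \<le> M"
    and mollify_close: "cmod (mollify \<epsilon> w x - w x) \<le> L * \<epsilon>"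
    and mollify_lip: "cmod (mollify \<epsilon> w x - mollify \<epsilon> w y) \<le> L * norm (x - y)"
proof -
  have i: "integrable lborel (\<lambda>z. bump z *\<^sub>R g z)"
    if "g \<in> borel_measurable borel" "\<And>z. cmod (g z) \<le> c" for g :: "'a \<Rightarrow> complex" and c
    using integrable_mult_bounded[OF integrable_of_real[OF bump_integrable] _ that(2)] that(1)
    by (simp add: scaleR_conv_of_real)
  have b: "cmod (\<integral>z. bump z *\<^sub>R g z \<partial>lborel) \<le> c"
    if [measurable]: "g \<in> borel_measurable borel" and c: "\<And>z. norm z < 1 \<Longrightarrow> cmod (g z) \<le> c" and c': "\<And>z. cmod (g z) \<le> c'"
    for g :: "'a \<Rightarrow> complex" and c c'
  proof -
    have "cmod (\<integral>z. bump z *\<^sub>R g z \<partial>lborel) \<le> (\<integral>z. bump z * c \<partial>(lborel :: 'a measure))"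
    proof (rule Bochner_Integration.integral_norm_bound_integral)
      fix z :: 'a
      show "norm (bump z *\<^sub>R g z) \<le> bump z * c"
        using c[of z] bump_nonneg[of z] bump_zero[of z] by (cases "norm z < 1") (auto intro!: mult_left_mono)
    qed (use bump_integrable i[OF that(1) c'] in auto)
    thus ?thesis by (simp add: bump_integral)
  qed
  have ii: "integrable lborel (\<lambda>z. bump z *\<^sub>R w (x - \<epsilon> *\<^sub>R z))" for x by (rule i[OF _ M]) measurable
  show "cmod (mollify \<epsilon> w x) \<le> M" unfolding mollify_alt[OF e] by (rule b[OF _ M M]) measurable
  have "(\<integral>z. bump z *\<^sub>R w x \<partial>(lborel :: 'a measure)) = w x"
    by (subst integral_scaleR_left) (simp_all add: bump_integrable bump_integral)
  moreover have "integrable (lborel :: 'a measure) (\<lambda>z. bump z *\<^sub>R w x)"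
    by (intro integrable_scaleR_left bump_integrable)
  ultimately have "mollify \<epsilon> w x - w x = (\<integral>z. bump z *\<^sub>R (w (x - \<epsilon> *\<^sub>R z) - w x) \<partial>lborel)"
    using ii[of x] by (simp add: mollify_alt[OF e] scaleR_diff_right)
  also have "cmod \<dots> \<le> L * \<epsilon>"
  proof (rule b)
    fix z :: 'a
    show "cmod (w (x - \<epsilon> *\<^sub>R z) - w x) \<le> M + M"
      using norm_triangle_ineq4[of "w (x - \<epsilon> *\<^sub>R z)" "w x"] M[of "x - \<epsilon> *\<^sub>R z"] M[of x] by linarith
    assume "norm z < 1"
    hence "\<epsilon> * norm z \<le> \<epsilon>" using e by (simp add: mult_left_le)
    thus "cmod (w (x - \<epsilon> *\<^sub>R z) - w x) \<le> L * \<epsilon>"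
      using L[of "x - \<epsilon> *\<^sub>R z" x] mult_left_mono[OF _ \<open>L \<ge> 0\<close>, of "\<epsilon> * norm z" \<epsilon>] e by simp
  qed measurable
  finally show "cmod (mollify \<epsilon> w x - w x) \<le> L * \<epsilon>" .
  have "mollify \<epsilon> w x - mollify \<epsilon> w y = (\<integral>z. bump z *\<^sub>R (w (x - \<epsilon> *\<^sub>R z) - w (y - \<epsilon> *\<^sub>R z)) \<partial>lborel)"
    using ii by (simp add: mollify_alt[OF e] scaleR_diff_right)
  also have "cmod \<dots> \<le> L * norm (x - y)"
  proof (rule b)
    fix z :: 'a
    have "cmod (w (x - \<epsilon> *\<^sub>R z) - w (y - \<epsilon> *\<^sub>R z)) \<le> L * norm (x - y)" using L[of "x - \<epsilon> *\<^sub>R z" "y - \<epsilon> *\<^sub>R z"] by simp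
    thus "cmod (w (x - \<epsilon> *\<^sub>R z) - w (y - \<epsilon> *\<^sub>R z)) \<le> L * norm (x - y)"
      and "cmod (w (x - \<epsilon> *\<^sub>R z) - w (y - \<epsilon> *\<^sub>R z)) \<le> L * norm (x - y)" by auto
  qed measurable
  finally show "cmod (mollify \<epsilon> w x - mollify \<epsilon> w y) \<le> L * norm (x - y)" .
qed

section \<open>The Fourier transform of integrable functions\<close>

lemma cis_measurable [measurable]: "cis \<in> borel_measurable borel"
  by (intro borel_measurable_continuous_onI continuous_intros)

lemma cnj_measurable [measurable]: "cnj \<in> borel_measurable borel"
  by (intro borel_measurable_continuous_onI continuous_intros)

lemma fourier_measurable [measurable]:
  assumes [measurable]: "u \<in> borel_measurable borel"
  shows "fourier u \<in> borel_measurable borel"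
  unfolding fourier_def[abs_def] by measurable

lemma integrable_cis_mult:
  fixes u :: "'a::euclidean_space \<Rightarrow> complex"
  assumes "integrable lborel u" shows "integrable lborel (\<lambda>x. cis (x \<bullet> \<xi>) * u x)"
  using integrable_mult_bounded[OF assms, of "\<lambda>x. cis (x \<bullet> \<xi>)" 1] by (simp add: mult.commute)

lemma integrable_cis_minus_mult:
  fixes u :: "'a::euclidean_space \<Rightarrow> complex"
  assumes "integrable lborel u" shows "integrable lborel (\<lambda>x. cis (- (x \<bullet> \<xi>)) * u x)"
  using integrable_cis_mult[OF assms, of "-\<xi>"] by simp

lemma fourier_bound:
  assumes "integrable lborel u"
  shows "cmod (fourier u \<xi>) \<le> (\<integral>x. cmod (u x) \<partial>lborel)"
proof -
  have "cmod (fourier u \<xi>) \<le> (\<integral>x. cmod (cis (- (x \<bullet> \<xi>)) * u x) \<partial>lborel)"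
    unfolding fourier_def by (rule integral_norm_bound)
  thus ?thesis by (simp add: norm_mult)
qed

lemma fourier_translate: "fourier (\<lambda>x. u (h + x)) \<xi> = cis (h \<bullet> \<xi>) * fourier u \<xi>"
proof -
  have "fourier u \<xi> = (\<integral>x. cis (- ((h + x) \<bullet> \<xi>)) * u (h + x) \<partial>lborel)"
    unfolding fourier_def by (rule integral_lborel_translate[symmetric])
  also have "\<dots> = (\<integral>x. cis (- (h \<bullet> \<xi>)) * (cis (- (x \<bullet> \<xi>)) * u (h + x)) \<partial>lborel)"
    by (simp add: inner_add_left cis_mult mult.assoc[symmetric])
  also have "\<dots> = cis (- (h \<bullet> \<xi>)) * fourier (\<lambda>x. u (h + x)) \<xi>"
    by (simp add: fourier_def)
  finally show ?thesis by (simp add: mult.assoc[symmetric] cis_mult)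
qed

lemma fourier_modulate: "fourier (\<lambda>x. cis (x \<bullet> \<zeta>) * u x) \<xi> = fourier u (\<xi> - \<zeta>)"
  by (simp add: fourier_def mult.assoc[symmetric] cis_mult inner_diff_right)

lemma fourier_cnj: "fourier (\<lambda>x. cnj (u x)) \<xi> = cnj (fourier u (- \<xi>))"
proof -
  have "(\<lambda>x. cis (- (x \<bullet> \<xi>)) * cnj (u x)) = (\<lambda>x. cnj (cis (- (x \<bullet> - \<xi>)) * u x))" by (simp add: cis_cnj)
  thus ?thesis unfolding fourier_def by (simp only: Bochner_Integration.integral_cnj)
qed

lemma fourier_scale:
  fixes u :: "'a::euclidean_space \<Rightarrow> complex"
  assumes "c > 0"
  shows "fourier (\<lambda>x. u (c *\<^sub>R x)) \<xi> = (1 / c) ^ DIM('a) *\<^sub>R fourier u ((1 / c) *\<^sub>R \<xi>)"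
  unfolding fourier_def using assms
  by (subst integral_lborel_affine[of "1 / c" _ 0]) simp_all

lemma fourier_add:
  assumes "integrable lborel u" "integrable lborel v"
  shows "fourier (\<lambda>x. u x + v x) \<xi> = fourier u \<xi> + fourier v \<xi>"
  unfolding fourier_def using assms by (simp add: ring_distribs integrable_cis_minus_mult)

lemma fourier_sum:
  assumes "\<And>i. i \<in> I \<Longrightarrow> integrable lborel (u i)"
  shows "fourier (\<lambda>x. \<Sum>i\<in>I. u i x) \<xi> = (\<Sum>i\<in>I. fourier (u i) \<xi>)"
  unfolding fourier_def using assms
  by (simp add: sum_distrib_left integrable_cis_minus_mult)

lemma fourier_cmult: "fourier (\<lambda>x. c * u x) \<xi> = c * fourier u \<xi>"
  by (simp add: fourier_def mult.left_commute)

text \<open>Fubini: both sides are the double integral of \<open>cis (- (x \<bullet> \<xi>)) * u x * a \<xi>\<close>.\<close>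

lemma fourier_multiplication_formula:
  fixes u a :: "'a::euclidean_space \<Rightarrow> complex"
  assumes u: "integrable lborel u" and a: "integrable lborel a"
  shows "(\<integral>\<xi>. fourier u \<xi> * a \<xi> \<partial>lborel) = (\<integral>x. u x * fourier a x \<partial>lborel)"
proof -
  have "(\<integral>x. (\<integral>\<xi>. u x * a \<xi> * cis (- (x \<bullet> \<xi>)) \<partial>lborel) \<partial>lborel)
      = (\<integral>\<xi>. (\<integral>x. u x * a \<xi> * cis (- (x \<bullet> \<xi>)) \<partial>lborel) \<partial>lborel)"
    by (rule fubini_bounded(1)[OF u a, of _ 1]) auto
  moreover have "(\<integral>\<xi>. u x * a \<xi> * cis (- (x \<bullet> \<xi>)) \<partial>lborel) = u x * fourier a x" for x
  proof -
    have "u x * a \<xi> * cis (- (x \<bullet> \<xi>)) = u x * (cis (- (\<xi> \<bullet> x)) * a \<xi>)" for \<xi>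
      by (simp add: inner_commute)
    thus ?thesis by (simp only: fourier_def integral_mult_right_zero)
  qed
  moreover have "(\<integral>x. u x * a \<xi> * cis (- (x \<bullet> \<xi>)) \<partial>lborel) = fourier u \<xi> * a \<xi>" for \<xi>
  proof -
    have "u x * a \<xi> * cis (- (x \<bullet> \<xi>)) = (cis (- (x \<bullet> \<xi>)) * u x) * a \<xi>" for x by simp
    thus ?thesis by (simp only: fourier_def integral_mult_left_zero)
  qed
  ultimately show ?thesis by simp
qed

subsection \<open>Gaussians\<close>

lemma
  fixes f :: "'a::euclidean_space \<Rightarrow> real \<Rightarrow> complex"
  assumes f: "\<And>b. b \<in> Basis \<Longrightarrow> integrable lborel (f b)"
  shows integral_lborel_prod: "(\<integral>x. (\<Prod>b\<in>Basis. f b (x \<bullet> b)) \<partial>lborel) = (\<Prod>b\<in>Basis. \<integral>t. f b t \<partial>lborel)" (is ?A)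
    and integrable_lborel_prod: "integrable lborel (\<lambda>x::'a. \<Prod>b\<in>Basis. f b (x \<bullet> b))" (is ?B)
proof -
  interpret P: product_sigma_finite "\<lambda>_::'a. lborel :: real measure" ..
  have m [measurable]: "f b \<in> borel_measurable borel" if "b \<in> Basis" for b
    using borel_measurable_integrable[OF f[OF that]] by simp
  have [measurable]: "(\<lambda>x::'a. \<Prod>b\<in>Basis. f b (x \<bullet> b)) \<in> borel_measurable borel"
    by (intro borel_measurable_prod measurable_compose[OF _ m]) auto
  have eq: "(\<Prod>b\<in>Basis. f b ((\<Sum>c\<in>Basis. w c *\<^sub>R c) \<bullet> b)) = (\<Prod>b\<in>(Basis::'a set). f b (w b))" for w
    by (intro prod.cong refl) simp
  show ?A
    by (subst lborel_eq, subst integral_distr) (simp_all add: eq P.product_integral_prod f)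
  show ?B
    by (subst lborel_eq, subst integrable_distr_eq) (simp_all add: eq P.product_integrable_prod f)
qed

definition gauss :: "'a::real_inner \<Rightarrow> real" where "gauss x = exp (- (x \<bullet> x) / 2)"

lemma gauss_pos: "0 < gauss x" by (simp add: gauss_def)
lemma gauss_le_1: "gauss x \<le> 1" by (simp add: gauss_def)
lemma gauss_minus: "gauss (- x) = gauss x" by (simp add: gauss_def)
lemma gauss_0 [simp]: "gauss 0 = 1" by (simp add: gauss_def)
lemma gauss_measurable [measurable]: "gauss \<in> borel_measurable (borel :: 'a::euclidean_space measure)"
  unfolding gauss_def[abs_def] by measurable

lemma gauss_real_integrable: "integrable lborel (gauss :: real \<Rightarrow> real)"
proof -
  have eq: "(gauss :: real \<Rightarrow> real) = (\<lambda>x. sqrt (2 * pi) * std_normal_density x)"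
    by (auto simp: gauss_def std_normal_density_def power2_eq_square)
  show ?thesis unfolding eq by (intro integrable_mult_right integrable_normal_density zero_less_one)
qed

lemma fourier_gauss_real: "(\<integral>s. cis (- (s * t)) * of_real (gauss s) \<partial>lborel) = of_real (sqrt (2 * pi) * gauss (t :: real))"
proof -
  have eq: "gauss s = sqrt (2 * pi) * std_normal_density s" for s :: real
    by (auto simp: gauss_def std_normal_density_def power2_eq_square)
  have "char std_normal_distribution (- t) = (CLBINT s. std_normal_density s *\<^sub>R iexp (- t * s))"
    unfolding char_def by (subst integral_density) auto
  hence "of_real (exp (- (t^2) / 2)) = (CLBINT s. std_normal_density s *\<^sub>R iexp (- t * s))"
    by (simp add: char_std_normal_distribution)
  moreover have "cis (- (s * t)) * of_real (gauss s) = of_real (sqrt (2 * pi)) * (std_normal_density s *\<^sub>R iexp (- t * s))" for s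
    by (simp add: eq cis_conv_exp scaleR_conv_of_real mult_ac)
  hence "(\<integral>s. cis (- (s * t)) * of_real (gauss s) \<partial>lborel)
      = of_real (sqrt (2 * pi)) * (CLBINT s. std_normal_density s *\<^sub>R iexp (- t * s))"
    by (simp only: integral_mult_right_zero)
  ultimately show ?thesis by (simp add: gauss_def power2_eq_square)
qed

lemma gauss_prod: "gauss x = (\<Prod>b\<in>Basis. gauss (x \<bullet> b))"
  by (simp add: gauss_def exp_sum[symmetric] euclidean_inner[of x x] sum_divide_distrib sum_negf)

lemma gauss_integrable_complex: "integrable lborel (\<lambda>x::'a::euclidean_space. complex_of_real (gauss x))"
  using integrable_lborel_prod[of "\<lambda>_::'a. \<lambda>t. complex_of_real (gauss t)"] gauss_real_integrable
  by (simp add: gauss_prod[symmetric] flip: of_real_prod)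

lemma gauss_integrable: "integrable lborel (gauss :: 'a::euclidean_space \<Rightarrow> real)"
  using gauss_integrable_complex[where 'a='a] by (simp add: complex_of_real_integrable_eq)

abbreviation gauss_mass :: "'a::euclidean_space itself \<Rightarrow> real" where
  "gauss_mass (_ :: 'a itself) \<equiv> sqrt (2 * pi) ^ DIM('a)"

lemma fourier_gauss:
  fixes \<xi> :: "'a::euclidean_space"
  shows "fourier (\<lambda>x. of_real (gauss x)) \<xi> = of_real (gauss_mass TYPE('a) * gauss \<xi>)"
proof -
  have i: "integrable lborel (\<lambda>t. cis (- (t * (\<xi> \<bullet> b))) * complex_of_real (gauss t))" for b
    using integrable_cis_minus_mult[OF gauss_integrable_complex[where 'a=real], of "\<xi> \<bullet> b"] by simp
  have "cis (- (x \<bullet> \<xi>)) * of_real (gauss x) = (\<Prod>b\<in>Basis. cis (- ((x \<bullet> b) * (\<xi> \<bullet> b))) * of_real (gauss (x \<bullet> b)))" for x :: 'a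
  proof -
    have "cis (- (x \<bullet> \<xi>)) = (\<Prod>b\<in>Basis. cis (- ((x \<bullet> b) * (\<xi> \<bullet> b))))"
      by (simp add: cis_conv_exp exp_sum[symmetric] euclidean_inner[of x \<xi>] sum_negf sum_distrib_left)
    thus ?thesis by (simp add: gauss_prod[of x] prod.distrib)
  qed
  hence "fourier (\<lambda>x. of_real (gauss x)) \<xi> = (\<Prod>b\<in>Basis. \<integral>t. cis (- (t * (\<xi> \<bullet> b))) * of_real (gauss t) \<partial>lborel)"
    unfolding fourier_def using integral_lborel_prod[OF i] by simp
  thus ?thesis by (simp add: fourier_gauss_real prod.distrib gauss_prod[of \<xi>])
qed

lemma gauss_integral: "(\<integral>x. gauss x \<partial>(lborel :: 'a::euclidean_space measure)) = gauss_mass TYPE('a)"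
proof -
  have "of_real (\<integral>x. gauss x \<partial>(lborel :: 'a measure)) = fourier (\<lambda>x::'a. of_real (gauss x)) 0"
    by (simp add: fourier_def)
  thus ?thesis unfolding fourier_gauss by (simp only: of_real_eq_iff gauss_0 mult_1_right)
qed

lemma gauss_scale_integrable:
  "\<epsilon> > 0 \<Longrightarrow> integrable lborel (\<lambda>x::'a::euclidean_space. complex_of_real (gauss (\<epsilon> *\<^sub>R x)))"
  using integrable_lborel_affine[OF gauss_integrable_complex, of \<epsilon> 0] by simp

definition gauss_smooth :: "real \<Rightarrow> ('a::euclidean_space \<Rightarrow> complex) \<Rightarrow> 'a \<Rightarrow> complex" where
  "gauss_smooth \<epsilon> u y = (\<integral>z. gauss z *\<^sub>R u (y - \<epsilon> *\<^sub>R z) \<partial>lborel)"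

text \<open>The multiplication formula for a modulated Gaussian: its Fourier transform is a Gaussian centred at
  \<open>y\<close>, so Fourier inversion with a Gaussian cut-off returns a Gaussian average of \<open>u\<close> around \<open>y\<close>.\<close>

lemma gauss_inversion:
  fixes u :: "'a::euclidean_space \<Rightarrow> complex"
  assumes u: "integrable lborel u" and e: "\<epsilon> > 0"
  shows "(\<integral>\<xi>. fourier u \<xi> * (cis (y \<bullet> \<xi>) * of_real (gauss (\<epsilon> *\<^sub>R \<xi>))) \<partial>lborel)
       = gauss_mass TYPE('a) * gauss_smooth \<epsilon> u y"
proof -
  let ?a = "\<lambda>\<xi>. cis (\<xi> \<bullet> y) * complex_of_real (gauss (\<epsilon> *\<^sub>R \<xi>))"
  have a: "integrable lborel ?a" by (rule integrable_cis_mult[OF gauss_scale_integrable[OF e]])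
  have Fa: "fourier ?a x = of_real ((1/\<epsilon>) ^ DIM('a) * gauss_mass TYPE('a) * gauss ((1/\<epsilon>) *\<^sub>R (x - y)))" for x
    using e by (simp add: fourier_modulate fourier_scale[OF e, of "\<lambda>x. of_real (gauss x)"] fourier_gauss scaleR_conv_of_real)
  have "(\<integral>\<xi>. fourier u \<xi> * ?a \<xi> \<partial>lborel) = (\<integral>x. u x * fourier ?a x \<partial>lborel)"
    by (rule fourier_multiplication_formula[OF u a])
  also have "\<dots> = \<epsilon> ^ DIM('a) *\<^sub>R (\<integral>z. u (y - \<epsilon> *\<^sub>R z) * fourier ?a (y - \<epsilon> *\<^sub>R z) \<partial>lborel)"
    using e by (subst integral_lborel_affine[of "-\<epsilon>" _ y]) simp_all
  also have "\<dots> = (\<integral>z. of_real (gauss_mass TYPE('a)) * (gauss z *\<^sub>R u (y - \<epsilon> *\<^sub>R z)) \<partial>lborel)"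
  proof -
    have "\<epsilon> ^ DIM('a) *\<^sub>R (u (y - \<epsilon> *\<^sub>R z) * fourier ?a (y - \<epsilon> *\<^sub>R z))
        = of_real (gauss_mass TYPE('a)) * (gauss z *\<^sub>R u (y - \<epsilon> *\<^sub>R z))" for z
      unfolding Fa using e by (simp add: gauss_minus scaleR_conv_of_real power_one_over)
    thus ?thesis unfolding integral_scaleR_right[symmetric] by presburger
  qed
  also have "\<dots> = gauss_mass TYPE('a) * gauss_smooth \<epsilon> u y"
    by (simp only: gauss_smooth_def integral_mult_right_zero)
  finally show ?thesis by (simp add: inner_commute)
qed

subsection \<open>Plancherel's inequalities\<close>

lemma gauss_mass_square: "gauss_mass TYPE('a::euclidean_space) * gauss_mass TYPE('a) = (2 * pi) ^ DIM('a)"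
proof -
  have "sqrt (2 * pi) * sqrt (2 * pi) = 2 * pi" by (subst real_sqrt_mult_self) simp
  thus ?thesis by (simp only: power_mult_distrib[symmetric])
qed

text \<open>With a Gaussian weight the integral of \<open>|F u|\<^sup>2\<close> becomes the pairing of \<open>u\<close> with its own Gaussian
  average. Estimating each product by \<open>|a b| \<le> (|a|\<^sup>2 + |b|\<^sup>2) / 2\<close> bounds it by the integral of \<open>|u|\<^sup>2\<close>,
  and Fatou's lemma removes the weight. The statement in \<open>[0, \<infinity>]\<close> makes it usable for integrable
  functions that are not known to be square integrable.\<close>

lemma plancherel_upper:
  fixes u :: "'a::euclidean_space \<Rightarrow> complex"
  assumes u: "integrable lborel u"
  shows "(\<integral>\<^sup>+\<xi>. ennreal ((cmod (fourier u \<xi>))\<^sup>2) \<partial>lborel)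
       \<le> ennreal ((2 * pi) ^ DIM('a)) * (\<integral>\<^sup>+x. ennreal ((cmod (u x))\<^sup>2) \<partial>lborel)"
proof -
  have [measurable]: "u \<in> borel_measurable borel" using u by auto
  let ?I = "\<integral>\<^sup>+x. ennreal ((cmod (u x))\<^sup>2) \<partial>lborel"
  let ?m = "gauss_mass TYPE('a)"
  have key: "(\<integral>\<^sup>+\<xi>. ennreal ((cmod (fourier u \<xi>))\<^sup>2 * gauss (\<epsilon> *\<^sub>R \<xi>)) \<partial>lborel) \<le> ennreal ((2 * pi) ^ DIM('a)) * ?I"
    if e: "\<epsilon> > 0" for \<epsilon>
  proof -
    let ?a = "\<lambda>\<xi>. cnj (fourier u \<xi>) * of_real (gauss (\<epsilon> *\<^sub>R \<xi>))"
    have a: "integrable lborel ?a"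
    proof -
      have "integrable lborel (\<lambda>\<xi>. of_real (gauss (\<epsilon> *\<^sub>R \<xi>)) * cnj (fourier u \<xi>))"
        by (rule integrable_mult_bounded[OF gauss_scale_integrable[OF e], of _ "\<integral>x. cmod (u x) \<partial>lborel"])
           (use fourier_bound[OF u] in auto)
      thus ?thesis by (simp only: mult.commute)
    qed
    have Fa: "fourier ?a x = ?m * cnj (gauss_smooth \<epsilon> u x)" for x
    proof -
      have "fourier ?a x = cnj (\<integral>\<xi>. fourier u \<xi> * (cis (x \<bullet> \<xi>) * of_real (gauss (\<epsilon> *\<^sub>R \<xi>))) \<partial>lborel)"
        unfolding fourier_def[of ?a] Bochner_Integration.integral_cnj[symmetric]
        by (intro Bochner_Integration.integral_cong refl) (simp add: cis_cnj inner_commute mult_ac)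
      thus ?thesis by (simp add: gauss_inversion[OF u e])
    qed
    have gi: "integrable lborel (\<lambda>\<xi>. (cmod (fourier u \<xi>))\<^sup>2 * gauss (\<epsilon> *\<^sub>R \<xi>))"
    proof -
      have "integrable lborel (\<lambda>\<xi>. ?a \<xi> * fourier u \<xi>)"
        by (rule integrable_mult_bounded[OF a _ fourier_bound[OF u]]) simp
      moreover have "?a \<xi> * fourier u \<xi> = of_real ((cmod (fourier u \<xi>))\<^sup>2 * gauss (\<epsilon> *\<^sub>R \<xi>))" for \<xi>
        unfolding of_real_mult complex_norm_square by (simp add: mult_ac)
      ultimately have "complex_integrable lborel (\<lambda>\<xi>. complex_of_real ((cmod (fourier u \<xi>))\<^sup>2 * gauss (\<epsilon> *\<^sub>R \<xi>)))" by simp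
      thus ?thesis by (simp only: complex_of_real_integrable_eq)
    qed
    have "of_real (\<integral>\<xi>. (cmod (fourier u \<xi>))\<^sup>2 * gauss (\<epsilon> *\<^sub>R \<xi>) \<partial>lborel) = (\<integral>\<xi>. fourier u \<xi> * ?a \<xi> \<partial>lborel)"
    proof -
      have "fourier u \<xi> * ?a \<xi> = of_real ((cmod (fourier u \<xi>))\<^sup>2 * gauss (\<epsilon> *\<^sub>R \<xi>))" for \<xi>
        unfolding of_real_mult complex_norm_square by (simp add: mult_ac)
      thus ?thesis by (simp only: integral_complex_of_real)
    qed
    also have "\<dots> = (\<integral>x. u x * fourier ?a x \<partial>lborel)"
      by (rule fourier_multiplication_formula[OF u a])
    finally have eq: "complex_of_real (\<integral>\<xi>. (cmod (fourier u \<xi>))\<^sup>2 * gauss (\<epsilon> *\<^sub>R \<xi>) \<partial>lborel) = (\<integral>x. u x * fourier ?a x \<partial>lborel)" .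
    have "(\<integral>\<^sup>+\<xi>. ennreal ((cmod (fourier u \<xi>))\<^sup>2 * gauss (\<epsilon> *\<^sub>R \<xi>)) \<partial>lborel)
        = ennreal (\<integral>\<xi>. (cmod (fourier u \<xi>))\<^sup>2 * gauss (\<epsilon> *\<^sub>R \<xi>) \<partial>lborel)"
      by (rule nn_integral_eq_integral[OF gi]) (simp add: gauss_pos less_imp_le)
    also have "\<dots> \<le> ennreal (cmod (\<integral>x. u x * fourier ?a x \<partial>lborel))"
      unfolding eq[symmetric] by (intro ennreal_leI) simp
    also have "\<dots> \<le> (\<integral>\<^sup>+x. ennreal (cmod (u x * fourier ?a x)) \<partial>lborel)"
    proof (cases "integrable lborel (\<lambda>x. u x * fourier ?a x)")
      case True thus ?thesis by (rule integral_norm_bound_ennreal)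
    qed (simp add: not_integrable_integral_eq)
    also have "\<dots> \<le> (\<integral>\<^sup>+x. (\<integral>\<^sup>+z. ennreal (?m * gauss z) * (ennreal ((cmod (u x))\<^sup>2 / 2) + ennreal ((cmod (u (x - \<epsilon> *\<^sub>R z)))\<^sup>2 / 2)) \<partial>lborel) \<partial>lborel)"
    proof (intro nn_integral_mono)
      fix x
      have "ennreal (cmod (gauss_smooth \<epsilon> u x)) \<le> (\<integral>\<^sup>+z. ennreal (gauss z * cmod (u (x - \<epsilon> *\<^sub>R z))) \<partial>lborel)"
      proof (cases "integrable lborel (\<lambda>z. gauss z *\<^sub>R u (x - \<epsilon> *\<^sub>R z))")
        case True
        from integral_norm_bound_ennreal[OF this] show ?thesis
          by (simp add: gauss_smooth_def gauss_pos less_imp_le)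
      qed (simp add: not_integrable_integral_eq gauss_smooth_def)
      hence "ennreal (?m * cmod (u x)) * ennreal (cmod (gauss_smooth \<epsilon> u x))
          \<le> ennreal (?m * cmod (u x)) * (\<integral>\<^sup>+z. ennreal (gauss z * cmod (u (x - \<epsilon> *\<^sub>R z))) \<partial>lborel)"
        by (rule mult_left_mono) simp
      also have "\<dots> = (\<integral>\<^sup>+z. ennreal (?m * gauss z) * ennreal (cmod (u x) * cmod (u (x - \<epsilon> *\<^sub>R z))) \<partial>lborel)"
        by (subst nn_integral_cmult[symmetric])
           (auto intro!: nn_integral_cong simp: gauss_pos less_imp_le mult_ac simp flip: ennreal_mult')
      also have "\<dots> \<le> (\<integral>\<^sup>+z. ennreal (?m * gauss z) * (ennreal ((cmod (u x))\<^sup>2 / 2) + ennreal ((cmod (u (x - \<epsilon> *\<^sub>R z)))\<^sup>2 / 2)) \<partial>lborel)"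
      proof (intro nn_integral_mono mult_left_mono)
        fix z
        have "cmod (u x) * cmod (u (x - \<epsilon> *\<^sub>R z)) \<le> (cmod (u x))\<^sup>2 / 2 + (cmod (u (x - \<epsilon> *\<^sub>R z)))\<^sup>2 / 2"
          using sum_squares_bound[of "cmod (u x)" "cmod (u (x - \<epsilon> *\<^sub>R z))"] by simp
        from ennreal_leI[OF this]
        show "ennreal (cmod (u x) * cmod (u (x - \<epsilon> *\<^sub>R z))) \<le> ennreal ((cmod (u x))\<^sup>2 / 2) + ennreal ((cmod (u (x - \<epsilon> *\<^sub>R z)))\<^sup>2 / 2)"
          by simp
      qed simp
      finally show "ennreal (cmod (u x * fourier ?a x)) \<le> (\<integral>\<^sup>+z. ennreal (?m * gauss z) * (ennreal ((cmod (u x))\<^sup>2 / 2) + ennreal ((cmod (u (x - \<epsilon> *\<^sub>R z)))\<^sup>2 / 2)) \<partial>lborel)"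
        unfolding Fa by (simp add: norm_mult mult_ac ennreal_mult[symmetric] norm_power)
    qed
    also have "\<dots> = (\<integral>\<^sup>+z. (\<integral>\<^sup>+x. ennreal (?m * gauss z) * (ennreal ((cmod (u x))\<^sup>2 / 2) + ennreal ((cmod (u (x - \<epsilon> *\<^sub>R z)))\<^sup>2 / 2)) \<partial>lborel) \<partial>lborel)"
      by (rule lborel_pair.Fubini') measurable
    also have "\<dots> = (\<integral>\<^sup>+z. ennreal (?m * gauss (z::'a)) * ?I \<partial>lborel)"
    proof (intro nn_integral_cong)
      fix z :: 'a
      have h: "ennreal (r / 2) = ennreal (1/2) * ennreal r" if "r \<ge> 0" for r
        using that by (subst ennreal_mult[symmetric]) simp_all
      have "(\<integral>\<^sup>+x. ennreal ((cmod (u (x - \<epsilon> *\<^sub>R z)))\<^sup>2) \<partial>lborel) = ?I"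
        using nn_integral_lborel_translate[of "\<lambda>x. ennreal ((cmod (u x))\<^sup>2)" "- \<epsilon> *\<^sub>R z"] by (simp add: algebra_simps)
      moreover have "ennreal (1/2) * ?I + ennreal (1/2) * ?I = ?I"
      proof -
        have "ennreal (1/2) + ennreal (1/2) = 1" by (subst ennreal_plus[symmetric]) simp_all
        thus ?thesis unfolding distrib_right[symmetric] by simp
      qed
      ultimately show "(\<integral>\<^sup>+x. ennreal (?m * gauss z) * (ennreal ((cmod (u x))\<^sup>2 / 2) + ennreal ((cmod (u (x - \<epsilon> *\<^sub>R z)))\<^sup>2 / 2)) \<partial>lborel)
         = ennreal (?m * gauss z) * ?I"
        by (simp add: nn_integral_cmult nn_integral_add h)
    qed
    also have "\<dots> = ennreal (?m * ?m) * ?I"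
    proof -
      have "(\<integral>\<^sup>+z. ennreal (?m * gauss (z::'a)) \<partial>lborel) = ennreal (\<integral>z. ?m * gauss (z::'a) \<partial>lborel)"
        by (rule nn_integral_eq_integral) (use gauss_integrable in \<open>auto simp: gauss_pos less_imp_le\<close>)
      thus ?thesis by (simp add: nn_integral_multc gauss_integral)
    qed
    finally show ?thesis by (simp only: gauss_mass_square)
  qed
  have lim: "(\<lambda>n. ennreal ((cmod (fourier u \<xi>))\<^sup>2 * gauss ((1 / Suc n) *\<^sub>R \<xi>))) \<longlonglongrightarrow> ennreal ((cmod (fourier u \<xi>))\<^sup>2)" for \<xi>
  proof (intro tendsto_ennrealI)
    have "(\<lambda>n. (1 / Suc n) *\<^sub>R \<xi>) \<longlonglongrightarrow> 0"
      using tendsto_scaleR[OF LIMSEQ_Suc[OF lim_1_over_n] tendsto_const[of \<xi>]] by simp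
    hence "(\<lambda>n. gauss ((1 / Suc n) *\<^sub>R \<xi>)) \<longlonglongrightarrow> exp (- ((0::'a) \<bullet> 0) / 2)"
      unfolding gauss_def by (intro tendsto_intros) auto
    from tendsto_mult[OF tendsto_const this]
    show "(\<lambda>n. (cmod (fourier u \<xi>))\<^sup>2 * gauss ((1 / Suc n) *\<^sub>R \<xi>)) \<longlonglongrightarrow> (cmod (fourier u \<xi>))\<^sup>2" by simp
  qed
  have "(\<integral>\<^sup>+\<xi>. ennreal ((cmod (fourier u \<xi>))\<^sup>2) \<partial>lborel)
      = (\<integral>\<^sup>+\<xi>. liminf (\<lambda>n. ennreal ((cmod (fourier u \<xi>))\<^sup>2 * gauss ((1 / Suc n) *\<^sub>R \<xi>))) \<partial>lborel)"
    using lim_imp_Liminf[OF trivial_limit_sequentially lim] by simp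
  also have "\<dots> \<le> liminf (\<lambda>n. \<integral>\<^sup>+\<xi>. ennreal ((cmod (fourier u \<xi>))\<^sup>2 * gauss ((1 / Suc n) *\<^sub>R \<xi>)) \<partial>lborel)"
    by (rule nn_integral_liminf) measurable
  also have "\<dots> \<le> ennreal ((2 * pi) ^ DIM('a)) * ?I"
    by (rule Liminf_le) (use key in auto)
  finally show ?thesis .
qed

lemma gauss_smooth_tendsto:
  fixes u :: "'a::euclidean_space \<Rightarrow> complex"
  assumes c: "continuous_on UNIV u" and B: "\<And>x. cmod (u x) \<le> B"
  shows "(\<lambda>n. gauss_smooth (1 / Suc n) u y) \<longlonglongrightarrow> of_real (gauss_mass TYPE('a)) * u y"
proof -
  have [measurable]: "u \<in> borel_measurable borel" using c by (rule borel_measurable_continuous_onI)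
  have "(\<lambda>n. \<integral>z. gauss z *\<^sub>R u (y - (1 / Suc n) *\<^sub>R z) \<partial>lborel) \<longlonglongrightarrow> (\<integral>z. gauss z *\<^sub>R u y \<partial>(lborel :: 'a measure))"
  proof (rule integral_dominated_convergence[where w="\<lambda>z. B * gauss z"])
    show "integrable lborel (\<lambda>z::'a. B * gauss z)" by (intro integrable_mult_right gauss_integrable)
    show "AE z in lborel. (\<lambda>n. gauss z *\<^sub>R u (y - (1 / Suc n) *\<^sub>R z)) \<longlonglongrightarrow> gauss z *\<^sub>R u y"
    proof (intro AE_I2 tendsto_scaleR tendsto_const)
      fix z :: 'a
      have "(\<lambda>n. y - (1 / Suc n) *\<^sub>R z) \<longlonglongrightarrow> y"
        using tendsto_diff[OF tendsto_const[of y] tendsto_scaleR[OF LIMSEQ_Suc[OF lim_1_over_n] tendsto_const[of z]]] by simp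
      moreover have "isCont u y" using c by (simp add: continuous_on_eq_continuous_at)
      ultimately show "(\<lambda>n. u (y - (1 / Suc n) *\<^sub>R z)) \<longlonglongrightarrow> u y" by (rule isCont_tendsto_compose[rotated])
    qed
    show "AE z in lborel. norm (gauss z *\<^sub>R u (y - (1 / Suc n) *\<^sub>R z)) \<le> B * gauss z" for n
    proof (intro AE_I2)
      fix z :: 'a
      show "norm (gauss z *\<^sub>R u (y - (1 / Suc n) *\<^sub>R z)) \<le> B * gauss z"
        using mult_right_mono[OF B[of "y - (1 / Suc n) *\<^sub>R z"] less_imp_le[OF gauss_pos[of z]]] gauss_pos[of z]
        by (simp add: mult.commute less_imp_le)
    qed
  qed measurable
  also have "(\<integral>z. gauss z *\<^sub>R u y \<partial>(lborel :: 'a measure)) = of_real (gauss_mass TYPE('a)) * u y"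
    by (subst integral_scaleR_left) (simp_all add: gauss_integrable gauss_integral scaleR_conv_of_real)
  finally show ?thesis by (simp add: gauss_smooth_def)
qed

text \<open>Both sides of \<open>gauss_inversion\<close> converge as the cut-off is removed; the constant is the square of the
  Gaussian mass.\<close>

lemma fourier_inversion:
  fixes u :: "'a::euclidean_space \<Rightarrow> complex"
  assumes u: "integrable lborel u" and Fu: "integrable lborel (fourier u)"
    and c: "continuous_on UNIV u" and B: "\<And>x. cmod (u x) \<le> B"
  shows "fourier (fourier u) (- y) = (2 * pi) ^ DIM('a) *\<^sub>R u y"
proof -
  have [measurable]: "u \<in> borel_measurable borel" using c by (rule borel_measurable_continuous_onI)
  have lim: "(\<lambda>n. gauss ((1 / Suc n) *\<^sub>R \<xi>)) \<longlonglongrightarrow> 1" for \<xi> :: 'a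
  proof -
    have "(\<lambda>n. (1 / Suc n) *\<^sub>R \<xi>) \<longlonglongrightarrow> 0"
      using tendsto_scaleR[OF LIMSEQ_Suc[OF lim_1_over_n] tendsto_const[of \<xi>]] by simp
    hence "(\<lambda>n. gauss ((1 / Suc n) *\<^sub>R \<xi>)) \<longlonglongrightarrow> exp (- ((0::'a) \<bullet> 0) / 2)"
      unfolding gauss_def by (intro tendsto_intros) auto
    thus ?thesis by simp
  qed
  have "(\<lambda>n. \<integral>\<xi>. fourier u \<xi> * (cis (y \<bullet> \<xi>) * of_real (gauss ((1 / Suc n) *\<^sub>R \<xi>))) \<partial>lborel)
      \<longlonglongrightarrow> (\<integral>\<xi>. fourier u \<xi> * (cis (y \<bullet> \<xi>) * of_real 1) \<partial>lborel)"
  proof (rule integral_dominated_convergence[where w="\<lambda>\<xi>. cmod (fourier u \<xi>)"])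
    show "integrable lborel (\<lambda>\<xi>. cmod (fourier u \<xi>))" using Fu by simp
    show "AE \<xi> in lborel. (\<lambda>n. fourier u \<xi> * (cis (y \<bullet> \<xi>) * of_real (gauss ((1 / Suc n) *\<^sub>R \<xi>))))
        \<longlonglongrightarrow> fourier u \<xi> * (cis (y \<bullet> \<xi>) * of_real 1)"
      by (intro AE_I2 tendsto_intros lim)
    show "AE \<xi> in lborel. norm (fourier u \<xi> * (cis (y \<bullet> \<xi>) * of_real (gauss ((1 / Suc n) *\<^sub>R \<xi>)))) \<le> cmod (fourier u \<xi>)" for n
      by (intro AE_I2) (auto simp: norm_mult gauss_pos less_imp_le intro!: mult_left_le gauss_le_1)
  qed measurable
  moreover have "(\<integral>\<xi>. fourier u \<xi> * (cis (y \<bullet> \<xi>) * of_real (gauss ((1 / Suc n) *\<^sub>R \<xi>))) \<partial>lborel)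
      = gauss_mass TYPE('a) * gauss_smooth (1 / Suc n) u y" for n
    by (rule gauss_inversion[OF u]) simp
  ultimately have "(\<lambda>n. gauss_mass TYPE('a) * gauss_smooth (1 / Suc n) u y) \<longlonglongrightarrow> (\<integral>\<xi>. fourier u \<xi> * (cis (y \<bullet> \<xi>) * of_real 1) \<partial>lborel)"
    by simp
  moreover have "(\<lambda>n. gauss_mass TYPE('a) * gauss_smooth (1 / Suc n) u y) \<longlonglongrightarrow> gauss_mass TYPE('a) * (gauss_mass TYPE('a) * u y)"
    by (intro tendsto_mult tendsto_const gauss_smooth_tendsto[OF c B])
  ultimately have "(\<integral>\<xi>. fourier u \<xi> * (cis (y \<bullet> \<xi>) * of_real 1) \<partial>lborel) = gauss_mass TYPE('a) * (gauss_mass TYPE('a) * u y)"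
    using LIMSEQ_unique by blast
  also have "\<dots> = of_real (gauss_mass TYPE('a) * gauss_mass TYPE('a)) * u y" by simp
  finally show ?thesis unfolding gauss_mass_square
    by (simp add: fourier_def[of "fourier u"] inner_commute mult.commute scaleR_conv_of_real)
qed

lemma gauss_smooth_measurable [measurable]:
  assumes [measurable]: "u \<in> borel_measurable borel"
  shows "gauss_smooth \<epsilon> u \<in> borel_measurable borel"
  unfolding gauss_smooth_def[abs_def] by measurable

text \<open>By Minkowski the \<open>L\<^sup>1\<close> distance is at most a Gaussian average of the \<open>L\<^sup>1\<close> moduli of continuity
  of \<open>u\<close> at small translations.\<close>

lemma gauss_smooth_L1:
  fixes u :: "'a::euclidean_space \<Rightarrow> complex"
  assumes u: "integrable lborel u"
  defines "m \<equiv> gauss_mass TYPE('a)"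
  shows "(\<lambda>n. \<integral>\<^sup>+y. ennreal (cmod (gauss_smooth (1 / Suc n) u y - of_real m * u y)) \<partial>lborel) \<longlonglongrightarrow> 0"
proof -
  have [measurable]: "u \<in> borel_measurable borel" using u by auto
  let ?h = "\<lambda>n z. - ((1 / Suc n) *\<^sub>R z) :: 'a"
  let ?I = "\<lambda>n z. \<integral>y. cmod (u (y + ?h n z) - u y) \<partial>lborel"
  have tr: "integrable lborel (\<lambda>y. u (y + h))" for h
    using integrable_lborel_translate[OF u, of h] by (simp add: add.commute)
  have I_int: "integrable lborel (\<lambda>y. cmod (u (y + h) - u y))" for h using tr u by auto
  have I_bound: "?I n z \<le> 2 * (\<integral>y. cmod (u y) \<partial>lborel)" for n z
  proof -
    have "?I n z \<le> (\<integral>y. cmod (u (y + ?h n z)) + cmod (u y) \<partial>lborel)"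
      by (rule integral_mono[OF I_int])
         (intro Bochner_Integration.integrable_add integrable_norm tr u norm_triangle_ineq4)+
    also have "\<dots> = (\<integral>y. cmod (u (y + ?h n z)) \<partial>lborel) + (\<integral>y. cmod (u y) \<partial>lborel)"
      by (intro Bochner_Integration.integral_add integrable_norm tr u)
    also have "(\<integral>y. cmod (u (y + ?h n z)) \<partial>lborel) = (\<integral>y. cmod (u y) \<partial>lborel)"
      using integral_lborel_translate[of "\<lambda>y. cmod (u y)" "?h n z"] by (simp add: add.commute)
    finally show ?thesis by simp
  qed
  have dom: "(\<lambda>n. \<integral>z. gauss z * ?I n z \<partial>lborel) \<longlonglongrightarrow> (\<integral>z. 0 \<partial>(lborel :: 'a measure))"
  proof (rule integral_dominated_convergence[where w="\<lambda>z. gauss z * (2 * (\<integral>y. cmod (u y) \<partial>lborel))"])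
    show "integrable lborel (\<lambda>z::'a. gauss z * (2 * (\<integral>y. cmod (u y) \<partial>lborel)))"
      by (intro integrable_mult_left gauss_integrable)
    show "AE z in lborel. (\<lambda>n. gauss z * ?I n z) \<longlonglongrightarrow> 0"
    proof (intro AE_I2 tendsto_mult_right_zero)
      fix z :: 'a
      have "(\<lambda>n. ?h n z) \<longlonglongrightarrow> 0"
        using tendsto_minus[OF tendsto_scaleR[OF LIMSEQ_Suc[OF lim_1_over_n] tendsto_const[of z]]] by simp
      thus "(\<lambda>n. ?I n z) \<longlonglongrightarrow> 0" by (rule L1_translation_continuous[OF u])
    qed
    show "AE z in lborel. norm (gauss z * ?I n z) \<le> gauss z * (2 * (\<integral>y. cmod (u y) \<partial>lborel))" for n
    proof (intro AE_I2)
      fix z :: 'a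
      have "0 \<le> ?I n z" by simp
      thus "norm (gauss z * ?I n z) \<le> gauss z * (2 * (\<integral>y. cmod (u y) \<partial>lborel))"
        using I_bound[where n=n and z=z] gauss_pos[of z] by (simp add: abs_mult mult_left_mono)
    qed
  qed measurable
  have le: "(\<integral>\<^sup>+y. ennreal (cmod (gauss_smooth (1 / Suc n) u y - of_real m * u y)) \<partial>lborel)
      \<le> ennreal (\<integral>z. gauss z * ?I n z \<partial>lborel)" for n
  proof -
    have "ennreal (cmod (gauss_smooth (1 / Suc n) u y - of_real m * u y))
        \<le> (\<integral>\<^sup>+z. ennreal (gauss z * cmod (u (y + ?h n z) - u y)) \<partial>lborel)"
      if i: "integrable lborel (\<lambda>z. gauss z *\<^sub>R u (y - (1 / Suc n) *\<^sub>R z))" for y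
    proof -
      have i2: "integrable lborel (\<lambda>z::'a. gauss z *\<^sub>R u y)" by (intro integrable_scaleR_left gauss_integrable)
      have "gauss_smooth (1 / Suc n) u y - of_real m * u y
          = (\<integral>z. gauss z *\<^sub>R u (y - (1 / Suc n) *\<^sub>R z) \<partial>lborel) - (\<integral>z. gauss z *\<^sub>R u y \<partial>(lborel :: 'a measure))"
        by (subst integral_scaleR_left)
           (simp_all add: gauss_smooth_def gauss_integrable gauss_integral m_def scaleR_conv_of_real)
      also have "\<dots> = (\<integral>z. gauss z *\<^sub>R u (y - (1 / Suc n) *\<^sub>R z) - gauss z *\<^sub>R u y \<partial>lborel)"
        by (rule Bochner_Integration.integral_diff[OF i i2, symmetric])
      finally have "ennreal (cmod (gauss_smooth (1 / Suc n) u y - of_real m * u y))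
         \<le> (\<integral>\<^sup>+z. ennreal (norm (gauss z *\<^sub>R u (y - (1 / Suc n) *\<^sub>R z) - gauss z *\<^sub>R u y)) \<partial>lborel)"
        using integral_norm_bound_ennreal[OF Bochner_Integration.integrable_diff[OF i i2]] by simp
      thus ?thesis by (simp add: scaleR_diff_right[symmetric] gauss_pos less_imp_le)
    qed
    moreover have "AE y in lborel. integrable lborel (\<lambda>z. gauss z *\<^sub>R u (y - (1 / Suc n) *\<^sub>R z))"
    proof -
      have "(\<integral>\<^sup>+y. (\<integral>\<^sup>+z. ennreal (norm (gauss z *\<^sub>R u (y - (1 / Suc n) *\<^sub>R z))) \<partial>lborel) \<partial>lborel)
          = (\<integral>\<^sup>+z. (\<integral>\<^sup>+y. ennreal (norm (gauss z *\<^sub>R u (y - (1 / Suc n) *\<^sub>R z))) \<partial>lborel) \<partial>lborel)"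
        by (rule lborel_pair.Fubini'[symmetric]) measurable
      also have "\<dots> = (\<integral>\<^sup>+z. ennreal (gauss (z::'a)) * (\<integral>\<^sup>+y. ennreal (cmod (u y)) \<partial>lborel) \<partial>lborel)"
      proof (intro nn_integral_cong)
        fix z :: 'a
        show "(\<integral>\<^sup>+y. ennreal (norm (gauss z *\<^sub>R u (y - (1 / Suc n) *\<^sub>R z))) \<partial>lborel)
            = ennreal (gauss (z::'a)) * (\<integral>\<^sup>+y. ennreal (cmod (u y)) \<partial>lborel)"
          using nn_integral_lborel_translate[of "\<lambda>y. ennreal (cmod (u y))" "?h n z"]
          by (simp add: ennreal_mult' gauss_pos less_imp_le nn_integral_cmult)
      qed
      also have "\<dots> = (\<integral>\<^sup>+z. ennreal (gauss (z::'a)) \<partial>lborel) * (\<integral>\<^sup>+y. ennreal (cmod (u y)) \<partial>lborel)"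
        by (simp add: nn_integral_multc)
      also have "\<dots> < \<infinity>"
      proof -
        have "(\<integral>\<^sup>+z. ennreal (gauss (z::'a)) \<partial>lborel) < \<infinity>"
          using gauss_integrable[where 'a='a] unfolding integrable_iff_bounded by (simp add: gauss_pos less_imp_le)
        moreover have "(\<integral>\<^sup>+y. ennreal (cmod (u y)) \<partial>lborel) < \<infinity>" using u by (simp add: integrable_iff_bounded)
        ultimately show ?thesis by (simp add: ennreal_mult_less_top)
      qed
      finally have "AE y in lborel. (\<integral>\<^sup>+z. ennreal (norm (gauss z *\<^sub>R u (y - (1 / Suc n) *\<^sub>R z))) \<partial>lborel) \<noteq> \<infinity>"
        by (intro nn_integral_PInf_AE) auto
      thus ?thesis by eventually_elim (auto simp: integrable_iff_bounded less_top)
    qed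
    ultimately have "(\<integral>\<^sup>+y. ennreal (cmod (gauss_smooth (1 / Suc n) u y - of_real m * u y)) \<partial>lborel)
        \<le> (\<integral>\<^sup>+y. (\<integral>\<^sup>+z. ennreal (gauss z * cmod (u (y + ?h n z) - u y)) \<partial>lborel) \<partial>lborel)"
      by (intro nn_integral_mono_AE) auto
    also have "\<dots> = (\<integral>\<^sup>+z. (\<integral>\<^sup>+y. ennreal (gauss z * cmod (u (y + ?h n z) - u y)) \<partial>lborel) \<partial>lborel)"
      by (rule lborel_pair.Fubini') measurable
    also have "\<dots> = (\<integral>\<^sup>+z. ennreal (gauss z * ?I n z) \<partial>lborel)"
    proof (intro nn_integral_cong)
      fix z :: 'a
      have "(\<integral>\<^sup>+y. ennreal (gauss z * cmod (u (y + ?h n z) - u y)) \<partial>lborel)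
          = ennreal (\<integral>y. gauss z * cmod (u (y + ?h n z) - u y) \<partial>lborel)"
        by (rule nn_integral_eq_integral[OF integrable_mult_right[OF I_int]]) (simp add: gauss_pos less_imp_le)
      thus "(\<integral>\<^sup>+y. ennreal (gauss z * cmod (u (y + ?h n z) - u y)) \<partial>lborel) = ennreal (gauss z * ?I n z)"
        by simp
    qed
    also have "\<dots> = ennreal (\<integral>z. gauss z * ?I n z \<partial>lborel)"
    proof (rule nn_integral_eq_integral)
      show "integrable lborel (\<lambda>z. gauss z * ?I n z)"
      proof (rule Bochner_Integration.integrable_bound)
        show "integrable lborel (\<lambda>z::'a. gauss z * (2 * (\<integral>y. cmod (u y) \<partial>lborel)))"
          by (intro integrable_mult_left gauss_integrable)
        show "AE z in lborel. norm (gauss z * ?I n z) \<le> norm (gauss z * (2 * (\<integral>y. cmod (u y) \<partial>lborel)))"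
        proof (intro AE_I2)
          fix z :: 'a
          have "0 \<le> ?I n z" by simp
          thus "norm (gauss z * ?I n z) \<le> norm (gauss z * (2 * (\<integral>y. cmod (u y) \<partial>lborel)))"
            using I_bound[where n=n and z=z] gauss_pos[of z] by (simp add: abs_mult mult_left_mono)
        qed
      qed measurable
    qed (simp add: gauss_pos less_imp_le)
    finally show ?thesis .
  qed
  show ?thesis
  proof (rule tendsto_sandwich[OF _ _ tendsto_const])
    show "(\<lambda>n. ennreal (\<integral>z. gauss z * ?I n z \<partial>lborel)) \<longlonglongrightarrow> 0"
      using tendsto_ennrealI[OF dom] by simp
  qed (use le in auto)
qed

text \<open>Duality: the smoothed function is, up to reflection and a factor, the Fourier transform of \<open>F u\<close> times a
  Gaussian, so the upper bound applies to it. Smoothing converges in \<open>L\<^sup>1\<close>, hence almost everywhere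
  along a subsequence, and Fatou's lemma passes to the limit.\<close>

lemma plancherel_lower:
  fixes u :: "'a::euclidean_space \<Rightarrow> complex"
  assumes u: "integrable lborel u"
  shows "ennreal ((2 * pi) ^ DIM('a)) * (\<integral>\<^sup>+x. ennreal ((cmod (u x))\<^sup>2) \<partial>lborel)
       \<le> (\<integral>\<^sup>+\<xi>. ennreal ((cmod (fourier u \<xi>))\<^sup>2) \<partial>lborel)"
proof -
  have [measurable]: "u \<in> borel_measurable borel" using u by auto
  let ?m = "gauss_mass TYPE('a)" and ?s = "\<lambda>n. gauss_smooth (1 / Suc n) u"
  have m: "?m > 0" by simp
  have bound: "(\<integral>\<^sup>+y. ennreal ((cmod (?s n y))\<^sup>2) \<partial>lborel) \<le> (\<integral>\<^sup>+\<xi>. ennreal ((cmod (fourier u \<xi>))\<^sup>2) \<partial>lborel)" for n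
  proof -
    let ?\<epsilon> = "1 / real (Suc n)"
    have e: "?\<epsilon> > 0" by simp
    let ?v = "\<lambda>\<xi>. fourier u \<xi> * of_real (gauss (?\<epsilon> *\<^sub>R \<xi>))"
    have v: "integrable lborel ?v"
    proof -
      have "integrable lborel (\<lambda>\<xi>. of_real (gauss (?\<epsilon> *\<^sub>R \<xi>)) * fourier u \<xi>)"
        by (rule integrable_mult_bounded[OF gauss_scale_integrable[OF e] _ fourier_bound[OF u]]) simp
      thus ?thesis by (simp only: mult.commute)
    qed
    have F: "fourier ?v (- y) = of_real ?m * ?s n y" for y
      using gauss_inversion[OF u e, of y] unfolding fourier_def[of ?v] by (simp add: inner_commute mult_ac)
    have "ennreal ((2 * pi) ^ DIM('a)) * (\<integral>\<^sup>+y. ennreal ((cmod (?s n y))\<^sup>2) \<partial>lborel)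
        = (\<integral>\<^sup>+y. ennreal ((cmod (fourier ?v (- y)))\<^sup>2) \<partial>lborel)"
      unfolding F gauss_mass_square[symmetric]
      by (subst nn_integral_cmult[symmetric]) (auto intro!: nn_integral_cong simp: norm_mult power2_eq_square ennreal_mult[symmetric] mult_ac norm_power)
    also have "\<dots> = (\<integral>\<^sup>+y. ennreal ((cmod (fourier ?v y))\<^sup>2) \<partial>lborel)"
      using nn_integral_lborel_reflect[of "\<lambda>y. ennreal ((cmod (fourier ?v y))\<^sup>2)" 0] by simp
    also have "\<dots> \<le> ennreal ((2 * pi) ^ DIM('a)) * (\<integral>\<^sup>+\<xi>. ennreal ((cmod (?v \<xi>))\<^sup>2) \<partial>lborel)"
      by (rule plancherel_upper[OF v])
    finally have "(\<integral>\<^sup>+y. ennreal ((cmod (?s n y))\<^sup>2) \<partial>lborel) \<le> (\<integral>\<^sup>+\<xi>. ennreal ((cmod (?v \<xi>))\<^sup>2) \<partial>lborel)"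
      by (subst (asm) ennreal_mult_le_mult_iff) auto
    also have "\<dots> \<le> (\<integral>\<^sup>+\<xi>. ennreal ((cmod (fourier u \<xi>))\<^sup>2) \<partial>lborel)"
      by (intro nn_integral_mono ennreal_leI power_mono)
         (auto simp: norm_mult gauss_pos less_imp_le intro!: mult_left_le gauss_le_1)
    finally show ?thesis .
  qed
  let ?d = "\<lambda>n y. ?s n y - of_real ?m * u y"
  have L1: "(\<lambda>n. \<integral>\<^sup>+y. ennreal (cmod (?d n y)) \<partial>lborel) \<longlonglongrightarrow> 0"
    by (rule gauss_smooth_L1[OF u])
  hence "\<forall>\<^sub>F n in sequentially. (\<integral>\<^sup>+y. ennreal (cmod (?d n y)) \<partial>lborel) < \<infinity>"
    by (rule order_tendstoD) simp
  then obtain N where N: "\<And>n. n \<ge> N \<Longrightarrow> (\<integral>\<^sup>+y. ennreal (cmod (?d n y)) \<partial>lborel) < \<infinity>"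
    by (auto simp: eventually_sequentially)
  have di: "integrable lborel (?d (n + N))" for n
    unfolding integrable_iff_bounded using N[of "n + N"] by simp
  have "(\<lambda>n. \<integral>y. norm (?d (n + N) y) \<partial>lborel) \<longlonglongrightarrow> 0"
  proof -
    have "ennreal (\<integral>y. norm (?d (n + N) y) \<partial>lborel) = (\<integral>\<^sup>+y. ennreal (cmod (?d (n + N) y)) \<partial>lborel)" for n
      using di[of n] by (intro nn_integral_eq_integral[symmetric]) auto
    hence "(\<lambda>n. ennreal (\<integral>y. norm (?d (n + N) y) \<partial>lborel)) \<longlonglongrightarrow> ennreal 0"
      using LIMSEQ_ignore_initial_segment[OF L1, of N] by simp
    thus ?thesis by (subst (asm) tendsto_ennreal_iff) auto
  qed
  from tendsto_L1_AE_subseq[OF di this]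
  obtain r :: "nat \<Rightarrow> nat" where r: "strict_mono r" "AE y in lborel. (\<lambda>n. ?d (r n + N) y) \<longlonglongrightarrow> 0" by blast
  have ae: "AE y in lborel. ennreal ((2 * pi) ^ DIM('a)) * ennreal ((cmod (u y))\<^sup>2)
      = liminf (\<lambda>n. ennreal ((cmod (?s (r n + N) y))\<^sup>2))"
    using r(2)
  proof eventually_elim
    case (elim y)
    have "(\<lambda>n. ?d (r n + N) y + of_real ?m * u y) \<longlonglongrightarrow> 0 + of_real ?m * u y"
      by (intro tendsto_add elim tendsto_const)
    hence "(\<lambda>n. ?s (r n + N) y) \<longlonglongrightarrow> of_real ?m * u y" by simp
    hence "(\<lambda>n. ennreal ((cmod (?s (r n + N) y))\<^sup>2)) \<longlonglongrightarrow> ennreal ((cmod (of_real ?m * u y))\<^sup>2)"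
      by (intro tendsto_ennrealI tendsto_intros)
    hence "liminf (\<lambda>n. ennreal ((cmod (?s (r n + N) y))\<^sup>2)) = ennreal ((cmod (of_real ?m * u y))\<^sup>2)"
      by (rule lim_imp_Liminf[OF trivial_limit_sequentially])
    also have "(cmod (of_real ?m * u y))\<^sup>2 = (2 * pi) ^ DIM('a) * (cmod (u y))\<^sup>2"
    proof -
      have sq: "(a * b)\<^sup>2 = (a * a) * b\<^sup>2" for a b :: real by (simp add: power2_eq_square)
      show ?thesis unfolding norm_mult norm_of_real abs_of_pos[OF m] sq gauss_mass_square ..
    qed
    finally show ?case by (simp add: ennreal_mult)
  qed
  have "ennreal ((2 * pi) ^ DIM('a)) * (\<integral>\<^sup>+x. ennreal ((cmod (u x))\<^sup>2) \<partial>lborel)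
      = (\<integral>\<^sup>+y. liminf (\<lambda>n. ennreal ((cmod (?s (r n + N) y))\<^sup>2)) \<partial>lborel)"
    using nn_integral_cong_AE[OF ae] by (simp add: nn_integral_cmult)
  also have "\<dots> \<le> liminf (\<lambda>n. \<integral>\<^sup>+y. ennreal ((cmod (?s (r n + N) y))\<^sup>2) \<partial>lborel)"
    by (rule nn_integral_liminf) measurable
  also have "\<dots> \<le> (\<integral>\<^sup>+\<xi>. ennreal ((cmod (fourier u \<xi>))\<^sup>2) \<partial>lborel)"
    by (rule Liminf_le, rule trivial_limit_sequentially, rule always_eventually, rule allI, rule bound)
  finally show ?thesis .
qed

subsection \<open>Decay of the Fourier transform of a test function\<close>

text \<open>The difference quotients have integral zero because Lebesgue measure is translation invariant; they
  converge boundedly on a fixed compact set.\<close>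

lemma integral_derivative_zero:
  assumes t: "test_function \<Omega> \<phi>" and D: "\<And>x. (\<phi> has_derivative D x) (at x)"
  shows "(\<integral>x. D x i \<partial>lborel) = 0"
proof -
  obtain S where S: "compact S" "\<And>x. x \<notin> S \<Longrightarrow> \<phi> x = 0" using test_functionE[OF t] by metis
  obtain L where L: "L > 0" "\<And>x y. cmod (\<phi> x - \<phi> y) \<le> L * norm (x - y)" using test_function_lipschitz[OF t] by metis
  let ?k = "\<lambda>n::nat. (1 / Suc n) *\<^sub>R i"
  let ?q = "\<lambda>n x. (\<phi> (x + ?k n) - \<phi> x) * of_real (Suc n)"
  define T where "T = {x + y | x y. x \<in> S \<and> y \<in> cball 0 (norm i)}"
  have [measurable]: "\<phi> \<in> borel_measurable borel" using test_function_measurable[OF t] .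
  have T: "compact T" unfolding T_def using S by (intro compact_sums) auto
  have [measurable]: "T \<in> sets borel" using T by (simp add: compact_imp_closed)
  have lim: "(\<lambda>n. ?q n x) \<longlonglongrightarrow> D x i" for x
  proof (cases "i = 0")
    case True
    thus ?thesis using has_derivative_bounded_linear[OF D] by (simp add: linear_simps)
  next
    case False
    interpret bounded_linear "D x" using has_derivative_bounded_linear[OF D] .
    have "?k \<longlonglongrightarrow> 0" using tendsto_scaleR[OF LIMSEQ_Suc[OF lim_1_over_n] tendsto_const[of i]] by simp
    hence f: "filterlim ?k (at 0) sequentially"
      using False by (intro filterlim_atI always_eventually) simp_all
    have "((\<lambda>k. norm (\<phi> (x + k) - \<phi> x - D x k) / norm k) \<longlongrightarrow> 0) (at 0)"
      using D unfolding has_derivative_at by blast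
    from filterlim_compose[OF this f]
    have "(\<lambda>n. norm (\<phi> (x + ?k n) - \<phi> x - D x (?k n)) / norm (?k n) * norm i) \<longlonglongrightarrow> 0"
      by (rule tendsto_mult_left_zero)
    moreover have "norm (\<phi> (x + ?k n) - \<phi> x - D x (?k n)) / norm (?k n) * norm i = norm (?q n x - D x i)" for n
    proof -
      have "?q n x - D x i = (\<phi> (x + ?k n) - \<phi> x - D x (?k n)) * of_real (Suc n)"
      proof -
        have "D x (?k n) * of_real (Suc n) = D x i"
          unfolding scaleR scaleR_conv_of_real by (simp del: of_nat_Suc)
        thus ?thesis by (simp only: left_diff_distrib)
      qed
      hence "norm (?q n x - D x i) = norm (\<phi> (x + ?k n) - \<phi> x - D x (?k n)) * real (Suc n)"
        by (simp only: norm_mult norm_of_real norm_of_nat of_real_of_nat_eq)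
      thus ?thesis using False by (simp add: field_simps)
    qed
    ultimately have "(\<lambda>n. norm (?q n x - D x i)) \<longlonglongrightarrow> 0" by simp
    thus ?thesis using LIM_zero_cancel tendsto_norm_zero_iff by blast
  qed
  have "(\<lambda>n. \<integral>x. ?q n x \<partial>lborel) \<longlonglongrightarrow> (\<integral>x. D x i \<partial>lborel)"
  proof (rule integral_dominated_convergence[where w="\<lambda>x. (L * norm i) * indicator T x"])
    show "(\<lambda>x. D x i) \<in> borel_measurable lborel"
      by (rule borel_measurable_LIMSEQ_metric[OF _ lim]) measurable
    show "integrable lborel (\<lambda>x. (L * norm i) * indicator T x)"
      using emeasure_compact_finite[OF T] by (intro integrable_mult_right) auto
    show "AE x in lborel. norm (?q n x) \<le> (L * norm i) * indicator T x" for n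
    proof (intro AE_I2)
      fix x
      show "norm (?q n x) \<le> (L * norm i) * indicator T x"
      proof (cases "x \<in> T")
        case True
        have "norm (?q n x) = norm (\<phi> (x + ?k n) - \<phi> x) * real (Suc n)"
          by (simp only: norm_mult norm_of_real norm_of_nat of_real_of_nat_eq)
        also have "\<dots> \<le> (L * norm (?k n)) * real (Suc n)"
          using L(2)[of "x + ?k n" x] by (intro mult_right_mono) auto
        finally show ?thesis using True by simp
      next
        case False
        have "x \<notin> S" using False unfolding T_def by force
        moreover have "x + ?k n \<notin> S"
        proof
          assume *: "x + ?k n \<in> S"
          have "norm i / (1 + real n) \<le> norm i" by (simp add: divide_le_eq mult_le_cancel_left1)
          hence "- ?k n \<in> cball 0 (norm i)" by (simp add: divide_inverse mult.commute)
          hence "(x + ?k n) + (- ?k n) \<in> T" unfolding T_def using * by blast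
          thus False using False by simp
        qed
        ultimately show ?thesis using S(2) L(1) by simp
      qed
    qed
  qed (use lim in \<open>auto simp del: of_nat_Suc\<close>)
  moreover have "(\<integral>x. ?q n x \<partial>lborel) = 0" for n
  proof -
    have "integrable lborel \<phi>" by (rule test_function_integrable[OF t])
    moreover have "integrable lborel (\<lambda>x. \<phi> (x + ?k n))"
      using integrable_lborel_translate[OF test_function_integrable[OF t], of "?k n"] by (simp add: add.commute)
    ultimately have "(\<integral>x. \<phi> (x + ?k n) - \<phi> x \<partial>lborel) = 0"
      using integral_lborel_translate[of \<phi> "?k n"] by (simp add: add.commute)
    thus ?thesis by simp
  qed
  ultimately show ?thesis using LIMSEQ_unique tendsto_const by (metis (no_types, lifting) LIMSEQ_const_iff ext)
qed

lemma fourier_derivative: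
  assumes t: "test_function \<Omega> \<phi>" and D: "\<And>x. (\<phi> has_derivative D x) (at x)" and ti: "test_function \<Omega> (\<lambda>x. D x i)"
  shows "fourier (\<lambda>x. D x i) \<xi> = \<i> * of_real (i \<bullet> \<xi>) * fourier \<phi> \<xi>"
proof -
  let ?c = "\<lambda>x. cis (x \<bullet> (- \<xi>))"
  have dc: "(?c has_derivative (\<lambda>h. ?c x * (\<i> * of_real (h \<bullet> (- \<xi>))))) (at x)" for x
  proof -
    have "((\<lambda>x. \<i> * complex_of_real (x \<bullet> (- \<xi>))) has_derivative (\<lambda>h. \<i> * complex_of_real (h \<bullet> (- \<xi>)))) (at x)"
      by (intro has_derivative_mult_right has_derivative_of_real has_derivative_inner_left has_derivative_ident)
    from has_derivative_compose[OF this DERIV_exp[unfolded has_field_derivative_def]]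
    show ?thesis by (simp add: cis_conv_exp)
  qed
  have t': "test_function \<Omega> (\<lambda>x. ?c x * \<phi> x)" by (rule test_function_mult[OF t C_k_cis])
  have "(\<integral>x. ?c x * D x i + ?c x * (\<i> * of_real (i \<bullet> (- \<xi>))) * \<phi> x \<partial>lborel) = 0"
    by (rule integral_derivative_zero[OF t' has_derivative_mult[OF dc D]])
  hence "0 = (\<integral>x. cis (- (x \<bullet> \<xi>)) * D x i - (\<i> * of_real (i \<bullet> \<xi>)) * (cis (- (x \<bullet> \<xi>)) * \<phi> x) \<partial>lborel)"
    by (simp add: mult_ac)
  also have "\<dots> = (\<integral>x. cis (- (x \<bullet> \<xi>)) * D x i \<partial>lborel) - (\<integral>x. (\<i> * of_real (i \<bullet> \<xi>)) * (cis (- (x \<bullet> \<xi>)) * \<phi> x) \<partial>lborel)"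
    by (intro Bochner_Integration.integral_diff integrable_mult_right integrable_cis_minus_mult
        test_function_integrable[OF t] test_function_integrable[OF ti])
  finally show ?thesis by (simp only: integral_mult_right_zero) (simp add: fourier_def)
qed

lemma test_function_cmult: "test_function \<Omega> \<phi> \<Longrightarrow> test_function \<Omega> (\<lambda>x. c * \<phi> x)"
  by (rule test_function_mult[OF _ C_k_const])

lemma test_function_zero: "test_function \<Omega> (\<lambda>x. 0)"
  by (rule test_functionI[where S="{}"]) auto

lemma test_function_sum:
  "(\<And>i. i \<in> I \<Longrightarrow> test_function \<Omega> (f i)) \<Longrightarrow> test_function \<Omega> (\<lambda>x. \<Sum>i\<in>I. f i x)"
  by (induction I rule: infinite_finite_induct) (auto intro: test_function_add test_function_zero)

text \<open>Here \<open>\<psi> = (1 - \<Delta>) \<phi>\<close>; applying this repeatedly trades smoothness for decay of the Fourier transform.\<close>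

lemma test_function_bessel:
  fixes \<phi> :: "'a::euclidean_space \<Rightarrow> complex"
  assumes t: "test_function \<Omega> \<phi>"
  obtains \<psi> where "test_function \<Omega> \<psi>" "\<And>\<xi>. fourier \<psi> \<xi> = of_real (1 + (norm \<xi>)\<^sup>2) * fourier \<phi> \<xi>"
proof -
  obtain D where D: "\<And>x. (\<phi> has_derivative D x) (at x)" "\<And>i. i \<in> Basis \<Longrightarrow> test_function \<Omega> (\<lambda>x. D x i)"
    using test_function_derivative[OF t] by blast
  have "\<exists>E. (\<forall>x. ((\<lambda>x. D x i) has_derivative E x) (at x)) \<and> test_function \<Omega> (\<lambda>x. E x i)" if "i \<in> Basis" for i
    using test_function_derivative[OF D(2)[OF that]] that by metis
  then obtain E where E: "\<And>i x. i \<in> Basis \<Longrightarrow> ((\<lambda>x. D x i) has_derivative E i x) (at x)"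
      "\<And>i. i \<in> Basis \<Longrightarrow> test_function \<Omega> (\<lambda>x. E i x i)" by metis
  let ?\<psi> = "\<lambda>x. \<phi> x + (\<Sum>i\<in>Basis. (-1) * E i x i)"
  have FE: "fourier (\<lambda>x. E i x i) \<xi> = - of_real ((i \<bullet> \<xi>)\<^sup>2) * fourier \<phi> \<xi>" if "i \<in> Basis" for i \<xi>
    using fourier_derivative[OF D(2)[OF that] E(1)[OF that] E(2)[OF that], of \<xi>]
      fourier_derivative[OF t D(1) D(2)[OF that], of \<xi>] by (simp add: power2_eq_square mult_ac)
  show ?thesis
  proof (rule that[of ?\<psi>])
    show "test_function \<Omega> ?\<psi>" by (intro test_function_add t test_function_sum test_function_cmult E(2))
    fix \<xi>
    have "fourier ?\<psi> \<xi> = fourier \<phi> \<xi> + (\<Sum>i\<in>Basis. (-1) * fourier (\<lambda>x. E i x i) \<xi>)"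
      by (subst fourier_add, rule test_function_integrable[OF t],
          rule test_function_integrable[OF test_function_sum[OF test_function_cmult[OF E(2)]]], assumption,
          subst fourier_sum, rule test_function_integrable[OF test_function_cmult[OF E(2)]], assumption,
          simp only: fourier_cmult)
    also have "\<dots> = fourier \<phi> \<xi> + (\<Sum>i\<in>Basis. of_real ((i \<bullet> \<xi>)\<^sup>2) * fourier \<phi> \<xi>)"
      by (simp add: FE)
    also have "(\<Sum>i\<in>Basis. of_real ((i \<bullet> \<xi>)\<^sup>2) * fourier \<phi> \<xi>) = of_real ((norm \<xi>)\<^sup>2) * fourier \<phi> \<xi>"
      by (simp add: sum_distrib_right[symmetric] norm_eq_sqrt_inner euclidean_inner[of \<xi> \<xi>] power2_eq_square inner_commute sum_nonneg)
    finally show "fourier ?\<psi> \<xi> = of_real (1 + (norm \<xi>)\<^sup>2) * fourier \<phi> \<xi>" by (simp add: ring_distribs)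
  qed
qed

lemma fourier_test_decay:
  assumes "test_function \<Omega> \<phi>"
  shows "\<exists>C\<ge>0. \<forall>\<xi>. cmod (fourier \<phi> \<xi>) * (1 + (norm \<xi>)\<^sup>2) ^ m \<le> C"
  using assms
proof (induction m arbitrary: \<phi>)
  case 0
  show ?case using fourier_bound[OF test_function_integrable[OF 0]]
    by (intro exI[of _ "\<integral>x. cmod (\<phi> x) \<partial>lborel"]) simp
next
  case (Suc m)
  obtain \<psi> where \<psi>: "test_function \<Omega> \<psi>" "\<And>\<xi>. fourier \<psi> \<xi> = of_real (1 + (norm \<xi>)\<^sup>2) * fourier \<phi> \<xi>"
    using test_function_bessel[OF Suc.prems] by blast
  have "cmod (fourier \<psi> \<xi>) = (1 + (norm \<xi>)\<^sup>2) * cmod (fourier \<phi> \<xi>)" for \<xi>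
    unfolding \<psi>(2) norm_mult norm_of_real by simp
  with Suc.IH[OF \<psi>(1)] show ?case by (auto simp: mult_ac)
qed

lemma inverse_1_plus_square_integrable: "integrable lborel (\<lambda>x::real. 1 / (1 + x\<^sup>2))"
  using integrable_inverse_1_plus_square by (simp add: set_integrable_def einterval_def inverse_eq_divide)

text \<open>The denominator is at least the product of the \<open>1 + x\<^sub>i\<^sup>2\<close> over the coordinates.\<close>

lemma japanese_bracket_integrable:
  "integrable lborel (\<lambda>\<xi>::'a::euclidean_space. 1 / (1 + (norm \<xi>)\<^sup>2) ^ DIM('a))"
proof (rule Bochner_Integration.integrable_bound)
  have "integrable lborel (\<lambda>x::'a. \<Prod>b\<in>Basis. complex_of_real (1 / (1 + (x \<bullet> b)\<^sup>2)))"
    by (rule integrable_lborel_prod) (intro integrable_of_real inverse_1_plus_square_integrable)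
  thus "integrable lborel (\<lambda>x::'a. \<Prod>b\<in>Basis. 1 / (1 + (x \<bullet> b)\<^sup>2))"
    unfolding of_real_prod[symmetric] complex_of_real_integrable_eq .
  show "AE x::'a in lborel. norm (1 / (1 + (norm x)\<^sup>2) ^ DIM('a)) \<le> norm (\<Prod>b\<in>Basis. 1 / (1 + (x \<bullet> b)\<^sup>2))"
  proof (intro AE_I2)
    fix x :: 'a
    have "(\<Prod>b\<in>(Basis::'a set). 1 / (1 + (norm x)\<^sup>2)) \<le> (\<Prod>b\<in>Basis. 1 / (1 + (x \<bullet> b)\<^sup>2))"
    proof (rule prod_mono, rule conjI)
      fix b :: 'a assume "b \<in> Basis"
      hence "\<bar>x \<bullet> b\<bar>\<^sup>2 \<le> (norm x)\<^sup>2" by (intro power_mono Basis_le_norm) auto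
      thus "1 / (1 + (norm x)\<^sup>2) \<le> 1 / (1 + (x \<bullet> b)\<^sup>2)"
        by (intro divide_left_mono) (auto simp: add_pos_nonneg)
    qed simp
    moreover have "0 \<le> (\<Prod>b\<in>(Basis::'a set). 1 / (1 + (x \<bullet> b)\<^sup>2))" by (intro prod_nonneg) auto
    ultimately show "norm (1 / (1 + (norm x)\<^sup>2) ^ DIM('a)) \<le> norm (\<Prod>b\<in>Basis. 1 / (1 + (x \<bullet> b)\<^sup>2))"
      by (simp add: power_one_over)
  qed
qed measurable

lemma fourier_test_weighted_integrable:
  fixes \<phi> :: "'a::euclidean_space \<Rightarrow> complex"
  assumes t: "test_function \<Omega> \<phi>"
  shows "integrable lborel (\<lambda>\<xi>. (1 + norm \<xi>) ^ k * cmod (fourier \<phi> \<xi>))"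
proof -
  have [measurable]: "\<phi> \<in> borel_measurable borel" using test_function_measurable[OF t] .
  obtain C where C: "C \<ge> 0" "\<And>\<xi>. cmod (fourier \<phi> \<xi>) * (1 + (norm \<xi>)\<^sup>2) ^ (DIM('a) + k) \<le> C"
    using fourier_test_decay[OF t] by blast
  show ?thesis
  proof (rule Bochner_Integration.integrable_bound)
    show "integrable lborel (\<lambda>\<xi>::'a. (2 ^ k * C) * (1 / (1 + (norm \<xi>)\<^sup>2) ^ DIM('a)))"
      by (intro integrable_mult_right japanese_bracket_integrable)
    show "AE \<xi> in lborel. norm ((1 + norm \<xi>) ^ k * cmod (fourier \<phi> \<xi>)) \<le> norm ((2 ^ k * C) * (1 / (1 + (norm \<xi>)\<^sup>2) ^ DIM('a)))"
    proof (intro AE_I2)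
      fix \<xi> :: 'a
      let ?s = "1 + (norm \<xi>)\<^sup>2"
      have s: "?s > 0" by (simp add: add_pos_nonneg)
      \<comment> \<open>\<open>2 r\<^sup>2 - r + 1 = 2 (r - 1/4)\<^sup>2 + 7/8\<close>\<close>
      have "1 + r \<le> 2 * (1 + r\<^sup>2)" for r :: real
        using zero_le_power2[of "r - 1/4"] by (simp add: power2_diff power_divide)
      from this[of "norm \<xi>"] have "1 + norm \<xi> \<le> 2 * ?s" .
      hence "(1 + norm \<xi>) ^ k \<le> (2 * ?s) ^ k" by (intro power_mono) auto
      hence "(1 + norm \<xi>) ^ k * cmod (fourier \<phi> \<xi>) \<le> (2 ^ k * ?s ^ k) * cmod (fourier \<phi> \<xi>)"
        unfolding power_mult_distrib by (intro mult_right_mono norm_ge_zero)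
      also have "\<dots> = 2 ^ k * (cmod (fourier \<phi> \<xi>) * ?s ^ (DIM('a) + k)) / ?s ^ DIM('a)"
        using s by (simp add: power_add field_simps)
      also have "\<dots> \<le> 2 ^ k * C / ?s ^ DIM('a)"
        using C s by (intro divide_right_mono mult_left_mono) auto
      finally show "norm ((1 + norm \<xi>) ^ k * cmod (fourier \<phi> \<xi>)) \<le> norm ((2 ^ k * C) * (1 / (1 + (norm \<xi>)\<^sup>2) ^ DIM('a)))"
        using C s by (simp add: abs_mult)
    qed
  qed measurable
qed

lemma fourier_test_integrable:
  assumes "test_function \<Omega> \<phi>" shows "integrable lborel (fourier \<phi>)"
proof -
  have [measurable]: "\<phi> \<in> borel_measurable borel" using test_function_measurable[OF assms] .
  have "integrable lborel (\<lambda>x. norm (fourier \<phi> x))"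
    using fourier_test_weighted_integrable[OF assms, of 0] by simp
  thus ?thesis by (rule integrable_norm_cancel) measurable
qed

lemma fourier_inversion_test:
  fixes \<phi> :: "'a::euclidean_space \<Rightarrow> complex"
  assumes t: "test_function \<Omega> \<phi>"
  shows "fourier (fourier \<phi>) (- y) = (2 * pi) ^ DIM('a) *\<^sub>R \<phi> y"
proof -
  obtain B where "\<And>x. cmod (\<phi> x) \<le> B" using test_function_bounded[OF t] by metis
  thus ?thesis
    by (intro fourier_inversion test_function_integrable[OF t] fourier_test_integrable[OF t]
        C_k_continuous[OF test_function_C_k[OF t, of 0]])
qed

text \<open>The multiplication formula for \<open>a \<eta> = F \<beta> (\<xi> - \<eta>)\<close>, whose Fourier transform is known by inversion.\<close>

lemma fourier_test_mult:
  fixes \<beta> u :: "'a::euclidean_space \<Rightarrow> complex"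
  assumes t: "test_function \<Omega> \<beta>" and u: "integrable lborel u"
  shows "(\<integral>\<eta>. fourier \<beta> (\<xi> - \<eta>) * fourier u \<eta> \<partial>lborel) = (2 * pi) ^ DIM('a) *\<^sub>R fourier (\<lambda>x. \<beta> x * u x) \<xi>"
proof -
  let ?a = "\<lambda>\<eta>. fourier \<beta> (\<xi> - \<eta>)"
  have a: "integrable lborel ?a" by (rule integrable_lborel_reflect[OF fourier_test_integrable[OF t]])
  have Fa: "fourier ?a x = (2 * pi) ^ DIM('a) *\<^sub>R (cis (- (x \<bullet> \<xi>)) * \<beta> x)" for x
  proof -
    have "fourier ?a x = (\<integral>\<zeta>. cis (- ((\<xi> - \<zeta>) \<bullet> x)) * fourier \<beta> \<zeta> \<partial>lborel)"
      unfolding fourier_def[of ?a]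
      using integral_lborel_reflect[of "\<lambda>\<zeta>. cis (- ((\<xi> - \<zeta>) \<bullet> x)) * fourier \<beta> \<zeta>" \<xi>] by simp
    also have "\<dots> = (\<integral>\<zeta>. cis (- (x \<bullet> \<xi>)) * (cis (- (\<zeta> \<bullet> (- x))) * fourier \<beta> \<zeta>) \<partial>lborel)"
      by (simp add: mult.assoc[symmetric] cis_mult inner_diff_left inner_diff_right inner_commute[of _ x])
    also have "\<dots> = cis (- (x \<bullet> \<xi>)) * fourier (fourier \<beta>) (- x)"
      by (simp only: integral_mult_right_zero fourier_def[of "fourier \<beta>"])
    finally show ?thesis by (simp add: fourier_inversion_test[OF t])
  qed
  have "(\<integral>\<eta>. fourier u \<eta> * ?a \<eta> \<partial>lborel) = (\<integral>x. u x * fourier ?a x \<partial>lborel)"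
    by (rule fourier_multiplication_formula[OF u a])
  also have "\<dots> = (\<integral>x. (2 * pi) ^ DIM('a) *\<^sub>R (cis (- (x \<bullet> \<xi>)) * (\<beta> x * u x)) \<partial>lborel)"
    unfolding Fa by (simp add: mult_ac)
  finally show ?thesis by (simp only: integral_scaleR_right fourier_def[of "\<lambda>x. \<beta> x * u x"] mult.commute)
qed

section \<open>The fractional Laplacian as a singular integral\<close>

lemma dyadic_scale:
  assumes "1 \<le> (r::real)" obtains n where "2 ^ n \<le> r" "r < 2 ^ Suc n"
proof -
  define n where "n = (LEAST n. r < 2 ^ n)"
  have n: "r < 2 ^ n" unfolding n_def using real_arch_pow[of 2 r] by (auto intro: LeastI)
  have "n \<noteq> 0" using n assms by (cases n) auto
  then obtain m where m: "n = Suc m" by (cases n) auto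
  have "\<not> r < 2 ^ m" using not_less_Least[of m "\<lambda>n. r < 2 ^ n"] m by (simp add: n_def)
  thus ?thesis using that[of m] n m by simp
qed

text \<open>Split into dyadic shells; the shell of radius \<open>2\<^sup>j\<close> contributes \<open>min 1 2\<^sup>j \<cdot> 2\<^sup>-\<^sup>\<alpha>\<^sup>j\<close> up to a
  constant, which is summable in both directions because \<open>0 < \<alpha> < 1\<close>.\<close>

lemma singular_kernel_finite:
  assumes a: "0 < \<alpha>" "\<alpha> < 1"
  shows "(\<integral>\<^sup>+h. ennreal (min 1 (norm h) * norm h powr (- (real DIM('a) + \<alpha>))) \<partial>(lborel :: 'a::euclidean_space measure)) < \<infinity>"
proof -
  let ?d = "real DIM('a)" and ?p = "- (real DIM('a) + \<alpha>)"
  let ?f = "\<lambda>h::'a. min 1 (norm h) * norm h powr ?p"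
  define a1 where "a1 n = (2 ^ n) powr ?p" for n :: nat
  define b1 where "b1 n = (1/2) ^ n * ((1/2) ^ Suc n) powr ?p" for n :: nat
  define A where "A n = ball (0::'a) (2 ^ Suc n)" for n
  define B where "B n = ball (0::'a) (2 * (1/2) ^ n)" for n
  let ?g = "\<lambda>n h. ennreal (a1 n) * indicator (A n) h + ennreal (b1 n) * indicator (B n) h"
  have [measurable]: "A n \<in> sets borel" "B n \<in> sets borel" for n by (simp_all add: A_def B_def)
  have nn: "0 \<le> a1 n" "0 \<le> b1 n" for n by (simp_all add: a1_def b1_def)
  have pt: "ennreal (?f h) \<le> (\<Sum>n. ?g n h)" for h
  proof -
    have "\<exists>n. ennreal (?f h) \<le> ?g n h"
    proof (cases "h = 0")
      case False
      show ?thesis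
      proof (cases "1 \<le> norm h")
        case True
        then obtain n where n: "2 ^ n \<le> norm h" "norm h < 2 ^ Suc n" using dyadic_scale by blast
        have "?f h = norm h powr ?p" using True by (simp add: min_def)
        also have "\<dots> \<le> a1 n" unfolding a1_def using n a by (intro powr_mono2') auto
        finally have "ennreal (?f h) \<le> ennreal (a1 n) * indicator (A n) h"
          using n by (simp add: A_def ennreal_leI)
        thus ?thesis by (metis add_increasing2 zero_le)
      next
        case small: False
        hence "1 \<le> 1 / norm h" using False by (simp add: field_simps)
        then obtain n where n: "2 ^ n \<le> 1 / norm h" "1 / norm h < 2 ^ Suc n" using dyadic_scale by blast
        have lo: "(1/2) ^ Suc n \<le> norm h" using n(2) False by (simp add: field_simps power_one_over)
        have up: "norm h \<le> (1/2) ^ n" using n(1) False by (simp add: field_simps power_one_over)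
        have "?f h = norm h * norm h powr ?p" using small by (simp add: min_def)
        also have "\<dots> \<le> b1 n" unfolding b1_def
          by (intro mult_mono up powr_mono2' lo) (use a in auto)
        finally have "ennreal (?f h) \<le> ennreal (b1 n)" by (rule ennreal_leI)
        moreover have "norm h < 2 * (1/2) ^ n" using up by (rule le_less_trans) simp
        ultimately have "ennreal (?f h) \<le> ennreal (b1 n) * indicator (B n) h" by (simp add: B_def)
        thus ?thesis by (metis add_increasing zero_le)
      qed
    qed (use a in simp)
    then obtain n where n: "ennreal (?f h) \<le> ?g n h" by blast
    also have "?g n h = (\<Sum>k\<in>{n}. ?g k h)" by simp
    also have "\<dots> \<le> (\<Sum>k. ?g k h)" by (rule sum_le_suminf) auto
    finally show ?thesis .
  qed
  let ?V = "unit_ball_vol ?d"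
  have V: "?V \<ge> 0" by simp
  have pp: "(x ^ n) powr q = (x powr q) ^ n" if "x > 0" for x q :: real and n
    using that by (induction n) (simp_all add: powr_mult)
  let ?c = "2 ^ DIM('a) * ((1/2) powr ?p)"
  have I: "(\<integral>\<^sup>+h. ?g n h \<partial>lborel) = ennreal (?V * (2 ^ DIM('a) * (2 powr (-\<alpha>)) ^ n) + ?V * (?c * ((1/2) powr (1 - \<alpha>)) ^ n))" for n
  proof -
    have 1: "a1 n * (2 ^ Suc n) ^ DIM('a) = 2 ^ DIM('a) * (2 powr (-\<alpha>)) ^ n"
    proof -
      have "(2::real) powr ?p * 2 ^ DIM('a) = 2 powr (?p + ?d)" by (simp only: powr_add powr_realpow zero_less_numeral)
      hence "(2::real) powr ?p * 2 ^ DIM('a) = 2 powr (-\<alpha>)" by simp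
      moreover have "a1 n * (2 ^ Suc n) ^ DIM('a) = 2 ^ DIM('a) * (2 powr ?p * 2 ^ DIM('a)) ^ n"
        unfolding a1_def pp[OF zero_less_numeral] power_Suc power_mult_distrib
        by (simp only: power_mult[symmetric] mult.commute mult.left_commute)
      ultimately show ?thesis by simp
    qed
    have 2: "b1 n * (2 * (1/2) ^ n) ^ DIM('a) = ?c * ((1/2) powr (1 - \<alpha>)) ^ n"
    proof -
      have h: "0 < (1/2::real)" by simp
      have "(1/2::real) * (1/2) powr ?p * (1/2) ^ DIM('a) = (1/2) powr (1 + ?p + ?d)"
        by (simp only: powr_add powr_realpow[OF h] powr_one[OF less_imp_le[OF h]])
      hence "(1/2::real) * (1/2) powr ?p * (1/2) ^ DIM('a) = (1/2) powr (1 - \<alpha>)" by simp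
      moreover have "b1 n * (2 * (1/2) ^ n) ^ DIM('a) = ?c * ((1/2) * (1/2) powr ?p * (1/2) ^ DIM('a)) ^ n"
        unfolding b1_def pp[OF h] power_Suc power_mult_distrib
        unfolding powr_mult by (simp only: pp[OF h] power_mult[symmetric] mult.commute mult.left_commute)
      ultimately show ?thesis by simp
    qed
    have "(\<integral>\<^sup>+h. ?g n h \<partial>lborel) = ennreal (a1 n) * emeasure lborel (A n) + ennreal (b1 n) * emeasure lborel (B n)"
      by (simp add: nn_integral_add nn_integral_cmult)
    also have "\<dots> = ennreal (a1 n * (?V * (2 ^ Suc n) ^ DIM('a))) + ennreal (b1 n * (?V * (2 * (1/2) ^ n) ^ DIM('a)))"
      unfolding A_def B_def using nn by (simp add: emeasure_ball ennreal_mult'[symmetric])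
    also have "\<dots> = ennreal (a1 n * (?V * (2 ^ Suc n) ^ DIM('a)) + b1 n * (?V * (2 * (1/2) ^ n) ^ DIM('a)))"
      by (rule ennreal_plus[symmetric]) (use nn in auto)
    also have "a1 n * (?V * (2 ^ Suc n) ^ DIM('a)) = ?V * (a1 n * (2 ^ Suc n) ^ DIM('a))" by (rule mult.left_commute)
    also have "b1 n * (?V * (2 * (1/2) ^ n) ^ DIM('a)) = ?V * (b1 n * (2 * (1/2) ^ n) ^ DIM('a))" by (rule mult.left_commute)
    finally show ?thesis unfolding 1 2 .
  qed
  have "(\<integral>\<^sup>+h. ennreal (?f h) \<partial>lborel) \<le> (\<integral>\<^sup>+h. (\<Sum>n. ?g n h) \<partial>lborel)"
    by (intro nn_integral_mono pt)
  also have "\<dots> = (\<Sum>n. \<integral>\<^sup>+h. ?g n h \<partial>lborel)" by (rule nn_integral_suminf) measurable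
  also have "\<dots> < \<infinity>"
  proof -
    have "2 powr (-\<alpha>) < 1" using a powr_less_mono[of "-\<alpha>" 0 2] by auto
    moreover have "(1/2) powr (1 - \<alpha>) < 1" using a powr_less_mono2[of "1 - \<alpha>" "1/2" 1] by simp
    ultimately have "summable (\<lambda>n. ?V * (2 ^ DIM('a) * (2 powr (-\<alpha>)) ^ n) + ?V * (?c * ((1/2) powr (1 - \<alpha>)) ^ n))"
      by (intro summable_add summable_mult summable_geometric) auto
    thus ?thesis unfolding I infinity_ennreal_def by (subst suminf_ennreal_eq[OF _ summable_sums]) auto
  qed
  finally show ?thesis .
qed

lemma AE_lborel_open_witness:
  fixes S :: "'a::euclidean_space set"
  assumes "AE x in lborel. P x" "open S" "S \<noteq> {}"
  obtains x where "x \<in> S" "P x"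
proof -
  obtain N where N: "{x. \<not> P x} \<subseteq> N" "N \<in> null_sets lborel" using assms(1) by (auto simp: eventually_ae_filter)
  obtain x r where r: "r > 0" "ball x r \<subseteq> S" using assms(2,3) by (metis openE ex_in_conv)
  have "\<not> ball x r \<subseteq> N"
  proof
    assume "ball x r \<subseteq> N"
    hence "emeasure lborel (ball x r) \<le> emeasure lborel N" using N(2) by (intro emeasure_mono) auto
    hence "emeasure lborel (ball x r) = 0" using N(2) by auto
    thus False using content_ball_pos[of r x] r(1) by (simp add: measure_def)
  qed
  thus ?thesis using N(1) r(2) that by blast
qed

lemma power_as_gaussian_mixture:
  assumes p: "p > 0" and s: "s > 0"
  shows "(\<integral>\<^sup>+t. ennreal (indicator {0<..} t * (t powr (p - 1) * exp (- (t * s)))) \<partial>lborel)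
       = ennreal (Gamma p * s powr (- p))"
proof -
  let ?f = "\<lambda>t::real. t powr (p - 1) / exp t"
  have "(\<integral>\<^sup>+t. ennreal (indicator {0..} t * ?f t) \<partial>lborel) = ennreal (Gamma p)"
    using Gamma_conv_nn_integral_real[OF p] by simp
  also have "(\<integral>\<^sup>+t. ennreal (indicator {0..} t * ?f t) \<partial>lborel) = (\<integral>\<^sup>+t. ennreal (indicator {0<..} t * ?f t) \<partial>lborel)"
    by (intro nn_integral_cong_AE AE_mp[OF AE_lborel_singleton[of 0] AE_I2]) (auto split: split_indicator)
  finally have G: "(\<integral>\<^sup>+t. ennreal (indicator {0<..} t * ?f t) \<partial>lborel) = ennreal (Gamma p)" .
  have "(\<integral>\<^sup>+t. ennreal (indicator {0<..} t * (t powr (p - 1) * exp (- (t * s)))) \<partial>lborel)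
      = ennreal (1/s) * (\<integral>\<^sup>+t. ennreal (indicator {0<..} (t / s) * ((t / s) powr (p - 1) * exp (- t))) \<partial>lborel)"
    using s by (subst nn_integral_real_affine[of _ "1/s" 0]) (simp_all add: mult.commute)
  also have "(\<integral>\<^sup>+t. ennreal (indicator {0<..} (t / s) * ((t / s) powr (p - 1) * exp (- t))) \<partial>lborel)
      = (\<integral>\<^sup>+t. ennreal (s powr (1 - p)) * ennreal (indicator {0<..} t * ?f t) \<partial>lborel)"
  proof (intro nn_integral_cong)
    fix t :: real
    show "ennreal (indicator {0<..} (t / s) * ((t / s) powr (p - 1) * exp (- t)))
        = ennreal (s powr (1 - p)) * ennreal (indicator {0<..} t * ?f t)"
    proof (cases "t > 0")
      case True
      have "(t / s) powr (p - 1) = s powr (1 - p) * t powr (p - 1)"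
        using True s by (simp add: powr_divide powr_diff field_simps)
      thus ?thesis using True s by (simp add: ennreal_mult'[symmetric] exp_minus divide_inverse mult_ac)
    qed (use s in \<open>simp add: zero_less_divide_iff\<close>)
  qed
  also have "\<dots> = ennreal (s powr (1 - p)) * ennreal (Gamma p)" by (subst nn_integral_cmult, measurable, simp only: G)
  also have "ennreal (1/s) * \<dots> = ennreal (1 / s * (s powr (1 - p) * Gamma p))"
    using s p by (simp add: ennreal_mult'[symmetric] Gamma_real_pos less_imp_le)
  also have "1 / s * (s powr (1 - p) * Gamma p) = Gamma p * s powr (- p)"
    using s by (simp add: powr_diff powr_minus field_simps)
  finally show ?thesis .
qed

text \<open>The homogeneous kernel is a superposition of Gaussians, and for a Gaussian the identity holds because
  its Fourier transform is radial.\<close>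

lemma fractional_symbol_radial:
  fixes \<xi> \<xi>' :: "'a::euclidean_space"
  assumes a: "0 < \<alpha>" and n: "norm \<xi> = norm \<xi>'"
  defines "q \<equiv> - (real DIM('a) + \<alpha>)"
  shows "(\<integral>\<^sup>+h. ennreal ((1 - cos (h \<bullet> \<xi>)) * norm h powr q) \<partial>lborel)
       = (\<integral>\<^sup>+h. ennreal ((1 - cos (h \<bullet> \<xi>')) * norm h powr q) \<partial>lborel)"
proof -
  define p where "p = (real DIM('a) + \<alpha>) / 2"
  have p: "p > 0" using a by (simp add: p_def add_pos_pos)
  let ?w = "\<lambda>t::real. indicator {0<..} t * t powr (p - 1)"
  have inner: "(\<integral>\<^sup>+h. ennreal ((1 - cos (h \<bullet> \<xi>)) * gauss (c *\<^sub>R h)) \<partial>lborel)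
      = ennreal (Re (fourier (\<lambda>x::'a. of_real (gauss (c *\<^sub>R x))) 0 - fourier (\<lambda>x::'a. of_real (gauss (c *\<^sub>R x))) \<xi>))"
    if c: "c > 0" for c and \<xi> :: 'a
  proof -
    let ?g = "\<lambda>x::'a. complex_of_real (gauss (c *\<^sub>R x))"
    have g: "integrable lborel ?g" by (rule gauss_scale_integrable[OF c])
    have i: "integrable lborel (\<lambda>h. ?g h - cis (- (h \<bullet> \<xi>)) * ?g h)"
      by (intro Bochner_Integration.integrable_diff g integrable_cis_minus_mult)
    have eq: "(1 - cos (h \<bullet> \<xi>)) * gauss (c *\<^sub>R h) = Re (?g h - cis (- (h \<bullet> \<xi>)) * ?g h)" for h
      by (simp add: left_diff_distrib)
    have "(\<integral>\<^sup>+h. ennreal ((1 - cos (h \<bullet> \<xi>)) * gauss (c *\<^sub>R h)) \<partial>lborel)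
        = ennreal (\<integral>h. (1 - cos (h \<bullet> \<xi>)) * gauss (c *\<^sub>R h) \<partial>lborel)"
    proof (rule nn_integral_eq_integral)
      show "integrable lborel (\<lambda>h. (1 - cos (h \<bullet> \<xi>)) * gauss (c *\<^sub>R h))"
        unfolding eq using integrable_Re[OF i] .
    qed (simp add: gauss_pos less_imp_le)
    also have "(\<integral>h. (1 - cos (h \<bullet> \<xi>)) * gauss (c *\<^sub>R h) \<partial>lborel) = Re (\<integral>h. ?g h - cis (- (h \<bullet> \<xi>)) * ?g h \<partial>lborel)"
      unfolding eq by (rule integral_Re[OF i])
    also have "(\<integral>h. ?g h - cis (- (h \<bullet> \<xi>)) * ?g h \<partial>lborel) = fourier ?g 0 - fourier ?g \<xi>"
      unfolding fourier_def using g integrable_cis_minus_mult[OF g, of \<xi>] by simp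
    finally show ?thesis .
  qed
  have gx: "gauss x = gauss y" if "norm x = norm y" for x y :: 'a
    using that by (simp add: gauss_def dot_square_norm)
  have radial: "(\<integral>\<^sup>+h. ennreal ((1 - cos (h \<bullet> \<xi>)) * gauss (c *\<^sub>R h)) \<partial>lborel)
      = (\<integral>\<^sup>+h. ennreal ((1 - cos (h \<bullet> \<xi>')) * gauss (c *\<^sub>R h)) \<partial>lborel)" if "c > 0" for c
    unfolding inner[OF that] fourier_scale[OF that, of "\<lambda>x. of_real (gauss x)"] fourier_gauss
    using gx[of "(1/c) *\<^sub>R \<xi>" "(1/c) *\<^sub>R \<xi>'"] n by simp
  have mix: "ennreal (Gamma p) * (\<integral>\<^sup>+h. ennreal ((1 - cos (h \<bullet> \<zeta>)) * norm h powr q) \<partial>lborel)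
      = (\<integral>\<^sup>+t. ennreal (?w t) * (\<integral>\<^sup>+h. ennreal ((1 - cos (h \<bullet> \<zeta>)) * gauss (sqrt (2 * t) *\<^sub>R h)) \<partial>lborel) \<partial>lborel)"
    for \<zeta> :: 'a
  proof -
    have "ennreal (Gamma p) * (\<integral>\<^sup>+h. ennreal ((1 - cos (h \<bullet> \<zeta>)) * norm h powr q) \<partial>lborel)
        = (\<integral>\<^sup>+h. ennreal (Gamma p) * ennreal ((1 - cos (h \<bullet> \<zeta>)) * norm h powr q) \<partial>lborel)"
      by (rule nn_integral_cmult[symmetric]) measurable
    also have "\<dots> = (\<integral>\<^sup>+h. (\<integral>\<^sup>+t. ennreal (?w t * ((1 - cos (h \<bullet> \<zeta>)) * gauss (sqrt (2 * t) *\<^sub>R h))) \<partial>lborel) \<partial>lborel)"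
    proof (intro nn_integral_cong)
      fix h :: 'a
      show "ennreal (Gamma p) * ennreal ((1 - cos (h \<bullet> \<zeta>)) * norm h powr q)
          = (\<integral>\<^sup>+t. ennreal (?w t * ((1 - cos (h \<bullet> \<zeta>)) * gauss (sqrt (2 * t) *\<^sub>R h))) \<partial>lborel)"
      proof (cases "h = 0")
        case False
        have "(\<integral>\<^sup>+t. ennreal (?w t * ((1 - cos (h \<bullet> \<zeta>)) * gauss (sqrt (2 * t) *\<^sub>R h))) \<partial>lborel)
            = (\<integral>\<^sup>+t. ennreal (1 - cos (h \<bullet> \<zeta>)) * ennreal (indicator {0<..} t * (t powr (p - 1) * exp (- (t * (norm h)\<^sup>2)))) \<partial>lborel)"
        proof (intro nn_integral_cong)
          fix t :: real
          show "ennreal (?w t * ((1 - cos (h \<bullet> \<zeta>)) * gauss (sqrt (2 * t) *\<^sub>R h)))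
              = ennreal (1 - cos (h \<bullet> \<zeta>)) * ennreal (indicator {0<..} t * (t powr (p - 1) * exp (- (t * (norm h)\<^sup>2))))"
          proof (cases "t > 0")
            case True
            hence "gauss (sqrt (2 * t) *\<^sub>R h) = exp (- (t * (norm h)\<^sup>2))"
              by (simp add: gauss_def dot_square_norm power_mult_distrib)
            thus ?thesis using True by (simp add: ennreal_mult'[symmetric] mult_ac)
          qed simp
        qed
        also have "\<dots> = ennreal (1 - cos (h \<bullet> \<zeta>)) * ennreal (Gamma p * (norm h)\<^sup>2 powr (- p))"
          using False by (subst nn_integral_cmult) (simp_all add: power_as_gaussian_mixture[OF p])
        also have "(norm h)\<^sup>2 powr (- p) = norm h powr q"
        proof -
          have "2 * (- p) = q" by (simp add: p_def q_def field_simps)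
          thus ?thesis using powr_powr[of "norm h" 2 "- p"] False by simp
        qed
        finally show ?thesis using p by (simp add: ennreal_mult'[symmetric] Gamma_real_pos less_imp_le mult_ac)
      qed simp
    qed
    also have "\<dots> = (\<integral>\<^sup>+t. (\<integral>\<^sup>+h. ennreal (?w t * ((1 - cos (h \<bullet> \<zeta>)) * gauss (sqrt (2 * t) *\<^sub>R h))) \<partial>lborel) \<partial>lborel)"
      by (rule lborel_pair.Fubini') measurable
    also have "\<dots> = (\<integral>\<^sup>+t. ennreal (?w t) * (\<integral>\<^sup>+h. ennreal ((1 - cos (h \<bullet> \<zeta>)) * gauss (sqrt (2 * t) *\<^sub>R h)) \<partial>lborel) \<partial>lborel)"
      by (intro nn_integral_cong, subst nn_integral_cmult[symmetric]) (auto simp: ennreal_mult')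
    finally show ?thesis .
  qed
  have "ennreal (?w t) * (\<integral>\<^sup>+h. ennreal ((1 - cos (h \<bullet> \<xi>)) * gauss (sqrt (2 * t) *\<^sub>R h)) \<partial>lborel)
      = ennreal (?w t) * (\<integral>\<^sup>+h. ennreal ((1 - cos (h \<bullet> \<xi>')) * gauss (sqrt (2 * t) *\<^sub>R h)) \<partial>lborel)" for t
    using radial[of "sqrt (2 * t)"] by (cases "t > 0") auto
  hence "ennreal (Gamma p) * (\<integral>\<^sup>+h. ennreal ((1 - cos (h \<bullet> \<xi>)) * norm h powr q) \<partial>lborel)
       = ennreal (Gamma p) * (\<integral>\<^sup>+h. ennreal ((1 - cos (h \<bullet> \<xi>')) * norm h powr q) \<partial>lborel)"
    unfolding mix by presburger
  thus ?thesis using Gamma_real_pos[OF p] by (subst (asm) ennreal_mult_cancel_left) auto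
qed

lemma one_minus_cis_le_2: "cmod (1 - cis t) \<le> 2"
  using norm_triangle_ineq4[of 1 "cis t"] by simp

lemma one_minus_cis_le: "cmod (1 - cis t) \<le> \<bar>t\<bar>"
  using iexp_approx1[of t 0] by (simp add: cis_conv_exp norm_minus_commute)

lemma one_minus_cis_bound: "cmod (1 - cis (h \<bullet> \<xi>)) \<le> (2 + norm \<xi>) * min 1 (norm h)"
proof (cases "1 \<le> norm h")
  case True
  have "cmod (1 - cis (h \<bullet> \<xi>)) \<le> 2 + norm \<xi>" using one_minus_cis_le_2[of "h \<bullet> \<xi>"] by (simp add: add_increasing2)
  thus ?thesis using True by (simp add: min_def)
next
  case False
  have "cmod (1 - cis (h \<bullet> \<xi>)) \<le> norm h * norm \<xi>"
    using one_minus_cis_le[of "h \<bullet> \<xi>"] Cauchy_Schwarz_ineq2[of h \<xi>] by simp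
  also have "\<dots> \<le> norm h * (2 + norm \<xi>)" by (intro mult_left_mono) auto
  finally show ?thesis using False by (simp add: min_def mult.commute)
qed

text \<open>\<open>\<xi> \<mapsto> \<integral> (1 - cos (h \<bullet> \<xi>)) |h|\<^sup>-\<^sup>d\<^sup>-\<^sup>\<alpha> dh\<close> is rotation invariant and homogeneous of degree \<open>\<alpha>\<close>,
  hence a positive multiple of \<open>|\<xi>|\<^sup>\<alpha>\<close>; the imaginary part vanishes because the kernel is even.\<close>

lemma fractional_symbol:
  fixes \<alpha> :: real
  assumes a: "0 < \<alpha>" "\<alpha> < 1"
  obtains c where "c > 0" "\<And>\<xi> :: 'a::euclidean_space. (\<integral>h. (1 - cis (h \<bullet> \<xi>)) * of_real (c * norm h powr (- (real DIM('a) + \<alpha>))) \<partial>lborel) = of_real (norm \<xi> powr \<alpha>)"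
proof -
  let ?p = "- (real DIM('a) + \<alpha>)"
  let ?F = "\<lambda>\<xi> (h :: 'a). (1 - cis (h \<bullet> \<xi>)) * complex_of_real (norm h powr ?p)"
  define J where "J \<xi> = (\<integral>h. ?F \<xi> h \<partial>lborel)" for \<xi>
  have base: "integrable lborel (\<lambda>h :: 'a. min 1 (norm h) * norm h powr ?p)"
    using singular_kernel_finite[OF a, where 'a='a] by (simp add: integrable_iff_bounded)
  have int: "integrable lborel (?F \<xi>)" for \<xi>
  proof (rule Bochner_Integration.integrable_bound)
    show "integrable lborel (\<lambda>h :: 'a. (2 + norm \<xi>) * (min 1 (norm h) * norm h powr ?p))"
      using base by (intro integrable_mult_right)
    show "AE h in lborel. norm (?F \<xi> h) \<le> norm ((2 + norm \<xi>) * (min 1 (norm h) * norm h powr ?p))"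
    proof (intro AE_I2)
      fix h :: 'a
      have "cmod (1 - cis (h \<bullet> \<xi>)) \<le> (2 + norm \<xi>) * min 1 (norm h)" by (rule one_minus_cis_bound)
      hence "cmod (1 - cis (h \<bullet> \<xi>)) * norm h powr ?p \<le> ((2 + norm \<xi>) * min 1 (norm h)) * norm h powr ?p"
        by (rule mult_right_mono) simp
      thus "norm (?F \<xi> h) \<le> norm ((2 + norm \<xi>) * (min 1 (norm h) * norm h powr ?p))"
        by (simp add: norm_mult abs_mult mult.assoc)
    qed
  qed measurable
  have scale: "J (r *\<^sub>R \<xi>) = r powr \<alpha> * J \<xi>" if r: "r > 0" for r \<xi>
  proof -
    have eq: "?F (r *\<^sub>R \<xi>) ((1/r) *\<^sub>R h) = of_real ((1/r) powr ?p) * ?F \<xi> h" for h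
      using r by (simp add: powr_mult powr_divide mult_ac)
    have "J (r *\<^sub>R \<xi>) = (1/r) ^ DIM('a) *\<^sub>R (\<integral>h. ?F (r *\<^sub>R \<xi>) ((1/r) *\<^sub>R h) \<partial>lborel)"
      unfolding J_def using r by (subst integral_lborel_affine[of "1/r" _ 0]) auto
    also have "\<dots> = of_real ((1/r) ^ DIM('a) * (1/r) powr ?p) * J \<xi>"
      unfolding eq integral_mult_right_zero J_def by (simp add: scaleR_conv_of_real)
    also have "(1/r) ^ DIM('a) * (1/r) powr ?p = r powr \<alpha>"
    proof -
      have "(1/r) ^ DIM('a) = (1/r) powr real DIM('a)" using r by (simp add: powr_realpow)
      hence "(1/r) ^ DIM('a) * (1/r) powr ?p = (1/r) powr (- \<alpha>)"
        by (simp only: powr_add[symmetric]) simp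
      thus ?thesis using r by (simp add: powr_divide powr_minus field_simps)
    qed
    finally show ?thesis .
  qed
  have real: "J \<xi> = of_real (Re (J \<xi>))" for \<xi>
  proof -
    have "J \<xi> = (\<integral>h. ?F \<xi> (0 - h) \<partial>lborel)" unfolding J_def by (rule integral_lborel_reflect[symmetric])
    also have "\<dots> = (\<integral>h. cnj (?F \<xi> h) \<partial>lborel)" by (simp add: cis_cnj)
    also have "\<dots> = cnj (J \<xi>)" unfolding J_def by (rule Bochner_Integration.integral_cnj)
    finally show ?thesis by (metis Reals_cnj_iff of_real_Re)
  qed
  have ReJ: "Re (J \<xi>) = (\<integral>h. (1 - cos (h \<bullet> \<xi>)) * norm h powr ?p \<partial>lborel)" for \<xi>
    unfolding J_def by (subst integral_Re[OF int, symmetric]) simp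
  have Rint: "integrable lborel (\<lambda>h. (1 - cos (h \<bullet> \<xi>)) * norm h powr ?p)" for \<xi> :: 'a
    using integrable_Re[OF int[of \<xi>]] by simp
  have rot: "J \<xi> = J \<xi>'" if "norm \<xi> = norm \<xi>'" for \<xi> \<xi>' :: 'a
  proof -
    have "Re (J \<xi>) = Re (J \<xi>')"
      unfolding ReJ using fractional_symbol_radial[OF a(1) that]
      by (subst (1 2) integral_eq_nn_integral) auto
    thus ?thesis using real by metis
  qed
  define e :: 'a where "e = (SOME b. b \<in> Basis)"
  have e: "norm e = 1" unfolding e_def by (simp add: some_in_eq)
  define j where "j = Re (J e)"
  have "j > 0"
  proof -
    note Re = ReJ[of e, folded j_def] and i = Rint[of e]
    have nn: "0 \<le> (1 - cos (h \<bullet> e)) * norm h powr ?p" for h by simp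
    have "j \<noteq> 0"
    proof
      assume "j = 0"
      hence "AE h in lborel. (1 - cos (h \<bullet> e)) * norm h powr ?p = 0"
        unfolding Re using integral_nonneg_eq_0_iff_AE[OF i] nn by blast
      moreover have "open {h. 0 < h \<bullet> e \<and> h \<bullet> e < 1}"
        by (intro open_Collect_conj open_Collect_less continuous_intros)
      moreover have "(1/2) *\<^sub>R e \<in> {h. 0 < h \<bullet> e \<and> h \<bullet> e < 1}" using e by (simp add: dot_square_norm)
      ultimately obtain h where h: "0 < h \<bullet> e" "h \<bullet> e < 1" "(1 - cos (h \<bullet> e)) * norm h powr ?p = 0"
        using AE_lborel_open_witness[of "\<lambda>h. (1 - cos (h \<bullet> e)) * norm h powr ?p = 0" "{h. 0 < h \<bullet> e \<and> h \<bullet> e < 1}"] by blast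
      have "h \<noteq> 0" using h(1) by auto
      hence "cos (h \<bullet> e) = 1" using h(3) by simp
      moreover have "cos (h \<bullet> e) < cos 0" using h(1,2) pi_gt3 by (intro cos_monotone_0_pi) auto
      ultimately show False by simp
    qed
    thus ?thesis unfolding Re using integral_nonneg_AE[of "\<lambda>h. (1 - cos (h \<bullet> e)) * norm h powr ?p" lborel] nn
      by (simp add: order_less_le)
  qed
  have J: "J \<xi> = of_real (norm \<xi> powr \<alpha> * j)" for \<xi>
  proof (cases "\<xi> = 0")
    case True
    thus ?thesis by (simp add: J_def)
  next
    case False
    let ?\<xi> = "(1 / norm \<xi>) *\<^sub>R \<xi>"
    have "J \<xi> = J (norm \<xi> *\<^sub>R ?\<xi>)" using False by simp
    also have "\<dots> = norm \<xi> powr \<alpha> * J ?\<xi>" using False by (intro scale) simp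
    also have "J ?\<xi> = J e" by (rule rot) (use False e in simp)
    also have "J e = of_real j" unfolding j_def by (rule real)
    finally show ?thesis by simp
  qed
  show ?thesis
  proof (rule that[of "1 / j"])
    show "1 / j > 0" using \<open>j > 0\<close> by simp
    fix \<xi> :: 'a
    have "(\<integral>h. (1 - cis (h \<bullet> \<xi>)) * of_real (1 / j * norm h powr ?p) \<partial>lborel) = (\<integral>h. of_real (1/j) * ?F \<xi> h \<partial>lborel)"
      by (simp add: mult_ac)
    also have "\<dots> = of_real (1/j) * J \<xi>" unfolding J_def by (rule integral_mult_right_zero)
    finally show "(\<integral>h. (1 - cis (h \<bullet> \<xi>)) * of_real (1 / j * norm h powr ?p) \<partial>lborel) = of_real (norm \<xi> powr \<alpha>)"
      using \<open>j > 0\<close> by (simp add: J)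
  qed
qed

lemma powr_le_1_plus: "0 \<le> s \<Longrightarrow> 0 < a \<Longrightarrow> a < 1 \<Longrightarrow> s powr a \<le> 1 + (s::real)"
proof -
  assume "0 \<le> s" "0 < a" "a < 1"
  show ?thesis
  proof (cases "s \<le> 1")
    case True
    hence "s powr a \<le> 1" using \<open>0 \<le> s\<close> \<open>0 < a\<close> powr_le1 by auto
    thus ?thesis using \<open>0 \<le> s\<close> by simp
  next
    case False
    hence "s powr a \<le> s powr 1" using \<open>a < 1\<close> by (intro powr_mono) auto
    thus ?thesis using False by simp
  qed
qed

lemma integrable_test_mult:
  assumes t: "test_function \<Omega> \<beta>" and u: "integrable lborel u"
  shows "integrable lborel (\<lambda>x. \<beta> x * u x)"
proof -
  have [measurable]: "\<beta> \<in> borel_measurable borel" using test_function_measurable[OF t] .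
  obtain N where "\<And>x. cmod (\<beta> x) \<le> N" using test_function_bounded[OF t] by blast
  hence "integrable lborel (\<lambda>x. u x * \<beta> x)" by (intro integrable_mult_bounded[OF u, of _ N]) auto
  thus ?thesis by (simp only: mult.commute)
qed

text \<open>The fractional Laplacian of a test function, as a function: the inverse Fourier transform of
  the multiplied Fourier transform.\<close>

definition fracL :: "real \<Rightarrow> ('a::euclidean_space \<Rightarrow> complex) \<Rightarrow> 'a \<Rightarrow> complex" where
  "fracL \<alpha> \<phi> y = fourier (\<lambda>\<xi>. of_real (norm \<xi> powr \<alpha>) * fourier \<phi> (- \<xi>)) y / (2 * pi) ^ DIM('a)"

lemma fourier_test_powr_integrable:
  fixes \<phi> :: "'a::euclidean_space \<Rightarrow> complex"
  assumes a: "0 < \<alpha>" "\<alpha> < 1" and t: "test_function \<Omega> \<phi>"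
  shows "integrable lborel (\<lambda>\<xi>. of_real (norm \<xi> powr \<alpha>) * fourier \<phi> (- \<xi>))"
proof (rule Bochner_Integration.integrable_bound)
  have [measurable]: "\<phi> \<in> borel_measurable borel" using test_function_measurable[OF t] .
  show "(\<lambda>\<xi>. of_real (norm \<xi> powr \<alpha>) * fourier \<phi> (- \<xi>)) \<in> borel_measurable lborel" by measurable
  show "integrable lborel (\<lambda>\<xi>. (1 + norm \<xi>) ^ 1 * cmod (fourier \<phi> (- \<xi>)))"
    using integrable_lborel_reflect[OF fourier_test_weighted_integrable[OF t, of 1], of 0] by simp
  show "AE \<xi> in lborel. norm (of_real (norm \<xi> powr \<alpha>) * fourier \<phi> (- \<xi>)) \<le> norm ((1 + norm \<xi>) ^ 1 * cmod (fourier \<phi> (- \<xi>)))"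
  proof (intro AE_I2)
    fix \<xi> :: 'a
    have "norm \<xi> powr \<alpha> * cmod (fourier \<phi> (- \<xi>)) \<le> (1 + norm \<xi>) * cmod (fourier \<phi> (- \<xi>))"
      by (intro mult_right_mono powr_le_1_plus a) auto
    thus "norm (of_real (norm \<xi> powr \<alpha>) * fourier \<phi> (- \<xi>)) \<le> norm ((1 + norm \<xi>) ^ 1 * cmod (fourier \<phi> (- \<xi>)))"
      by (simp add: norm_mult abs_mult)
  qed
qed

lemma fracL_measurable [measurable]:
  assumes [measurable]: "\<phi> \<in> borel_measurable borel" shows "fracL \<alpha> \<phi> \<in> borel_measurable borel"
  unfolding fracL_def[abs_def] by measurable

lemma fracL_bounded:
  assumes a: "0 < \<alpha>" "\<alpha> < 1" and t: "test_function \<Omega> \<phi>"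
  obtains B where "\<And>y. cmod (fracL \<alpha> \<phi> y) \<le> B"
proof -
  let ?B = "(\<integral>\<xi>. cmod (of_real (norm \<xi> powr \<alpha>) * fourier \<phi> (- \<xi>)) \<partial>lborel) / cmod ((2 * pi) ^ DIM('a))"
  have "cmod (fracL \<alpha> \<phi> y) \<le> ?B" for y
    unfolding fracL_def norm_divide
    by (intro divide_right_mono fourier_bound fourier_test_powr_integrable[OF a t]) auto
  thus ?thesis by (rule that)
qed

lemma integrable_mult_fracL:
  assumes a: "0 < \<alpha>" "\<alpha> < 1" and t: "test_function \<Omega> \<phi>" and u: "integrable lborel u"
  shows "integrable lborel (\<lambda>x. u x * fracL \<alpha> \<phi> x)"
proof -
  have [measurable]: "\<phi> \<in> borel_measurable borel" using test_function_measurable[OF t] .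
  obtain B where "\<And>y. cmod (fracL \<alpha> \<phi> y) \<le> B" using fracL_bounded[OF a t] by blast
  thus ?thesis using integrable_mult_bounded[OF u, of "fracL \<alpha> \<phi>" B] by simp
qed

text \<open>The multiplication formula moves the multiplier from \<open>u\<close> to the test function, where \<open>fracL\<close> is a
  bounded function.\<close>

lemma frac_laplacian_pairing:
  fixes \<phi> u :: "'a::euclidean_space \<Rightarrow> complex"
  assumes a: "0 < \<alpha>" "\<alpha> < 1" and t: "test_function \<Omega> \<phi>" and u: "integrable lborel u"
  shows "(\<integral>\<xi>. (norm \<xi> powr \<alpha>) *\<^sub>R fourier u \<xi> * fourier \<phi> (- \<xi>) \<partial>lborel) / (2 * pi) ^ DIM('a)
       = (\<integral>x. u x * fracL \<alpha> \<phi> x \<partial>lborel)"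
proof -
  let ?a = "\<lambda>\<xi>. of_real (norm \<xi> powr \<alpha>) * fourier \<phi> (- \<xi>)"
  have "(\<integral>\<xi>. (norm \<xi> powr \<alpha>) *\<^sub>R fourier u \<xi> * fourier \<phi> (- \<xi>) \<partial>lborel) = (\<integral>\<xi>. fourier u \<xi> * ?a \<xi> \<partial>lborel)"
    by (intro Bochner_Integration.integral_cong refl) (simp add: scaleR_conv_of_real mult_ac)
  also have "\<dots> = (\<integral>x. u x * fourier ?a x \<partial>lborel)"
    by (rule fourier_multiplication_formula[OF u fourier_test_powr_integrable[OF a t]])
  also have "\<dots> / (2 * pi) ^ DIM('a) = (\<integral>x. u x * fourier ?a x / (2 * pi) ^ DIM('a) \<partial>lborel)"
    by (rule integral_divide_zero[symmetric])
  finally show ?thesis by (simp add: fracL_def)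
qed

lemma fracL_fourier:
  fixes \<phi> :: "'a::euclidean_space \<Rightarrow> complex"
  shows "(\<integral>\<zeta>. of_real (norm \<zeta> powr \<alpha>) * fourier \<phi> \<zeta> * cis (y \<bullet> \<zeta>) \<partial>lborel) = (2 * pi) ^ DIM('a) * fracL \<alpha> \<phi> y"
proof -
  have "(\<integral>\<zeta>. of_real (norm \<zeta> powr \<alpha>) * fourier \<phi> \<zeta> * cis (y \<bullet> \<zeta>) \<partial>lborel)
     = (\<integral>\<zeta>. of_real (norm (0 - \<zeta>) powr \<alpha>) * fourier \<phi> (0 - \<zeta>) * cis (y \<bullet> (0 - \<zeta>)) \<partial>lborel)"
    by (rule integral_lborel_reflect[symmetric])
  also have "\<dots> = fourier (\<lambda>\<xi>. of_real (norm \<xi> powr \<alpha>) * fourier \<phi> (- \<xi>)) y"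
    unfolding fourier_def[of "\<lambda>\<xi>. of_real (norm \<xi> powr \<alpha>) * fourier \<phi> (- \<xi>)"]
    by (intro Bochner_Integration.integral_cong refl) (simp add: inner_commute mult_ac)
  finally show ?thesis by (simp add: fracL_def)
qed

lemma test_function_min_lipschitz:
  assumes "test_function \<Omega> \<phi>"
  obtains B where "B > 0" "\<And>x y. cmod (\<phi> x - \<phi> y) \<le> B * min 1 (norm (x - y))"
proof -
  obtain M where M: "M > 0" "\<And>x. cmod (\<phi> x) \<le> M" using test_function_bounded[OF assms] by blast
  obtain L where L: "L > 0" "\<And>x y. cmod (\<phi> x - \<phi> y) \<le> L * norm (x - y)" using test_function_lipschitz[OF assms] by blast
  show ?thesis
  proof (rule that[of "2 * M + L"])
    fix x y
    show "cmod (\<phi> x - \<phi> y) \<le> (2 * M + L) * min 1 (norm (x - y))"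
    proof (cases "1 \<le> norm (x - y)")
      case True
      have "cmod (\<phi> x - \<phi> y) \<le> M + M" using norm_triangle_ineq4[of "\<phi> x" "\<phi> y"] M(2)[of x] M(2)[of y] by linarith
      thus ?thesis using True L(1) by (simp add: min_def)
    next
      case False
      have "L * norm (x - y) \<le> (2 * M + L) * norm (x - y)" using M(1) by (intro mult_right_mono) auto
      thus ?thesis using False L(2)[of x y] by (simp add: min_def)
    qed
  qed (use M L in auto)
qed

text \<open>The kernel of the fractional Laplacian. The constant \<open>c\<close> is determined implicitly by requiring the
  symbol to be \<open>|\<xi>|\<^sup>\<alpha>\<close>; \<open>fractional_symbol\<close> provides it.\<close>

locale frac_kernel =
  fixes \<alpha> c :: real and K :: "'a::euclidean_space \<Rightarrow> real"
  assumes \<alpha>_pos: "0 < \<alpha>" and \<alpha>_less_1: "\<alpha> < 1" and c_pos: "0 < c"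
    and K_eq: "K h = c * norm h powr (- (real DIM('a) + \<alpha>))"
    and symbol: "(\<integral>h. (1 - cis (h \<bullet> \<xi>)) * of_real (K h) \<partial>lborel) = of_real (norm \<xi> powr \<alpha>)"
begin

lemmas \<alpha>_range = \<alpha>_pos \<alpha>_less_1

lemma K_measurable [measurable]: "K \<in> borel_measurable borel"
  unfolding K_eq[abs_def] by measurable

lemma K_nonneg: "0 \<le> K h" using c_pos by (simp add: K_eq)
lemma K_0 [simp]: "K 0 = 0" by (simp add: K_eq)

lemma K_integrable: "integrable lborel (\<lambda>h. min 1 (norm h) * K h)"
proof -
  have "integrable lborel (\<lambda>h::'a. min 1 (norm h) * norm h powr (- (real DIM('a) + \<alpha>)))"
    using singular_kernel_finite[OF \<alpha>_range, where 'a='a] by (simp add: integrable_iff_bounded)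
  from integrable_mult_right[OF this, of c] show ?thesis by (simp add: K_eq mult_ac)
qed

lemma K_scaled_finite:
  assumes "B \<ge> 0" shows "(\<integral>\<^sup>+h. ennreal (B * (min 1 (norm h) * K h)) \<partial>lborel) < \<infinity>"
proof -
  have "(\<integral>\<^sup>+h. ennreal (B * (min 1 (norm h) * K h)) \<partial>lborel) = ennreal (\<integral>h. B * (min 1 (norm h) * K h) \<partial>lborel)"
    by (rule nn_integral_eq_integral[OF integrable_mult_right[OF K_integrable]]) (use assms K_nonneg in auto)
  thus ?thesis by simp
qed

lemma K_mult_integrable:
  fixes f :: "'a \<Rightarrow> complex"
  assumes [measurable]: "f \<in> borel_measurable borel" and f: "\<And>h. cmod (f h) \<le> B * min 1 (norm h)"
  shows "integrable lborel (\<lambda>h. f h * of_real (K h))"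
proof (rule Bochner_Integration.integrable_bound)
  show "integrable lborel (\<lambda>h. B * (min 1 (norm h) * K h))" by (intro integrable_mult_right K_integrable)
  show "AE h in lborel. norm (f h * of_real (K h)) \<le> norm (B * (min 1 (norm h) * K h))"
  proof (intro AE_I2)
    fix h
    have "cmod (f h) * K h \<le> (B * min 1 (norm h)) * K h" by (intro mult_right_mono f K_nonneg)
    also have "\<dots> \<le> \<bar>B * (min 1 (norm h) * K h)\<bar>" by (simp add: mult.assoc)
    finally show "norm (f h * of_real (K h)) \<le> norm (B * (min 1 (norm h) * K h))"
      using K_nonneg[of h] by (simp add: norm_mult)
  qed
qed measurable

text \<open>On test functions the Fourier multiplier is the singular integral: expand the difference by
  Fourier inversion and exchange the integrals. The coupling is bounded once \<open>min 1 |h|\<close> is moved to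
  the kernel and \<open>1 + |\<zeta>|\<close> to the Fourier transform.\<close>

lemma fracL_singular_integral:
  fixes \<phi> :: "'a \<Rightarrow> complex"
  assumes t: "test_function \<Omega> \<phi>"
  shows "(\<integral>h. (\<phi> y - \<phi> (y + h)) * of_real (K h) \<partial>lborel) = fracL \<alpha> \<phi> y"
proof -
  have [measurable]: "\<phi> \<in> borel_measurable borel" using test_function_measurable[OF t] .
  let ?d = "complex_of_real ((2 * pi) ^ DIM('a))"
  have d0: "?d \<noteq> 0" by simp
  let ?f = "\<lambda>h. complex_of_real (min 1 (norm h) * K h)"
  let ?g = "\<lambda>\<zeta>. of_real (1 + norm \<zeta>) * fourier \<phi> \<zeta>"
  let ?m = "\<lambda>h \<zeta>::'a. min 1 (norm h) * (1 + norm \<zeta>)"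
  \<comment> \<open>the coupling, bounded by \<open>2\<close>\<close>
  let ?h = "\<lambda>h \<zeta>. cis (y \<bullet> \<zeta>) * (1 - cis (h \<bullet> \<zeta>)) / complex_of_real (?m h \<zeta>)"
  have f: "integrable lborel ?f" by (intro integrable_of_real K_integrable)
  have g: "integrable lborel ?g"
  proof -
    have eq: "norm (?g \<zeta>) = (1 + norm \<zeta>) ^ 1 * cmod (fourier \<phi> \<zeta>)" for \<zeta>
      unfolding norm_mult norm_of_real by simp
    have "integrable lborel (\<lambda>\<zeta>. norm (?g \<zeta>))"
      unfolding eq by (rule fourier_test_weighted_integrable[OF t])
    thus ?thesis by (rule integrable_norm_cancel) measurable
  qed
  have B: "cmod (?h h \<zeta>) \<le> 2" for h \<zeta> :: 'a
  proof -
    have "cmod (1 - cis (h \<bullet> \<zeta>)) \<le> (2 + norm \<zeta>) * min 1 (norm h)" by (rule one_minus_cis_bound)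
    also have "\<dots> \<le> (2 * (1 + norm \<zeta>)) * min 1 (norm h)" by (intro mult_right_mono) auto
    finally have "cmod (1 - cis (h \<bullet> \<zeta>)) \<le> 2 * ?m h \<zeta>"
      by (simp only: mult.assoc mult.commute mult.left_commute)
    moreover have "0 \<le> ?m h \<zeta>" by simp
    ultimately have "cmod (1 - cis (h \<bullet> \<zeta>)) / ?m h \<zeta> \<le> 2"
      by (cases "?m h \<zeta> = 0") (auto simp: pos_divide_le_eq less_le)
    thus ?thesis using \<open>0 \<le> ?m h \<zeta>\<close> by (simp add: norm_mult norm_divide del: of_real_mult)
  qed
  have eq: "?f h * ?g \<zeta> * ?h h \<zeta> = of_real (K h) * (fourier \<phi> \<zeta> * cis (y \<bullet> \<zeta>) * (1 - cis (h \<bullet> \<zeta>)))" for h \<zeta>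
  proof (cases "h = 0")
    case False
    have "1 + norm \<zeta> \<noteq> 0" using norm_ge_zero[of \<zeta>] by linarith
    hence "complex_of_real (1 + norm \<zeta>) \<noteq> 0" unfolding of_real_eq_0_iff .
    moreover have "complex_of_real (min 1 (norm h)) \<noteq> 0" using False by (simp add: min_def)
    moreover have "(a * k) * (b * p) * (v * q / (a * b)) = k * (p * v * q)" if "b \<noteq> 0" "a \<noteq> 0" for a b k p v q :: complex
      using that by (simp add: field_simps)
    ultimately show ?thesis unfolding of_real_mult by blast
  qed simp
  have inv: "(\<integral>\<zeta>. fourier \<phi> \<zeta> * cis (y \<bullet> \<zeta>) * (1 - cis (h \<bullet> \<zeta>)) \<partial>lborel) = ?d * (\<phi> y - \<phi> (y + h))" for h
  proof -
    have i: "integrable lborel (\<lambda>\<zeta>. cis (- (\<zeta> \<bullet> (- z))) * fourier \<phi> \<zeta>)" for z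
      by (rule integrable_cis_minus_mult[OF fourier_test_integrable[OF t]])
    have "fourier \<phi> \<zeta> * cis (y \<bullet> \<zeta>) * (1 - cis (h \<bullet> \<zeta>))
        = cis (- (\<zeta> \<bullet> (- y))) * fourier \<phi> \<zeta> - cis (- (\<zeta> \<bullet> (- (y + h)))) * fourier \<phi> \<zeta>" for \<zeta>
    proof -
      have "cis (y \<bullet> \<zeta>) * cis (h \<bullet> \<zeta>) = cis (- (\<zeta> \<bullet> (- (y + h))))"
      proof -
        have "\<zeta> \<bullet> (- (y + h)) = - (y \<bullet> \<zeta> + h \<bullet> \<zeta>)"
          by (simp only: inner_minus_right inner_add_right inner_commute[of \<zeta>])
        thus ?thesis by (simp only: cis_mult minus_minus)
      qed
      moreover have "cis (y \<bullet> \<zeta>) = cis (- (\<zeta> \<bullet> (- y)))" by (simp add: inner_commute)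
      ultimately show ?thesis by (metis (no_types, lifting) mult.assoc mult.commute mult.right_neutral right_diff_distrib)
    qed
    hence "(\<integral>\<zeta>. fourier \<phi> \<zeta> * cis (y \<bullet> \<zeta>) * (1 - cis (h \<bullet> \<zeta>)) \<partial>lborel)
        = fourier (fourier \<phi>) (- y) - fourier (fourier \<phi>) (- (y + h))"
      unfolding fourier_def[of "fourier \<phi>"] using Bochner_Integration.integral_diff[OF i i, of y "y + h"] by presburger
    thus ?thesis unfolding fourier_inversion_test[OF t] by (simp add: scaleR_conv_of_real right_diff_distrib)
  qed
  have "?d * (\<integral>h. (\<phi> y - \<phi> (y + h)) * of_real (K h) \<partial>lborel) = (\<integral>h. (\<integral>\<zeta>. ?f h * ?g \<zeta> * ?h h \<zeta> \<partial>lborel) \<partial>lborel)"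
    unfolding eq integral_mult_right_zero inv by (simp add: mult_ac flip: integral_mult_right_zero)
  also have "\<dots> = (\<integral>\<zeta>. (\<integral>h. ?f h * ?g \<zeta> * ?h h \<zeta> \<partial>lborel) \<partial>lborel)"
    by (rule fubini_bounded(1)[OF f g _ B]) measurable
  also have "\<dots> = (\<integral>\<zeta>. of_real (norm \<zeta> powr \<alpha>) * fourier \<phi> \<zeta> * cis (y \<bullet> \<zeta>) \<partial>lborel)"
  proof (intro Bochner_Integration.integral_cong refl)
    fix \<zeta> :: 'a
    have "(\<integral>h. ?f h * ?g \<zeta> * ?h h \<zeta> \<partial>lborel) = (\<integral>h. (fourier \<phi> \<zeta> * cis (y \<bullet> \<zeta>)) * ((1 - cis (h \<bullet> \<zeta>)) * of_real (K h)) \<partial>lborel)"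
      unfolding eq by (simp add: mult_ac)
    also have "\<dots> = (fourier \<phi> \<zeta> * cis (y \<bullet> \<zeta>)) * of_real (norm \<zeta> powr \<alpha>)"
      unfolding integral_mult_right_zero symbol ..
    finally show "(\<integral>h. ?f h * ?g \<zeta> * ?h h \<zeta> \<partial>lborel) = of_real (norm \<zeta> powr \<alpha>) * fourier \<phi> \<zeta> * cis (y \<bullet> \<zeta>)"
      by (simp add: mult_ac)
  qed
  also have "\<dots> = ?d * fracL \<alpha> \<phi> y" using fracL_fourier[of \<alpha> \<phi> y] by simp
  finally show ?thesis using d0 by simp
qed

subsection \<open>The commutator as a weakly singular integral operator\<close>

text \<open>In \<open>\<beta> (-\<Delta>)\<^sup>\<alpha>\<^sup>/\<^sup>2 u - (-\<Delta>)\<^sup>\<alpha>\<^sup>/\<^sup>2 (\<beta> u)\<close>, written with the singular integral, the terms \<open>\<beta>(x) u(x)\<close>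
  cancel. The factor \<open>\<beta> y - \<beta> x\<close> compensates one power of \<open>|x - y|\<close>, so for \<open>\<alpha> < 1\<close> the integral
  converges absolutely.\<close>

definition comm_op :: "('a \<Rightarrow> complex) \<Rightarrow> ('a \<Rightarrow> complex) \<Rightarrow> 'a \<Rightarrow> complex" where
  "comm_op \<beta> u x = (\<integral>y. of_real (K (x - y)) * (\<beta> y - \<beta> x) * u y \<partial>lborel)"

lemma comm_op_measurable [measurable]:
  assumes [measurable]: "\<beta> \<in> borel_measurable borel" "u \<in> borel_measurable borel"
  shows "comm_op \<beta> u \<in> borel_measurable borel"
  unfolding comm_op_def[abs_def] by measurable

lemma comm_op_bound:
  assumes B: "\<And>x y. cmod (\<beta> x - \<beta> y) \<le> B * min 1 (norm (x - y))"
  shows "cmod (of_real (K (x - y)) * (\<beta> y - \<beta> x) * u) \<le> (B * (min 1 (norm (x - y)) * K (x - y))) * cmod u"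
proof -
  have "K (x - y) * cmod (\<beta> y - \<beta> x) \<le> K (x - y) * (B * min 1 (norm (x - y)))"
    using B[of x y] by (intro mult_left_mono K_nonneg) (simp add: norm_minus_commute)
  hence "K (x - y) * cmod (\<beta> y - \<beta> x) * cmod u \<le> (K (x - y) * (B * min 1 (norm (x - y)))) * cmod u"
    by (rule mult_right_mono) simp
  thus ?thesis using K_nonneg[of "x - y"] by (simp add: norm_mult mult_ac)
qed

lemma comm_op_pairing:
  fixes \<phi> u \<beta> :: "'a \<Rightarrow> complex"
  assumes t: "test_function \<Omega> \<beta>" and u: "integrable lborel u"
    and \<phi>[measurable]: "\<phi> \<in> borel_measurable borel" and M: "\<And>x. cmod (\<phi> x) \<le> M"
  shows "(\<integral>x. comm_op \<beta> u x * \<phi> x \<partial>lborel)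
       = (\<integral>y. u y * (\<integral>h. (\<beta> y - \<beta> (y + h)) * \<phi> (y + h) * of_real (K h) \<partial>lborel) \<partial>lborel)"
    and "integrable lborel (comm_op \<beta> u)"
proof -
  have [measurable]: "\<beta> \<in> borel_measurable borel" using test_function_measurable[OF t] .
  have [measurable]: "u \<in> borel_measurable borel" using u by auto
  obtain B where B: "B > 0" "\<And>x y. cmod (\<beta> x - \<beta> y) \<le> B * min 1 (norm (x - y))"
    using test_function_min_lipschitz[OF t] by blast
  let ?k = "\<lambda>h. B * (min 1 (norm h) * K h)"
  have M0: "0 \<le> M" using M[of 0] norm_ge_zero order_trans by blast
  have kfin: "(\<integral>\<^sup>+h. ennreal (?k h) \<partial>lborel) < \<infinity>"
    by (rule K_scaled_finite) (use B(1) in simp)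
  have fin: "(\<integral>\<^sup>+x. (\<integral>\<^sup>+y. ennreal (?k (x - y) * cmod (u y)) \<partial>lborel) \<partial>lborel) < \<infinity>"
  proof -
    have "(\<integral>\<^sup>+x. (\<integral>\<^sup>+y. ennreal (?k (x - y) * cmod (u y)) \<partial>lborel) \<partial>lborel)
        = (\<integral>\<^sup>+x. (\<integral>\<^sup>+y. ennreal (?k (x - y)) * ennreal (cmod (u y)) \<partial>lborel) \<partial>lborel)"
      using B(1) K_nonneg by (simp add: ennreal_mult)
    also have "\<dots> = (\<integral>\<^sup>+h. ennreal (?k h) \<partial>lborel) * (\<integral>\<^sup>+y. ennreal (cmod (u y)) \<partial>lborel)"
      by (rule young_L1) measurable
    also have "\<dots> < \<infinity>" using kfin u by (simp add: ennreal_mult_less_top integrable_iff_bounded)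
    finally show ?thesis .
  qed
  have int: "integrable (lborel \<Otimes>\<^sub>M lborel) (\<lambda>(x, y). of_real (K (x - y)) * (\<beta> y - \<beta> x) * u y * \<psi> x)"
    if [measurable]: "\<psi> \<in> borel_measurable borel" and N: "\<And>x. cmod (\<psi> x) \<le> N" for \<psi> :: "'a \<Rightarrow> complex" and N
  proof -
    have N0: "0 \<le> N" using N[of 0] norm_ge_zero order_trans by blast
    have "(\<integral>\<^sup>+p. ennreal (norm (case p of (x, y) \<Rightarrow> of_real (K (x - y)) * (\<beta> y - \<beta> x) * u y * \<psi> x)) \<partial>(lborel \<Otimes>\<^sub>M lborel))
        = (\<integral>\<^sup>+x. (\<integral>\<^sup>+y. ennreal (norm (of_real (K (x - y)) * (\<beta> y - \<beta> x) * u y * \<psi> x)) \<partial>lborel) \<partial>lborel)"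
      by (subst lborel.nn_integral_fst[symmetric]) simp_all
    also have "\<dots> \<le> (\<integral>\<^sup>+x. (\<integral>\<^sup>+y. ennreal N * ennreal (?k (x - y) * cmod (u y)) \<partial>lborel) \<partial>lborel)"
    proof (intro nn_integral_mono)
      fix x y
      have "norm (of_real (K (x - y)) * (\<beta> y - \<beta> x) * u y * \<psi> x) \<le> (?k (x - y) * cmod (u y)) * N"
        unfolding norm_mult[of _ "\<psi> x"]
        by (intro mult_mono comm_op_bound B N) (use B(1) K_nonneg in auto)
      thus "ennreal (norm (of_real (K (x - y)) * (\<beta> y - \<beta> x) * u y * \<psi> x)) \<le> ennreal N * ennreal (?k (x - y) * cmod (u y))"
        using N0 by (subst ennreal_mult'[symmetric]) (auto intro: ennreal_leI simp: mult.commute)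
    qed
    also have "\<dots> = ennreal N * (\<integral>\<^sup>+x. (\<integral>\<^sup>+y. ennreal (?k (x - y) * cmod (u y)) \<partial>lborel) \<partial>lborel)"
      by (simp add: nn_integral_cmult)
    also have "\<dots> < \<infinity>" using fin by (simp add: ennreal_mult_less_top)
    finally show ?thesis by (auto simp: integrable_iff_bounded)
  qed
  from lborel_pair.integrable_fst[OF int[of "\<lambda>_. 1" 1]]
  show "integrable lborel (comm_op \<beta> u)" by (simp add: comm_op_def[abs_def])
  have "(\<integral>x. comm_op \<beta> u x * \<phi> x \<partial>lborel) = (\<integral>x. (\<integral>y. of_real (K (x - y)) * (\<beta> y - \<beta> x) * u y * \<phi> x \<partial>lborel) \<partial>lborel)"
    by (simp only: comm_op_def integral_mult_left_zero)
  also have "\<dots> = (\<integral>y. (\<integral>x. of_real (K (x - y)) * (\<beta> y - \<beta> x) * u y * \<phi> x \<partial>lborel) \<partial>lborel)"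
    using lborel_pair.Fubini_integral[OF int[OF \<phi> M]] by simp
  also have "\<dots> = (\<integral>y. u y * (\<integral>h. (\<beta> y - \<beta> (y + h)) * \<phi> (y + h) * of_real (K h) \<partial>lborel) \<partial>lborel)"
  proof (intro Bochner_Integration.integral_cong refl)
    fix y
    have "(\<integral>x. of_real (K (x - y)) * (\<beta> y - \<beta> x) * u y * \<phi> x \<partial>lborel)
        = (\<integral>h. of_real (K (y + h - y)) * (\<beta> y - \<beta> (y + h)) * u y * \<phi> (y + h) \<partial>lborel)"
      by (rule integral_lborel_translate[symmetric])
    also have "\<dots> = (\<integral>h. u y * ((\<beta> y - \<beta> (y + h)) * \<phi> (y + h) * of_real (K h)) \<partial>lborel)"
      by (intro Bochner_Integration.integral_cong refl) (simp add: mult_ac)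
    finally show "(\<integral>x. of_real (K (x - y)) * (\<beta> y - \<beta> x) * u y * \<phi> x \<partial>lborel)
        = u y * (\<integral>h. (\<beta> y - \<beta> (y + h)) * \<phi> (y + h) * of_real (K h) \<partial>lborel)"
      by (simp only: integral_mult_right_zero)
  qed
  finally show "(\<integral>x. comm_op \<beta> u x * \<phi> x \<partial>lborel)
       = (\<integral>y. u y * (\<integral>h. (\<beta> y - \<beta> (y + h)) * \<phi> (y + h) * of_real (K h) \<partial>lborel) \<partial>lborel)" .
qed

lemma test_diff_K_integrable:
  assumes t: "test_function \<Omega> \<phi>"
  shows "integrable lborel (\<lambda>h. (\<phi> y - \<phi> (y + h)) * of_real (K h))"
proof -
  have [measurable]: "\<phi> \<in> borel_measurable borel" using test_function_measurable[OF t] .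
  obtain B where B: "B > 0" "\<And>x y. cmod (\<phi> x - \<phi> y) \<le> B * min 1 (norm (x - y))"
    using test_function_min_lipschitz[OF t] by blast
  show ?thesis
  proof (rule K_mult_integrable)
    show "cmod (\<phi> y - \<phi> (y + h)) \<le> B * min 1 (norm h)" for h using B(2)[of y "y + h"] by simp
  qed measurable
qed

lemma comm_op_adjoint_test:
  assumes b: "test_function \<Omega> \<beta>" and t: "test_function \<Omega>' \<phi>"
  shows "(\<integral>h. (\<beta> y - \<beta> (y + h)) * \<phi> (y + h) * of_real (K h) \<partial>lborel)
       = fracL \<alpha> (\<lambda>x. \<beta> x * \<phi> x) y - \<beta> y * fracL \<alpha> \<phi> y"
proof -
  have bt: "test_function \<Omega>' (\<lambda>x. \<beta> x * \<phi> x)" by (rule test_function_mult[OF t test_function_C_k[OF b]])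
  have "(\<beta> y - \<beta> (y + h)) * \<phi> (y + h) * of_real (K h)
      = (\<beta> y * \<phi> y - \<beta> (y + h) * \<phi> (y + h)) * of_real (K h) - \<beta> y * ((\<phi> y - \<phi> (y + h)) * of_real (K h))" for h
    by (simp add: algebra_simps)
  thus ?thesis
    using test_diff_K_integrable[OF bt, of y] test_diff_K_integrable[OF t, of y]
      fracL_singular_integral[OF bt, of y] fracL_singular_integral[OF t, of y] by simp
qed

text \<open>A plane wave is an eigenfunction of the singular integral with eigenvalue \<open>|\<xi>|\<^sup>\<alpha>\<close>, so it may take
  the place of the test function in the preceding identity.\<close>

lemma comm_op_adjoint_exp:
  assumes b: "test_function \<Omega> \<beta>"
  shows "(\<integral>h. (\<beta> y - \<beta> (y + h)) * cis (- ((y + h) \<bullet> \<xi>)) * of_real (K h) \<partial>lborel)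
       = fracL \<alpha> (\<lambda>x. cis (x \<bullet> (- \<xi>)) * \<beta> x) y - of_real (norm \<xi> powr \<alpha>) * (cis (- (y \<bullet> \<xi>)) * \<beta> y)"
proof -
  let ?e = "\<lambda>x. cis (x \<bullet> (- \<xi>)) * \<beta> x"
  have bt: "test_function \<Omega> ?e" by (rule test_function_mult[OF b C_k_cis])
  have i: "integrable lborel (\<lambda>h. (1 - cis (h \<bullet> (- \<xi>))) * of_real (K h))"
    by (rule K_mult_integrable[OF _ one_minus_cis_bound]) measurable
  have "(\<beta> y - \<beta> (y + h)) * cis (- ((y + h) \<bullet> \<xi>)) * of_real (K h)
      = (?e y - ?e (y + h)) * of_real (K h) - (cis (- (y \<bullet> \<xi>)) * \<beta> y) * ((1 - cis (h \<bullet> (- \<xi>))) * of_real (K h))" for h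
  proof -
    have "cis (- ((y + h) \<bullet> \<xi>)) = cis (- (y \<bullet> \<xi>)) * cis (- (h \<bullet> \<xi>))" by (simp add: cis_mult inner_add_left)
    thus ?thesis by (simp add: algebra_simps)
  qed
  hence "(\<integral>h. (\<beta> y - \<beta> (y + h)) * cis (- ((y + h) \<bullet> \<xi>)) * of_real (K h) \<partial>lborel)
     = (\<integral>h. (?e y - ?e (y + h)) * of_real (K h) \<partial>lborel) - (\<integral>h. (cis (- (y \<bullet> \<xi>)) * \<beta> y) * ((1 - cis (h \<bullet> (- \<xi>))) * of_real (K h)) \<partial>lborel)"
    using Bochner_Integration.integral_diff[OF test_diff_K_integrable[OF bt, of y] integrable_mult_right[OF i, of "cis (- (y \<bullet> \<xi>)) * \<beta> y"]] by presburger
  thus ?thesis unfolding fracL_singular_integral[OF bt] integral_mult_right_zero symbol by (simp add: mult.commute)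
qed

lemma comm_op_agrees:
  assumes b: "test_function \<Omega> \<beta>" and t: "test_function \<Omega>' \<phi>" and u: "integrable lborel u"
  shows "(\<integral>x. comm_op \<beta> u x * \<phi> x \<partial>lborel)
     = (\<integral>x. u x * fracL \<alpha> (\<lambda>x. \<beta> x * \<phi> x) x \<partial>lborel) - (\<integral>x. (\<beta> x * u x) * fracL \<alpha> \<phi> x \<partial>lborel)"
proof -
  have bt: "test_function \<Omega>' (\<lambda>x. \<beta> x * \<phi> x)" by (rule test_function_mult[OF t test_function_C_k[OF b]])
  obtain M where M: "\<And>x. cmod (\<phi> x) \<le> M" using test_function_bounded[OF t] by blast
  have bu: "integrable lborel (\<lambda>x. \<beta> x * u x)" by (rule integrable_test_mult[OF b u])
  have "(\<integral>x. comm_op \<beta> u x * \<phi> x \<partial>lborel)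
     = (\<integral>x. u x * fracL \<alpha> (\<lambda>x. \<beta> x * \<phi> x) x - (\<beta> x * u x) * fracL \<alpha> \<phi> x \<partial>lborel)"
    unfolding comm_op_pairing(1)[OF b u test_function_measurable[OF t] M] comm_op_adjoint_test[OF b t]
    by (simp add: algebra_simps)
  also have "\<dots> = (\<integral>x. u x * fracL \<alpha> (\<lambda>x. \<beta> x * \<phi> x) x \<partial>lborel) - (\<integral>x. (\<beta> x * u x) * fracL \<alpha> \<phi> x \<partial>lborel)"
    by (intro Bochner_Integration.integral_diff integrable_mult_fracL[OF \<alpha>_range bt u] integrable_mult_fracL[OF \<alpha>_range t bu])
  finally show ?thesis .
qed

text \<open>Pairing \<open>comm_op \<beta> u\<close> with a plane wave leaves the Fourier transform of \<open>\<beta>\<close> against that of \<open>u\<close> with the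
  difference of the two multipliers.\<close>

lemma fourier_comm_op:
  assumes b: "test_function \<Omega> \<beta>" and u: "integrable lborel u"
  shows "(2 * pi) ^ DIM('a) * fourier (comm_op \<beta> u) \<xi>
    = (\<integral>\<eta>. of_real (norm \<eta> powr \<alpha> - norm \<xi> powr \<alpha>) * fourier \<beta> (\<xi> - \<eta>) * fourier u \<eta> \<partial>lborel)"
proof -
  let ?e = "\<lambda>x. cis (x \<bullet> (- \<xi>)) * \<beta> x" and ?d = "complex_of_real ((2 * pi) ^ DIM('a))"
  have [measurable]: "\<beta> \<in> borel_measurable borel" using test_function_measurable[OF b] .
  have bt: "test_function \<Omega> ?e" by (rule test_function_mult[OF b C_k_cis])
  have bu: "integrable lborel (\<lambda>x. \<beta> x * u x)" by (rule integrable_test_mult[OF b u])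
  have Fe: "fourier ?e (- \<eta>) = fourier \<beta> (\<xi> - \<eta>)" for \<eta> by (subst fourier_modulate) simp
  have "fourier (comm_op \<beta> u) \<xi> = (\<integral>x. comm_op \<beta> u x * cis (- (x \<bullet> \<xi>)) \<partial>lborel)"
    by (simp add: fourier_def mult.commute)
  also have "\<dots> = (\<integral>y. u y * (fracL \<alpha> ?e y - of_real (norm \<xi> powr \<alpha>) * (cis (- (y \<bullet> \<xi>)) * \<beta> y)) \<partial>lborel)"
    unfolding comm_op_adjoint_exp[OF b, symmetric] by (rule comm_op_pairing(1)[OF b u, of _ 1]) auto
  also have "\<dots> = (\<integral>y. u y * fracL \<alpha> ?e y - of_real (norm \<xi> powr \<alpha>) * (cis (- (y \<bullet> \<xi>)) * (\<beta> y * u y)) \<partial>lborel)"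
    by (intro Bochner_Integration.integral_cong refl) (simp add: algebra_simps)
  also have "\<dots> = (\<integral>y. u y * fracL \<alpha> ?e y \<partial>lborel) - (\<integral>y. of_real (norm \<xi> powr \<alpha>) * (cis (- (y \<bullet> \<xi>)) * (\<beta> y * u y)) \<partial>lborel)"
    by (intro Bochner_Integration.integral_diff integrable_mult_fracL[OF \<alpha>_range bt u] integrable_mult_right integrable_cis_minus_mult bu)
  also have "(\<integral>y. of_real (norm \<xi> powr \<alpha>) * (cis (- (y \<bullet> \<xi>)) * (\<beta> y * u y)) \<partial>lborel) = of_real (norm \<xi> powr \<alpha>) * fourier (\<lambda>x. \<beta> x * u x) \<xi>"
    unfolding fourier_def by (rule integral_mult_right_zero)
  finally have 1: "?d * fourier (comm_op \<beta> u) \<xi> = ?d * (\<integral>y. u y * fracL \<alpha> ?e y \<partial>lborel) - of_real (norm \<xi> powr \<alpha>) * (?d * fourier (\<lambda>x. \<beta> x * u x) \<xi>)"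
    by (simp add: right_diff_distrib)
  have 2: "?d * (\<integral>y. u y * fracL \<alpha> ?e y \<partial>lborel) = (\<integral>\<eta>. (norm \<eta> powr \<alpha>) *\<^sub>R fourier u \<eta> * fourier \<beta> (\<xi> - \<eta>) \<partial>lborel)"
    using frac_laplacian_pairing[OF \<alpha>_range bt u, symmetric] unfolding Fe by simp
  have 3: "?d * fourier (\<lambda>x. \<beta> x * u x) \<xi> = (\<integral>\<eta>. fourier \<beta> (\<xi> - \<eta>) * fourier u \<eta> \<partial>lborel)"
    using fourier_test_mult[OF b u, of \<xi>] by (simp add: scaleR_conv_of_real)
  have i1: "integrable lborel (\<lambda>\<eta>. (norm \<eta> powr \<alpha>) *\<^sub>R fourier u \<eta> * fourier \<beta> (\<xi> - \<eta>))"
  proof -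
    have "integrable lborel (\<lambda>\<eta>. (of_real (norm \<eta> powr \<alpha>) * fourier ?e (- \<eta>)) * fourier u \<eta>)"
      by (rule integrable_mult_bounded[OF fourier_test_powr_integrable[OF \<alpha>_range bt] _ fourier_bound[OF u]]) (use u in auto)
    thus ?thesis unfolding Fe by (simp add: scaleR_conv_of_real mult_ac)
  qed
  have i2: "integrable lborel (\<lambda>\<eta>. fourier \<beta> (\<xi> - \<eta>) * fourier u \<eta>)"
    by (rule integrable_mult_bounded[OF integrable_lborel_reflect[OF fourier_test_integrable[OF b]] _ fourier_bound[OF u]]) (use u in auto)
  have "?d * fourier (comm_op \<beta> u) \<xi>
      = (\<integral>\<eta>. (norm \<eta> powr \<alpha>) *\<^sub>R fourier u \<eta> * fourier \<beta> (\<xi> - \<eta>) - of_real (norm \<xi> powr \<alpha>) * (fourier \<beta> (\<xi> - \<eta>) * fourier u \<eta>) \<partial>lborel)"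
    unfolding 1 2 3 using i1 i2 by simp
  also have "\<dots> = (\<integral>\<eta>. of_real (norm \<eta> powr \<alpha> - norm \<xi> powr \<alpha>) * fourier \<beta> (\<xi> - \<eta>) * fourier u \<eta> \<partial>lborel)"
    by (intro Bochner_Integration.integral_cong refl) (simp add: scaleR_conv_of_real algebra_simps)
  finally show ?thesis by simp
qed

end

section \<open>The interior part of the commutator\<close>

lemma square_integrableD:
  assumes "square_integrable u"
  shows "u \<in> borel_measurable borel" "(\<integral>\<^sup>+x. ennreal ((cmod (u x))\<^sup>2) \<partial>lborel) = ennreal ((L2norm u)\<^sup>2)"
proof -
  show "u \<in> borel_measurable borel" using assms by (simp add: square_integrable_def)
  have "(\<integral>\<^sup>+x. ennreal ((cmod (u x))\<^sup>2) \<partial>lborel) = ennreal (\<integral>x. (cmod (u x))\<^sup>2 \<partial>lborel)"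
    by (rule nn_integral_eq_integral) (use assms in \<open>auto simp: square_integrable_def\<close>)
  thus "(\<integral>\<^sup>+x. ennreal ((cmod (u x))\<^sup>2) \<partial>lborel) = ennreal ((L2norm u)\<^sup>2)" by (simp add: L2norm_def)
qed

lemma L2norm_nonneg: "0 \<le> L2norm u" by (simp add: L2norm_def)

lemma square_integrableI:
  assumes [measurable]: "u \<in> borel_measurable borel"
    and B: "(\<integral>\<^sup>+x. ennreal ((cmod (u x))\<^sup>2) \<partial>lborel) \<le> ennreal (B\<^sup>2)" "0 \<le> B"
  shows "square_integrable u" "L2norm u \<le> B"
proof -
  show s: "square_integrable u"
    unfolding square_integrable_def integrable_iff_bounded
    using le_less_trans[OF B(1), of \<infinity>] by simp
  from B(1) have "ennreal ((L2norm u)\<^sup>2) \<le> ennreal (B\<^sup>2)" using square_integrableD(2)[OF s] by simp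
  hence "(L2norm u)\<^sup>2 \<le> B\<^sup>2" by (subst (asm) ennreal_le_iff) auto
  thus "L2norm u \<le> B" using B(2) by (rule power2_le_imp_le)
qed

text \<open>Write \<open>X = X\<^sup>1\<^sup>-\<^sup>\<theta> X\<^sup>\<theta>\<close>. Below, \<open>X \<le> A\<close> will be a bound that holds for every function and \<open>\<mu> X \<le> B\<close> one
  that comes from the eigenvalue equation.\<close>

lemma interpolate_bound:
  fixes X A B \<mu> \<theta> :: real
  assumes "0 \<le> X" "X \<le> A" "\<mu> * X \<le> B" "0 < \<mu>" "0 \<le> \<theta>" "\<theta> \<le> 1"
  shows "X \<le> \<mu> powr (- \<theta>) * A powr (1 - \<theta>) * B powr \<theta>"
proof (cases "X = 0")
  case False
  hence X: "X > 0" using assms by simp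
  have "X = \<mu> powr (- \<theta>) * X powr (1 - \<theta>) * (\<mu> * X) powr \<theta>"
  proof -
    have "X powr (1 - \<theta>) * X powr \<theta> = X" using X by (simp add: powr_add[symmetric])
    moreover have "\<mu> powr (- \<theta>) * \<mu> powr \<theta> = 1" using assms(4) by (simp add: powr_add[symmetric])
    moreover have "(\<mu> * X) powr \<theta> = \<mu> powr \<theta> * X powr \<theta>" using X assms by (simp add: powr_mult)
    ultimately show ?thesis by (metis mult.assoc mult.commute mult.left_neutral)
  qed
  also have "\<dots> \<le> \<mu> powr (- \<theta>) * A powr (1 - \<theta>) * B powr \<theta>"
    using assms X by (intro mult_mono[OF mult_left_mono[OF powr_mono2] powr_mono2]) auto
  finally show ?thesis .
qed auto

text \<open>\<open>||a|\<^sup>\<alpha> - |b|\<^sup>\<alpha>|\<close> gains the factor \<open>(1 + a)\<^sup>\<alpha>\<^sup>-\<^sup>1\<close> against one power of the difference: this is the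
  order \<open>\<alpha> - 1\<close> of the commutator.\<close>

lemma powr_diff_bound:
  fixes a b \<alpha> :: real
  assumes \<alpha>: "0 < \<alpha>" "\<alpha> < 1" and ab: "0 \<le> a" "0 \<le> b"
  shows "\<bar>a powr \<alpha> - b powr \<alpha>\<bar> \<le> 2 * (1 + \<bar>a - b\<bar>) * (1 + a) powr (\<alpha> - 1)"
proof (cases "a < 1")
  case True
  have "(1 + a) powr (\<alpha> - 1) \<ge> 1/2"
  proof -
    have "(2::real) powr (- 1) \<le> 2 powr (\<alpha> - 1)" using \<alpha> by (intro powr_mono) auto
    also have "\<dots> \<le> (1 + a) powr (\<alpha> - 1)" using \<alpha> ab True by (intro powr_mono2') auto
    finally show ?thesis by (simp add: powr_minus)
  qed
  hence "(1 + \<bar>a - b\<bar>) * 1 \<le> (1 + \<bar>a - b\<bar>) * (2 * (1 + a) powr (\<alpha> - 1))" by (intro mult_left_mono) auto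
  moreover have "\<bar>a powr \<alpha> - b powr \<alpha>\<bar> \<le> 1 + \<bar>a - b\<bar>"
  proof (cases "b \<le> 1")
    case True
    have "a powr \<alpha> \<le> 1" "b powr \<alpha> \<le> 1" using \<alpha> ab True \<open>a < 1\<close> by (auto intro: powr_le1)
    moreover have "a powr \<alpha> \<ge> 0" "b powr \<alpha> \<ge> 0" by auto
    ultimately show ?thesis unfolding abs_le_iff by linarith
  next
    case False
    hence "a powr \<alpha> \<le> b powr \<alpha>" using \<alpha> ab \<open>a < 1\<close> by (intro powr_mono2) auto
    moreover have "b powr \<alpha> \<le> b powr 1" using False \<alpha> by (intro powr_mono) auto
    moreover have "a powr \<alpha> \<ge> 0" "b powr 1 = b" "b - a \<le> \<bar>a - b\<bar>" using False by auto
    ultimately show ?thesis using False \<open>a < 1\<close> by linarith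
  qed
  ultimately have "\<bar>a powr \<alpha> - b powr \<alpha>\<bar> \<le> (1 + \<bar>a - b\<bar>) * (2 * (1 + a) powr (\<alpha> - 1))"
    by (simp only: mult_1_right order_trans)
  also have "\<dots> = 2 * (1 + \<bar>a - b\<bar>) * (1 + a) powr (\<alpha> - 1)" by (simp only: mult_ac)
  finally show ?thesis .
next
  case False
  have key: "y powr \<alpha> - x powr \<alpha> \<le> (y - x) * y powr (\<alpha> - 1)" if "0 \<le> x" "x \<le> y" "0 < y" for x y
  proof -
    have "x / y \<le> (x / y) powr \<alpha>"
    proof (cases "x = 0")
      case False
      hence "(x / y) powr 1 \<le> (x / y) powr \<alpha>" using that \<alpha> by (intro powr_mono') auto
      thus ?thesis using that False by simp
    qed simp
    hence "y powr \<alpha> * (x / y) \<le> y powr \<alpha> * (x / y) powr \<alpha>" by (intro mult_left_mono) auto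
    also have "\<dots> = x powr \<alpha>" using that by (simp add: powr_divide)
    finally have "y powr \<alpha> - x powr \<alpha> \<le> y powr \<alpha> * (1 - x / y)" by (simp add: right_diff_distrib)
    also have "\<dots> = (y - x) * (y powr \<alpha> / y)" using that by (simp add: field_simps)
    also have "y powr \<alpha> / y = y powr (\<alpha> - 1)" using that by (simp add: powr_diff)
    finally show ?thesis .
  qed
  have "\<bar>a powr \<alpha> - b powr \<alpha>\<bar> \<le> \<bar>a - b\<bar> * a powr (\<alpha> - 1)"
  proof (cases "b \<le> a")
    case True
    have "b powr \<alpha> \<le> a powr \<alpha>" using True \<alpha> ab by (intro powr_mono2) auto
    thus ?thesis using key[of b a] True ab False by simp
  next
    case gt: False
    have "a powr \<alpha> \<le> b powr \<alpha>" using gt \<alpha> ab by (intro powr_mono2) auto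
    moreover have "b powr (\<alpha> - 1) \<le> a powr (\<alpha> - 1)" using gt \<alpha> False by (intro powr_mono2') auto
    hence "(b - a) * b powr (\<alpha> - 1) \<le> (b - a) * a powr (\<alpha> - 1)" using gt by (intro mult_left_mono) auto
    moreover have "b powr \<alpha> - a powr \<alpha> \<le> (b - a) * b powr (\<alpha> - 1)" using key[of a b] gt ab False by simp
    moreover have "\<bar>a powr \<alpha> - b powr \<alpha>\<bar> = b powr \<alpha> - a powr \<alpha>" "\<bar>a - b\<bar> = b - a"
      using calculation(1) gt by auto
    ultimately show ?thesis by (simp only: order_trans)
  qed
  also have "\<dots> \<le> (1 + \<bar>a - b\<bar>) * (2 * (1 + a) powr (\<alpha> - 1))"
  proof (intro mult_mono)
    have "(2 * a) powr (\<alpha> - 1) \<le> (1 + a) powr (\<alpha> - 1)" using \<alpha> False by (intro powr_mono2') auto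
    moreover have "(2 * a) powr (\<alpha> - 1) = 2 powr (\<alpha> - 1) * a powr (\<alpha> - 1)" using False by (simp add: powr_mult)
    moreover have "2 powr (- 1) * a powr (\<alpha> - 1) \<le> 2 powr (\<alpha> - 1) * a powr (\<alpha> - 1)"
      using \<alpha> by (intro mult_right_mono powr_mono) auto
    ultimately show "a powr (\<alpha> - 1) \<le> 2 * (1 + a) powr (\<alpha> - 1)" by (simp add: powr_minus)
  qed auto
  also have "\<dots> = 2 * (1 + \<bar>a - b\<bar>) * (1 + a) powr (\<alpha> - 1)" by (simp only: mult_ac)
  finally show ?thesis .
qed

context frac_kernel begin

text \<open>The equation tested against functions supported in \<open>\<Omega>\<close>, with the operator moved to the test
  function.\<close>

definition weak_eigen :: "'a set \<Rightarrow> real \<Rightarrow> ('a \<Rightarrow> complex) \<Rightarrow> bool" where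
  "weak_eigen \<Omega> \<mu> e \<longleftrightarrow> integrable lborel e \<and> square_integrable e \<and>
     (\<forall>\<phi>. test_function \<Omega> \<phi> \<longrightarrow> (\<integral>x. e x * fracL \<alpha> \<phi> x \<partial>lborel) = of_real \<mu> * (\<integral>x. e x * \<phi> x \<partial>lborel))"

lemma weak_eigenD:
  assumes "weak_eigen \<Omega> \<mu> e"
  shows "integrable lborel e" "square_integrable e" "e \<in> borel_measurable borel"
    and "test_function \<Omega> \<phi> \<Longrightarrow> (\<integral>x. e x * fracL \<alpha> \<phi> x \<partial>lborel) = of_real \<mu> * (\<integral>x. e x * \<phi> x \<partial>lborel)"
  using assms by (auto simp: weak_eigen_def dest: square_integrableD(1))

text \<open>A convolution that bounds the Fourier transform of \<open>\<zeta> e\<close> up to a constant; the extra weight \<open>1 + |\<xi> - \<eta>|\<close> leaves room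
  to replace the multiplier \<open>|\<eta>|\<^sup>\<alpha>\<close> by \<open>(1 + |\<xi>|)\<^sup>\<alpha>\<close>.\<close>

definition majorant :: "('a \<Rightarrow> complex) \<Rightarrow> ('a \<Rightarrow> complex) \<Rightarrow> 'a \<Rightarrow> real" where
  "majorant \<zeta> e \<xi> = (\<integral>\<eta>. (1 + norm (\<xi> - \<eta>)) * cmod (fourier \<zeta> (\<xi> - \<eta>)) * cmod (fourier e \<eta>) \<partial>lborel)"

lemma majorant_integrable:
  assumes t: "test_function \<Omega> \<zeta>" and u: "integrable lborel e"
  shows "integrable lborel (\<lambda>\<eta>. (1 + norm (\<xi> - \<eta>)) * cmod (fourier \<zeta> (\<xi> - \<eta>)) * cmod (fourier e \<eta>))"
proof (rule Bochner_Integration.integrable_bound)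
  have [measurable]: "\<zeta> \<in> borel_measurable borel" "e \<in> borel_measurable borel"
    using test_function_measurable[OF t] u by auto
  let ?N = "\<integral>x. cmod (e x) \<partial>lborel"
  show "integrable lborel (\<lambda>\<eta>. (1 + norm (\<xi> - \<eta>)) ^ 1 * cmod (fourier \<zeta> (\<xi> - \<eta>)) * ?N)"
    by (intro integrable_mult_left integrable_lborel_reflect[OF fourier_test_weighted_integrable[OF t]])
  show "(\<lambda>\<eta>. (1 + norm (\<xi> - \<eta>)) * cmod (fourier \<zeta> (\<xi> - \<eta>)) * cmod (fourier e \<eta>)) \<in> borel_measurable lborel"
    by measurable
  show "AE \<eta> in lborel. norm ((1 + norm (\<xi> - \<eta>)) * cmod (fourier \<zeta> (\<xi> - \<eta>)) * cmod (fourier e \<eta>))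
      \<le> norm ((1 + norm (\<xi> - \<eta>)) ^ 1 * cmod (fourier \<zeta> (\<xi> - \<eta>)) * ?N)"
    using fourier_bound[OF u] by (intro AE_I2) (auto simp: abs_mult intro!: mult_left_mono)
qed

lemma majorant_nonneg: "0 \<le> majorant \<zeta> e \<xi>"
  unfolding majorant_def by (intro integral_nonneg_AE AE_I2) simp

lemma majorant_measurable [measurable]:
  assumes [measurable]: "\<zeta> \<in> borel_measurable borel" "e \<in> borel_measurable borel"
  shows "majorant \<zeta> e \<in> borel_measurable borel"
  unfolding majorant_def[abs_def] by measurable

lemma majorant_L2:
  assumes t: "test_function \<Omega> \<zeta>" and u: "integrable lborel e"
  shows "(\<integral>\<^sup>+\<xi>. ennreal ((majorant \<zeta> e \<xi>)\<^sup>2) \<partial>lborel)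
    \<le> ennreal ((\<integral>h. (1 + norm h) * cmod (fourier \<zeta> h) \<partial>lborel)\<^sup>2) * (\<integral>\<^sup>+\<xi>. ennreal ((cmod (fourier e \<xi>))\<^sup>2) \<partial>lborel)"
proof -
  have [measurable]: "\<zeta> \<in> borel_measurable borel" "e \<in> borel_measurable borel"
    using test_function_measurable[OF t] u by auto
  let ?k = "\<lambda>h. (1 + norm h) * cmod (fourier \<zeta> h)"
  have k: "(\<integral>\<^sup>+h. ennreal (?k h) \<partial>lborel) = ennreal (\<integral>h. ?k h \<partial>lborel)"
    using fourier_test_weighted_integrable[OF t, of 1] by (intro nn_integral_eq_integral) auto
  have "(\<integral>\<^sup>+\<xi>. ennreal ((majorant \<zeta> e \<xi>)\<^sup>2) \<partial>lborel) = (\<integral>\<^sup>+\<xi>. (\<integral>\<^sup>+\<eta>. ennreal (?k (\<xi> - \<eta>) * cmod (fourier e \<eta>)) \<partial>lborel)\<^sup>2 \<partial>lborel)"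
  proof (intro nn_integral_cong)
    fix \<xi>
    have "(\<integral>\<^sup>+\<eta>. ennreal (?k (\<xi> - \<eta>) * cmod (fourier e \<eta>)) \<partial>lborel) = ennreal (majorant \<zeta> e \<xi>)"
      unfolding majorant_def by (intro nn_integral_eq_integral majorant_integrable[OF t u]) auto
    thus "ennreal ((majorant \<zeta> e \<xi>)\<^sup>2) = (\<integral>\<^sup>+\<eta>. ennreal (?k (\<xi> - \<eta>) * cmod (fourier e \<eta>)) \<partial>lborel)\<^sup>2"
      by (simp add: ennreal_power majorant_nonneg)
  qed
  also have "\<dots> \<le> (\<integral>\<^sup>+h. ennreal (?k h) \<partial>lborel)\<^sup>2 * (\<integral>\<^sup>+\<xi>. ennreal ((cmod (fourier e \<xi>))\<^sup>2) \<partial>lborel)"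
    by (rule young_L2) auto
  finally show ?thesis unfolding k by (simp add: ennreal_power)
qed

text \<open>Testing the equation with \<open>\<zeta>\<close> times a plane wave gives the Fourier transform of \<open>\<zeta> e\<close>, so the equation
  bounds \<open>\<mu> F(\<zeta> e)(\<xi>)\<close> by \<open>(1 + |\<xi>|)\<^sup>\<alpha>\<close> times the majorant, while \<open>F(\<zeta> e)(\<xi>)\<close> itself is bounded by the
  majorant. Interpolation with exponent \<open>\<theta> = (1 - \<alpha>) / \<alpha>\<close> gives the norm of order \<open>\<alpha> - 1\<close>; it requires
  \<open>\<theta> \<le> 1\<close>, that is \<open>\<alpha> \<ge> 1/2\<close>.\<close>

lemma eigen_negative_norm:
  assumes e: "weak_eigen \<Omega> \<mu> e" and t: "test_function \<Omega> \<zeta>" and \<mu>: "\<mu> > 0" and \<alpha>2: "1/2 \<le> \<alpha>"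
  shows "(2 * pi) ^ DIM('a) * cmod (fourier (\<lambda>x. \<zeta> x * e x) \<xi>) * (1 + norm \<xi>) powr (\<alpha> - 1)
    \<le> \<mu> powr (1 - 1 / \<alpha>) * majorant \<zeta> e \<xi>"
proof -
  note ei = weak_eigenD[OF e]
  let ?F = "fourier (\<lambda>x. \<zeta> x * e x) \<xi>" and ?d = "(2 * pi) ^ DIM('a)" and ?G = "majorant \<zeta> e \<xi>"
  have d: "?d > 0" by simp
  let ?\<phi> = "\<lambda>x. cis (x \<bullet> (- \<xi>)) * \<zeta> x"
  have p: "test_function \<Omega> ?\<phi>" by (rule test_function_mult[OF t C_k_cis])
  have Fp: "fourier ?\<phi> (- \<eta>) = fourier \<zeta> (\<xi> - \<eta>)" for \<eta> by (subst fourier_modulate) simp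
  have i: "integrable lborel (\<lambda>\<eta>. (1 + norm (\<xi> - \<eta>)) * cmod (fourier \<zeta> (\<xi> - \<eta>)) * cmod (fourier e \<eta>))"
    by (rule majorant_integrable[OF t ei(1)])
  \<comment> \<open>a bound from the definition and one from the equation\<close>
  have A: "?d * cmod ?F \<le> ?G"
  proof -
    have "?d * cmod ?F = cmod (\<integral>\<eta>. fourier \<zeta> (\<xi> - \<eta>) * fourier e \<eta> \<partial>lborel)"
      unfolding fourier_test_mult[OF t ei(1)] by simp
    also have "\<dots> \<le> (\<integral>\<eta>. (1 + norm (\<xi> - \<eta>)) * cmod (fourier \<zeta> (\<xi> - \<eta>)) * cmod (fourier e \<eta>) \<partial>lborel)"
    proof (rule Bochner_Integration.integral_norm_bound_integral[OF _ i])
      show "integrable lborel (\<lambda>\<eta>. fourier \<zeta> (\<xi> - \<eta>) * fourier e \<eta>)"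
        by (rule integrable_mult_bounded[OF integrable_lborel_reflect[OF fourier_test_integrable[OF t]] _ fourier_bound[OF ei(1)]])
           (use ei(3) in auto)
      fix \<eta>
      show "norm (fourier \<zeta> (\<xi> - \<eta>) * fourier e \<eta>) \<le> (1 + norm (\<xi> - \<eta>)) * cmod (fourier \<zeta> (\<xi> - \<eta>)) * cmod (fourier e \<eta>)"
        unfolding norm_mult by (intro mult_right_mono) (auto simp: mult_le_cancel_right1)
    qed
    finally show ?thesis by (simp add: majorant_def)
  qed
  have B: "\<mu> * (?d * cmod ?F) \<le> (1 + norm \<xi>) powr \<alpha> * ?G"
  proof -
    have "of_real \<mu> * ?F = of_real \<mu> * (\<integral>x. e x * ?\<phi> x \<partial>lborel)"
      by (simp add: fourier_def mult_ac)
    also have "\<dots> = (\<integral>x. e x * fracL \<alpha> ?\<phi> x \<partial>lborel)" by (rule ei(4)[OF p, symmetric])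
    also have "\<dots> = (\<integral>\<eta>. (norm \<eta> powr \<alpha>) *\<^sub>R fourier e \<eta> * fourier \<zeta> (\<xi> - \<eta>) \<partial>lborel) / ?d"
      using frac_laplacian_pairing[OF \<alpha>_range p ei(1)] unfolding Fp by simp
    finally have "cmod (of_real \<mu> * ?F) = cmod (\<integral>\<eta>. (norm \<eta> powr \<alpha>) *\<^sub>R fourier e \<eta> * fourier \<zeta> (\<xi> - \<eta>) \<partial>lborel) / ?d"
      by (simp add: norm_divide norm_power norm_mult)
    hence "\<mu> * (?d * cmod ?F) = cmod (\<integral>\<eta>. (norm \<eta> powr \<alpha>) *\<^sub>R fourier e \<eta> * fourier \<zeta> (\<xi> - \<eta>) \<partial>lborel)"
      using \<mu> d by (simp add: norm_mult field_simps)
    also have "\<dots> \<le> (\<integral>\<eta>. (1 + norm \<xi>) powr \<alpha> * ((1 + norm (\<xi> - \<eta>)) * cmod (fourier \<zeta> (\<xi> - \<eta>)) * cmod (fourier e \<eta>)) \<partial>lborel)"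
    proof (rule Bochner_Integration.integral_norm_bound_integral[OF _ integrable_mult_right[OF i]])
      show "integrable lborel (\<lambda>\<eta>. (norm \<eta> powr \<alpha>) *\<^sub>R fourier e \<eta> * fourier \<zeta> (\<xi> - \<eta>))"
      proof -
        have "integrable lborel (\<lambda>\<eta>. (of_real (norm \<eta> powr \<alpha>) * fourier ?\<phi> (- \<eta>)) * fourier e \<eta>)"
          by (rule integrable_mult_bounded[OF fourier_test_powr_integrable[OF \<alpha>_range p] _ fourier_bound[OF ei(1)]])
             (use ei(3) in auto)
        thus ?thesis unfolding Fp by (simp add: scaleR_conv_of_real mult_ac)
      qed
      fix \<eta>
      have "norm \<eta> \<le> norm \<xi> + norm (\<xi> - \<eta>)" using norm_triangle_ineq4[of \<xi> "\<xi> - \<eta>"] by simp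
      also have "\<dots> \<le> (1 + norm \<xi>) * (1 + norm (\<xi> - \<eta>))" by (simp add: ring_distribs)
      finally have "norm \<eta> powr \<alpha> \<le> ((1 + norm \<xi>) * (1 + norm (\<xi> - \<eta>))) powr \<alpha>"
        using \<alpha>_range by (intro powr_mono2) auto
      also have "\<dots> = (1 + norm \<xi>) powr \<alpha> * (1 + norm (\<xi> - \<eta>)) powr \<alpha>" by (simp add: powr_mult)
      also have "(1 + norm (\<xi> - \<eta>)) powr \<alpha> \<le> (1 + norm (\<xi> - \<eta>)) powr 1"
        using \<alpha>_range by (intro powr_mono) auto
      finally have "norm \<eta> powr \<alpha> \<le> (1 + norm \<xi>) powr \<alpha> * (1 + norm (\<xi> - \<eta>))" by (simp add: mult_left_mono)
      hence "norm \<eta> powr \<alpha> * (cmod (fourier \<zeta> (\<xi> - \<eta>)) * cmod (fourier e \<eta>))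
         \<le> ((1 + norm \<xi>) powr \<alpha> * (1 + norm (\<xi> - \<eta>))) * (cmod (fourier \<zeta> (\<xi> - \<eta>)) * cmod (fourier e \<eta>))"
        by (rule mult_right_mono) simp
      thus "norm ((norm \<eta> powr \<alpha>) *\<^sub>R fourier e \<eta> * fourier \<zeta> (\<xi> - \<eta>))
          \<le> (1 + norm \<xi>) powr \<alpha> * ((1 + norm (\<xi> - \<eta>)) * cmod (fourier \<zeta> (\<xi> - \<eta>)) * cmod (fourier e \<eta>))"
        by (simp add: norm_mult mult_ac)
    qed
    finally show ?thesis by (simp add: majorant_def)
  qed
  let ?\<theta> = "(1 - \<alpha>) / \<alpha>"
  have \<theta>: "0 \<le> ?\<theta>" "?\<theta> \<le> 1" using \<alpha>_range \<alpha>2 by (auto simp: divide_le_eq)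
  have "?d * cmod ?F \<le> \<mu> powr (- ?\<theta>) * ?G powr (1 - ?\<theta>) * ((1 + norm \<xi>) powr \<alpha> * ?G) powr ?\<theta>"
    by (rule interpolate_bound[OF _ A B \<mu> \<theta>]) simp
  also have "\<dots> = \<mu> powr (1 - 1 / \<alpha>) * (?G powr (1 - ?\<theta>) * ?G powr ?\<theta>) * (1 + norm \<xi>) powr (1 - \<alpha>)"
  proof -
    have "((1 + norm \<xi>) powr \<alpha> * ?G) powr ?\<theta> = (1 + norm \<xi>) powr (1 - \<alpha>) * ?G powr ?\<theta>"
      using \<alpha>_range majorant_nonneg by (simp add: powr_mult powr_powr)
    moreover have "- ?\<theta> = 1 - 1 / \<alpha>" using \<alpha>_range by (simp add: field_simps)
    ultimately show ?thesis by (simp add: mult_ac)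
  qed
  also have "?G powr (1 - ?\<theta>) * ?G powr ?\<theta> = ?G"
    using majorant_nonneg[of \<zeta> e \<xi>] by (simp add: powr_add[symmetric])
  finally have "?d * cmod ?F * (1 + norm \<xi>) powr (\<alpha> - 1)
     \<le> (\<mu> powr (1 - 1 / \<alpha>) * ?G * (1 + norm \<xi>) powr (1 - \<alpha>)) * (1 + norm \<xi>) powr (\<alpha> - 1)"
    by (rule mult_right_mono) simp
  also have "\<dots> = \<mu> powr (1 - 1 / \<alpha>) * ?G * ((1 + norm \<xi>) powr (1 - \<alpha>) * (1 + norm \<xi>) powr (\<alpha> - 1))"
    by (simp only: mult.assoc)
  also have "(1 + norm \<xi>) powr (1 - \<alpha>) * (1 + norm \<xi>) powr (\<alpha> - 1) = 1"
    by (simp add: powr_add[symmetric] add_pos_nonneg less_imp_neq[symmetric])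
  finally show ?thesis by simp
qed

text \<open>By \<open>powr_diff_bound\<close> the Fourier transform of the commutator is at most the convolution of the integrable
  function \<open>(1 + |h|) |F \<beta> (h)|\<close> with \<open>(1 + |\<eta>|)\<^sup>\<alpha>\<^sup>-\<^sup>1 |F(\<zeta> e)(\<eta>)|\<close>, which has just been estimated.\<close>

lemma comm_op_interior:
  assumes b: "test_function \<Omega>' \<beta>" and t: "test_function \<Omega> \<zeta>" and \<alpha>2: "1/2 \<le> \<alpha>"
  obtains C where "C \<ge> 0" "\<And>\<mu> e. weak_eigen \<Omega> \<mu> e \<Longrightarrow> \<mu> > 0 \<Longrightarrow>
    (\<integral>\<^sup>+x. ennreal ((cmod (comm_op \<beta> (\<lambda>x. \<zeta> x * e x) x))\<^sup>2) \<partial>lborel) \<le> ennreal ((C * \<mu> powr (1 - 1 / \<alpha>) * L2norm e)\<^sup>2)"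
proof -
  have [measurable]: "\<beta> \<in> borel_measurable borel" "\<zeta> \<in> borel_measurable borel"
    using test_function_measurable[OF t] test_function_measurable[OF b] by auto
  let ?d = "(2 * pi) ^ DIM('a)"
  have d: "?d > 0" by simp
  let ?k = "\<lambda>h. (1 + norm h) * cmod (fourier \<beta> h)" and ?l = "\<lambda>h. (1 + norm h) * cmod (fourier \<zeta> h)"
  have ki: "integrable lborel ?k" "integrable lborel ?l"
    using fourier_test_weighted_integrable[OF b, of 1] fourier_test_weighted_integrable[OF t, of 1] by auto
  have kk: "(\<integral>\<^sup>+h. ennreal (?k h) \<partial>lborel) = ennreal (\<integral>h. ?k h \<partial>lborel)"
    using ki(1) by (intro nn_integral_eq_integral) auto
  have k0: "0 \<le> (\<integral>h. ?k h \<partial>lborel)" "0 \<le> (\<integral>h. ?l h \<partial>lborel)" by (intro integral_nonneg_AE AE_I2, simp)+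
  define C where "C = 2 / ?d\<^sup>2 * (\<integral>h. ?k h \<partial>lborel) * (\<integral>h. ?l h \<partial>lborel)"
  have C0: "C \<ge> 0" unfolding C_def using k0 by simp
  have main: "(\<integral>\<^sup>+x. ennreal ((cmod (comm_op \<beta> (\<lambda>x. \<zeta> x * e x) x))\<^sup>2) \<partial>lborel) \<le> ennreal ((C * \<mu> powr (1 - 1 / \<alpha>) * L2norm e)\<^sup>2)"
    if e: "weak_eigen \<Omega> \<mu> e" and \<mu>: "\<mu> > 0" for \<mu> e
  proof -
    note ei = weak_eigenD[OF e]
    have [measurable]: "e \<in> borel_measurable borel" by (rule ei(3))
    let ?u = "\<lambda>x. \<zeta> x * e x" and ?m = "\<mu> powr (1 - 1 / \<alpha>)" and ?G = "majorant \<zeta> e"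
    have u: "integrable lborel ?u" by (rule integrable_test_mult[OF t ei(1)])
    have cu: "integrable lborel (comm_op \<beta> ?u)"
      by (rule comm_op_pairing(2)[OF b u, of "\<lambda>_. 0" 0]) auto
    have pt: "ennreal (cmod (fourier (comm_op \<beta> ?u) \<xi>)) \<le> (\<integral>\<^sup>+\<eta>. ennreal (?k (\<xi> - \<eta>) * (2 / ?d\<^sup>2 * ?m * ?G \<eta>)) \<partial>lborel)" for \<xi>
    proof -
      let ?I = "\<lambda>\<eta>. of_real (norm \<eta> powr \<alpha> - norm \<xi> powr \<alpha>) * fourier \<beta> (\<xi> - \<eta>) * fourier ?u \<eta>"
      have "cmod (complex_of_real ?d * fourier (comm_op \<beta> ?u) \<xi>) = cmod (\<integral>\<eta>. ?I \<eta> \<partial>lborel)"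
        using fourier_comm_op[OF b u, of \<xi>] by simp
      hence h: "cmod (fourier (comm_op \<beta> ?u) \<xi>) = (1 / ?d) * cmod (\<integral>\<eta>. ?I \<eta> \<partial>lborel)"
        using d by (simp add: norm_mult norm_power field_simps)
      have "ennreal (cmod (fourier (comm_op \<beta> ?u) \<xi>)) = ennreal (1 / ?d) * ennreal (cmod (\<integral>\<eta>. ?I \<eta> \<partial>lborel))"
        unfolding h by (rule ennreal_mult') simp
      also have "\<dots> \<le> ennreal (1 / ?d) * (\<integral>\<^sup>+\<eta>. ennreal (cmod (?I \<eta>)) \<partial>lborel)"
      proof (intro mult_left_mono)
        show "ennreal (cmod (\<integral>\<eta>. ?I \<eta> \<partial>lborel)) \<le> (\<integral>\<^sup>+\<eta>. ennreal (cmod (?I \<eta>)) \<partial>lborel)"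
          by (rule norm_integral_le_nn_integral)
      qed simp
      also have "\<dots> = (\<integral>\<^sup>+\<eta>. ennreal (1 / ?d) * ennreal (cmod (?I \<eta>)) \<partial>lborel)"
        by (rule nn_integral_cmult[symmetric]) measurable
      also have "\<dots> \<le> (\<integral>\<^sup>+\<eta>. ennreal (?k (\<xi> - \<eta>) * (2 / ?d\<^sup>2 * ?m * ?G \<eta>)) \<partial>lborel)"
      proof (intro nn_integral_mono)
        fix \<eta> :: 'a
        have "\<bar>norm \<eta> powr \<alpha> - norm \<xi> powr \<alpha>\<bar> \<le> 2 * (1 + \<bar>norm \<eta> - norm \<xi>\<bar>) * (1 + norm \<eta>) powr (\<alpha> - 1)"
          by (rule powr_diff_bound[OF \<alpha>_range]) auto
        also have "\<dots> \<le> 2 * (1 + norm (\<xi> - \<eta>)) * (1 + norm \<eta>) powr (\<alpha> - 1)"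
          using norm_triangle_ineq3[of \<eta> \<xi>] by (intro mult_right_mono) (auto simp: norm_minus_commute)
        finally have "\<bar>norm \<eta> powr \<alpha> - norm \<xi> powr \<alpha>\<bar> * (cmod (fourier \<beta> (\<xi> - \<eta>)) * cmod (fourier ?u \<eta>))
          \<le> (2 * (1 + norm (\<xi> - \<eta>)) * (1 + norm \<eta>) powr (\<alpha> - 1)) * (cmod (fourier \<beta> (\<xi> - \<eta>)) * cmod (fourier ?u \<eta>))"
          by (rule mult_right_mono) simp
        also have "\<dots> = (2 * ?k (\<xi> - \<eta>) / ?d) * (?d * cmod (fourier ?u \<eta>) * (1 + norm \<eta>) powr (\<alpha> - 1))"
          using d by (simp add: field_simps)
        also have "\<dots> \<le> (2 * ?k (\<xi> - \<eta>) / ?d) * (?m * ?G \<eta>)"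
          by (intro mult_left_mono eigen_negative_norm[OF e t \<mu> \<alpha>2]) auto
        finally have "(1 / ?d) * cmod (?I \<eta>) \<le> (1 / ?d) * ((2 * ?k (\<xi> - \<eta>) / ?d) * (?m * ?G \<eta>))"
          by (intro mult_left_mono) (auto simp: norm_mult mult.assoc simp del: of_real_diff)
        also have "\<dots> = ?k (\<xi> - \<eta>) * (2 / ?d\<^sup>2 * ?m * ?G \<eta>)" by (simp add: power2_eq_square)
        finally show "ennreal (1 / ?d) * ennreal (cmod (?I \<eta>)) \<le> ennreal (?k (\<xi> - \<eta>) * (2 / ?d\<^sup>2 * ?m * ?G \<eta>))"
          by (subst ennreal_mult'[symmetric]) (auto intro: ennreal_leI)
      qed
      finally show ?thesis .
    qed
    have "ennreal ?d * (\<integral>\<^sup>+x. ennreal ((cmod (comm_op \<beta> ?u x))\<^sup>2) \<partial>lborel) \<le> (\<integral>\<^sup>+\<xi>. ennreal ((cmod (fourier (comm_op \<beta> ?u) \<xi>))\<^sup>2) \<partial>lborel)"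
      by (rule plancherel_lower[OF cu])
    also have "\<dots> \<le> (\<integral>\<^sup>+\<xi>. (\<integral>\<^sup>+\<eta>. ennreal (?k (\<xi> - \<eta>) * (2 / ?d\<^sup>2 * ?m * ?G \<eta>)) \<partial>lborel)\<^sup>2 \<partial>lborel)"
    proof (intro nn_integral_mono)
      fix \<xi>
      from power_mono[OF pt[of \<xi>], of 2]
      show "ennreal ((cmod (fourier (comm_op \<beta> ?u) \<xi>))\<^sup>2) \<le> (\<integral>\<^sup>+\<eta>. ennreal (?k (\<xi> - \<eta>) * (2 / ?d\<^sup>2 * ?m * ?G \<eta>)) \<partial>lborel)\<^sup>2"
        by (simp add: ennreal_power)
    qed
    also have "\<dots> \<le> (\<integral>\<^sup>+h. ennreal (?k h) \<partial>lborel)\<^sup>2 * (\<integral>\<^sup>+\<eta>. ennreal ((2 / ?d\<^sup>2 * ?m * ?G \<eta>)\<^sup>2) \<partial>lborel)"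
      by (rule young_L2) (auto simp: majorant_nonneg)
    also have "(\<integral>\<^sup>+\<eta>. ennreal ((2 / ?d\<^sup>2 * ?m * ?G \<eta>)\<^sup>2) \<partial>lborel) = ennreal ((2 / ?d\<^sup>2 * ?m)\<^sup>2) * (\<integral>\<^sup>+\<eta>. ennreal ((?G \<eta>)\<^sup>2) \<partial>lborel)"
      unfolding power_mult_distrib[of "2 / ?d\<^sup>2 * ?m"] by (simp add: ennreal_mult' nn_integral_cmult)
    also have "(\<integral>\<^sup>+\<eta>. ennreal ((?G \<eta>)\<^sup>2) \<partial>lborel) \<le> ennreal ((\<integral>h. ?l h \<partial>lborel)\<^sup>2) * (ennreal ?d * ennreal ((L2norm e)\<^sup>2))"
    proof -
      have "(\<integral>\<^sup>+\<xi>. ennreal ((cmod (fourier e \<xi>))\<^sup>2) \<partial>lborel) \<le> ennreal ?d * ennreal ((L2norm e)\<^sup>2)"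
        using plancherel_upper[OF ei(1)] square_integrableD(2)[OF ei(2)] by simp
      from order_trans[OF majorant_L2[OF t ei(1)] mult_left_mono[OF this]] show ?thesis by simp
    qed
    finally have "ennreal ?d * (\<integral>\<^sup>+x. ennreal ((cmod (comm_op \<beta> ?u x))\<^sup>2) \<partial>lborel)
      \<le> (ennreal (\<integral>h. ?k h \<partial>lborel))\<^sup>2 * (ennreal ((2 / ?d\<^sup>2 * ?m)\<^sup>2) * (ennreal ((\<integral>h. ?l h \<partial>lborel)\<^sup>2) * (ennreal ?d * ennreal ((L2norm e)\<^sup>2))))"
      unfolding kk by (simp add: mult_left_mono)
    also have "\<dots> = ennreal ?d * ennreal ((C * ?m * L2norm e)\<^sup>2)"
      unfolding C_def using k0 d
      by (simp add: ennreal_power ennreal_mult'[symmetric] power_mult_distrib power_divide mult_ac)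
    finally show ?thesis using d by (subst (asm) ennreal_mult_le_mult_iff) auto
  qed
  show ?thesis by (rule that[OF C0 main])
qed

end

section \<open>Eigenfunctions paired with Lipschitz functions\<close>

context frac_kernel begin

text \<open>Plancherel turns \<open>\<mu> \<integral> e w\<close> into \<open>\<integral> |\<xi>|\<^sup>\<alpha> F e F w\<close>. Split \<open>|\<xi>|\<^sup>2\<^sup>\<alpha> \<le> s\<^sup>2\<^sup>\<alpha> + s\<^sup>2\<^sup>\<alpha>\<^sup>-\<^sup>2 |\<xi>|\<^sup>2\<close>: for \<open>w\<close> of height \<open>M\<close>
  and slope \<open>M s\<close> the height controls the first term, the slope the second, and both are of the same size.\<close>

lemma eigen_test_bound:
  assumes e: "weak_eigen \<Omega> \<mu> e" and t: "test_function \<Omega> w" and \<mu>: "\<mu> \<ge> 0"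
    and M: "\<And>x. cmod (w x) \<le> M" and s: "s > 0"
    and lip: "\<And>x y. cmod (w x - w y) \<le> (M * s) * norm (x - y)"
    and S: "closed S" "\<And>x. x \<notin> S \<Longrightarrow> w x = 0" "emeasure lborel S \<le> ennreal V" and V: "V \<ge> 0"
  shows "\<mu> * cmod (\<integral>x. e x * w x \<partial>lborel) \<le> L2norm e * (M * s powr \<alpha> * sqrt (V * (1 + DIM('a))))"
proof -
  note ei = weak_eigenD[OF e]
  have [measurable]: "e \<in> borel_measurable borel" "w \<in> borel_measurable borel" "S \<in> sets borel"
    using ei(3) test_function_measurable[OF t] S(1) by auto
  have wi: "integrable lborel w" by (rule test_function_integrable[OF t])
  have M0: "M \<ge> 0" using M[of 0] norm_ge_zero order_trans by blast
  let ?d = "(2 * pi) ^ DIM('a)"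
  have d: "?d > 0" by simp
  obtain D where D: "\<And>x. (w has_derivative D x) (at x)" "\<And>i. i \<in> Basis \<Longrightarrow> test_function \<Omega> (\<lambda>x. D x i)"
    using test_function_derivative[OF t] by blast
  have Di: "cmod (D x i) \<le> M * s" if "i \<in> Basis" for x i
    using lipschitz_derivative_bound[OF D(1) lip, of x i] that by simp
  have Dz: "D x i = 0" if "x \<notin> S" for x i
  proof -
    have "((\<lambda>_. 0) has_derivative D x) (at x)"
    proof (rule has_derivative_transform_within_open[OF D(1)])
      show "open (- S)" using S(1) by auto
      show "\<And>y. y \<in> - S \<Longrightarrow> w y = 0" using S(2) by blast
    qed (use that in auto)
    hence "D x = (\<lambda>h. 0)" using has_derivative_unique has_derivative_const by blast
    thus ?thesis by simp
  qed
  let ?n = "real DIM('a)"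
  have L2: "(\<integral>\<^sup>+x. ennreal ((cmod (f x))\<^sup>2) \<partial>lborel) \<le> ennreal (B\<^sup>2 * V)"
    if "\<And>x. cmod (f x) \<le> B" "\<And>x. x \<notin> S \<Longrightarrow> f x = 0" for f :: "'a \<Rightarrow> complex" and B
  proof -
    have "(\<integral>\<^sup>+x. ennreal ((cmod (f x))\<^sup>2) \<partial>lborel) \<le> (\<integral>\<^sup>+x. ennreal (B\<^sup>2) * indicator S x \<partial>lborel)"
    proof (intro nn_integral_mono)
      fix x
      have "(cmod (f x))\<^sup>2 \<le> B\<^sup>2" by (intro power_mono that) auto
      thus "ennreal ((cmod (f x))\<^sup>2) \<le> ennreal (B\<^sup>2) * indicator S x"
        using that(2)[of x] by (auto split: split_indicator intro: ennreal_leI)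
    qed
    also have "\<dots> = ennreal (B\<^sup>2) * emeasure lborel S" by (simp add: nn_integral_cmult)
    also have "\<dots> \<le> ennreal (B\<^sup>2) * ennreal V" by (intro mult_left_mono S(3)) simp
    finally show ?thesis using V by (simp add: ennreal_mult)
  qed
  have planch: "(\<integral>\<^sup>+\<xi>. ennreal ((cmod (fourier f \<xi>))\<^sup>2) \<partial>lborel) \<le> ennreal (?d * (B\<^sup>2 * V))"
    if "integrable lborel f" "\<And>x. cmod (f x) \<le> B" "\<And>x. x \<notin> S \<Longrightarrow> f x = 0" for f :: "'a \<Rightarrow> complex" and B
  proof -
    have "(\<integral>\<^sup>+\<xi>. ennreal ((cmod (fourier f \<xi>))\<^sup>2) \<partial>lborel) \<le> ennreal ?d * ennreal (B\<^sup>2 * V)"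
      using order_trans[OF plancherel_upper[OF that(1)] mult_left_mono[OF L2[OF that(2,3)]]] by simp
    thus ?thesis using d by (simp add: ennreal_mult')
  qed
  have split: "(r powr \<alpha>)\<^sup>2 \<le> (s powr \<alpha>)\<^sup>2 + (s powr \<alpha> / s)\<^sup>2 * r\<^sup>2" if "r \<ge> 0" for r :: real
  proof (cases "r \<le> s")
    case True
    have "(r powr \<alpha>)\<^sup>2 \<le> (s powr \<alpha>)\<^sup>2" using True that \<alpha>_range by (intro power_mono powr_mono2) auto
    thus ?thesis by (simp add: add_increasing2)
  next
    case False
    have "r powr \<alpha> = r powr (\<alpha> - 1) * r" using False s by (simp add: powr_diff)
    also have "\<dots> \<le> s powr (\<alpha> - 1) * r" using False s \<alpha>_range by (intro mult_right_mono powr_mono2') auto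
    also have "s powr (\<alpha> - 1) = s powr \<alpha> / s" using s by (simp add: powr_diff)
    finally have "(r powr \<alpha>)\<^sup>2 \<le> (s powr \<alpha> / s * r)\<^sup>2" by (intro power_mono) auto
    also have "\<dots> = (s powr \<alpha> / s)\<^sup>2 * r\<^sup>2" by (rule power_mult_distrib)
    finally show ?thesis using zero_le_power2[of "s powr \<alpha>"] by linarith
  qed
  have Fw: "(\<integral>\<^sup>+\<xi>. (ennreal (norm \<xi> powr \<alpha> * cmod (fourier w (- \<xi>))))\<^sup>2 \<partial>lborel) \<le> ennreal (?d * ((M * s powr \<alpha>)\<^sup>2 * (V * (1 + ?n))))"
  proof -
    have "(\<integral>\<^sup>+\<xi>. (ennreal (norm \<xi> powr \<alpha> * cmod (fourier w (- \<xi>))))\<^sup>2 \<partial>lborel)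
        = (\<integral>\<^sup>+\<xi>. ennreal ((norm \<xi> powr \<alpha> * cmod (fourier w \<xi>))\<^sup>2) \<partial>lborel)"
      using nn_integral_lborel_reflect[of "\<lambda>\<xi>. ennreal ((norm \<xi> powr \<alpha> * cmod (fourier w \<xi>))\<^sup>2)" 0]
      by (simp add: ennreal_power)
    also have "\<dots> \<le> (\<integral>\<^sup>+\<xi>. ennreal ((s powr \<alpha>)\<^sup>2) * ennreal ((cmod (fourier w \<xi>))\<^sup>2)
        + (\<Sum>i\<in>Basis. ennreal ((s powr \<alpha> / s)\<^sup>2) * ennreal ((cmod (fourier (\<lambda>x. D x i) \<xi>))\<^sup>2)) \<partial>lborel)"
    proof (intro nn_integral_mono)
      fix \<xi> :: 'a
      have "(norm \<xi>)\<^sup>2 = (\<Sum>i\<in>Basis. (i \<bullet> \<xi>)\<^sup>2)"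
        unfolding power2_norm_eq_inner by (subst euclidean_inner) (simp add: power2_eq_square inner_commute)
      hence "(norm \<xi>)\<^sup>2 * (cmod (fourier w \<xi>))\<^sup>2 = (\<Sum>i\<in>Basis. (cmod (fourier (\<lambda>x. D x i) \<xi>))\<^sup>2)"
        by (simp add: sum_distrib_right fourier_derivative[OF t D(1) D(2)] norm_mult power_mult_distrib)
      moreover have "(norm \<xi> powr \<alpha> * cmod (fourier w \<xi>))\<^sup>2 \<le> ((s powr \<alpha>)\<^sup>2 + (s powr \<alpha> / s)\<^sup>2 * (norm \<xi>)\<^sup>2) * (cmod (fourier w \<xi>))\<^sup>2"
        unfolding power_mult_distrib by (intro mult_right_mono split) auto
      ultimately have "(norm \<xi> powr \<alpha> * cmod (fourier w \<xi>))\<^sup>2 \<le> (s powr \<alpha>)\<^sup>2 * (cmod (fourier w \<xi>))\<^sup>2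
          + (\<Sum>i\<in>Basis. (s powr \<alpha> / s)\<^sup>2 * (cmod (fourier (\<lambda>x. D x i) \<xi>))\<^sup>2)"
        by (simp add: distrib_right mult.assoc sum_distrib_left[symmetric])
      from ennreal_leI[OF this]
      show "ennreal ((norm \<xi> powr \<alpha> * cmod (fourier w \<xi>))\<^sup>2) \<le> ennreal ((s powr \<alpha>)\<^sup>2) * ennreal ((cmod (fourier w \<xi>))\<^sup>2)
        + (\<Sum>i\<in>Basis. ennreal ((s powr \<alpha> / s)\<^sup>2) * ennreal ((cmod (fourier (\<lambda>x. D x i) \<xi>))\<^sup>2))"
        by (simp add: ennreal_mult sum_nonneg flip: sum_ennreal)
    qed
    also have "\<dots> = ennreal ((s powr \<alpha>)\<^sup>2) * (\<integral>\<^sup>+\<xi>. ennreal ((cmod (fourier w \<xi>))\<^sup>2) \<partial>lborel)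
        + (\<Sum>i\<in>Basis. ennreal ((s powr \<alpha> / s)\<^sup>2) * (\<integral>\<^sup>+\<xi>. ennreal ((cmod (fourier (\<lambda>x. D x i) \<xi>))\<^sup>2) \<partial>lborel))"
    proof -
      have m: "fourier (\<lambda>x. D x i) \<in> borel_measurable borel" if "i \<in> Basis" for i
        using test_function_measurable[OF D(2)[OF that]] by measurable
      have m2: "(\<lambda>\<xi>. ennreal ((cmod (fourier (\<lambda>x. D x i) \<xi>))\<^sup>2)) \<in> borel_measurable borel" if "i \<in> Basis" for i
        using m[OF that] by measurable
      have m3: "(\<lambda>\<xi>. ennreal ((s powr \<alpha> / s)\<^sup>2) * ennreal ((cmod (fourier (\<lambda>x. D x i) \<xi>))\<^sup>2)) \<in> borel_measurable lborel"
        if "i \<in> Basis" for i using m2[OF that] by measurable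
      have m4: "(\<lambda>\<xi>. ennreal ((cmod (fourier w \<xi>))\<^sup>2)) \<in> borel_measurable lborel" by measurable
      have m5: "(\<lambda>\<xi>. ennreal ((s powr \<alpha>)\<^sup>2) * ennreal ((cmod (fourier w \<xi>))\<^sup>2)) \<in> borel_measurable lborel" by measurable
      have c: "(\<integral>\<^sup>+\<xi>. ennreal ((s powr \<alpha> / s)\<^sup>2) * ennreal ((cmod (fourier (\<lambda>x. D x i) \<xi>))\<^sup>2) \<partial>lborel)
          = ennreal ((s powr \<alpha> / s)\<^sup>2) * (\<integral>\<^sup>+\<xi>. ennreal ((cmod (fourier (\<lambda>x. D x i) \<xi>))\<^sup>2) \<partial>lborel)" if "i \<in> Basis" for i
        by (rule nn_integral_cmult) (use m2[OF that] in simp)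
      show ?thesis
        by (subst nn_integral_add, rule m5, rule borel_measurable_sum[OF m3], assumption,
            subst nn_integral_cmult[OF m4], subst nn_integral_sum[OF m3], assumption,
            rule arg_cong2[where f="(+)"], rule refl, rule sum.cong, rule refl, rule c)
    qed
    also have "\<dots> \<le> ennreal ((s powr \<alpha>)\<^sup>2) * ennreal (?d * (M\<^sup>2 * V))
        + (\<Sum>i\<in>(Basis :: 'a set). ennreal ((s powr \<alpha> / s)\<^sup>2) * ennreal (?d * ((M * s)\<^sup>2 * V)))"
      by (intro add_mono mult_left_mono sum_mono planch wi M S(2) test_function_integrable[OF D(2)] Di Dz) auto
    also have "\<dots> = ennreal ((s powr \<alpha>)\<^sup>2 * (?d * (M\<^sup>2 * V)) + ?n * ((s powr \<alpha> / s)\<^sup>2 * (?d * ((M * s)\<^sup>2 * V))))"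
      using V d by (simp add: ennreal_mult'[symmetric] ennreal_of_nat_eq_real_of_nat)
    also have "(s powr \<alpha>)\<^sup>2 * (?d * (M\<^sup>2 * V)) + ?n * ((s powr \<alpha> / s)\<^sup>2 * (?d * ((M * s)\<^sup>2 * V))) = ?d * ((M * s powr \<alpha>)\<^sup>2 * (V * (1 + ?n)))"
      using s by (simp add: power_divide power_mult_distrib field_simps)
    finally show ?thesis .
  qed
  let ?X = "cmod (\<integral>x. e x * w x \<partial>lborel)"
  let ?I = "\<lambda>\<xi>. (norm \<xi> powr \<alpha>) *\<^sub>R fourier e \<xi> * fourier w (- \<xi>)"
  have "of_real \<mu> * (\<integral>x. e x * w x \<partial>lborel) = (\<integral>\<xi>. ?I \<xi> \<partial>lborel) / ?d"
    using frac_laplacian_pairing[OF \<alpha>_range t ei(1)] ei(4)[OF t] by simp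
  hence "cmod (of_real \<mu> * (\<integral>x. e x * w x \<partial>lborel)) = cmod (\<integral>\<xi>. ?I \<xi> \<partial>lborel) / ?d"
    by (simp add: norm_divide norm_mult norm_power)
  hence eq: "?d * (\<mu> * ?X) = cmod (\<integral>\<xi>. ?I \<xi> \<partial>lborel)" using \<mu> d by (simp add: norm_mult field_simps)
  have "ennreal (?d * (\<mu> * ?X)) \<le> (\<integral>\<^sup>+\<xi>. ennreal (cmod (?I \<xi>)) \<partial>lborel)"
    unfolding eq by (rule norm_integral_le_nn_integral)
  also have "\<dots> = (\<integral>\<^sup>+\<xi>. ennreal (cmod (fourier e \<xi>)) * ennreal (norm \<xi> powr \<alpha> * cmod (fourier w (- \<xi>))) \<partial>lborel)"
    by (intro nn_integral_cong) (simp add: norm_mult ennreal_mult[symmetric] mult_ac)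
  finally have "(ennreal (?d * (\<mu> * ?X)))\<^sup>2 \<le> (\<integral>\<^sup>+\<xi>. ennreal (cmod (fourier e \<xi>)) * ennreal (norm \<xi> powr \<alpha> * cmod (fourier w (- \<xi>))) \<partial>lborel)\<^sup>2"
    by (rule power_mono) simp
  also have "\<dots> \<le> (\<integral>\<^sup>+\<xi>. (ennreal (cmod (fourier e \<xi>)))\<^sup>2 \<partial>lborel) * (\<integral>\<^sup>+\<xi>. (ennreal (norm \<xi> powr \<alpha> * cmod (fourier w (- \<xi>))))\<^sup>2 \<partial>lborel)"
    by (rule Cauchy_Schwarz_nn_integral) measurable
  also have "\<dots> \<le> ennreal (?d * (L2norm e)\<^sup>2) * ennreal (?d * ((M * s powr \<alpha>)\<^sup>2 * (V * (1 + ?n))))"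
  proof (intro mult_mono Fw)
    show "(\<integral>\<^sup>+\<xi>. (ennreal (cmod (fourier e \<xi>)))\<^sup>2 \<partial>lborel) \<le> ennreal (?d * (L2norm e)\<^sup>2)"
      using plancherel_upper[OF ei(1)] square_integrableD(2)[OF ei(2)] d by (simp add: ennreal_power ennreal_mult')
  qed auto
  also have "\<dots> = ennreal ((?d * (L2norm e * (M * s powr \<alpha> * sqrt (V * (1 + ?n)))))\<^sup>2)"
  proof -
    have sq: "(c * (l * (p * sqrt q)))\<^sup>2 = (c * l\<^sup>2) * (c * (p\<^sup>2 * q))" if "q \<ge> 0" for c l p q :: real
      unfolding power_mult_distrib real_sqrt_pow2[OF that] by (simp add: power2_eq_square)
    have "0 \<le> V * (1 + ?n)" using V by simp
    from sq[OF this] show ?thesis by (subst ennreal_mult'[symmetric]) (simp_all only: zero_le_mult_iff zero_le_power2 less_imp_le[OF d] simp_thms)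
  qed
  finally have "(?d * (\<mu> * ?X))\<^sup>2 \<le> (?d * (L2norm e * (M * s powr \<alpha> * sqrt (V * (1 + ?n)))))\<^sup>2"
    using \<mu> d by (simp add: ennreal_power)
  hence "?d * (\<mu> * ?X) \<le> ?d * (L2norm e * (M * s powr \<alpha> * sqrt (V * (1 + ?n))))"
    by (rule power2_le_imp_le) (simp add: V M0 L2norm_nonneg)
  thus ?thesis using d by simp
qed

lemma L2_pairing_bound:
  assumes e: "square_integrable e" and w: "w \<in> borel_measurable borel" and M: "\<And>x. cmod (w x) \<le> M"
    and S: "S \<in> sets borel" "\<And>x. x \<notin> S \<Longrightarrow> w x = 0" "emeasure lborel S \<le> ennreal V" and V: "V \<ge> 0"
  shows "cmod (\<integral>x. e x * w x \<partial>lborel) \<le> L2norm e * (M * sqrt V)"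
proof -
  note [measurable] = square_integrableD(1)[OF e] w S(1)
  have M0: "M \<ge> 0" using M[of undefined] norm_ge_zero order_trans by blast
  let ?X = "cmod (\<integral>x. e x * w x \<partial>lborel)"
  have "ennreal ?X \<le> (\<integral>\<^sup>+x. ennreal (cmod (e x * w x)) \<partial>lborel)"
    by (rule norm_integral_le_nn_integral)
  also have "\<dots> = (\<integral>\<^sup>+x. ennreal (cmod (e x)) * ennreal (cmod (w x)) \<partial>lborel)"
    by (intro nn_integral_cong) (simp add: norm_mult ennreal_mult)
  finally have "(ennreal ?X)\<^sup>2 \<le> (\<integral>\<^sup>+x. ennreal (cmod (e x)) * ennreal (cmod (w x)) \<partial>lborel)\<^sup>2"
    by (rule power_mono) simp
  also have "\<dots> \<le> (\<integral>\<^sup>+x. (ennreal (cmod (e x)))\<^sup>2 \<partial>lborel) * (\<integral>\<^sup>+x. (ennreal (cmod (w x)))\<^sup>2 \<partial>lborel)"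
    by (rule Cauchy_Schwarz_nn_integral) measurable
  also have "\<dots> \<le> ennreal ((L2norm e)\<^sup>2) * ennreal (M\<^sup>2 * V)"
  proof (intro mult_mono)
    have "(\<integral>\<^sup>+x. (ennreal (cmod (w x)))\<^sup>2 \<partial>lborel) \<le> (\<integral>\<^sup>+x. ennreal (M\<^sup>2) * indicator S x \<partial>lborel)"
    proof (intro nn_integral_mono)
      fix x
      have "(cmod (w x))\<^sup>2 \<le> M\<^sup>2" by (intro power_mono M) auto
      thus "(ennreal (cmod (w x)))\<^sup>2 \<le> ennreal (M\<^sup>2) * indicator S x"
        using S(2)[of x] by (auto split: split_indicator intro: ennreal_leI simp: ennreal_power)
    qed
    also have "\<dots> = ennreal (M\<^sup>2) * emeasure lborel S" by (simp add: nn_integral_cmult)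
    also have "\<dots> \<le> ennreal (M\<^sup>2) * ennreal V" by (intro mult_left_mono S(3)) simp
    finally show "(\<integral>\<^sup>+x. (ennreal (cmod (w x)))\<^sup>2 \<partial>lborel) \<le> ennreal (M\<^sup>2 * V)" using V by (simp add: ennreal_mult)
  qed (use square_integrableD(2)[OF e] in \<open>simp_all add: ennreal_power\<close>)
  also have "\<dots> = ennreal ((L2norm e * (M * sqrt V))\<^sup>2)"
    using V by (simp add: ennreal_mult'[symmetric] power_mult_distrib)
  finally have "?X\<^sup>2 \<le> (L2norm e * (M * sqrt V))\<^sup>2" by (simp add: ennreal_power)
  thus ?thesis by (rule power2_le_imp_le) (simp add: V M0 L2norm_nonneg)
qed

text \<open>Mollification preserves height and slope and, at scales below \<open>r\<close>, keeps the support in \<open>S\<close>.\<close>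

lemma eigen_lipschitz_bound:
  assumes e: "weak_eigen \<Omega> \<mu> e" and \<mu>: "\<mu> \<ge> 0"
    and w: "w \<in> borel_measurable borel" and M: "\<And>x. cmod (w x) \<le> M" and s: "s > 0"
    and lip: "\<And>x y. cmod (w x - w y) \<le> (M * s) * norm (x - y)"
    and T: "compact T" "\<And>x. x \<notin> T \<Longrightarrow> w x = 0"
    and S: "closed S" "S \<subseteq> \<Omega>" "emeasure lborel S \<le> ennreal V" and V: "V \<ge> 0"
    and r: "r > 0" "\<And>x y. x \<in> T \<Longrightarrow> dist x y \<le> r \<Longrightarrow> y \<in> S"
  shows "\<mu> * cmod (\<integral>x. e x * w x \<partial>lborel) \<le> L2norm e * (M * s powr \<alpha> * sqrt (V * (1 + DIM('a))))"
proof -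
  note ei = weak_eigenD[OF e]
  have [measurable]: "e \<in> borel_measurable borel" "w \<in> borel_measurable borel" using ei(3) w by auto
  have M0: "M \<ge> 0" using M[of 0] norm_ge_zero order_trans by blast
  have Ms: "M * s \<ge> 0" using M0 s by simp
  have wc: "continuous_on UNIV w"
    by (rule lipschitz_on_continuous_on[where L="M * s"]) (use lip Ms in \<open>auto simp: lipschitz_on_def dist_norm\<close>)
  have wi: "integrable lborel w" by (rule compact_support_integrable[OF wc T])
  let ?\<epsilon> = "\<lambda>n::nat. r / Suc n" and ?R = "L2norm e * (M * s powr \<alpha> * sqrt (V * (1 + DIM('a))))"
  let ?w = "\<lambda>n. mollify (?\<epsilon> n) w"
  have \<epsilon>: "?\<epsilon> n > 0" "?\<epsilon> n \<le> r" for n using r(1) by (auto simp: divide_le_eq mult_le_cancel_left1)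
  have in_S: "y \<in> S" if "x \<in> T" "dist x y \<le> ?\<epsilon> n" for x y n
    using r(2)[OF that(1)] that(2) \<epsilon>(2)[of n] by (meson order_trans)
  have tS: "test_function S (?w n)" for n
    by (rule test_function_mollify[OF \<epsilon>(1) wi T in_S])
  have bound: "\<mu> * cmod (\<integral>x. e x * ?w n x \<partial>lborel) \<le> ?R" for n
  proof (rule eigen_test_bound[OF e test_function_mono[OF tS S(2)] \<mu> _ s _ S(1) _ S(3) V])
    show "cmod (?w n x) \<le> M" for x by (rule mollify_bound[OF \<epsilon>(1) w M lip Ms])
    show "cmod (?w n x - ?w n y) \<le> (M * s) * norm (x - y)" for x y by (rule mollify_lip[OF \<epsilon>(1) w M lip Ms])
    show "?w n x = 0" if "x \<notin> S" for x
      by (rule test_functionE[OF tS[of n]]) (use that in auto)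
  qed
  have "(\<lambda>n. \<integral>x. e x * ?w n x \<partial>lborel) \<longlonglongrightarrow> (\<integral>x. e x * w x \<partial>lborel)"
  proof (rule integral_dominated_convergence[where w="\<lambda>x. M * cmod (e x)"])
    have [measurable]: "?w n \<in> borel_measurable borel" for n by (rule test_function_measurable[OF tS])
    show "(\<lambda>x. e x * ?w n x) \<in> borel_measurable lborel" for n by measurable
    show "(\<lambda>x. e x * w x) \<in> borel_measurable lborel" by measurable
    show "integrable lborel (\<lambda>x. M * cmod (e x))" using ei(1) by simp
    show "AE x in lborel. norm (e x * ?w n x) \<le> M * cmod (e x)" for n
      using mollify_bound[OF \<epsilon>(1) w M lip Ms]
      by (intro AE_I2) (simp add: norm_mult mult.commute[of M] mult_left_mono)
    show "AE x in lborel. (\<lambda>n. e x * ?w n x) \<longlonglongrightarrow> e x * w x"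
    proof (intro AE_I2 tendsto_mult tendsto_const)
      fix x
      have "(\<lambda>n. M * s * ?\<epsilon> n) \<longlonglongrightarrow> 0"
        using tendsto_mult_right_zero[OF LIMSEQ_Suc[OF lim_1_over_n], of "M * s * r"] by simp
      hence "(\<lambda>n. ?w n x - w x) \<longlonglongrightarrow> 0"
        by (rule Lim_null_comparison[rotated]) (use mollify_close[OF \<epsilon>(1) w M lip Ms] in auto)
      thus "(\<lambda>n. ?w n x) \<longlonglongrightarrow> w x" by (rule LIM_zero_cancel)
    qed
  qed
  hence "(\<lambda>n. \<mu> * cmod (\<integral>x. e x * ?w n x \<partial>lborel)) \<longlonglongrightarrow> \<mu> * cmod (\<integral>x. e x * w x \<partial>lborel)"
    by (intro tendsto_intros)
  thus ?thesis by (rule LIMSEQ_le_const2) (use bound in auto)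
qed

end

section \<open>The boundary layer of a domain\<close>

lemma emeasure_lborel_translate:
  fixes S :: "'a::euclidean_space set"
  assumes [measurable]: "S \<in> sets borel"
  shows "emeasure lborel {x. x - a \<in> S} = emeasure lborel S"
proof -
  have "emeasure lborel {x. x - a \<in> S} = (\<integral>\<^sup>+x. indicator S (- a + x) \<partial>lborel)"
  proof -
    have "emeasure lborel {x. x - a \<in> S} = (\<integral>\<^sup>+x. indicator {x. x - a \<in> S} x \<partial>lborel)"
      by (rule nn_integral_indicator[symmetric]) measurable
    also have "\<dots> = (\<integral>\<^sup>+x. indicator S (- a + x) \<partial>lborel)"
      by (intro nn_integral_cong) (auto split: split_indicator)
    finally show ?thesis .
  qed
  also have "\<dots> = emeasure lborel S" by (subst nn_integral_lborel_translate) simp_all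
  finally show ?thesis .
qed

text \<open>A set on which a function lies in \<open>(0, h]\<close> is thin if the function grows with unit speed along
  some direction: about \<open>1 / h\<close> of its translates are disjoint.\<close>

lemma thin_set_measure:
  fixes S B :: "'a::euclidean_space set" and f :: "'a \<Rightarrow> real"
  assumes [measurable]: "S \<in> sets borel" "B \<in> sets borel"
    and f: "\<And>x s. f (x + s *\<^sub>R \<nu>) = f x + s" and h: "\<And>x. x \<in> S \<Longrightarrow> 0 < f x \<and> f x \<le> h"
    and B: "\<And>x s. x \<in> S \<Longrightarrow> 0 \<le> s \<Longrightarrow> s \<le> r \<Longrightarrow> x + s *\<^sub>R \<nu> \<in> B" and SB: "emeasure lborel B \<le> ennreal W"
    and pos: "h > 0" "r > 0" "W \<ge> 0"
  shows "emeasure lborel S \<le> ennreal (2 * W / r * h)"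
proof (cases "h \<le> r")
  case False
  have "S \<subseteq> B" using B[of _ 0] pos by auto
  hence "emeasure lborel S \<le> ennreal W" using emeasure_mono[of S B lborel] SB by (auto intro: order_trans)
  also have "W \<le> 2 * W / r * h"
  proof -
    have "1 * W \<le> (2 * h / r) * W" using False pos by (intro mult_right_mono) (auto simp: field_simps)
    thus ?thesis by (simp add: mult_ac)
  qed
  finally show ?thesis using ennreal_leI order_trans by blast
next
  case True
  \<comment> \<open>the number of disjoint translates of \<open>S\<close> by multiples of \<open>h \<nu>\<close> that fit into \<open>B\<close>\<close>
  define N where "N = nat \<lfloor>r / h\<rfloor>"
  have N1: "real N \<le> r / h" "r / h < real N + 1" using pos unfolding N_def by (auto simp: of_nat_nat)
  have "1 \<le> r / h" using True pos by simp
  hence N0: "N > 0" using N1 by (cases N) auto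
  define T where "T j = {x. x - (real j * h) *\<^sub>R \<nu> \<in> S}" for j :: nat
  have [measurable]: "T j \<in> sets borel" for j unfolding T_def by measurable
  have fT: "real j * h < f x \<and> f x \<le> (real j + 1) * h" if "x \<in> T j" for x j
    using h[of "x - (real j * h) *\<^sub>R \<nu>"] that f[of x "- (real j * h)"] by (simp add: T_def algebra_simps)
  have "disjoint_family_on T {..<N}"
    unfolding disjoint_family_on_def
  proof (intro ballI impI)
    fix i j :: nat assume "i \<noteq> j"
    have False if "x \<in> T i" "x \<in> T j" for x
    proof -
      have "real i * h < (real j + 1) * h" "real j * h < (real i + 1) * h" using fT[OF that(1)] fT[OF that(2)] by linarith+
      hence "i = j" using pos by simp
      thus False using \<open>i \<noteq> j\<close> by simp
    qed
    thus "T i \<inter> T j = {}" by blast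
  qed
  hence "(\<Sum>j<N. emeasure lborel (T j)) = emeasure lborel (\<Union>j<N. T j)"
    by (intro sum_emeasure) auto
  also have "\<dots> \<le> emeasure lborel B"
  proof (intro emeasure_mono UN_least)
    fix j assume "j \<in> {..<N}"
    hence "real j * h \<le> real N * h" using pos by (intro mult_right_mono) auto
    also have "\<dots> \<le> r" using N1(1) pos by (simp add: field_simps)
    finally have "real j * h \<le> r" .
    thus "T j \<subseteq> B" using B[of "_ - (real j * h) *\<^sub>R \<nu>" "real j * h"] pos by (auto simp: T_def)
  qed simp
  finally have "of_nat N * emeasure lborel S \<le> ennreal W"
    using SB by (simp add: T_def emeasure_lborel_translate)
  moreover have "ennreal (1 / real N) * of_nat N = 1"
    using N0 by (simp add: ennreal_of_nat_eq_real_of_nat flip: ennreal_mult')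
  ultimately have "emeasure lborel S \<le> ennreal (1 / real N) * ennreal W"
    by (metis mult.assoc mult.left_neutral mult_left_mono zero_le)
  also have "\<dots> = ennreal (W / real N)" using pos by (simp flip: ennreal_mult')
  also have "W / real N \<le> 2 * W / r * h"
  proof -
    have "r / h \<le> 2 * real N" using N1 N0 by linarith
    hence "1 / real N \<le> 2 * h / r" using pos N0 by (simp add: field_simps)
    hence "(1 / real N) * W \<le> (2 * h / r) * W" using pos by (intro mult_right_mono) auto
    thus ?thesis by (simp add: mult_ac)
  qed
  finally show ?thesis using ennreal_leI order_trans by blast
qed

text \<open>Take \<open>f x = x \<bullet> \<nu> - \<gamma> (x')\<close> with \<open>x'\<close> the projection of \<open>x\<close> along \<open>\<nu>\<close>. It has unit speed along \<open>\<nu>\<close>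
  because moving along \<open>\<nu>\<close> does not change \<open>x'\<close>, and it is Lipschitz on the ball because the gradient of
  \<open>\<gamma>\<close>, being Lipschitz, is bounded there.\<close>

lemma C11_chart:
  fixes \<Omega> :: "'a::euclidean_space set"
  assumes C: "C11_domain \<Omega>" and p: "p \<in> frontier \<Omega>"
  obtains r \<nu> f L where "r > 0" "norm \<nu> = 1" "continuous_on UNIV f" "L \<ge> 0"
    "\<And>x. x \<in> ball p r \<Longrightarrow> x \<in> \<Omega> \<longleftrightarrow> f x > 0" "\<And>x s. f (x + s *\<^sub>R \<nu>) = f x + s"
    "\<And>x y. x \<in> ball p r \<Longrightarrow> y \<in> ball p r \<Longrightarrow> f x - f y \<le> L * dist x y"
proof -
  obtain r \<nu> \<gamma> where r: "r > 0" "norm \<nu> = 1" "C11_function \<gamma>"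
    "\<Omega> \<inter> ball p r = {x \<in> ball p r. x \<bullet> \<nu> > \<gamma> (x - (x \<bullet> \<nu>) *\<^sub>R \<nu>)}"
    using C p unfolding C11_domain_def by meson
  obtain G L where G: "\<And>x. (\<gamma> has_derivative (\<lambda>h. G x \<bullet> h)) (at x)" "L-lipschitz_on UNIV G"
    using r(3) unfolding C11_function_def by blast
  define q where "q x = x - (x \<bullet> \<nu>) *\<^sub>R \<nu>" for x :: 'a
  define f where "f x = x \<bullet> \<nu> - \<gamma> (q x)" for x
  have \<nu>\<nu>: "\<nu> \<bullet> \<nu> = 1" using r(2) by (simp add: dot_square_norm)
  have qd: "norm (q x - q y) \<le> 2 * norm (x - y)" for x y
  proof -
    have "q x - q y = (x - y) - ((x - y) \<bullet> \<nu>) *\<^sub>R \<nu>" by (simp add: q_def inner_diff_left algebra_simps)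
    moreover have "norm (((x - y) \<bullet> \<nu>) *\<^sub>R \<nu>) \<le> norm (x - y)" using Cauchy_Schwarz_ineq2[of "x - y" \<nu>] r(2) by simp
    ultimately show ?thesis using norm_triangle_ineq4[of "x - y" "((x - y) \<bullet> \<nu>) *\<^sub>R \<nu>"] by simp
  qed
  define B where "B = norm (G (q p)) + L * (2 * r)"
  have L0: "L \<ge> 0" using G(2) by (rule lipschitz_on_nonneg)
  have B0: "B \<ge> 0" unfolding B_def using L0 r(1) by simp
  have \<gamma>L: "norm (\<gamma> (q x) - \<gamma> (q y)) \<le> B * norm (q x - q y)" if "x \<in> ball p r" "y \<in> ball p r" for x y
  proof (rule differentiable_bound[of "cball (q p) (2 * r)" \<gamma> "\<lambda>x h. G x \<bullet> h"])
    show "convex (cball (q p) (2 * r))" by simp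
    show "(\<gamma> has_derivative (\<lambda>h. G z \<bullet> h)) (at z within cball (q p) (2 * r))" for z
      using G(1) has_derivative_at_withinI by blast
    show "onorm (\<lambda>h. G z \<bullet> h) \<le> B" if z: "z \<in> cball (q p) (2 * r)" for z
    proof (rule onorm_le)
      fix h
      have "dist (G (q p)) (G z) \<le> L * dist (q p) z" using G(2) by (rule lipschitz_onD) auto
      also have "\<dots> \<le> L * (2 * r)" using z L0 by (intro mult_left_mono) auto
      finally have "norm (G z) \<le> B" unfolding B_def using norm_triangle_ineq4[of "G (q p)" "G (q p) - G z"] by (simp add: dist_norm)
      thus "norm (G z \<bullet> h) \<le> B * norm h"
        using Cauchy_Schwarz_ineq2[of "G z" h] mult_right_mono[of "norm (G z)" B "norm h"] by simp
    qed
    show "q x \<in> cball (q p) (2 * r)" "q y \<in> cball (q p) (2 * r)"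
      using qd[of p x] qd[of p y] that by (auto simp: dist_norm)
  qed
  have \<gamma>c: "continuous_on UNIV \<gamma>"
    using G(1) by (auto intro!: continuous_at_imp_continuous_on has_derivative_continuous)
  have qc: "continuous_on UNIV q" unfolding q_def by (intro continuous_intros)
  show ?thesis
  proof (rule that[OF r(1,2), of f "1 + B * 2"])
    show "continuous_on UNIV f" unfolding f_def
      by (intro continuous_intros continuous_on_compose2[OF \<gamma>c qc]) auto
    show "x \<in> \<Omega> \<longleftrightarrow> f x > 0" if "x \<in> ball p r" for x
      using r(4) that unfolding f_def q_def by (auto simp: set_eq_iff)
    show "f (x + s *\<^sub>R \<nu>) = f x + s" for x s
    proof -
      have "q (x + s *\<^sub>R \<nu>) = q x" unfolding q_def by (simp add: inner_add_left \<nu>\<nu> algebra_simps)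
      thus ?thesis by (simp add: f_def inner_add_left \<nu>\<nu>)
    qed
    fix x y assume xy: "x \<in> ball p r" "y \<in> ball p r"
    have "(x - y) \<bullet> \<nu> \<le> norm (x - y)" using norm_cauchy_schwarz[of "x - y" \<nu>] r(2) by simp
    moreover have "\<gamma> (q y) - \<gamma> (q x) \<le> B * (2 * norm (x - y))"
      using order_trans[OF \<gamma>L[OF xy] mult_left_mono[OF qd[of x y] B0]] by (simp add: abs_le_iff)
    ultimately show "f x - f y \<le> (1 + B * 2) * dist x y"
      by (simp add: f_def dist_norm inner_diff_left algebra_simps)
  qed (use B0 in simp)
qed

text \<open>A point of \<open>\<Omega>\<close> within distance \<open>t\<close> of the complement has chart height at most a multiple of \<open>t\<close>, since
  the chart function is Lipschitz and nonpositive off \<open>\<Omega>\<close>; such points form a thin set. For large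
  \<open>t\<close> the measure of the ball suffices, and for interior \<open>p\<close> and small \<open>t\<close> the set is empty.\<close>

lemma boundary_layer_local:
  fixes \<Omega> :: "'a::euclidean_space set"
  assumes C: "C11_domain \<Omega>" and bd: "bounded \<Omega>" and p: "p \<in> closure \<Omega>"
  shows "\<exists>r c. r > 0 \<and> c \<ge> 0 \<and> (\<forall>t>0. emeasure lborel {x \<in> \<Omega> \<inter> ball p r. infdist x (- \<Omega>) \<le> t} \<le> ennreal (c * t))"
proof -
  have op: "open \<Omega>" using C by (simp add: C11_domain_def)
  have [measurable]: "\<Omega> \<in> sets borel" using op by simp
  have ne: "- \<Omega> \<noteq> {}" using bd not_bounded_UNIV by (metis Compl_empty_eq double_complement)
  have cl: "closed (- \<Omega>)" using op by (simp add: closed_Compl)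
  have fin: "emeasure lborel (ball p s) \<le> ennreal (measure lborel (ball p s))" for s
    using emeasure_lborel_ball_finite[of p s] by (simp add: emeasure_eq_ennreal_measure)
  have [measurable]: "(\<lambda>x. infdist x (- \<Omega>)) \<in> borel_measurable borel"
    by (intro borel_measurable_continuous_onI continuous_intros)
  show ?thesis
  proof (cases "p \<in> \<Omega>")
    case True
    obtain R where R: "R > 0" "ball p R \<subseteq> \<Omega>" using op True openE by blast
    let ?r = "R / 2" and ?W = "measure lborel (ball p (R / 2))"
    have "emeasure lborel {x \<in> \<Omega> \<inter> ball p ?r. infdist x (- \<Omega>) \<le> t} \<le> ennreal (?W / ?r * t)" if t: "t > 0" for t
    proof (cases "t < ?r")
      case True
      have "{x \<in> \<Omega> \<inter> ball p ?r. infdist x (- \<Omega>) \<le> t} = {}"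
      proof (rule ccontr)
        assume "\<not> ?thesis"
        then obtain x where x: "x \<in> ball p ?r" "infdist x (- \<Omega>) \<le> t" by blast
        obtain y where y: "y \<in> - \<Omega>" "infdist x (- \<Omega>) = dist x y" using infdist_attains_inf[OF cl ne] by blast
        have "dist p y < R" using dist_triangle[of p y x] x y True by simp
        thus False using y R by auto
      qed
      thus ?thesis by (simp only: emeasure_empty zero_le)
    next
      case False
      have "emeasure lborel {x \<in> \<Omega> \<inter> ball p ?r. infdist x (- \<Omega>) \<le> t} \<le> emeasure lborel (ball p ?r)"
        by (intro emeasure_mono) auto
      also have "\<dots> \<le> ennreal ?W" by (rule fin)
      also have "\<dots> \<le> ennreal (?W / ?r * t)"
      proof (rule ennreal_leI)
        have "?W * 1 \<le> ?W * (t / ?r)" using False R by (intro mult_left_mono) auto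
        thus "?W \<le> ?W / ?r * t" by (simp add: mult_ac)
      qed
      finally show ?thesis .
    qed
    thus ?thesis using R by (intro exI[of _ ?r] exI[of _ "?W / ?r"]) auto
  next
    case False
    hence "p \<in> frontier \<Omega>" using p op by (simp add: frontier_def interior_open)
    from C11_chart[OF C this]
    obtain R \<nu> f L where R: "R > 0" "norm \<nu> = 1" "continuous_on UNIV f" "L \<ge> 0"
      "\<And>x. x \<in> ball p R \<Longrightarrow> x \<in> \<Omega> \<longleftrightarrow> f x > 0" "\<And>x s. f (x + s *\<^sub>R \<nu>) = f x + s"
      "\<And>x y. x \<in> ball p R \<Longrightarrow> y \<in> ball p R \<Longrightarrow> f x - f y \<le> L * dist x y" by metis
    have [measurable]: "f \<in> borel_measurable borel" using R(3) by (rule borel_measurable_continuous_onI)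
    let ?r = "R / 4" and ?W = "measure lborel (ball p R)"
    have W: "?W \<ge> 0" by simp
    have "emeasure lborel {x \<in> \<Omega> \<inter> ball p ?r. infdist x (- \<Omega>) \<le> t} \<le> ennreal ((2 * ?W / ?r * (L + 1)) * t)" if t: "t > 0" for t
    proof (cases "t \<le> ?r")
      case True
      let ?S = "{x \<in> \<Omega> \<inter> ball p ?r. infdist x (- \<Omega>) \<le> t}"
      have "emeasure lborel ?S \<le> ennreal (2 * ?W / ?r * ((L + 1) * t))"
      proof (rule thin_set_measure[where f=f and \<nu>=\<nu> and B="ball p R", OF _ _ R(6)])
        fix x assume x: "x \<in> ?S"
        hence xR: "x \<in> ball p R" using R(1) by auto
        obtain y where y: "y \<in> - \<Omega>" "infdist x (- \<Omega>) = dist x y" using infdist_attains_inf[OF cl ne] by blast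
        have d: "dist x y \<le> t" using x y by simp
        have "dist p y \<le> dist p x + dist x y" by (rule dist_triangle)
        hence yR: "y \<in> ball p R" using x d True R(1) by auto
        have "f y \<le> 0" using R(5)[OF yR] y(1) by auto
        moreover have "f x - f y \<le> L * t" using R(7)[OF xR yR] mult_left_mono[OF d R(4)] by linarith
        ultimately have "f x \<le> (L + 1) * t" using t by (simp add: ring_distribs)
        thus "0 < f x \<and> f x \<le> (L + 1) * t" using R(5)[OF xR] x by auto
        fix s :: real assume "0 \<le> s" "s \<le> ?r"
        hence "norm (s *\<^sub>R \<nu>) \<le> ?r" using R(2) by simp
        moreover have "dist p (x + s *\<^sub>R \<nu>) \<le> dist p x + norm (s *\<^sub>R \<nu>)"
          using norm_triangle_ineq4[of "p - x" "s *\<^sub>R \<nu>"] by (simp add: dist_norm algebra_simps)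
        ultimately show "x + s *\<^sub>R \<nu> \<in> ball p R" using x R(1) by auto
      qed (use R t fin in auto)
      thus ?thesis by (simp add: mult_ac)
    next
      case False
      have "emeasure lborel {x \<in> \<Omega> \<inter> ball p ?r. infdist x (- \<Omega>) \<le> t} \<le> emeasure lborel (ball p R)"
        using R(1) by (intro emeasure_mono) auto
      also have "\<dots> \<le> ennreal ?W" by (rule fin)
      also have "\<dots> \<le> ennreal ((2 * ?W / ?r * (L + 1)) * t)"
      proof (rule ennreal_leI)
        have "1 \<le> t / ?r" using False R(1) by simp
        also have "t / ?r \<le> (2 * (L + 1)) * (t / ?r)"
          using mult_right_mono[of 1 "2 * (L + 1)" "t / ?r"] R t by simp
        finally have "?W * 1 \<le> ?W * ((2 * (L + 1)) * (t / ?r))" by (intro mult_left_mono) auto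
        moreover have "?W * ((2 * (L + 1)) * (t / ?r)) = (2 * ?W / ?r * (L + 1)) * t" using R(1) by (simp add: field_simps)
        ultimately show "?W \<le> (2 * ?W / ?r * (L + 1)) * t" by (simp only: mult_1_right)
      qed
      finally show ?thesis .
    qed
    thus ?thesis using R by (intro exI[of _ ?r] exI[of _ "2 * ?W / ?r * (L + 1)"]) auto
  qed
qed

lemma boundary_layer_measure:
  fixes \<Omega> :: "'a::euclidean_space set"
  assumes C: "C11_domain \<Omega>" and bd: "bounded \<Omega>"
  obtains c where "c \<ge> 0" "\<And>t. t > 0 \<Longrightarrow> emeasure lborel {x \<in> \<Omega>. infdist x (- \<Omega>) \<le> t} \<le> ennreal (c * t)"
proof -
  have [measurable]: "\<Omega> \<in> sets borel" using C by (simp add: C11_domain_def)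
  have [measurable]: "(\<lambda>x. infdist x (- \<Omega>)) \<in> borel_measurable borel"
    by (intro borel_measurable_continuous_onI continuous_intros)
  let ?P = "\<lambda>p r c. r > 0 \<and> c \<ge> 0 \<and> (\<forall>t>0. emeasure lborel {x \<in> \<Omega> \<inter> ball p r. infdist x (- \<Omega>) \<le> t} \<le> ennreal (c * t))"
  have "\<forall>p\<in>closure \<Omega>. \<exists>q. ?P p (fst q) (snd q)"
    using boundary_layer_local[OF C bd] by simp
  then obtain q where "\<forall>p\<in>closure \<Omega>. ?P p (fst (q p)) (snd (q p))" unfolding bchoice_iff ..
  then obtain r c where rc: "\<And>p. p \<in> closure \<Omega> \<Longrightarrow> r p > 0" "\<And>p. p \<in> closure \<Omega> \<Longrightarrow> c p \<ge> 0"
     "\<And>p t. p \<in> closure \<Omega> \<Longrightarrow> t > 0 \<Longrightarrow> emeasure lborel {x \<in> \<Omega> \<inter> ball p (r p). infdist x (- \<Omega>) \<le> t} \<le> ennreal (c p * t)"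
    by (intro that[of "\<lambda>p. fst (q p)" "\<lambda>p. snd (q p)"]) blast+
  have cpt: "compact (closure \<Omega>)" using bd by (simp add: compact_closure)
  have cov: "closure \<Omega> \<subseteq> (\<Union>p\<in>closure \<Omega>. ball p (r p))" using rc(1) by force
  obtain F where F: "F \<subseteq> closure \<Omega>" "finite F" "closure \<Omega> \<subseteq> (\<Union>p\<in>F. ball p (r p))"
    by (rule compactE_image[OF cpt open_ball cov])
  show ?thesis
  proof (rule that[of "sum c F"])
    show "sum c F \<ge> 0" using rc(2) F(1) by (intro sum_nonneg) auto
    fix t :: real assume t: "t > 0"
    have "{x \<in> \<Omega>. infdist x (- \<Omega>) \<le> t} \<subseteq> (\<Union>p\<in>F. {x \<in> \<Omega> \<inter> ball p (r p). infdist x (- \<Omega>) \<le> t})"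
      using F(3) closure_subset by blast
    hence "emeasure lborel {x \<in> \<Omega>. infdist x (- \<Omega>) \<le> t} \<le> emeasure lborel (\<Union>p\<in>F. {x \<in> \<Omega> \<inter> ball p (r p). infdist x (- \<Omega>) \<le> t})"
      using F(2) by (intro emeasure_mono) auto
    also have "\<dots> \<le> (\<Sum>p\<in>F. emeasure lborel {x \<in> \<Omega> \<inter> ball p (r p). infdist x (- \<Omega>) \<le> t})"
      using F(2) by (intro emeasure_subadditive_finite) auto
    also have "\<dots> \<le> (\<Sum>p\<in>F. ennreal (c p * t))" using rc(3) t F(1) by (intro sum_mono) auto
    also have "\<dots> = ennreal (sum c F * t)"
      using rc(2) F(1) t by (subst sum_ennreal) (auto simp: sum_distrib_right)
    finally show "emeasure lborel {x \<in> \<Omega>. infdist x (- \<Omega>) \<le> t} \<le> ennreal (sum c F * t)" .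
  qed
qed

text \<open>The chart function is nonnegative on the closure of the domain and grows along \<open>\<nu>\<close>.\<close>

lemma inward_translation:
  fixes \<Omega> :: "'a::euclidean_space set"
  assumes C: "C11_domain \<Omega>" and p: "p \<in> closure \<Omega>"
  shows "\<exists>r \<nu>. r > 0 \<and> (\<forall>t x. 0 < t \<longrightarrow> t < r \<longrightarrow> x \<in> closure \<Omega> \<inter> ball p r \<longrightarrow> x + t *\<^sub>R \<nu> \<in> \<Omega>)"
proof -
  have op: "open \<Omega>" using C by (simp add: C11_domain_def)
  show ?thesis
  proof (cases "p \<in> \<Omega>")
    case True
    obtain R where "R > 0" "ball p R \<subseteq> \<Omega>" using op True openE by blast
    thus ?thesis by (intro exI[of _ R] exI[of _ 0]) auto
  next
    case False
    hence "p \<in> frontier \<Omega>" using p op by (simp add: frontier_def interior_open)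
    from C11_chart[OF C this]
    obtain R \<nu> f L where R: "R > 0" "norm \<nu> = 1" "continuous_on UNIV f"
      "\<And>x. x \<in> ball p R \<Longrightarrow> x \<in> \<Omega> \<longleftrightarrow> f x > 0" "\<And>x s. f (x + s *\<^sub>R \<nu>) = f x + s" by metis
    have "x + t *\<^sub>R \<nu> \<in> \<Omega>" if t: "0 < t" "t < R / 2" and x: "x \<in> closure \<Omega> \<inter> ball p (R / 2)" for t x
    proof -
      have "x \<in> closure (\<Omega> \<inter> ball p R)"
        using x R(1) open_Int_closure_subset[of "ball p R" \<Omega>] by (auto simp: Int_commute)
      moreover have "closure (\<Omega> \<inter> ball p R) \<subseteq> {x. 0 \<le> f x}"
      proof (rule closure_minimal)
        show "\<Omega> \<inter> ball p R \<subseteq> {x. 0 \<le> f x}" using R(4) by (auto intro: less_imp_le)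
        show "closed {x. 0 \<le> f x}" by (intro closed_Collect_le continuous_on_const R(3))
      qed
      ultimately have "f (x + t *\<^sub>R \<nu>) > 0" using t R(5) by auto
      moreover have "x + t *\<^sub>R \<nu> \<in> ball p R"
      proof -
        have "dist p (x + t *\<^sub>R \<nu>) \<le> dist p x + norm (t *\<^sub>R \<nu>)"
          using norm_triangle_ineq4[of "p - x" "t *\<^sub>R \<nu>"] by (simp add: dist_norm algebra_simps)
        thus ?thesis using x t R(2) by simp
      qed
      ultimately show ?thesis using R(4) by blast
    qed
    thus ?thesis using R(1) by (intro exI[of _ "R / 2"] exI[of _ \<nu>]) auto
  qed
qed

section \<open>The boundary part of the commutator\<close>

context frac_kernel begin

lemma lipschitz_product:
  fixes \<psi> :: "'a \<Rightarrow> complex" and g :: "'a \<Rightarrow> real"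
  assumes g: "\<And>x. \<bar>g x\<bar> \<le> 1" "\<And>x y. \<bar>g x - g y\<bar> \<le> l * norm (x - y)"
    and \<psi>: "\<And>x. cmod (\<psi> x) \<le> M" "\<And>x y. cmod (\<psi> x - \<psi> y) \<le> M * norm (x - y)" and l: "0 \<le> l"
  shows "cmod (of_real (g x) * \<psi> x - of_real (g y) * \<psi> y) \<le> (M * (l + 1)) * norm (x - y)"
proof -
  have M0: "M \<ge> 0" using \<psi>(1)[of x] norm_ge_zero order_trans by blast
  have "of_real (g x) * \<psi> x - of_real (g y) * \<psi> y = of_real (g x - g y) * \<psi> x + of_real (g y) * (\<psi> x - \<psi> y)"
    by (simp add: algebra_simps)
  hence "cmod (of_real (g x) * \<psi> x - of_real (g y) * \<psi> y) \<le> \<bar>g x - g y\<bar> * cmod (\<psi> x) + \<bar>g y\<bar> * cmod (\<psi> x - \<psi> y)"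
    using norm_triangle_ineq[of "of_real (g x - g y) * \<psi> x" "of_real (g y) * (\<psi> x - \<psi> y)"]
    by (simp add: norm_mult del: of_real_diff)
  also have "\<dots> \<le> (l * norm (x - y)) * M + 1 * (M * norm (x - y))"
    using g \<psi> l by (intro add_mono mult_mono) auto
  finally show ?thesis by (simp add: algebra_simps)
qed

text \<open>One piece of the decomposition of \<open>\<Omega>\<close> by the distance to the boundary. Its pairing with \<open>e\<close> is bounded
  by Cauchy--Schwarz and, after multiplication by \<open>\<mu>\<close>, by the equation; interpolation gives the right
  power of \<open>\<mu>\<close> and a power of the thickness that is positive because \<open>\<alpha> > 1/2\<close>.\<close>

lemma layer_piece_bound:
  assumes \<alpha>2: "1/2 < \<alpha>"
    and e: "weak_eigen \<Omega> \<mu> e" and \<mu>: "\<mu> > 0" and op: "open \<Omega>" and bd: "bounded \<Omega>"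
    and v: "v \<ge> 0" "emeasure lborel {x \<in> \<Omega>. infdist x (- \<Omega>) \<le> b} \<le> ennreal (v * \<delta>)"
    and \<delta>: "0 < \<delta>" "\<delta> \<le> 1"
    and g: "g \<in> borel_measurable borel" "\<And>x. \<bar>g x\<bar> \<le> 1" "\<And>x y. \<bar>g x - g y\<bar> \<le> (2 / \<delta>) * norm (x - y)"
       "\<And>x. infdist x (- \<Omega>) < \<delta> \<or> infdist x (- \<Omega>) > b - \<delta> \<Longrightarrow> g x = 0"
    and \<psi>: "\<psi> \<in> borel_measurable borel" "\<And>x. cmod (\<psi> x) \<le> M" "\<And>x y. cmod (\<psi> x - \<psi> y) \<le> M * norm (x - y)"
  shows "cmod (\<integral>x. e x * (of_real (g x) * \<psi> x) \<partial>lborel)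
    \<le> \<mu> powr (1 - 1 / \<alpha>) * (L2norm e * M * (3 * sqrt (v * (1 + real DIM('a))))) * \<delta> powr (\<alpha> - 1/2)"
proof -
  let ?D = "\<lambda>x. infdist x (- \<Omega>)" and ?n = "real DIM('a)"
  have M0: "M \<ge> 0" using \<psi>(2)[of 0] norm_ge_zero order_trans by blast
  let ?w = "\<lambda>x. of_real (g x) * \<psi> x"
  have wm [measurable]: "?w \<in> borel_measurable borel" using g(1) \<psi>(1) by measurable
  have wM: "cmod (?w x) \<le> M" for x
    using mult_mono[OF g(2)[of x] \<psi>(2)[of x]] by (simp add: norm_mult)
  \<comment> \<open>the slope of \<open>g \<psi>\<close> per unit height: \<open>2 / \<delta>\<close> from \<open>g\<close> and \<open>1\<close> from \<open>\<psi>\<close>\<close>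
  define s where "s = 2 / \<delta> + 1"
  have s: "0 < s" "s \<le> 3 / \<delta>" using \<delta> by (auto simp: s_def add_pos_pos field_simps)
  have wl: "cmod (?w x - ?w y) \<le> (M * s) * norm (x - y)" for x y
    unfolding s_def by (rule lipschitz_product[OF g(2,3) \<psi>(2,3)]) (use \<delta> in simp)
  define V where "V = v * \<delta>"
  have V: "V \<ge> 0" using v \<delta> by (simp add: V_def)
  have Dc: "continuous_on UNIV ?D" by (intro continuous_intros)
  have D0: "?D x = 0" if "x \<notin> \<Omega>" for x using that by simp
  have Dl: "\<bar>?D x - ?D y\<bar> \<le> dist x y" for x y using infdist_triangle_abs[of x _ y] by simp
  define T where "T = {x. \<delta> \<le> ?D x} \<inter> {x. ?D x \<le> b - \<delta>}"
  define S where "S = {x. \<delta> / 2 \<le> ?D x} \<inter> {x. ?D x \<le> b}"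
  have "x \<in> \<Omega>" if "\<delta> / 2 \<le> ?D x" for x using D0[of x] that \<delta>(1) by (cases "x \<in> \<Omega>") simp_all
  hence S\<Omega>: "S \<subseteq> \<Omega>" and T\<Omega>: "T \<subseteq> \<Omega>" using \<delta>(1) unfolding S_def T_def by auto
  have Scl: "closed S" unfolding S_def by (intro closed_Int closed_Collect_le continuous_intros)
  have Tcl: "closed T" unfolding T_def by (intro closed_Int closed_Collect_le continuous_intros)
  have Tc: "compact T" using Tcl bounded_subset[OF bd T\<Omega>] by (simp add: compact_eq_bounded_closed)
  have Tz: "?w x = 0" if "x \<notin> T" for x using g(4)[of x] that unfolding T_def by (auto simp: not_le)
  have TS: "y \<in> S" if "x \<in> T" "dist x y \<le> \<delta> / 2" for x y
    using that Dl[of x y] unfolding S_def T_def by (auto simp: abs_le_iff)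
  have Sz: "?w x = 0" if "x \<notin> S" for x using Tz[of x] TS[of x x] that \<delta>(1) by fastforce
  have Sm: "emeasure lborel S \<le> ennreal V"
  proof -
    have "S \<subseteq> {x \<in> \<Omega>. ?D x \<le> b}" using S\<Omega> unfolding S_def by auto
    moreover have "{x \<in> \<Omega>. ?D x \<le> b} \<in> sets lborel"
    proof -
      have [measurable]: "?D \<in> borel_measurable borel" using Dc by (rule borel_measurable_continuous_onI)
      have [measurable]: "\<Omega> \<in> sets borel" using op by simp
      show ?thesis by simp
    qed
    ultimately show ?thesis unfolding V_def using v(2) emeasure_mono order_trans by blast
  qed
  let ?X = "cmod (\<integral>x. e x * ?w x \<partial>lborel)"
  define Y where "Y = L2norm e * M * (3 * sqrt (v * (1 + ?n)))"
  have LM: "L2norm e * M \<ge> 0" by (simp add: M0 L2norm_nonneg)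
  have Y0: "Y \<ge> 0" unfolding Y_def using LM v by simp
  have A: "?X \<le> Y * \<delta> powr (1/2)"
  proof -
    have "?X \<le> L2norm e * (M * sqrt V)"
      by (rule L2_pairing_bound[OF weak_eigenD(2)[OF e] wm wM borel_closed[OF Scl] Sz Sm V])
    also have "sqrt V = sqrt v * \<delta> powr (1/2)" unfolding V_def using \<delta> by (simp add: real_sqrt_mult powr_half_sqrt)
    also have "L2norm e * (M * (sqrt v * \<delta> powr (1/2))) = (L2norm e * M) * (sqrt v * \<delta> powr (1/2))" by simp
    also have "\<dots> \<le> (L2norm e * M) * ((3 * sqrt (v * (1 + ?n))) * \<delta> powr (1/2))"
    proof (intro mult_left_mono mult_right_mono LM)
      have "v * 1 \<le> v * (1 + ?n)" using v by (intro mult_left_mono) auto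
      hence "sqrt v \<le> sqrt (v * (1 + ?n))" by simp
      moreover have "0 \<le> sqrt (v * (1 + ?n))" using v by simp
      ultimately show "sqrt v \<le> 3 * sqrt (v * (1 + ?n))" by linarith
    qed auto
    finally show ?thesis unfolding Y_def by (simp only: mult.assoc)
  qed
  have B: "\<mu> * ?X \<le> Y * \<delta> powr (1/2 - \<alpha>)"
  proof -
    have "\<mu> * ?X \<le> L2norm e * (M * s powr \<alpha> * sqrt (V * (1 + DIM('a))))"
      by (rule eigen_lipschitz_bound[OF e less_imp_le[OF \<mu>] wm wM s(1) wl Tc Tz Scl S\<Omega> Sm V, of "\<delta> / 2"])
         (use \<delta> TS in auto)
    also have "\<dots> = (L2norm e * M) * (s powr \<alpha> * sqrt (V * (1 + ?n)))" by (simp add: mult.assoc)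
    also have "\<dots> \<le> (L2norm e * M) * (3 * sqrt (v * (1 + ?n)) * \<delta> powr (1/2 - \<alpha>))"
    proof (intro mult_left_mono LM)
      have "s powr \<alpha> \<le> (3 / \<delta>) powr \<alpha>" using s \<alpha>_range by (intro powr_mono2) auto
      also have "\<dots> = 3 powr \<alpha> * \<delta> powr (- \<alpha>)" using \<delta> by (simp add: powr_divide powr_minus_divide)
      also have "\<dots> \<le> 3 * \<delta> powr (- \<alpha>)"
        using powr_mono[of \<alpha> 1 "3::real"] \<alpha>_range by (intro mult_right_mono) auto
      finally have sa: "s powr \<alpha> \<le> 3 * \<delta> powr (- \<alpha>)" .
      have sV: "sqrt (V * (1 + ?n)) = sqrt (v * (1 + ?n)) * \<delta> powr (1/2)"
        unfolding V_def using \<delta> by (simp add: real_sqrt_mult powr_half_sqrt mult_ac)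
      have "s powr \<alpha> * sqrt (V * (1 + ?n)) \<le> (3 * \<delta> powr (- \<alpha>)) * (sqrt (v * (1 + ?n)) * \<delta> powr (1/2))"
        unfolding sV[symmetric] by (rule mult_right_mono[OF sa]) (use V in simp)
      also have "(3 * \<delta> powr (- \<alpha>)) * (sqrt (v * (1 + ?n)) * \<delta> powr (1/2)) = 3 * sqrt (v * (1 + ?n)) * (\<delta> powr (- \<alpha>) * \<delta> powr (1/2))"
        by simp
      also have "\<delta> powr (- \<alpha>) * \<delta> powr (1/2) = \<delta> powr (1/2 - \<alpha>)" by (simp add: powr_add[symmetric])
      finally show "s powr \<alpha> * sqrt (V * (1 + ?n)) \<le> 3 * sqrt (v * (1 + ?n)) * \<delta> powr (1/2 - \<alpha>)" .
    qed
    finally show ?thesis unfolding Y_def by (simp only: mult.assoc)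
  qed
  let ?\<theta> = "(1 - \<alpha>) / \<alpha>"
  have \<theta>: "0 \<le> ?\<theta>" "?\<theta> \<le> 1" using \<alpha>_range \<alpha>2 by (auto simp: divide_le_eq)
  have "?X \<le> \<mu> powr (- ?\<theta>) * (Y * \<delta> powr (1/2)) powr (1 - ?\<theta>) * (Y * \<delta> powr (1/2 - \<alpha>)) powr ?\<theta>"
    by (rule interpolate_bound[OF _ A B \<mu> \<theta>]) simp
  also have "\<dots> = \<mu> powr (- ?\<theta>) * (Y powr (1 - ?\<theta>) * Y powr ?\<theta>) * (\<delta> powr (1/2 * (1 - ?\<theta>)) * \<delta> powr ((1/2 - \<alpha>) * ?\<theta>))"
    using Y0 by (simp add: powr_mult powr_powr mult_ac)
  also have "Y powr (1 - ?\<theta>) * Y powr ?\<theta> = Y" using Y0 by (simp add: powr_add[symmetric])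
  also have "\<delta> powr (1/2 * (1 - ?\<theta>)) * \<delta> powr ((1/2 - \<alpha>) * ?\<theta>) = \<delta> powr (\<alpha> - 1/2)"
  proof -
    have "1/2 * (1 - ?\<theta>) + (1/2 - \<alpha>) * ?\<theta> = \<alpha> - 1/2" using \<alpha>_range by (simp add: field_simps)
    thus ?thesis by (simp only: powr_add[symmetric])
  qed
  also have "- ?\<theta> = 1 - 1 / \<alpha>" using \<alpha>_range by (simp add: field_simps)
  finally show ?thesis unfolding Y_def .
qed

definition clamp01 :: "real \<Rightarrow> real" where "clamp01 t = max 0 (min 1 t)"

lemma clamp01: "0 \<le> clamp01 t" "clamp01 t \<le> 1" "\<bar>clamp01 s - clamp01 t\<bar> \<le> \<bar>s - t\<bar>"
  "t \<le> 0 \<Longrightarrow> clamp01 t = 0" "1 \<le> t \<Longrightarrow> clamp01 t = 1"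
  by (auto simp: clamp01_def)

text \<open>\<open>\<psi>\<close> need not vanish on the boundary, so it is not admissible in the equation. It is a sum of dyadic
  pieces supported where the distance to the boundary is about \<open>2\<^sup>-\<^sup>k\<close>. Each piece is admissible, and the
  layers have measure \<open>O(2\<^sup>-\<^sup>k)\<close>, so the piece bounds form a geometric series with ratio
  \<open>2\<^sup>1\<^sup>/\<^sup>2\<^sup>-\<^sup>\<alpha> < 1\<close>.\<close>

lemma eigen_boundary_bound:
  assumes \<alpha>2: "1/2 < \<alpha>" and C11: "C11_domain \<Omega>" and bd: "bounded \<Omega>"
  obtains C where "C \<ge> 0" "\<And>\<mu> e \<psi> M. weak_eigen \<Omega> \<mu> e \<Longrightarrow> \<mu> > 0 \<Longrightarrow> (AE x in lborel. x \<notin> \<Omega> \<longrightarrow> e x = 0) \<Longrightarrow>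
     \<psi> \<in> borel_measurable borel \<Longrightarrow> (\<And>x. cmod (\<psi> x) \<le> M) \<Longrightarrow> (\<And>x y. cmod (\<psi> x - \<psi> y) \<le> M * norm (x - y)) \<Longrightarrow>
     cmod (\<integral>x. e x * \<psi> x \<partial>lborel) \<le> C * M * \<mu> powr (1 - 1 / \<alpha>) * L2norm e"
proof -
  have op: "open \<Omega>" using C11 by (simp add: C11_domain_def)
  let ?D = "\<lambda>x. infdist x (- \<Omega>)" and ?n = "real DIM('a)"
  have Dc: "continuous_on UNIV ?D" by (intro continuous_intros)
  have [measurable]: "?D \<in> borel_measurable borel" using Dc by (rule borel_measurable_continuous_onI)
  have Dl: "\<bar>?D x - ?D y\<bar> \<le> norm (x - y)" for x y using infdist_triangle_abs[of x _ y] by (simp add: dist_norm)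
  have D0: "?D x = 0" if "x \<notin> \<Omega>" for x using that by simp
  have Dpos: "?D x > 0" if "x \<in> \<Omega>" for x
  proof -
    have "- \<Omega> \<noteq> {}" using bd not_bounded_UNIV by (metis Compl_empty_eq double_complement)
    moreover have "closed (- \<Omega>)" using op by (simp add: closed_Compl)
    ultimately show ?thesis using that in_closed_iff_infdist_zero[of "- \<Omega>" x] infdist_nonneg[of x "- \<Omega>"] by (auto simp: less_le)
  qed
  obtain R where R: "\<And>x. ?D x \<le> R" "R > 0"
  proof -
    have "bounded (?D ` closure \<Omega>)"
      using bd by (intro compact_imp_bounded compact_continuous_image) (auto simp: compact_closure intro: continuous_on_subset[OF Dc])
    then obtain R where "R > 0" "\<And>x. x \<in> closure \<Omega> \<Longrightarrow> \<bar>?D x\<bar> \<le> R" by (auto simp: bounded_pos)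
    hence "?D x \<le> R" for x using D0[of x] closure_subset[of \<Omega>] by (cases "x \<in> \<Omega>") (force simp: abs_le_iff)+
    thus ?thesis using \<open>R > 0\<close> by (rule that)
  qed
  obtain c where c: "c \<ge> 0" "\<And>t. t > 0 \<Longrightarrow> emeasure lborel {x \<in> \<Omega>. ?D x \<le> t} \<le> ennreal (c * t)"
    using boundary_layer_measure[OF C11 bd] by blast
  let ?a = "\<lambda>c. 3 * sqrt (c * (1 + ?n))"
  define q where "q = (1/2::real) powr (\<alpha> - 1/2)"
  have q: "0 \<le> q" "q < 1" unfolding q_def using powr_less_mono2[of "\<alpha> - 1/2" "1/2" 1] \<alpha>2 by auto
  define C where "C = ?a (c * (R + 1)) + ?a (c * 5) * (1 / (1 - q))"
  have C0: "C \<ge> 0" unfolding C_def using c R q by (intro add_nonneg_nonneg mult_nonneg_nonneg) auto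
  have main: "cmod (\<integral>x. e x * \<psi> x \<partial>lborel) \<le> C * M * \<mu> powr (1 - 1 / \<alpha>) * L2norm e"
    if e: "weak_eigen \<Omega> \<mu> e" and \<mu>: "\<mu> > 0" and ae: "AE x in lborel. x \<notin> \<Omega> \<longrightarrow> e x = 0"
      and \<psi>: "\<psi> \<in> borel_measurable borel" "\<And>x. cmod (\<psi> x) \<le> M" "\<And>x y. cmod (\<psi> x - \<psi> y) \<le> M * norm (x - y)"
    for \<mu> e \<psi> M
  proof -
    note ei = weak_eigenD[OF e]
    have [measurable]: "e \<in> borel_measurable borel" "\<psi> \<in> borel_measurable borel" using ei(3) \<psi>(1) by auto
    have M0: "M \<ge> 0" using \<psi>(2)[of 0] norm_ge_zero order_trans by blast
    let ?P = "\<mu> powr (1 - 1 / \<alpha>) * (L2norm e * M)"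
    have P0: "?P \<ge> 0" by (simp add: M0 L2norm_nonneg)
    \<comment> \<open>\<open>0\<close> within distance \<open>2\<^sup>-\<^sup>k\<close> of the boundary, \<open>1\<close> beyond twice that distance\<close>
    define g where "g k x = clamp01 (2 ^ k * ?D x - 1)" for k :: nat and x
    have gm [measurable]: "g k \<in> borel_measurable borel" for k unfolding g_def clamp01_def by measurable
    have g01: "0 \<le> g k x" "g k x \<le> 1" for k x unfolding g_def by (rule clamp01)+
    have gl: "\<bar>g k x - g k y\<bar> \<le> 2 ^ k * norm (x - y)" for k x y
    proof -
      have "\<bar>g k x - g k y\<bar> \<le> \<bar>2 ^ k * (?D x - ?D y)\<bar>" unfolding g_def using clamp01(3)[of "2 ^ k * ?D x - 1" "2 ^ k * ?D y - 1"] by (simp add: right_diff_distrib)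
      also have "\<dots> = 2 ^ k * \<bar>?D x - ?D y\<bar>" by (simp add: abs_mult)
      also have "\<dots> \<le> 2 ^ k * norm (x - y)" by (intro mult_left_mono Dl) auto
      finally show ?thesis .
    qed
    have g0: "g k x = 0" if "?D x \<le> (1/2) ^ k" for k x
    proof -
      have "2 ^ k * ?D x \<le> 2 ^ k * (1/2) ^ k" using that by (intro mult_left_mono) auto
      thus ?thesis unfolding g_def by (intro clamp01(4)) (simp add: power_mult_distrib[symmetric])
    qed
    have g1: "g k x = 1" if "2 * (1/2) ^ k \<le> ?D x" for k x
    proof -
      have "2 ^ k * (2 * (1/2) ^ k) \<le> 2 ^ k * ?D x" using that by (intro mult_left_mono) auto
      moreover have "2 ^ k * (2 * (1/2) ^ k) = (2::real)" by (simp add: power_one_over)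
      ultimately show ?thesis unfolding g_def by (intro clamp01(5)) simp
    qed
    have wi: "integrable lborel (\<lambda>x. e x * (of_real (f x) * \<psi> x))"
      if [measurable]: "f \<in> borel_measurable borel" and f: "\<And>x. \<bar>f x\<bar> \<le> 1" for f :: "'a \<Rightarrow> real"
    proof (rule integrable_mult_bounded[OF ei(1)])
      show "cmod (of_real (f x) * \<psi> x) \<le> M" for x
        using mult_mono[OF f[of x] \<psi>(2)[of x]] by (simp add: norm_mult)
    qed measurable
    have piece0: "cmod (\<integral>x. e x * (of_real (g 0 x) * \<psi> x) \<partial>lborel) \<le> ?P * ?a (c * (R + 1))"
    proof -
      have "cmod (\<integral>x. e x * (of_real (g 0 x) * \<psi> x) \<partial>lborel)
        \<le> \<mu> powr (1 - 1 / \<alpha>) * (L2norm e * M * ?a (c * (R + 1))) * 1 powr (\<alpha> - 1/2)"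
      proof (rule layer_piece_bound[where b="R + 1" and g="g 0" and \<delta>=1 and v="c * (R + 1)", OF \<alpha>2 e \<mu> op bd _ _ _ _ gm _ _ _ \<psi>])
        show "emeasure lborel {x \<in> \<Omega>. ?D x \<le> R + 1} \<le> ennreal (c * (R + 1) * 1)" using c(2)[of "R + 1"] R(2) by simp
        show "g 0 x = 0" if "?D x < 1 \<or> ?D x > R + 1 - 1" for x using that g0[of x 0] R(1)[of x] by auto
        show "\<bar>g 0 x - g 0 y\<bar> \<le> 2 / 1 * norm (x - y)" for x y using gl[of 0 x y] norm_ge_zero[of "x - y"] by simp
      qed (use c R g01 in auto)
      thus ?thesis by (simp add: mult_ac)
    qed
    have piece: "cmod (\<integral>x. e x * (of_real (g (Suc k) x - g k x) * \<psi> x) \<partial>lborel) \<le> ?P * ?a (c * 5) * q ^ Suc k" for k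
    proof -
      let ?\<delta> = "(1/2::real) ^ Suc k"
      have d: "0 < ?\<delta>" by simp
      have d1: "?\<delta> \<le> 1" by (rule power_le_one) auto
      have "cmod (\<integral>x. e x * (of_real (g (Suc k) x - g k x) * \<psi> x) \<partial>lborel)
        \<le> \<mu> powr (1 - 1 / \<alpha>) * (L2norm e * M * ?a (c * 5)) * ?\<delta> powr (\<alpha> - 1/2)"
      proof (rule layer_piece_bound[OF \<alpha>2 e \<mu> op bd _ _ d d1 _ _ _ _ \<psi>, where b="5 * ?\<delta>"])
        show "emeasure lborel {x \<in> \<Omega>. ?D x \<le> 5 * ?\<delta>} \<le> ennreal (c * 5 * ?\<delta>)" using c(2)[of "5 * ?\<delta>"] d by (simp add: mult.assoc)
        show "\<bar>g (Suc k) x - g k x\<bar> \<le> 1" for x using g01[of "Suc k" x] g01[of k x] by (simp add: abs_le_iff)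
        show "\<bar>(g (Suc k) x - g k x) - (g (Suc k) y - g k y)\<bar> \<le> 2 / ?\<delta> * norm (x - y)" for x y
        proof -
          have "\<bar>(g (Suc k) x - g k x) - (g (Suc k) y - g k y)\<bar> \<le> (2 ^ Suc k + 2 ^ k) * norm (x - y)"
            using gl[of "Suc k" x y] gl[of k x y] by (simp add: ring_distribs abs_le_iff)
          also have "\<dots> \<le> 2 / ?\<delta> * norm (x - y)" by (intro mult_right_mono) (auto simp: power_one_over)
          finally show ?thesis .
        qed
        show "g (Suc k) x - g k x = 0" if "?D x < ?\<delta> \<or> ?D x > 5 * ?\<delta> - ?\<delta>" for x
        proof -
          have e: "(1/2) ^ k = 2 * ?\<delta>" by simp
          from that consider "?D x < ?\<delta>" | "?D x > 4 * ?\<delta>" by linarith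
          thus ?thesis
          proof cases
            case 1
            have "g (Suc k) x = 0" using 1 by (intro g0) linarith
            moreover have "g k x = 0" using 1 d by (intro g0) (unfold e, linarith)
            ultimately show ?thesis by simp
          next
            case 2
            have "g (Suc k) x = 1" using 2 d by (intro g1) linarith
            moreover have "g k x = 1" using 2 d by (intro g1) (unfold e, linarith)
            ultimately show ?thesis by simp
          qed
        qed
        show "(\<lambda>x. g (Suc k) x - g k x) \<in> borel_measurable borel" by measurable
      qed (use c in auto)
      also have "?\<delta> powr (\<alpha> - 1/2) = q ^ Suc k"
      proof -
        have "(x ^ n) powr p = (x powr p) ^ n" if "x > 0" for n and x p :: real
          using that by (induction n) (simp_all add: powr_mult)
        from this[of "1/2"] have "((1/2::real) ^ n) powr p = ((1/2) powr p) ^ n" for n p by simp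
        thus ?thesis unfolding q_def by blast
      qed
      finally show ?thesis by (simp add: mult_ac del: power_Suc)
    qed
    have partial: "cmod (\<integral>x. e x * (of_real (g k x) * \<psi> x) \<partial>lborel) \<le> ?P * ?a (c * (R + 1)) + ?P * ?a (c * 5) * (\<Sum>j<k. q ^ Suc j)" for k
    proof (induction k)
      case 0
      show ?case using piece0 by simp
    next
      case (Suc k)
      have "(\<integral>x. e x * (of_real (g (Suc k) x) * \<psi> x) \<partial>lborel)
          = (\<integral>x. e x * (of_real (g k x) * \<psi> x) + e x * (of_real (g (Suc k) x - g k x) * \<psi> x) \<partial>lborel)"
        by (intro Bochner_Integration.integral_cong refl) (simp add: algebra_simps)
      also have "\<dots> = (\<integral>x. e x * (of_real (g k x) * \<psi> x) \<partial>lborel) + (\<integral>x. e x * (of_real (g (Suc k) x - g k x) * \<psi> x) \<partial>lborel)"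
      proof (intro Bochner_Integration.integral_add wi)
        show "\<bar>g k x\<bar> \<le> 1" for x using g01[of k x] by simp
        show "\<bar>g (Suc k) x - g k x\<bar> \<le> 1" for x using g01[of "Suc k" x] g01[of k x] by (simp add: abs_le_iff)
      qed measurable
      finally have "cmod (\<integral>x. e x * (of_real (g (Suc k) x) * \<psi> x) \<partial>lborel)
         \<le> cmod (\<integral>x. e x * (of_real (g k x) * \<psi> x) \<partial>lborel) + cmod (\<integral>x. e x * (of_real (g (Suc k) x - g k x) * \<psi> x) \<partial>lborel)"
        by (simp only: norm_triangle_ineq)
      thus ?case using Suc piece[of k] by (simp only: sum.lessThan_Suc ring_distribs)
    qed
    have geo: "(\<Sum>j<k. q ^ Suc j) \<le> 1 / (1 - q)" for k
    proof -
      have "(\<Sum>j<k. q ^ Suc j) \<le> (\<Sum>j<k. q ^ j)" using q by (intro sum_mono) (simp add: mult_left_le_one_le)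
      also have "\<dots> \<le> (\<Sum>j. q ^ j)" using q by (intro sum_le_suminf summable_geometric) auto
      also have "\<dots> = 1 / (1 - q)" using q by (intro suminf_geometric) simp
      finally show ?thesis .
    qed
    have bound: "cmod (\<integral>x. e x * (of_real (g k x) * \<psi> x) \<partial>lborel) \<le> C * M * \<mu> powr (1 - 1 / \<alpha>) * L2norm e" for k
    proof -
      have "?P * ?a (c * 5) * (\<Sum>j<k. q ^ Suc j) \<le> ?P * ?a (c * 5) * (1 / (1 - q))"
      proof (rule mult_left_mono[OF geo])
        show "0 \<le> ?P * ?a (c * 5)" by (rule mult_nonneg_nonneg[OF P0]) (use c in auto)
      qed
      hence "cmod (\<integral>x. e x * (of_real (g k x) * \<psi> x) \<partial>lborel) \<le> ?P * ?a (c * (R + 1)) + ?P * ?a (c * 5) * (1 / (1 - q))"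
        using partial[of k] by linarith
      also have "\<dots> = C * M * \<mu> powr (1 - 1 / \<alpha>) * L2norm e" unfolding C_def by (simp only: ring_distribs mult_ac)
      finally show ?thesis .
    qed
    have "(\<lambda>k. \<integral>x. e x * (of_real (g k x) * \<psi> x) \<partial>lborel) \<longlonglongrightarrow> (\<integral>x. e x * \<psi> x \<partial>lborel)"
    proof (rule integral_dominated_convergence[where w="\<lambda>x. M * cmod (e x)"])
      show "(\<lambda>x. e x * (of_real (g k x) * \<psi> x)) \<in> borel_measurable lborel" for k by measurable
      show "(\<lambda>x. e x * \<psi> x) \<in> borel_measurable lborel" by measurable
      show "integrable lborel (\<lambda>x. M * cmod (e x))" using ei(1) by simp
      show "AE x in lborel. norm (e x * (of_real (g k x) * \<psi> x)) \<le> M * cmod (e x)" for k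
      proof (intro AE_I2)
        fix x
        have "\<bar>g k x\<bar> * cmod (\<psi> x) \<le> 1 * M" using g01[of k x] \<psi>(2)[of x] by (intro mult_mono) auto
        thus "norm (e x * (of_real (g k x) * \<psi> x)) \<le> M * cmod (e x)"
          by (simp add: norm_mult mult.commute[of M] mult_left_mono)
      qed
      show "AE x in lborel. (\<lambda>k. e x * (of_real (g k x) * \<psi> x)) \<longlonglongrightarrow> e x * \<psi> x"
        using ae
      proof eventually_elim
        case (elim x)
        show ?case
        proof (cases "x \<in> \<Omega>")
          case True
          have "(\<lambda>k. 2 * (1/2::real) ^ k) \<longlonglongrightarrow> 2 * 0" by (intro tendsto_intros) auto
          hence "\<forall>\<^sub>F k in sequentially. 2 * (1/2::real) ^ k < ?D x" using Dpos[OF True] by (intro order_tendstoD) auto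
          hence "\<forall>\<^sub>F k in sequentially. e x * (of_real (g k x) * \<psi> x) = e x * \<psi> x"
            by eventually_elim (simp add: g1)
          thus ?thesis by (rule tendsto_eventually)
        qed (use elim in simp)
      qed
    qed
    hence "(\<lambda>k. cmod (\<integral>x. e x * (of_real (g k x) * \<psi> x) \<partial>lborel)) \<longlonglongrightarrow> cmod (\<integral>x. e x * \<psi> x \<partial>lborel)" by (rule tendsto_norm)
    thus ?thesis by (rule LIMSEQ_le_const2) (use bound in auto)
  qed
  show ?thesis by (rule that[OF C0 main])
qed

end

lemma powr_lipschitz:
  fixes p \<delta> s t :: real
  assumes \<delta>: "\<delta> > 0" "\<delta> \<le> s" "\<delta> \<le> t" and p: "p \<le> 0"
  shows "\<bar>s powr p - t powr p\<bar> \<le> (- p * \<delta> powr (p - 1)) * \<bar>s - t\<bar>"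
proof -
  have "norm (s powr p - t powr p) \<le> (- p * \<delta> powr (p - 1)) * norm (s - t)"
  proof (rule differentiable_bound[of "{\<delta>..}" "\<lambda>x. x powr p" "\<lambda>x h. (p * x powr (p - 1)) * h"])
    fix x :: real assume x: "x \<in> {\<delta>..}"
    have "((\<lambda>x. x powr p) has_real_derivative p * x powr (p - 1)) (at x)"
      using x \<delta>(1) by (intro has_real_derivative_powr) auto
    thus "((\<lambda>x. x powr p) has_derivative (\<lambda>h. (p * x powr (p - 1)) * h)) (at x within {\<delta>..})"
      unfolding has_field_derivative_def by (rule has_derivative_at_withinI)
    show "onorm (\<lambda>h. (p * x powr (p - 1)) * h) \<le> - p * \<delta> powr (p - 1)"
    proof (rule onorm_le)
      fix h :: real
      have "x powr (p - 1) \<le> \<delta> powr (p - 1)" using x \<delta>(1) p by (intro powr_mono2') auto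
      hence "- p * x powr (p - 1) \<le> - p * \<delta> powr (p - 1)" using p by (intro mult_left_mono) auto
      hence "(- p * x powr (p - 1)) * \<bar>h\<bar> \<le> (- p * \<delta> powr (p - 1)) * \<bar>h\<bar>" by (rule mult_right_mono) simp
      thus "norm ((p * x powr (p - 1)) * h) \<le> (- p * \<delta> powr (p - 1)) * norm h"
        using p by (simp add: abs_mult)
    qed
  qed (use \<delta> in auto)
  thus ?thesis by simp
qed

context frac_kernel begin

text \<open>For \<open>x\<close> in the support of \<open>\<beta>\<close> only points \<open>y\<close> at distance at least \<open>\<delta>\<close> contribute. The kernel may
  therefore be frozen inside the ball of radius \<open>\<delta>\<close>, which makes \<open>y \<mapsto> K (x - y) (1 - \<zeta> y)\<close> bounded and
  Lipschitz uniformly in \<open>x\<close>, and the value of the commutator at \<open>x\<close> is a pairing of \<open>e\<close> with this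
  function.\<close>

lemma comm_op_boundary:
  assumes \<alpha>2: "1/2 < \<alpha>" and C11: "C11_domain \<Omega>" and bd: "bounded \<Omega>"
    and b: "test_function \<Omega>' \<beta>" and S: "compact S" "\<And>x. x \<notin> S \<Longrightarrow> \<beta> x = 0"
    and z: "test_function \<Omega>'' \<zeta>" and \<delta>: "\<delta> > 0" "\<And>x y. x \<in> S \<Longrightarrow> dist x y < \<delta> \<Longrightarrow> \<zeta> y = 1"
  obtains C where "C \<ge> 0" "\<And>\<mu> e. weak_eigen \<Omega> \<mu> e \<Longrightarrow> \<mu> > 0 \<Longrightarrow> (AE x in lborel. x \<notin> \<Omega> \<longrightarrow> e x = 0) \<Longrightarrow>
    (\<integral>\<^sup>+x. ennreal ((cmod (comm_op \<beta> (\<lambda>x. (1 - \<zeta> x) * e x) x))\<^sup>2) \<partial>lborel) \<le> ennreal ((C * \<mu> powr (1 - 1 / \<alpha>) * L2norm e)\<^sup>2)"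
proof -
  have [measurable]: "\<beta> \<in> borel_measurable borel" "\<zeta> \<in> borel_measurable borel"
    using test_function_measurable[OF b] test_function_measurable[OF z] by auto
  have [measurable]: "S \<in> sets borel" using S(1) by (simp add: compact_imp_closed)
  obtain N where N: "N > 0" "\<And>x. cmod (\<beta> x) \<le> N" using test_function_bounded[OF b] by blast
  obtain Z where Z: "Z > 0" "\<And>x. cmod (\<zeta> x) \<le> Z" using test_function_bounded[OF z] by blast
  obtain L where L: "L > 0" "\<And>x y. cmod (\<zeta> x - \<zeta> y) \<le> L * norm (x - y)" using test_function_lipschitz[OF z] by blast
  obtain C0 where C0: "C0 \<ge> 0" "\<And>\<mu> e \<psi> M. weak_eigen \<Omega> \<mu> e \<Longrightarrow> \<mu> > 0 \<Longrightarrow> (AE x in lborel. x \<notin> \<Omega> \<longrightarrow> e x = 0) \<Longrightarrow>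
     \<psi> \<in> borel_measurable borel \<Longrightarrow> (\<And>x. cmod (\<psi> x) \<le> M) \<Longrightarrow> (\<And>x y. cmod (\<psi> x - \<psi> y) \<le> M * norm (x - y)) \<Longrightarrow>
     cmod (\<integral>x. e x * \<psi> x \<partial>lborel) \<le> C0 * M * \<mu> powr (1 - 1 / \<alpha>) * L2norm e"
    using eigen_boundary_bound[OF \<alpha>2 C11 bd] by blast
  let ?p = "- (real DIM('a) + \<alpha>)"
  have p: "?p \<le> 0" using \<alpha>_range by simp
  \<comment> \<open>the kernel frozen inside the ball of radius \<open>\<delta>\<close>\<close>
  define k where "k h = c * (max \<delta> (norm h)) powr ?p" for h :: 'a
  have km [measurable]: "k \<in> borel_measurable borel" unfolding k_def by measurable
  define M1 where "M1 = c * \<delta> powr ?p"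
  define L1 where "L1 = c * (- ?p * \<delta> powr (?p - 1))"
  have M1: "M1 \<ge> 0" and L1: "L1 \<ge> 0" unfolding M1_def L1_def using c_pos p by (auto intro!: mult_nonneg_nonneg)
  have k0: "0 \<le> k h" and kM: "k h \<le> M1" for h
    unfolding k_def M1_def using c_pos \<delta>(1) p by (auto intro!: mult_left_mono powr_mono2')
  have kL: "\<bar>k h - k h'\<bar> \<le> L1 * norm (h - h')" for h h'
  proof -
    have "\<bar>max \<delta> (norm h) powr ?p - max \<delta> (norm h') powr ?p\<bar> \<le> (- ?p * \<delta> powr (?p - 1)) * \<bar>max \<delta> (norm h) - max \<delta> (norm h')\<bar>"
      by (rule powr_lipschitz[OF \<delta>(1) _ _ p]) auto
    also have "\<dots> \<le> (- ?p * \<delta> powr (?p - 1)) * norm (h - h')"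
    proof (rule mult_left_mono)
      show "\<bar>max \<delta> (norm h) - max \<delta> (norm h')\<bar> \<le> norm (h - h')"
        using norm_triangle_ineq3[of h h'] by (auto simp: max_def abs_le_iff)
    qed (use p in simp)
    finally have "c * \<bar>max \<delta> (norm h) powr ?p - max \<delta> (norm h') powr ?p\<bar> \<le> c * ((- ?p * \<delta> powr (?p - 1)) * norm (h - h'))"
      using c_pos by (intro mult_left_mono) auto
    moreover have "\<bar>k h - k h'\<bar> = c * \<bar>max \<delta> (norm h) powr ?p - max \<delta> (norm h') powr ?p\<bar>"
      unfolding k_def right_diff_distrib[symmetric] using c_pos by (simp add: abs_mult)
    ultimately show ?thesis unfolding L1_def by (simp only: mult.assoc)
  qed
  define M where "M = M1 * (1 + Z) + (L1 * (1 + Z) + M1 * L)"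
  have M: "M1 * (1 + Z) \<le> M" "L1 * (1 + Z) + M1 * L \<le> M" "M \<ge> 0"
    unfolding M_def using M1 L1 Z(1) L(1) by auto
  define \<psi> where "\<psi> x y = of_real (k (x - y)) * (1 - \<zeta> y)" for x y
  have \<psi>m [measurable]: "\<psi> x \<in> borel_measurable borel" for x unfolding \<psi>_def by measurable
  have z1: "cmod (1 - \<zeta> y) \<le> 1 + Z" for y using norm_triangle_ineq4[of 1 "\<zeta> y"] Z(2)[of y] by simp
  have \<psi>M: "cmod (\<psi> x y) \<le> M" for x y
  proof -
    have "k (x - y) * cmod (1 - \<zeta> y) \<le> M1 * (1 + Z)" by (intro mult_mono kM z1 M1) auto
    thus ?thesis unfolding \<psi>_def using k0 M(1) by (simp add: norm_mult)
  qed
  have \<psi>L: "cmod (\<psi> x y - \<psi> x y') \<le> M * norm (y - y')" for x y y'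
  proof -
    have "\<psi> x y - \<psi> x y' = of_real (k (x - y) - k (x - y')) * (1 - \<zeta> y) - of_real (k (x - y')) * (\<zeta> y - \<zeta> y')"
      unfolding \<psi>_def by (simp add: algebra_simps)
    hence "cmod (\<psi> x y - \<psi> x y') \<le> \<bar>k (x - y) - k (x - y')\<bar> * cmod (1 - \<zeta> y) + k (x - y') * cmod (\<zeta> y - \<zeta> y')"
      using norm_triangle_ineq4[of "of_real (k (x - y) - k (x - y')) * (1 - \<zeta> y)" "of_real (k (x - y')) * (\<zeta> y - \<zeta> y')"] k0[of "x - y'"]
      by (simp add: norm_mult del: of_real_diff)
    also have "\<dots> \<le> (L1 * norm (y - y')) * (1 + Z) + M1 * (L * norm (y - y'))"
    proof (intro add_mono mult_mono z1 kM L(2) M1)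
      show "\<bar>k (x - y) - k (x - y')\<bar> \<le> L1 * norm (y - y')" using kL[of "x - y" "x - y'"] by (simp add: norm_minus_commute)
    qed (use L1 in auto)
    also have "\<dots> = (L1 * (1 + Z) + M1 * L) * norm (y - y')" by (simp add: algebra_simps)
    also have "\<dots> \<le> M * norm (y - y')" by (intro mult_right_mono M) auto
    finally show ?thesis .
  qed
  let ?W = "measure lborel S"
  have Wfin: "emeasure lborel S = ennreal ?W" using emeasure_compact_finite[OF S(1)] by (simp add: emeasure_eq_ennreal_measure)
  define C where "C = N * (C0 * M) * sqrt ?W"
  have main: "(\<integral>\<^sup>+x. ennreal ((cmod (comm_op \<beta> (\<lambda>x. (1 - \<zeta> x) * e x) x))\<^sup>2) \<partial>lborel) \<le> ennreal ((C * \<mu> powr (1 - 1 / \<alpha>) * L2norm e)\<^sup>2)"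
    if e: "weak_eigen \<Omega> \<mu> e" and \<mu>: "\<mu> > 0" and ae: "AE x in lborel. x \<notin> \<Omega> \<longrightarrow> e x = 0" for \<mu> e
  proof -
    let ?Q = "N * (C0 * M * \<mu> powr (1 - 1 / \<alpha>) * L2norm e)"
    have bz: "\<beta> y * (1 - \<zeta> y) = 0" for y using S(2)[of y] \<delta>(1) \<delta>(2)[of y y] by (cases "y \<in> S") auto
    have eq: "of_real (K (x - y)) * (\<beta> y - \<beta> x) * ((1 - \<zeta> y) * e y) = - \<beta> x * (e y * \<psi> x y)" for x y
    proof (cases "\<beta> x = 0")
      case True
      have "of_real (K (x - y)) * (\<beta> y - \<beta> x) * ((1 - \<zeta> y) * e y) = of_real (K (x - y)) * e y * (\<beta> y * (1 - \<zeta> y))"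
        using True by simp
      thus ?thesis using True bz[of y] by simp
    next
      case False
      hence xS: "x \<in> S" using S(2) by blast
      have K: "of_real (K (x - y)) * (1 - \<zeta> y) = \<psi> x y"
      proof (cases "dist x y < \<delta>")
        case True
        thus ?thesis using \<delta>(2)[OF xS] by (simp add: \<psi>_def)
      next
        case False
        thus ?thesis by (simp add: \<psi>_def k_def K_eq dist_norm max_def)
      qed
      have "of_real (K (x - y)) * (\<beta> y - \<beta> x) * ((1 - \<zeta> y) * e y)
          = of_real (K (x - y)) * e y * (\<beta> y * (1 - \<zeta> y)) - \<beta> x * (e y * (of_real (K (x - y)) * (1 - \<zeta> y)))"
        by (simp add: algebra_simps)
      thus ?thesis unfolding K bz by simp
    qed
    have val: "comm_op \<beta> (\<lambda>x. (1 - \<zeta> x) * e x) x = - \<beta> x * (\<integral>y. e y * \<psi> x y \<partial>lborel)" for x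
      unfolding comm_op_def eq by (rule integral_mult_right_zero)
    have Q: "cmod (comm_op \<beta> (\<lambda>x. (1 - \<zeta> x) * e x) x) \<le> ?Q" for x
      unfolding val norm_mult norm_minus_cancel
      by (intro mult_mono N(2) C0(2)[OF e \<mu> ae] \<psi>m \<psi>M \<psi>L) (use N in auto)
    have "(\<integral>\<^sup>+x. ennreal ((cmod (comm_op \<beta> (\<lambda>x. (1 - \<zeta> x) * e x) x))\<^sup>2) \<partial>lborel) \<le> (\<integral>\<^sup>+x. ennreal (?Q\<^sup>2) * indicator S x \<partial>lborel)"
    proof (intro nn_integral_mono)
      fix x
      show "ennreal ((cmod (comm_op \<beta> (\<lambda>x. (1 - \<zeta> x) * e x) x))\<^sup>2) \<le> ennreal (?Q\<^sup>2) * indicator S x"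
      proof (cases "x \<in> S")
        case True
        have "(cmod (comm_op \<beta> (\<lambda>x. (1 - \<zeta> x) * e x) x))\<^sup>2 \<le> ?Q\<^sup>2" by (intro power_mono Q) auto
        thus ?thesis using True by (simp add: ennreal_leI)
      qed (simp add: val S(2))
    qed
    also have "\<dots> = ennreal (?Q\<^sup>2) * ennreal ?W" by (simp add: nn_integral_cmult Wfin)
    also have "\<dots> = ennreal (?Q\<^sup>2 * ?W)" by (simp add: ennreal_mult)
    also have "?Q\<^sup>2 * ?W = (C * \<mu> powr (1 - 1 / \<alpha>) * L2norm e)\<^sup>2"
      unfolding C_def power_mult_distrib by simp
    finally show ?thesis .
  qed
  have "C \<ge> 0" unfolding C_def using N C0 M by auto
  thus ?thesis using main by (rule that)
qed

end

section \<open>Nonpositive eigenvalues\<close>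

lemma fourier_mollify:
  fixes u :: "'a::euclidean_space \<Rightarrow> complex"
  assumes e: "\<epsilon> > 0" and u: "integrable lborel u"
  shows "fourier (mollify \<epsilon> u) \<xi> = fourier (\<lambda>z. of_real (bump z)) (\<epsilon> *\<^sub>R \<xi>) * fourier u \<xi>"
proof -
  let ?m = "\<lambda>y::'a. complex_of_real (mollifier \<epsilon> y)"
  have [measurable]: "u \<in> borel_measurable borel" using u by auto
  have m: "integrable lborel ?m" by (intro integrable_of_real mollifier_integrable e)
  have Fm: "fourier ?m \<xi> = fourier (\<lambda>z. of_real (bump z)) (\<epsilon> *\<^sub>R \<xi>)"
  proof -
    have "?m = (\<lambda>y. of_real ((1 / \<epsilon>) ^ DIM('a)) * complex_of_real (bump ((1 / \<epsilon>) *\<^sub>R y)))"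
      by (simp add: mollifier_def fun_eq_iff)
    hence "fourier ?m \<xi> = of_real ((1 / \<epsilon>) ^ DIM('a)) * fourier (\<lambda>y. complex_of_real (bump ((1 / \<epsilon>) *\<^sub>R y))) \<xi>"
      by (simp only: fourier_cmult)
    also have "\<dots> = of_real ((1 / \<epsilon>) ^ DIM('a) * \<epsilon> ^ DIM('a)) * fourier (\<lambda>z. of_real (bump z)) (\<epsilon> *\<^sub>R \<xi>)"
      using fourier_scale[of "1/\<epsilon>" "\<lambda>z. complex_of_real (bump z)" \<xi>] e by (simp add: scaleR_conv_of_real)
    also have "(1 / \<epsilon>) ^ DIM('a) * \<epsilon> ^ DIM('a) = 1" using e by (simp add: power_mult_distrib[symmetric])
    finally show ?thesis by simp
  qed
  have int: "integrable (lborel \<Otimes>\<^sub>M lborel) (\<lambda>(x, y). cis (- (x \<bullet> \<xi>)) * (?m (x - y) * u y))"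
  proof -
    have mfin: "(\<integral>\<^sup>+x. ennreal (mollifier \<epsilon> x) \<partial>(lborel :: 'a measure)) < \<infinity>"
      using mollifier_integrable[OF e, where 'a='a] mollifier_nonneg[OF e, where 'a='a] by (simp add: integrable_iff_bounded)
    have "(\<integral>\<^sup>+p. ennreal (norm (case p of (x, y) \<Rightarrow> cis (- (x \<bullet> \<xi>)) * (?m (x - y) * u y))) \<partial>(lborel \<Otimes>\<^sub>M lborel))
        = (\<integral>\<^sup>+x. (\<integral>\<^sup>+y. ennreal (mollifier \<epsilon> (x - y)) * ennreal (cmod (u y)) \<partial>lborel) \<partial>lborel)"
      by (subst lborel.nn_integral_fst[symmetric]) (simp_all add: norm_mult mollifier_nonneg[OF e] ennreal_mult)
    also have "\<dots> = (\<integral>\<^sup>+x. ennreal (mollifier \<epsilon> x) \<partial>(lborel :: 'a measure)) * (\<integral>\<^sup>+y. ennreal (cmod (u y)) \<partial>lborel)"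
      by (rule young_L1) measurable
    also have "\<dots> < \<infinity>" using mfin u by (simp add: ennreal_mult_less_top integrable_iff_bounded)
    finally show ?thesis by (auto simp: integrable_iff_bounded)
  qed
  have "fourier (mollify \<epsilon> u) \<xi> = (\<integral>x. (\<integral>y. cis (- (x \<bullet> \<xi>)) * (?m (x - y) * u y) \<partial>lborel) \<partial>lborel)"
    unfolding fourier_def mollify_def by (simp only: integral_mult_right_zero scaleR_conv_of_real)
  also have "\<dots> = (\<integral>y. (\<integral>x. cis (- (x \<bullet> \<xi>)) * (?m (x - y) * u y) \<partial>lborel) \<partial>lborel)"
    using lborel_pair.Fubini_integral[OF int] by simp
  also have "\<dots> = (\<integral>y. fourier ?m \<xi> * (cis (- (y \<bullet> \<xi>)) * u y) \<partial>lborel)"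
  proof (intro Bochner_Integration.integral_cong refl)
    fix y
    have "(\<integral>x. cis (- (x \<bullet> \<xi>)) * (?m (x - y) * u y) \<partial>lborel) = (\<integral>x. (cis (- (x \<bullet> \<xi>)) * ?m (- y + x)) * u y \<partial>lborel)"
      by (simp add: mult.assoc)
    also have "\<dots> = fourier (\<lambda>x. ?m (- y + x)) \<xi> * u y" unfolding fourier_def by (rule integral_mult_left_zero)
    also have "\<dots> = fourier ?m \<xi> * (cis (- (y \<bullet> \<xi>)) * u y)" unfolding fourier_translate[of ?m "- y" \<xi>] by simp
    finally show "(\<integral>x. cis (- (x \<bullet> \<xi>)) * (?m (x - y) * u y) \<partial>lborel) = fourier ?m \<xi> * (cis (- (y \<bullet> \<xi>)) * u y)" .
  qed
  finally show ?thesis unfolding Fm integral_mult_right_zero fourier_def[of u] .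
qed

lemma fourier_bump_near_1:
  fixes \<xi> :: "'a::euclidean_space"
  shows "cmod (fourier (\<lambda>z. of_real (bump z)) \<xi>) \<le> 1" "cmod (1 - fourier (\<lambda>z. of_real (bump z)) \<xi>) \<le> norm \<xi>"
proof -
  let ?b = "\<lambda>z::'a. complex_of_real (bump z)"
  have b: "integrable lborel ?b" by (intro integrable_of_real bump_integrable)
  show "cmod (fourier ?b \<xi>) \<le> 1" using fourier_bound[OF b, of \<xi>] by (simp add: bump_nonneg bump_integral)
  have i: "integrable lborel (\<lambda>z. cis (- (z \<bullet> \<xi>)) * ?b z)" by (rule integrable_cis_minus_mult[OF b])
  have "(\<integral>z. ?b z \<partial>lborel) = 1" by (simp add: bump_integral)
  hence "1 - fourier ?b \<xi> = (\<integral>z. ?b z - cis (- (z \<bullet> \<xi>)) * ?b z \<partial>lborel)"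
    unfolding fourier_def using Bochner_Integration.integral_diff[OF b i] by simp
  also have "cmod \<dots> \<le> (\<integral>z. norm \<xi> * bump (z::'a) \<partial>lborel)"
  proof (rule Bochner_Integration.integral_norm_bound_integral)
    fix z :: 'a
    have "?b z - cis (- (z \<bullet> \<xi>)) * ?b z = (1 - cis (- (z \<bullet> \<xi>))) * ?b z" by (simp add: left_diff_distrib)
    moreover have "cmod (1 - cis (- (z \<bullet> \<xi>))) * bump z \<le> norm \<xi> * bump z"
    proof (cases "norm z < 1")
      case True
      have "cmod (1 - cis (- (z \<bullet> \<xi>))) \<le> norm z * norm \<xi>"
        using one_minus_cis_le[of "- (z \<bullet> \<xi>)"] Cauchy_Schwarz_ineq2[of z \<xi>] by simp
      also have "\<dots> \<le> 1 * norm \<xi>" using True by (intro mult_right_mono) auto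
      finally show ?thesis by (intro mult_right_mono bump_nonneg) simp
    qed (simp add: bump_zero)
    ultimately show "cmod (?b z - cis (- (z \<bullet> \<xi>)) * ?b z) \<le> norm \<xi> * bump z"
      by (simp add: norm_mult bump_nonneg)
  qed (use b i bump_integrable in auto)
  finally show "cmod (1 - fourier ?b \<xi>) \<le> norm \<xi>" by (simp add: bump_integral)
qed

lemma C_k_prod: "(\<And>i. i \<in> I \<Longrightarrow> C_k k (f i)) \<Longrightarrow> C_k k (\<lambda>x. \<Prod>i\<in>I. (f i x :: complex))"
  by (induction I rule: infinite_finite_induct) (auto intro: C_k_mult)

text \<open>Telescoping: the \<open>j\<close>-th function is \<open>b\<^sub>j\<close> times the product of \<open>1 - b\<^sub>i\<close> over the earlier \<open>i\<close>. Where
  some \<open>b\<^sub>i\<close> equals \<open>1\<close>, the sum is \<open>1\<close>.\<close>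

lemma partition_of_unity:
  fixes b :: "'i \<Rightarrow> 'a::euclidean_space \<Rightarrow> complex"
  assumes "finite F" "\<And>i. i \<in> F \<Longrightarrow> test_function (U i) (b i)"
  shows "\<exists>\<rho>. (\<forall>i\<in>F. test_function (U i) (\<rho> i)) \<and> (\<forall>x. (\<Sum>i\<in>F. \<rho> i x) = 1 - (\<Prod>i\<in>F. 1 - b i x))"
  using assms
proof (induction F rule: finite_induct)
  case empty
  show ?case by simp
next
  case (insert j F)
  then obtain \<rho> where \<rho>: "\<forall>i\<in>F. test_function (U i) (\<rho> i)" "\<forall>x. (\<Sum>i\<in>F. \<rho> i x) = 1 - (\<Prod>i\<in>F. 1 - b i x)" by blast
  let ?\<sigma> = "\<rho>(j := \<lambda>x. (\<Prod>i\<in>F. 1 - b i x) * b j x)"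
  have "C_k k (\<lambda>x. 1 + (-1) * b i x)" if "i \<in> F" for i k
    by (rule C_k_add[OF C_k_const C_k_mult[OF C_k_const test_function_C_k[OF insert.prems]]]) (use that in simp)
  hence C: "C_k k (\<lambda>x. \<Prod>i\<in>F. 1 - b i x)" for k by (intro C_k_prod) simp
  have "test_function (U j) (\<lambda>x. (\<Prod>i\<in>F. 1 - b i x) * b j x)"
    by (rule test_function_mult[OF insert.prems C]) simp
  hence "\<forall>i\<in>insert j F. test_function (U i) (?\<sigma> i)" using \<rho>(1) by auto
  moreover have "(\<Sum>i\<in>insert j F. ?\<sigma> i x) = 1 - (\<Prod>i\<in>insert j F. 1 - b i x)" for x
  proof -
    have "(\<Sum>i\<in>F. ?\<sigma> i x) = (\<Sum>i\<in>F. \<rho> i x)" using insert(2) by (intro sum.cong) auto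
    thus ?thesis using insert(1,2) \<rho>(2) by (simp add: algebra_simps)
  qed
  ultimately show ?case by blast
qed

text \<open>Translate inward, then mollify at a scale below the distance gained. On the Fourier side both
  operations multiply by factors of modulus at most \<open>1\<close> that tend to \<open>1\<close>.\<close>

lemma inward_mollification:
  fixes v :: "'a::euclidean_space \<Rightarrow> complex"
  assumes v: "integrable lborel v" and S: "compact S" "\<And>x. x \<notin> S \<Longrightarrow> v x = 0" and op: "open \<Omega>"
    and r: "r > 0" "\<And>t x. 0 < t \<Longrightarrow> t < r \<Longrightarrow> x \<in> S \<Longrightarrow> x + t *\<^sub>R \<nu> \<in> \<Omega>"
  shows "\<exists>w. (\<forall>n::nat. test_function \<Omega> (w n)) \<and> (\<forall>n \<xi>. cmod (fourier (w n) \<xi>) \<le> cmod (fourier v \<xi>))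
    \<and> (\<forall>\<xi>. (\<lambda>n. fourier (w n) \<xi>) \<longlonglongrightarrow> fourier v \<xi>)"
proof -
  define t where "t n = r / (real n + 2)" for n :: nat
  have t: "0 < t n" "t n < r" for n unfolding t_def using r(1) by (auto simp: field_simps intro!: add_pos_nonneg)
  have t0: "t \<longlonglongrightarrow> 0" unfolding t_def by real_asymp
  let ?S = "\<lambda>n. (\<lambda>x. t n *\<^sub>R \<nu> + x) ` S"
  have cS: "compact (?S n)" for n using S(1) by (rule compact_translation)
  have "\<exists>\<epsilon>>0. \<epsilon> \<le> 1 / (real n + 1) \<and> (\<forall>x y. x \<in> ?S n \<longrightarrow> dist x y \<le> \<epsilon> \<longrightarrow> y \<in> \<Omega>)" for n
  proof -
    have "?S n \<subseteq> \<Omega>" using r(2)[OF t, of _ n] by (auto simp: add.commute)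
    then obtain e where e: "e > 0" "(\<Union>x\<in>?S n. ball x e) \<subseteq> \<Omega>"
      using compact_subset_open_imp_ball_epsilon_subset[OF cS op] by blast
    show ?thesis
    proof (intro exI[of _ "min (e / 2) (1 / (real n + 1))"] conjI allI impI)
      fix x y assume xy: "x \<in> ?S n" "dist x y \<le> min (e / 2) (1 / (real n + 1))"
      hence "y \<in> ball x e" using e(1) by simp
      thus "y \<in> \<Omega>" using e(2) xy(1) by blast
    qed (use e in auto)
  qed
  hence "\<forall>n. \<exists>\<epsilon>. \<epsilon> > 0 \<and> \<epsilon> \<le> 1 / (real n + 1) \<and> (\<forall>x y. x \<in> ?S n \<longrightarrow> dist x y \<le> \<epsilon> \<longrightarrow> y \<in> \<Omega>)" by blast
  from choice[OF this] obtain \<epsilon> where \<epsilon>: "\<And>n. \<epsilon> n > 0" "\<And>n. \<epsilon> n \<le> 1 / (real n + 1)"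
    "\<And>n x y. x \<in> ?S n \<Longrightarrow> dist x y \<le> \<epsilon> n \<Longrightarrow> y \<in> \<Omega>" by auto
  have \<epsilon>0: "\<epsilon> \<longlonglongrightarrow> 0"
  proof (rule tendsto_sandwich[of "\<lambda>_. 0" \<epsilon> sequentially "\<lambda>n. 1 / (real n + 1)"])
    show "(\<lambda>n. 1 / (real n + 1)) \<longlonglongrightarrow> 0" by real_asymp
  qed (use \<epsilon>(1,2) in \<open>auto intro: less_imp_le always_eventually\<close>)
  let ?u = "\<lambda>n x. v (- (t n *\<^sub>R \<nu>) + x)"
  have u: "integrable lborel (?u n)" for n by (rule integrable_lborel_translate[OF v])
  let ?w = "\<lambda>n. mollify (\<epsilon> n) (?u n)"
  let ?B = "\<lambda>\<xi>::'a. fourier (\<lambda>z. complex_of_real (bump z)) \<xi>"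
  have F: "fourier (?w n) \<xi> = ?B (\<epsilon> n *\<^sub>R \<xi>) * (cis (- (t n *\<^sub>R \<nu>) \<bullet> \<xi>) * fourier v \<xi>)" for n \<xi>
    using fourier_mollify[OF \<epsilon>(1) u] fourier_translate[of v] by metis
  have test: "test_function \<Omega> (?w n)" for n
  proof (rule test_function_mollify[OF \<epsilon>(1) u cS _ \<epsilon>(3)])
    fix x assume "x \<notin> ?S n"
    hence "- (t n *\<^sub>R \<nu>) + x \<notin> S" using image_eqI[of x "\<lambda>x. t n *\<^sub>R \<nu> + x" "- (t n *\<^sub>R \<nu>) + x" S] by auto
    thus "?u n x = 0" by (rule S(2))
  qed
  have bound: "cmod (fourier (?w n) \<xi>) \<le> cmod (fourier v \<xi>)" for n \<xi>
    using mult_right_mono[OF fourier_bump_near_1(1)[of "\<epsilon> n *\<^sub>R \<xi>"], of "cmod (fourier v \<xi>)"]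
    unfolding F by (simp add: norm_mult)
  have lim: "(\<lambda>n. fourier (?w n) \<xi>) \<longlonglongrightarrow> fourier v \<xi>" for \<xi>
  proof -
    have "(\<lambda>n. 1 - ?B (\<epsilon> n *\<^sub>R \<xi>)) \<longlonglongrightarrow> 0"
    proof (rule Lim_null_comparison)
      show "\<forall>\<^sub>F n in sequentially. norm (1 - ?B (\<epsilon> n *\<^sub>R \<xi>)) \<le> norm (\<epsilon> n *\<^sub>R \<xi>)"
        by (intro always_eventually allI fourier_bump_near_1(2))
      show "(\<lambda>n. norm (\<epsilon> n *\<^sub>R \<xi>)) \<longlonglongrightarrow> 0"
        using tendsto_norm[OF tendsto_scaleR[OF \<epsilon>0 tendsto_const[of \<xi>]]] by simp
    qed
    hence B: "(\<lambda>n. ?B (\<epsilon> n *\<^sub>R \<xi>)) \<longlonglongrightarrow> 1" using tendsto_diff[OF tendsto_const[of 1]] by fastforce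
    have "(\<lambda>n. (- (t n *\<^sub>R \<nu>)) \<bullet> \<xi>) \<longlonglongrightarrow> (- (0 *\<^sub>R \<nu>)) \<bullet> \<xi>" by (intro tendsto_intros t0)
    hence "(\<lambda>n. cis ((- (t n *\<^sub>R \<nu>)) \<bullet> \<xi>)) \<longlonglongrightarrow> cis ((- (0 *\<^sub>R \<nu>)) \<bullet> \<xi>)" by (rule tendsto_cis)
    hence c: "(\<lambda>n. cis ((- (t n *\<^sub>R \<nu>)) \<bullet> \<xi>)) \<longlonglongrightarrow> 1" by simp
    have "(\<lambda>n. fourier (?w n) \<xi>) \<longlonglongrightarrow> 1 * (1 * fourier v \<xi>)" unfolding F by (intro tendsto_mult B c tendsto_const)
    thus ?thesis by simp
  qed
  show ?thesis by (rule exI[of _ ?w]) (intro conjI allI test bound lim)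
qed

text \<open>The inward direction depends on the boundary point, so \<open>u\<close> is first cut into pieces by a partition of
  unity. The bound on the Fourier transforms serves as a majorant for dominated convergence.\<close>

lemma inward_approximation:
  fixes u :: "'a::euclidean_space \<Rightarrow> complex"
  assumes C: "C11_domain \<Omega>" and bd: "bounded \<Omega>"
    and u: "integrable lborel u" "\<And>x. x \<notin> closure \<Omega> \<Longrightarrow> u x = 0"
  obtains F :: "'a set" and \<rho> w where "finite F" "\<And>p. p \<in> F \<Longrightarrow> test_function UNIV (\<rho> p)"
    "\<And>n::nat. test_function \<Omega> (w n)"
    "\<And>n \<xi>. cmod (fourier (w n) \<xi>) \<le> (\<Sum>p\<in>F. cmod (fourier (\<lambda>x. \<rho> p x * u x) \<xi>))"
    "\<And>\<xi>. (\<lambda>n. fourier (w n) \<xi>) \<longlonglongrightarrow> fourier u \<xi>"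
proof -
  have op: "open \<Omega>" using C by (simp add: C11_domain_def)
  have "\<forall>p\<in>closure \<Omega>. \<exists>q. fst q > 0 \<and> (\<forall>t x. 0 < t \<longrightarrow> t < fst q \<longrightarrow> x \<in> closure \<Omega> \<inter> ball p (fst q) \<longrightarrow> x + t *\<^sub>R snd q \<in> \<Omega>)"
    using inward_translation[OF C] by (metis fst_conv snd_conv)
  from bchoice[OF this] obtain q :: "'a \<Rightarrow> real \<times> 'a" where q: "\<And>p. p \<in> closure \<Omega> \<Longrightarrow> fst (q p) > 0"
    "\<And>p t x. p \<in> closure \<Omega> \<Longrightarrow> 0 < t \<Longrightarrow> t < fst (q p) \<Longrightarrow> x \<in> closure \<Omega> \<inter> ball p (fst (q p)) \<Longrightarrow> x + t *\<^sub>R snd (q p) \<in> \<Omega>"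
    by auto
  let ?r = "\<lambda>p. fst (q p)"
  have cpt: "compact (closure \<Omega>)" using bd by (simp add: compact_closure)
  have cov: "closure \<Omega> \<subseteq> (\<Union>p\<in>closure \<Omega>. ball p (?r p / 2))" using q(1) by force
  obtain F where F: "F \<subseteq> closure \<Omega>" "finite F" "closure \<Omega> \<subseteq> (\<Union>p\<in>F. ball p (?r p / 2))"
    by (rule compactE_image[OF cpt open_ball cov])
  have "\<exists>b. test_function (ball p (?r p)) b \<and> (\<forall>x\<in>ball p (?r p / 2). b x = 1)" if p: "p \<in> F" for p
  proof -
    have r: "?r p > 0" using q(1) p F(1) by blast
    have "cball p (?r p / 2) \<subseteq> ball p (?r p)" using r by auto
    then obtain b \<delta> where b: "\<delta> > 0" "test_function (ball p (?r p)) b"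
      "\<And>x y. x \<in> cball p (?r p / 2) \<Longrightarrow> dist x y < \<delta> \<Longrightarrow> b y = 1"
      using smooth_cutoff[OF compact_cball open_ball] by metis
    have "b x = 1" if "x \<in> ball p (?r p / 2)" for x using b(3)[of x x] b(1) that by simp
    thus ?thesis using b(2) by blast
  qed
  hence "\<forall>p\<in>F. \<exists>b. test_function (ball p (?r p)) b \<and> (\<forall>x\<in>ball p (?r p / 2). b x = 1)" by blast
  from bchoice[OF this] obtain b
    where b': "\<forall>p\<in>F. test_function (ball p (?r p)) (b p) \<and> (\<forall>x\<in>ball p (?r p / 2). b p x = 1)" ..
  hence b: "\<And>p. p \<in> F \<Longrightarrow> test_function (ball p (?r p)) (b p)"
    "\<And>p x. p \<in> F \<Longrightarrow> x \<in> ball p (?r p / 2) \<Longrightarrow> b p x = 1" by blast+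
  obtain \<rho> where \<rho>: "\<forall>p\<in>F. test_function (ball p (?r p)) (\<rho> p)" "\<forall>x. (\<Sum>p\<in>F. \<rho> p x) = 1 - (\<Prod>p\<in>F. 1 - b p x)"
    using partition_of_unity[of F "\<lambda>p. ball p (?r p)" b] F(2) b(1) by blast
  have sum1: "(\<Sum>p\<in>F. \<rho> p x * u x) = u x" for x
  proof (cases "x \<in> closure \<Omega>")
    case True
    then obtain p where "p \<in> F" "x \<in> ball p (?r p / 2)" using F(3) by blast
    hence "(\<Prod>p\<in>F. 1 - b p x) = 0" using b(2) F(2) by (intro prod_zero) auto
    thus ?thesis using \<rho>(2) by (simp add: sum_distrib_right[symmetric])
  qed (simp add: u(2))
  have vi: "integrable lborel (\<lambda>x. \<rho> p x * u x)" if "p \<in> F" for p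
    using integrable_test_mult[OF _ u(1)] \<rho>(1) that by blast
  have "\<exists>w. (\<forall>n::nat. test_function \<Omega> (w n)) \<and> (\<forall>n \<xi>. cmod (fourier (w n) \<xi>) \<le> cmod (fourier (\<lambda>x. \<rho> p x * u x) \<xi>))
    \<and> (\<forall>\<xi>. (\<lambda>n. fourier (w n) \<xi>) \<longlonglongrightarrow> fourier (\<lambda>x. \<rho> p x * u x) \<xi>)" if p: "p \<in> F" for p
  proof -
    obtain T where T: "compact T" "T \<subseteq> ball p (?r p)" "\<And>x. x \<notin> T \<Longrightarrow> \<rho> p x = 0"
      using test_functionE \<rho>(1) p by blast
    have pc: "p \<in> closure \<Omega>" using p F(1) by blast
    show ?thesis
    proof (rule inward_mollification[OF vi[OF p] _ _ op q(1)[OF pc]])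
      show "compact (closure \<Omega> \<inter> T)" by (rule compact_Int[OF cpt T(1)])
      show "\<rho> p x * u x = 0" if "x \<notin> closure \<Omega> \<inter> T" for x using that T(3) u(2) by auto
      show "x + t *\<^sub>R snd (q p) \<in> \<Omega>" if "0 < t" "t < ?r p" "x \<in> closure \<Omega> \<inter> T" for t x
        using q(2)[OF pc that(1,2)] that(3) T(2) by blast
    qed
  qed
  hence "\<forall>p\<in>F. \<exists>w. (\<forall>n::nat. test_function \<Omega> (w n)) \<and> (\<forall>n \<xi>. cmod (fourier (w n) \<xi>) \<le> cmod (fourier (\<lambda>x. \<rho> p x * u x) \<xi>))
    \<and> (\<forall>\<xi>. (\<lambda>n. fourier (w n) \<xi>) \<longlonglongrightarrow> fourier (\<lambda>x. \<rho> p x * u x) \<xi>)" by blast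
  from bchoice[OF this] obtain w where w': "\<forall>p\<in>F. (\<forall>n::nat. test_function \<Omega> (w p n))
    \<and> (\<forall>n \<xi>. cmod (fourier (w p n) \<xi>) \<le> cmod (fourier (\<lambda>x. \<rho> p x * u x) \<xi>))
    \<and> (\<forall>\<xi>. (\<lambda>n. fourier (w p n) \<xi>) \<longlonglongrightarrow> fourier (\<lambda>x. \<rho> p x * u x) \<xi>)" ..
  hence w: "\<And>p n. p \<in> F \<Longrightarrow> test_function \<Omega> (w p n)"
    "\<And>p n \<xi>. p \<in> F \<Longrightarrow> cmod (fourier (w p n) \<xi>) \<le> cmod (fourier (\<lambda>x. \<rho> p x * u x) \<xi>)"
    "\<And>p \<xi>. p \<in> F \<Longrightarrow> (\<lambda>n. fourier (w p n) \<xi>) \<longlonglongrightarrow> fourier (\<lambda>x. \<rho> p x * u x) \<xi>" by blast+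
  have Fw: "fourier (\<lambda>x. \<Sum>p\<in>F. w p n x) \<xi> = (\<Sum>p\<in>F. fourier (w p n) \<xi>)" for n \<xi>
    by (rule fourier_sum) (rule test_function_integrable[OF w(1)])
  show ?thesis
  proof (rule that[of F \<rho> "\<lambda>n x. \<Sum>p\<in>F. w p n x"])
    show "finite F" by (rule F)
    show "test_function UNIV (\<rho> p)" if "p \<in> F" for p using \<rho>(1) that test_function_UNIV by blast
    show "test_function \<Omega> (\<lambda>x. \<Sum>p\<in>F. w p n x)" for n by (intro test_function_sum w(1))
    show "cmod (fourier (\<lambda>x. \<Sum>p\<in>F. w p n x) \<xi>) \<le> (\<Sum>p\<in>F. cmod (fourier (\<lambda>x. \<rho> p x * u x) \<xi>))" for n \<xi>
      unfolding Fw by (intro sum_norm_le w(2))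
    have "(\<lambda>n. \<Sum>p\<in>F. fourier (w p n) \<xi>) \<longlonglongrightarrow> (\<Sum>p\<in>F. fourier (\<lambda>x. \<rho> p x * u x) \<xi>)" for \<xi>
      by (intro tendsto_sum w(3))
    moreover have "(\<Sum>p\<in>F. fourier (\<lambda>x. \<rho> p x * u x) \<xi>) = fourier u \<xi>" for \<xi>
      using fourier_sum[of F "\<lambda>p x. \<rho> p x * u x" \<xi>, OF vi] by (simp add: sum1)
    ultimately show "(\<lambda>n. fourier (\<lambda>x. \<Sum>p\<in>F. w p n x) \<xi>) \<longlonglongrightarrow> fourier u \<xi>" for \<xi>
      unfolding Fw by simp
  qed
qed

text \<open>Multiplication by a test function preserves Sobolev regularity: by
  \<open>1 + |\<xi>| \<le> (1 + |\<xi> - \<eta>|) (1 + |\<eta>|)\<close> the weight passes under the convolution with \<open>F \<beta>\<close>, and Young's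
  inequality applies.\<close>

lemma fourier_test_mult_weighted:
  fixes u \<beta> :: "'a::euclidean_space \<Rightarrow> complex"
  assumes t: "test_function \<Omega> \<beta>" and u: "integrable lborel u" and s: "0 \<le> s" "s \<le> 1"
    and w: "integrable lborel (\<lambda>\<xi>. ((1 + norm \<xi>) powr s * cmod (fourier u \<xi>))\<^sup>2)"
  shows "integrable lborel (\<lambda>\<xi>. ((1 + norm \<xi>) powr s * cmod (fourier (\<lambda>x. \<beta> x * u x) \<xi>))\<^sup>2)"
proof -
  have [measurable]: "\<beta> \<in> borel_measurable borel" "u \<in> borel_measurable borel"
    using test_function_measurable[OF t] u by auto
  let ?k = "\<lambda>h. (1 + norm h) * cmod (fourier \<beta> h)"
  let ?f = "\<lambda>\<xi>. (1 + norm \<xi>) powr s * cmod (fourier u \<xi>)"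
  let ?g = "\<lambda>\<xi>. (1 + norm \<xi>) powr s * cmod (fourier (\<lambda>x. \<beta> x * u x) \<xi>)"
  have k: "integrable lborel ?k" using fourier_test_weighted_integrable[OF t, of 1] by simp
  have pt: "ennreal (?g \<xi>) \<le> (\<integral>\<^sup>+\<eta>. ennreal (?k (\<xi> - \<eta>) * ?f \<eta>) \<partial>lborel)" for \<xi>
  proof -
    have "?g \<xi> \<le> (2 * pi) ^ DIM('a) * ?g \<xi>"
      using mult_right_mono[of 1 "(2 * pi) ^ DIM('a)" "?g \<xi>"] one_le_power[of "2 * pi" "DIM('a)"] pi_ge_two by simp
    also have "\<dots> = norm (\<integral>\<eta>. of_real ((1 + norm \<xi>) powr s) * (fourier \<beta> (\<xi> - \<eta>) * fourier u \<eta>) \<partial>lborel)"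
      unfolding integral_mult_right_zero fourier_test_mult[OF t u] by (simp add: norm_mult)
    finally have "ennreal (?g \<xi>) \<le> \<dots>" by (rule ennreal_leI)
    also have "\<dots> \<le> (\<integral>\<^sup>+\<eta>. ennreal (norm (of_real ((1 + norm \<xi>) powr s) * (fourier \<beta> (\<xi> - \<eta>) * fourier u \<eta>))) \<partial>lborel)"
      by (rule norm_integral_le_nn_integral)
    also have "\<dots> \<le> (\<integral>\<^sup>+\<eta>. ennreal (?k (\<xi> - \<eta>) * ?f \<eta>) \<partial>lborel)"
    proof (intro nn_integral_mono ennreal_leI)
      fix \<eta> :: 'a
      have n0: "0 \<le> norm (\<xi> - \<eta>) * norm \<eta>" by simp
      have "1 + norm \<xi> \<le> (1 + norm (\<xi> - \<eta>)) * (1 + norm \<eta>)"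
        using norm_triangle_ineq[of "\<xi> - \<eta>" \<eta>] n0 unfolding diff_add_cancel ring_distribs by linarith
      hence "(1 + norm \<xi>) powr s \<le> ((1 + norm (\<xi> - \<eta>)) * (1 + norm \<eta>)) powr s" using s by (intro powr_mono2) auto
      also have "\<dots> = (1 + norm (\<xi> - \<eta>)) powr s * (1 + norm \<eta>) powr s" by (simp add: powr_mult)
      also have "\<dots> \<le> (1 + norm (\<xi> - \<eta>)) * (1 + norm \<eta>) powr s"
        using powr_mono[of s 1 "1 + norm (\<xi> - \<eta>)"] s by (intro mult_right_mono) auto
      finally have "(1 + norm \<xi>) powr s * (cmod (fourier \<beta> (\<xi> - \<eta>)) * cmod (fourier u \<eta>))
         \<le> ((1 + norm (\<xi> - \<eta>)) * (1 + norm \<eta>) powr s) * (cmod (fourier \<beta> (\<xi> - \<eta>)) * cmod (fourier u \<eta>))"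
        by (rule mult_right_mono) simp
      thus "norm (of_real ((1 + norm \<xi>) powr s) * (fourier \<beta> (\<xi> - \<eta>) * fourier u \<eta>)) \<le> ?k (\<xi> - \<eta>) * ?f \<eta>"
        by (simp add: norm_mult mult_ac)
    qed
    finally show ?thesis .
  qed
  have "(\<integral>\<^sup>+\<xi>. ennreal ((?g \<xi>)\<^sup>2) \<partial>lborel) = (\<integral>\<^sup>+\<xi>. (ennreal (?g \<xi>))\<^sup>2 \<partial>lborel)" by (simp add: ennreal_power)
  also have "\<dots> \<le> (\<integral>\<^sup>+\<xi>. (\<integral>\<^sup>+\<eta>. ennreal (?k (\<xi> - \<eta>) * ?f \<eta>) \<partial>lborel)\<^sup>2 \<partial>lborel)"
    by (intro nn_integral_mono power_mono pt) simp
  also have "\<dots> \<le> (\<integral>\<^sup>+h. ennreal (?k h) \<partial>lborel)\<^sup>2 * (\<integral>\<^sup>+\<eta>. ennreal ((?f \<eta>)\<^sup>2) \<partial>lborel)"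
    by (rule young_L2) auto
  also have "\<dots> < \<infinity>"
    using k w by (simp add: ennreal_mult_less_top integrable_iff_bounded power2_eq_square abs_mult)
  finally show ?thesis by (simp add: integrable_iff_bounded)
qed

lemma integral_test_fourier:
  fixes \<phi> u :: "'a::euclidean_space \<Rightarrow> complex"
  assumes t: "test_function \<Omega> \<phi>" and u: "integrable lborel u"
  shows "(\<integral>\<xi>. fourier u \<xi> * fourier \<phi> (- \<xi>) \<partial>lborel) = (2 * pi) ^ DIM('a) * (\<integral>x. u x * \<phi> x \<partial>lborel)"
proof -
  have a: "integrable lborel (\<lambda>\<xi>. fourier \<phi> (- \<xi>))"
    using integrable_lborel_reflect[OF fourier_test_integrable[OF t], of 0] by simp
  have inv: "fourier (\<lambda>\<xi>. fourier \<phi> (- \<xi>)) x = (2 * pi) ^ DIM('a) *\<^sub>R \<phi> x" for x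
  proof -
    have "fourier (\<lambda>\<xi>. fourier \<phi> (- \<xi>)) x = (\<integral>\<xi>. cis (- ((0 - \<xi>) \<bullet> - x)) * fourier \<phi> (0 - \<xi>) \<partial>lborel)"
      by (simp add: fourier_def)
    also have "\<dots> = (\<integral>\<xi>. cis (- (\<xi> \<bullet> - x)) * fourier \<phi> \<xi> \<partial>lborel)" by (rule integral_lborel_reflect)
    also have "\<dots> = fourier (fourier \<phi>) (- x)" unfolding fourier_def[of "fourier \<phi>"] ..
    also have "\<dots> = (2 * pi) ^ DIM('a) *\<^sub>R \<phi> x" by (rule fourier_inversion_test[OF t])
    finally show ?thesis .
  qed
  have "(\<integral>\<xi>. fourier u \<xi> * fourier \<phi> (- \<xi>) \<partial>lborel) = (\<integral>x. u x * ((2 * pi) ^ DIM('a) *\<^sub>R \<phi> x) \<partial>lborel)"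
    unfolding inv[symmetric] by (rule fourier_multiplication_formula[OF u a])
  also have "\<dots> = (\<integral>x. complex_of_real ((2 * pi) ^ DIM('a)) * (u x * \<phi> x) \<partial>lborel)"
    by (intro Bochner_Integration.integral_cong refl) (simp add: scaleR_conv_of_real mult_ac)
  finally show ?thesis by (simp only: integral_mult_right_zero of_real_power of_real_mult of_real_numeral)
qed

text \<open>Test the equation with \<open>e\<close> itself, more precisely with test functions that approximate its conjugate:
  in the limit \<open>\<integral> (|\<xi>|\<^sup>\<alpha> - \<mu>) |F e|\<^sup>2 = 0\<close>, and the multiplier is positive away from \<open>\<xi> = 0\<close>. The Sobolev
  regularity makes the integrands dominated.\<close>

lemma (in frac_kernel) weak_eigen_nonpos:
  assumes C: "C11_domain \<Omega>" and bd: "bounded \<Omega>" and e: "weak_eigen \<Omega> \<mu> e" and \<mu>: "\<mu> \<le> 0"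
    and ae: "AE x in lborel. x \<notin> \<Omega> \<longrightarrow> e x = 0"
    and w: "integrable lborel (\<lambda>\<xi>. ((1 + norm \<xi>) powr (\<alpha> / 2) * cmod (fourier e \<xi>))\<^sup>2)"
  shows "AE x in lborel. e x = 0"
proof -
  note ei = weak_eigenD[OF e]
  have [measurable]: "e \<in> borel_measurable borel" by (rule ei)
  \<comment> \<open>a version of the conjugate of \<open>e\<close> that vanishes everywhere outside the closure\<close>
  define u where "u x = indicator (closure \<Omega>) x * cnj (e x)" for x
  have um [measurable]: "u \<in> borel_measurable borel" unfolding u_def by measurable
  have "AE x in lborel. cnj (e x) = u x"
    using ae by eventually_elim (use closure_subset[of \<Omega>] in \<open>auto simp: u_def indicator_def\<close>)
  have ui: "integrable lborel u"
    by (rule Bochner_Integration.integrable_bound[OF ei(1)]) (auto simp: u_def norm_mult indicator_def)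
  have Fu: "fourier u \<xi> = cnj (fourier e (- \<xi>))" for \<xi>
  proof -
    have "fourier u \<xi> = fourier (\<lambda>x. cnj (e x)) \<xi>"
      unfolding fourier_def by (intro integral_cong_AE) (use \<open>AE x in lborel. cnj (e x) = u x\<close> in auto)
    thus ?thesis by (simp add: fourier_cnj)
  qed
  have uw: "integrable lborel (\<lambda>\<xi>. ((1 + norm \<xi>) powr (\<alpha> / 2) * cmod (fourier u \<xi>))\<^sup>2)"
    unfolding Fu using integrable_lborel_reflect[OF w, of 0] by simp
  obtain F :: "'a set" and \<rho> \<phi> where F: "finite F" "\<And>p. p \<in> F \<Longrightarrow> test_function UNIV (\<rho> p)"
    "\<And>n::nat. test_function \<Omega> (\<phi> n)"
    "\<And>n \<xi>. cmod (fourier (\<phi> n) \<xi>) \<le> (\<Sum>p\<in>F. cmod (fourier (\<lambda>x. \<rho> p x * u x) \<xi>))"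
    "\<And>\<xi>. (\<lambda>n. fourier (\<phi> n) \<xi>) \<longlonglongrightarrow> fourier u \<xi>"
    by (rule inward_approximation[OF C bd ui]) (auto simp: u_def)
  have \<phi>m [measurable]: "fourier (\<phi> n) \<in> borel_measurable borel" for n
    by (intro fourier_measurable test_function_measurable[OF F(3)])
  let ?v = "\<lambda>p \<xi>. cmod (fourier (\<lambda>x. \<rho> p x * u x) (- \<xi>))"
  have vw: "integrable lborel (\<lambda>\<xi>. ((1 + norm \<xi>) powr (\<alpha> / 2) * ?v p \<xi>)\<^sup>2)" if "p \<in> F" for p
    using integrable_lborel_reflect[OF fourier_test_mult_weighted[OF F(2)[OF that] ui _ _ uw], of 0] \<alpha>_range by simp
  let ?m = "\<lambda>\<xi>::'a. norm \<xi> powr \<alpha> - \<mu>"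
  let ?W = "\<lambda>\<xi>. (1 - \<mu>) * (\<Sum>p\<in>F. ((1 + norm \<xi>) powr (\<alpha> / 2) * cmod (fourier e \<xi>))\<^sup>2 + ((1 + norm \<xi>) powr (\<alpha> / 2) * ?v p \<xi>)\<^sup>2)"
  have m0: "0 \<le> ?m \<xi>" for \<xi> using \<mu> powr_ge_zero[of "norm \<xi>" \<alpha>] by linarith
  have m: "?m \<xi> \<le> (1 - \<mu>) * ((1 + norm \<xi>) powr (\<alpha> / 2) * (1 + norm \<xi>) powr (\<alpha> / 2))" for \<xi>
  proof -
    have "norm \<xi> powr \<alpha> \<le> (1 + norm \<xi>) powr \<alpha>" using \<alpha>_range by (intro powr_mono2) auto
    moreover have "1 \<le> (1 + norm \<xi>) powr \<alpha>" using \<alpha>_range by (intro ge_one_powr_ge_zero) auto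
    hence "- \<mu> * 1 \<le> - \<mu> * (1 + norm \<xi>) powr \<alpha>" using \<mu> by (intro mult_left_mono) auto
    ultimately show ?thesis by (simp add: powr_add[symmetric] algebra_simps)
  qed
  have eq0: "(\<integral>\<xi>. of_real (?m \<xi>) * (fourier e \<xi> * fourier (\<phi> n) (- \<xi>)) \<partial>lborel) = 0" for n
  proof -
    note t = F(3)[of n]
    have i1: "integrable lborel (\<lambda>\<xi>. (norm \<xi> powr \<alpha>) *\<^sub>R fourier e \<xi> * fourier (\<phi> n) (- \<xi>))"
      using integrable_mult_bounded[OF fourier_test_powr_integrable[OF \<alpha>_pos \<alpha>_less_1 t] _ fourier_bound[OF ei(1)]]
      by (simp add: scaleR_conv_of_real mult_ac)
    have i2: "integrable lborel (\<lambda>\<xi>. of_real \<mu> * (fourier e \<xi> * fourier (\<phi> n) (- \<xi>)))"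
      using integrable_mult_bounded[OF integrable_lborel_reflect[OF fourier_test_integrable[OF t], of 0] _ fourier_bound[OF ei(1)]]
      by (simp add: mult_ac)
    have "(\<integral>\<xi>. of_real (?m \<xi>) * (fourier e \<xi> * fourier (\<phi> n) (- \<xi>)) \<partial>lborel)
       = (\<integral>\<xi>. (norm \<xi> powr \<alpha>) *\<^sub>R fourier e \<xi> * fourier (\<phi> n) (- \<xi>) - of_real \<mu> * (fourier e \<xi> * fourier (\<phi> n) (- \<xi>)) \<partial>lborel)"
      by (intro Bochner_Integration.integral_cong refl) (simp add: scaleR_conv_of_real algebra_simps)
    also have "\<dots> = (\<integral>\<xi>. (norm \<xi> powr \<alpha>) *\<^sub>R fourier e \<xi> * fourier (\<phi> n) (- \<xi>) \<partial>lborel)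
        - of_real \<mu> * (\<integral>\<xi>. fourier e \<xi> * fourier (\<phi> n) (- \<xi>) \<partial>lborel)"
      unfolding Bochner_Integration.integral_diff[OF i1 i2] integral_mult_right_zero ..
    also have "(\<integral>\<xi>. (norm \<xi> powr \<alpha>) *\<^sub>R fourier e \<xi> * fourier (\<phi> n) (- \<xi>) \<partial>lborel) = (2 * pi) ^ DIM('a) * (\<integral>x. e x * fracL \<alpha> (\<phi> n) x \<partial>lborel)"
      using frac_laplacian_pairing[OF \<alpha>_pos \<alpha>_less_1 t ei(1)] by (simp add: field_simps)
    finally show ?thesis unfolding integral_test_fourier[OF t ei(1)] ei(4)[OF t] by simp
  qed
  have dom: "norm (of_real (?m \<xi>) * (fourier e \<xi> * fourier (\<phi> n) (- \<xi>))) \<le> ?W \<xi>" for n \<xi>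
  proof -
    let ?s = "(1 + norm \<xi>) powr (\<alpha> / 2)"
    have "norm (of_real (?m \<xi>) * (fourier e \<xi> * fourier (\<phi> n) (- \<xi>))) = ?m \<xi> * (cmod (fourier e \<xi>) * cmod (fourier (\<phi> n) (- \<xi>)))"
      using m0[of \<xi>] by (simp add: norm_mult del: of_real_diff)
    also have "\<dots> \<le> ((1 - \<mu>) * (?s * ?s)) * (cmod (fourier e \<xi>) * (\<Sum>p\<in>F. ?v p \<xi>))"
      by (intro mult_mono m F(4) order_refl) (use \<mu> in auto)
    also have "\<dots> = (1 - \<mu>) * (\<Sum>p\<in>F. (?s * cmod (fourier e \<xi>)) * (?s * ?v p \<xi>))"
      by (simp add: sum_distrib_left mult_ac)
    also have "\<dots> \<le> ?W \<xi>"
    proof (intro mult_left_mono sum_mono)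
      have xy: "x * y \<le> x\<^sup>2 + y\<^sup>2" if "0 \<le> x" "0 \<le> y" for x y :: real
        using sum_squares_bound[of x y] mult_nonneg_nonneg[OF that] by simp
      show "(?s * cmod (fourier e \<xi>)) * (?s * ?v p \<xi>) \<le> (?s * cmod (fourier e \<xi>))\<^sup>2 + (?s * ?v p \<xi>)\<^sup>2" for p
        by (rule xy) simp_all
    qed (use \<mu> in simp)
    finally show ?thesis .
  qed
  let ?G = "\<lambda>\<xi>. ?m \<xi> * (cmod (fourier e \<xi>))\<^sup>2"
  have pt: "of_real (?m \<xi>) * (fourier e \<xi> * fourier u (- \<xi>)) = complex_of_real (?G \<xi>)" for \<xi>
    unfolding Fu using complex_norm_square[of "fourier e \<xi>"] by (simp del: of_real_diff)
  have Wi: "integrable lborel ?W"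
    by (intro integrable_mult_right Bochner_Integration.integrable_sum Bochner_Integration.integrable_add w vw)
  have lim: "AE \<xi> in lborel. (\<lambda>n. of_real (?m \<xi>) * (fourier e \<xi> * fourier (\<phi> n) (- \<xi>))) \<longlonglongrightarrow> complex_of_real (?G \<xi>)"
    unfolding pt[symmetric] by (intro AE_I2 tendsto_intros F(5))
  have meas: "(\<lambda>\<xi>. complex_of_real (?G \<xi>)) \<in> borel_measurable lborel"
    "(\<lambda>\<xi>. of_real (?m \<xi>) * (fourier e \<xi> * fourier (\<phi> n) (- \<xi>))) \<in> borel_measurable lborel" for n by measurable
  have "(\<lambda>n. \<integral>\<xi>. of_real (?m \<xi>) * (fourier e \<xi> * fourier (\<phi> n) (- \<xi>)) \<partial>lborel) \<longlonglongrightarrow> (\<integral>\<xi>. complex_of_real (?G \<xi>) \<partial>lborel)"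
    by (rule integral_dominated_convergence[OF meas Wi lim]) (intro AE_I2 dom)
  hence "(\<integral>\<xi>. complex_of_real (?G \<xi>) \<partial>lborel) = 0" unfolding eq0 using LIMSEQ_unique tendsto_const by blast
  hence G0: "(\<integral>\<xi>. ?G \<xi> \<partial>lborel) = 0" unfolding integral_complex_of_real by simp
  have "integrable lborel (\<lambda>\<xi>. complex_of_real (?G \<xi>))"
    by (rule integrable_dominated_convergence[OF meas Wi lim]) (intro AE_I2 dom)
  hence "integrable lborel (\<lambda>\<xi>. Re (complex_of_real (?G \<xi>)))" by (rule integrable_Re)
  hence "integrable lborel ?G" by simp
  hence "AE \<xi> in lborel. ?G \<xi> = 0" using G0 m0 by (subst (asm) integral_nonneg_eq_0_iff_AE) auto
  moreover have "AE \<xi> in lborel. \<xi> \<noteq> (0::'a)" by (rule AE_lborel_singleton)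
  ultimately have "AE \<xi> in lborel. fourier e \<xi> = 0"
  proof eventually_elim
    case (elim \<xi>)
    have "0 < norm \<xi> powr \<alpha>" using elim(2) by simp
    thus ?case using elim(1) \<mu> by auto
  qed
  hence "(\<integral>\<^sup>+\<xi>. ennreal ((cmod (fourier e \<xi>))\<^sup>2) \<partial>lborel) = 0" by (subst nn_integral_0_iff_AE) auto
  hence "ennreal ((2 * pi) ^ DIM('a)) * (\<integral>\<^sup>+x. ennreal ((cmod (e x))\<^sup>2) \<partial>lborel) = 0"
    using plancherel_lower[OF ei(1)] by simp
  hence "(\<integral>\<^sup>+x. ennreal ((cmod (e x))\<^sup>2) \<partial>lborel) = 0"
    using zero_less_power[of "2 * pi" "DIM('a)"] pi_gt_zero by (simp add: ennreal_eq_0_iff not_le del: zero_less_power)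
  thus ?thesis by (subst (asm) nn_integral_0_iff_AE) auto
qed

section \<open>Dirichlet eigenfunctions and the estimate\<close>

text \<open>The truncations to large balls agree with \<open>u\<close> almost everywhere, so the Fourier integral of \<open>u\<close> is
  itself a Plancherel transform, and these are unique up to null sets.\<close>

lemma fourier_L2_bounded_support:
  fixes u :: "'a::euclidean_space \<Rightarrow> complex"
  assumes u: "square_integrable u" and bd: "bounded \<Omega>" and ae: "AE x in lborel. x \<notin> \<Omega> \<longrightarrow> u x = 0"
  shows "integrable lborel u" "AE \<xi> in lborel. fourier_L2 u \<xi> = fourier u \<xi>" "fourier_L2 u \<in> borel_measurable borel"
proof -
  have [measurable]: "u \<in> borel_measurable borel" using u by (simp add: square_integrable_def)
  obtain R where R: "\<And>x. x \<in> \<Omega> \<Longrightarrow> norm x \<le> R" using bd bounded_iff by metis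
  show ui: "integrable lborel u"
  proof (rule Bochner_Integration.integrable_bound)
    show "integrable lborel (\<lambda>x. (cmod (u x))\<^sup>2 + indicator (cball 0 R) x)"
    proof (rule Bochner_Integration.integrable_add)
      show "integrable lborel (\<lambda>x. (cmod (u x))\<^sup>2)" using u by (simp add: square_integrable_def)
      show "integrable lborel (indicat_real (cball (0::'a) R))" 
        using emeasure_compact_finite[OF compact_cball[of "0::'a" R]] by (intro integrable_real_indicator) auto
    qed
    show "AE x in lborel. norm (u x) \<le> norm ((cmod (u x))\<^sup>2 + indicator (cball 0 R) x :: real)"
      using ae
    proof eventually_elim
      case (elim x)
      have "t \<le> t\<^sup>2 + 1" for t :: real using sum_squares_bound[of t 1] zero_le_power2[of t] unfolding power_one mult_1_right by linarith
      thus ?case using elim R[of x] by (cases "x \<in> \<Omega>") auto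
    qed
  qed simp
  have trunc: "fourier (\<lambda>x. indicator (cball 0 r) x *\<^sub>R u x) = fourier u" if "R \<le> r" for r
  proof
    have [measurable]: "cball (0::'a) r \<in> sets borel" by simp
    fix \<xi>
    show "fourier (\<lambda>x. indicator (cball 0 r) x *\<^sub>R u x) \<xi> = fourier u \<xi>"
      unfolding fourier_def
    proof (rule integral_cong_AE)
      show "AE x in lborel. cis (- (x \<bullet> \<xi>)) * indicator (cball 0 r) x *\<^sub>R u x = cis (- (x \<bullet> \<xi>)) * u x"
        using ae by eventually_elim (use R that in \<open>force simp: indicator_def\<close>)
    qed measurable
  qed
  have ev: "\<forall>\<^sub>F r in at_top. fourier (\<lambda>x. indicator (cball 0 r) x *\<^sub>R u x) = fourier u"
    using eventually_ge_at_top[of R] by eventually_elim (rule trunc)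
  have "square_integrable (fourier u)"
    unfolding square_integrable_def
  proof
    have "(\<integral>\<^sup>+\<xi>. ennreal ((cmod (fourier u \<xi>))\<^sup>2) \<partial>lborel) \<le> ennreal ((2 * pi) ^ DIM('a)) * ennreal ((L2norm u)\<^sup>2)"
      using plancherel_upper[OF ui] unfolding square_integrableD(2)[OF u] .
    also have "\<dots> < \<infinity>" by (simp add: ennreal_mult_less_top)
    finally show "integrable lborel (\<lambda>\<xi>. (cmod (fourier u \<xi>))\<^sup>2)" by (simp add: integrable_iff_bounded)
  qed simp
  moreover have "((\<lambda>r. \<integral>\<^sup>+\<xi>. ennreal ((cmod (fourier u \<xi> - fourier (\<lambda>x. indicator (cball 0 r) x *\<^sub>R u x) \<xi>))\<^sup>2) \<partial>lborel) \<longlongrightarrow> 0) at_top"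
    by (rule tendsto_eventually) (use ev in eventually_elim, simp)
  ultimately have "is_fourier_L2 u (fourier u)" by (simp add: is_fourier_L2_def)
  hence isF: "is_fourier_L2 u (fourier_L2 u)" unfolding fourier_L2_def by (rule someI[of "is_fourier_L2 u"])
  show [measurable]: "fourier_L2 u \<in> borel_measurable borel"
    using isF by (simp add: is_fourier_L2_def square_integrable_def)
  let ?I = "\<integral>\<^sup>+\<xi>. ennreal ((cmod (fourier_L2 u \<xi> - fourier u \<xi>))\<^sup>2) \<partial>lborel"
  have "((\<lambda>r. \<integral>\<^sup>+\<xi>. ennreal ((cmod (fourier_L2 u \<xi> - fourier (\<lambda>x. indicator (cball 0 r) x *\<^sub>R u x) \<xi>))\<^sup>2) \<partial>lborel) \<longlongrightarrow> ?I) at_top"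
    by (rule tendsto_eventually) (use ev in eventually_elim, simp)
  hence "?I = 0" using isF unfolding is_fourier_L2_def by (intro tendsto_unique[OF trivial_limit_at_top_linorder]) auto
  thus "AE \<xi> in lborel. fourier_L2 u \<xi> = fourier u \<xi>" by (subst (asm) nn_integral_0_iff_AE) auto
qed

lemma frac_laplacian_bounded_support:
  fixes u :: "'a::euclidean_space \<Rightarrow> complex"
  assumes a: "0 < \<alpha>" "\<alpha> < 1" and t: "test_function \<Omega>' \<phi>"
    and u: "square_integrable u" "bounded \<Omega>" "AE x in lborel. x \<notin> \<Omega> \<longrightarrow> u x = 0"
  shows "frac_laplacian \<alpha> u \<phi> = (\<integral>x. u x * fracL \<alpha> \<phi> x \<partial>lborel)"
proof -
  note F = fourier_L2_bounded_support[OF u]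
  have [measurable]: "fourier u \<in> borel_measurable borel" "fourier \<phi> \<in> borel_measurable borel" "fourier_L2 u \<in> borel_measurable borel"
    using F(1,3) test_function_measurable[OF t] by (auto intro!: fourier_measurable)
  have "(\<integral>\<xi>. (norm \<xi> powr \<alpha>) *\<^sub>R fourier_L2 u \<xi> * fourier \<phi> (- \<xi>) \<partial>lborel)
      = (\<integral>\<xi>. (norm \<xi> powr \<alpha>) *\<^sub>R fourier u \<xi> * fourier \<phi> (- \<xi>) \<partial>lborel)"
    using F(2) by (intro integral_cong_AE) auto
  thus ?thesis unfolding frac_laplacian_def frac_laplacian_pairing[OF a t F(1), symmetric] by simp
qed

lemma (in frac_kernel) dirichlet_eigenfunction_weak:
  assumes e: "dirichlet_eigenfunction \<alpha> \<Omega> \<mu> e" and bd: "bounded \<Omega>"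
  shows "weak_eigen \<Omega> \<mu> e" "AE x in lborel. x \<notin> \<Omega> \<longrightarrow> e x = 0"
    "integrable lborel (\<lambda>\<xi>. ((1 + norm \<xi>) powr (\<alpha> / 2) * cmod (fourier e \<xi>))\<^sup>2)"
proof -
  have se: "square_integrable e" and ag: "agrees_on \<Omega> (frac_laplacian \<alpha> e) (\<lambda>x. complex_of_real \<mu> * e x)"
    and so: "square_integrable (\<lambda>\<xi>. (1 + (norm \<xi>)\<^sup>2) powr (\<alpha> / 4) *\<^sub>R fourier_L2 e \<xi>)"
    using e by (auto simp: dirichlet_eigenfunction_def sobolev_def)
  show ae: "AE x in lborel. x \<notin> \<Omega> \<longrightarrow> e x = 0" using e by (simp add: dirichlet_eigenfunction_def)
  note F = fourier_L2_bounded_support[OF se bd ae]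
  have "(\<integral>x. e x * fracL \<alpha> \<phi> x \<partial>lborel) = of_real \<mu> * (\<integral>x. e x * \<phi> x \<partial>lborel)" if t: "test_function \<Omega> \<phi>" for \<phi>
  proof -
    have "(\<integral>x. e x * fracL \<alpha> \<phi> x \<partial>lborel) = (\<integral>x. of_real \<mu> * (e x * \<phi> x) \<partial>lborel)"
      using ag t frac_laplacian_bounded_support[OF \<alpha>_pos \<alpha>_less_1 t se bd ae] by (simp add: agrees_on_def mult.assoc)
    thus ?thesis by (simp only: integral_mult_right_zero)
  qed
  thus "weak_eigen \<Omega> \<mu> e" unfolding weak_eigen_def using F(1) se by blast
  have [measurable]: "fourier e \<in> borel_measurable borel" using F(1) by (auto intro!: fourier_measurable)
  show "integrable lborel (\<lambda>\<xi>. ((1 + norm \<xi>) powr (\<alpha> / 2) * cmod (fourier e \<xi>))\<^sup>2)"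
  proof (rule Bochner_Integration.integrable_bound)
    show "integrable lborel (\<lambda>\<xi>. 2 * (cmod ((1 + (norm \<xi>)\<^sup>2) powr (\<alpha> / 4) *\<^sub>R fourier_L2 e \<xi>))\<^sup>2)"
      using so by (simp add: square_integrable_def)
    show "AE \<xi> in lborel. norm (((1 + norm \<xi>) powr (\<alpha> / 2) * cmod (fourier e \<xi>))\<^sup>2)
      \<le> norm (2 * (cmod ((1 + (norm \<xi>)\<^sup>2) powr (\<alpha> / 4) *\<^sub>R fourier_L2 e \<xi>))\<^sup>2)"
      using F(2)
    proof eventually_elim
      case (elim \<xi>)
      let ?r = "norm \<xi>"
      have "(1 + ?r)\<^sup>2 \<le> 2 * (1 + ?r\<^sup>2)" using sum_squares_bound[of 1 ?r] by (simp add: power2_sum)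
      hence "((1 + ?r)\<^sup>2) powr (\<alpha> / 2) \<le> (2 * (1 + ?r\<^sup>2)) powr (\<alpha> / 2)" using \<alpha>_range by (intro powr_mono2) auto
      also have "\<dots> = 2 powr (\<alpha> / 2) * (1 + ?r\<^sup>2) powr (\<alpha> / 2)" by (rule powr_mult)
      also have "\<dots> \<le> 2 * (1 + ?r\<^sup>2) powr (\<alpha> / 2)"
        using powr_mono[of "\<alpha> / 2" 1 "2::real"] \<alpha>_range by (intro mult_right_mono) auto
      finally have "((1 + ?r) powr (\<alpha> / 2))\<^sup>2 \<le> 2 * ((1 + ?r\<^sup>2) powr (\<alpha> / 4))\<^sup>2"
        by (simp add: powr_power powr_mult power2_eq_square powr_add[symmetric])
      hence "((1 + ?r) powr (\<alpha> / 2))\<^sup>2 * (cmod (fourier e \<xi>))\<^sup>2 \<le> 2 * ((1 + ?r\<^sup>2) powr (\<alpha> / 4))\<^sup>2 * (cmod (fourier e \<xi>))\<^sup>2"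
        by (rule mult_right_mono) simp
      thus ?case using elim by (simp add: power_mult_distrib)
    qed
  qed simp
qed

text \<open>Split \<open>e = \<zeta> e + (1 - \<zeta>) e\<close> with a cut-off \<open>\<zeta>\<close> that is \<open>1\<close> near the support of \<open>\<beta>\<close>. For \<open>\<mu> \<le> 0\<close> the
  eigenfunction vanishes.\<close>

lemma (in frac_kernel) commutator_estimate:
  fixes \<Omega> :: "'a set" and \<beta> :: "'a \<Rightarrow> complex"
  assumes \<alpha>2: "1/2 < \<alpha>" and C11: "C11_domain \<Omega>" and bd: "bounded \<Omega>" and b: "test_function \<Omega> \<beta>"
  shows "\<exists>C. \<forall>\<mu> e. dirichlet_eigenfunction \<alpha> \<Omega> \<mu> e \<longrightarrow>
    (\<exists>g. square_integrable g \<and> agrees_on UNIV (commutator \<beta> \<alpha> e) g \<and> L2norm g \<le> C * \<mu> powr (1 - 1 / \<alpha>) * L2norm e)"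
proof -
  have op: "open \<Omega>" using C11 by (simp add: C11_domain_def)
  have bm [measurable]: "\<beta> \<in> borel_measurable borel" by (rule test_function_measurable[OF b])
  obtain S where S: "compact S" "S \<subseteq> \<Omega>" "\<And>x. x \<notin> S \<Longrightarrow> \<beta> x = 0" by (rule test_functionE[OF b], rule that)
  obtain \<zeta> \<delta> where z: "\<delta> > 0" "test_function \<Omega> \<zeta>" "\<And>x y. x \<in> S \<Longrightarrow> dist x y < \<delta> \<Longrightarrow> \<zeta> y = 1"
    by (rule smooth_cutoff[OF S(1) op S(2)], rule that)
  obtain C1 where C1: "C1 \<ge> 0" "\<And>\<mu> e. weak_eigen \<Omega> \<mu> e \<Longrightarrow> \<mu> > 0 \<Longrightarrow>
    (\<integral>\<^sup>+x. ennreal ((cmod (comm_op \<beta> (\<lambda>x. \<zeta> x * e x) x))\<^sup>2) \<partial>lborel) \<le> ennreal ((C1 * \<mu> powr (1 - 1 / \<alpha>) * L2norm e)\<^sup>2)"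
    by (rule comm_op_interior[OF b z(2) less_imp_le[OF \<alpha>2]], rule that)
  obtain C2 where C2: "C2 \<ge> 0" "\<And>\<mu> e. weak_eigen \<Omega> \<mu> e \<Longrightarrow> \<mu> > 0 \<Longrightarrow> (AE x in lborel. x \<notin> \<Omega> \<longrightarrow> e x = 0) \<Longrightarrow>
    (\<integral>\<^sup>+x. ennreal ((cmod (comm_op \<beta> (\<lambda>x. (1 - \<zeta> x) * e x) x))\<^sup>2) \<partial>lborel) \<le> ennreal ((C2 * \<mu> powr (1 - 1 / \<alpha>) * L2norm e)\<^sup>2)"
    by (rule comm_op_boundary[OF \<alpha>2 C11 bd b S(1) _ z(2,1)]) (erule S(3), erule z(3), assumption, rule that)
  have zm [measurable]: "\<zeta> \<in> borel_measurable borel" by (rule test_function_measurable[OF z(2)])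
  show ?thesis
  proof (intro exI[of _ "2 * (C1 + C2)"] allI impI)
    fix \<mu> :: real and e :: "'a \<Rightarrow> complex"
    assume de: "dirichlet_eigenfunction \<alpha> \<Omega> \<mu> e"
    note we = dirichlet_eigenfunction_weak[OF de bd]
    note ei = weak_eigenD[OF we(1)]
    have em [measurable]: "e \<in> borel_measurable borel" by (rule ei)
    obtain M where M: "M > 0" "\<And>x. cmod (\<beta> x) \<le> M" using test_function_bounded[OF b] by blast
    have be: "square_integrable (\<lambda>x. \<beta> x * e x)"
      unfolding square_integrable_def
    proof
      show "integrable lborel (\<lambda>x. (cmod (\<beta> x * e x))\<^sup>2)"
      proof (rule Bochner_Integration.integrable_bound)
        show "integrable lborel (\<lambda>x. M\<^sup>2 * (cmod (e x))\<^sup>2)" using ei(2) by (simp add: square_integrable_def)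
        have "(cmod (\<beta> x))\<^sup>2 * (cmod (e x))\<^sup>2 \<le> M\<^sup>2 * (cmod (e x))\<^sup>2" for x
          by (intro mult_right_mono power_mono M(2)) auto
        thus "AE x in lborel. norm ((cmod (\<beta> x * e x))\<^sup>2) \<le> norm (M\<^sup>2 * (cmod (e x))\<^sup>2)"
          by (intro AE_I2) (simp add: norm_mult power_mult_distrib)
      qed measurable
    qed measurable
    have bae: "AE x in lborel. x \<notin> \<Omega> \<longrightarrow> \<beta> x * e x = 0" using we(2) by eventually_elim simp
    have com: "commutator \<beta> \<alpha> e \<phi> = (\<integral>x. e x * fracL \<alpha> (\<lambda>x. \<beta> x * \<phi> x) x \<partial>lborel) - (\<integral>x. (\<beta> x * e x) * fracL \<alpha> \<phi> x \<partial>lborel)"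
      if t: "test_function UNIV \<phi>" for \<phi>
    proof -
      have "test_function UNIV (\<lambda>x. \<beta> x * \<phi> x)" by (rule test_function_mult[OF t test_function_C_k[OF b]])
      thus ?thesis unfolding commutator_def smooth_mult_def
        using frac_laplacian_bounded_support[OF \<alpha>_pos \<alpha>_less_1 _ ei(2) bd we(2)] frac_laplacian_bounded_support[OF \<alpha>_pos \<alpha>_less_1 t be bd bae] by simp
    qed
    show "\<exists>g. square_integrable g \<and> agrees_on UNIV (commutator \<beta> \<alpha> e) g \<and> L2norm g \<le> 2 * (C1 + C2) * \<mu> powr (1 - 1 / \<alpha>) * L2norm e"
    proof (cases "\<mu> > 0")
      case True
      let ?A = "comm_op \<beta> (\<lambda>x. \<zeta> x * e x)" and ?B = "comm_op \<beta> (\<lambda>x. (1 - \<zeta> x) * e x)"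
      let ?P = "\<mu> powr (1 - 1 / \<alpha>) * L2norm e"
      let ?g = "\<lambda>x. ?A x + ?B x"
      have P0: "0 \<le> ?P" by (simp add: L2norm_nonneg)
      have i1: "integrable lborel (\<lambda>x. \<zeta> x * e x)" by (rule integrable_test_mult[OF z(2) ei(1)])
      have i2: "integrable lborel (\<lambda>x. (1 - \<zeta> x) * e x)"
        using Bochner_Integration.integrable_diff[OF ei(1) i1] by (simp add: algebra_simps)
      have Am [measurable]: "?A \<in> borel_measurable borel" by (rule comm_op_measurable) measurable
      have Bm [measurable]: "?B \<in> borel_measurable borel" by (rule comm_op_measurable) measurable
      have "(\<integral>\<^sup>+x. ennreal ((cmod (?g x))\<^sup>2) \<partial>lborel)
          \<le> (\<integral>\<^sup>+x. 2 * ennreal ((cmod (?A x))\<^sup>2) + 2 * ennreal ((cmod (?B x))\<^sup>2) \<partial>lborel)"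
      proof (intro nn_integral_mono)
        fix x
        have "(cmod (?g x))\<^sup>2 \<le> (cmod (?A x) + cmod (?B x))\<^sup>2" by (intro power_mono norm_triangle_ineq) simp
        also have "\<dots> \<le> 2 * (cmod (?A x))\<^sup>2 + 2 * (cmod (?B x))\<^sup>2"
          using sum_squares_bound[of "cmod (?A x)" "cmod (?B x)"] by (simp add: power2_sum)
        finally have "ennreal ((cmod (?g x))\<^sup>2) \<le> ennreal (2 * (cmod (?A x))\<^sup>2 + 2 * (cmod (?B x))\<^sup>2)" by (rule ennreal_leI)
        thus "ennreal ((cmod (?g x))\<^sup>2) \<le> 2 * ennreal ((cmod (?A x))\<^sup>2) + 2 * ennreal ((cmod (?B x))\<^sup>2)"
          by (simp add: ennreal_mult)
      qed
      also have "\<dots> = 2 * (\<integral>\<^sup>+x. ennreal ((cmod (?A x))\<^sup>2) \<partial>lborel) + 2 * (\<integral>\<^sup>+x. ennreal ((cmod (?B x))\<^sup>2) \<partial>lborel)"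
        by (simp add: nn_integral_add nn_integral_cmult)
      also have "\<dots> \<le> 2 * ennreal ((C1 * \<mu> powr (1 - 1 / \<alpha>) * L2norm e)\<^sup>2) + 2 * ennreal ((C2 * \<mu> powr (1 - 1 / \<alpha>) * L2norm e)\<^sup>2)"
        by (intro add_mono mult_left_mono C1(2)[OF we(1) True] C2(2)[OF we(1) True we(2)]) auto
      also have "\<dots> = ennreal (2 * (C1 * ?P)\<^sup>2 + 2 * (C2 * ?P)\<^sup>2)" by (simp add: ennreal_mult mult.assoc)
      also have "\<dots> \<le> ennreal ((2 * (C1 + C2) * ?P)\<^sup>2)"
      proof (rule ennreal_leI)
        have "0 \<le> C1 * C2" using C1(1) C2(1) by simp
        hence "2 * C1\<^sup>2 + 2 * C2\<^sup>2 \<le> (2 * (C1 + C2))\<^sup>2"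
          using zero_le_power2[of C1] zero_le_power2[of C2] by (simp add: power_mult_distrib power2_sum)
        hence "(2 * C1\<^sup>2 + 2 * C2\<^sup>2) * ?P\<^sup>2 \<le> (2 * (C1 + C2))\<^sup>2 * ?P\<^sup>2" by (rule mult_right_mono) simp
        thus "2 * (C1 * ?P)\<^sup>2 + 2 * (C2 * ?P)\<^sup>2 \<le> (2 * (C1 + C2) * ?P)\<^sup>2"
          unfolding power_mult_distrib[of C1] power_mult_distrib[of C2] power_mult_distrib[of "2 * (C1 + C2)"] by (simp only: ring_distribs mult.assoc)
      qed
      finally have B: "(\<integral>\<^sup>+x. ennreal ((cmod (?g x))\<^sup>2) \<partial>lborel) \<le> ennreal ((2 * (C1 + C2) * ?P)\<^sup>2)" .
      have gm: "?g \<in> borel_measurable borel" by measurable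
      have nn: "0 \<le> 2 * (C1 + C2) * ?P" using C1(1) C2(1) by (intro mult_nonneg_nonneg P0) auto
      note g = square_integrableI[OF gm B nn]
      have "commutator \<beta> \<alpha> e \<phi> = (\<integral>x. ?g x * \<phi> x \<partial>lborel)" if t: "test_function UNIV \<phi>" for \<phi>
      proof -
        let ?L1 = "fracL \<alpha> (\<lambda>x. \<beta> x * \<phi> x)" and ?L2 = "fracL \<alpha> \<phi>"
        have bt: "test_function UNIV (\<lambda>x. \<beta> x * \<phi> x)" by (rule test_function_mult[OF t test_function_C_k[OF b]])
        obtain N where N: "\<And>x. cmod (\<phi> x) \<le> N" using test_function_bounded[OF t] by blast
        have \<phi>m: "\<phi> \<in> borel_measurable lborel" using test_function_measurable[OF t] by simp
        have "(\<integral>x. ?g x * \<phi> x \<partial>lborel) = (\<integral>x. ?A x * \<phi> x + ?B x * \<phi> x \<partial>lborel)" by (simp add: distrib_right)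
        also have "\<dots> = (\<integral>x. ?A x * \<phi> x \<partial>lborel) + (\<integral>x. ?B x * \<phi> x \<partial>lborel)"
        proof (rule Bochner_Integration.integral_add)
          have \<beta>0: "\<And>x. cmod (\<beta> x) \<le> M" by (rule M)
          show "integrable lborel (\<lambda>x. ?A x * \<phi> x)"
            by (rule integrable_mult_bounded[OF comm_op_pairing(2)[OF b i1 bm \<beta>0] \<phi>m N])
          show "integrable lborel (\<lambda>x. ?B x * \<phi> x)"
            by (rule integrable_mult_bounded[OF comm_op_pairing(2)[OF b i2 bm \<beta>0] \<phi>m N])
        qed
        also have "\<dots> = ((\<integral>x. \<zeta> x * e x * ?L1 x \<partial>lborel) + (\<integral>x. (1 - \<zeta> x) * e x * ?L1 x \<partial>lborel))
           - ((\<integral>x. \<beta> x * (\<zeta> x * e x) * ?L2 x \<partial>lborel) + (\<integral>x. \<beta> x * ((1 - \<zeta> x) * e x) * ?L2 x \<partial>lborel))"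
          unfolding comm_op_agrees[OF b t i1] comm_op_agrees[OF b t i2] by simp
        also have "(\<integral>x. \<zeta> x * e x * ?L1 x \<partial>lborel) + (\<integral>x. (1 - \<zeta> x) * e x * ?L1 x \<partial>lborel) = (\<integral>x. e x * ?L1 x \<partial>lborel)"
          using Bochner_Integration.integral_add[OF integrable_mult_fracL[OF \<alpha>_pos \<alpha>_less_1 bt i1] integrable_mult_fracL[OF \<alpha>_pos \<alpha>_less_1 bt i2]]
          by (simp add: algebra_simps)
        also have "(\<integral>x. \<beta> x * (\<zeta> x * e x) * ?L2 x \<partial>lborel) + (\<integral>x. \<beta> x * ((1 - \<zeta> x) * e x) * ?L2 x \<partial>lborel) = (\<integral>x. (\<beta> x * e x) * ?L2 x \<partial>lborel)"
          using Bochner_Integration.integral_add[OF integrable_mult_fracL[OF \<alpha>_pos \<alpha>_less_1 t integrable_test_mult[OF b i1]]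
             integrable_mult_fracL[OF \<alpha>_pos \<alpha>_less_1 t integrable_test_mult[OF b i2]]]
          by (simp add: algebra_simps)
        finally show ?thesis unfolding com[OF t] by simp
      qed
      thus ?thesis using g by (intro exI[of _ ?g]) (simp add: agrees_on_def mult.assoc)
    next
      case False
      have e0: "AE x in lborel. e x = 0"
        by (rule weak_eigen_nonpos[OF C11 bd we(1) _ we(2,3)]) (use False in simp)
      have z0: "(\<integral>x. h x \<partial>lborel) = 0" if "AE x in lborel. h x = 0" for h :: "'a \<Rightarrow> complex"
        by (rule integral_eq_zero_AE[OF that])
      have "commutator \<beta> \<alpha> e \<phi> = 0" if t: "test_function UNIV \<phi>" for \<phi>
        unfolding com[OF t] using e0 by (subst (1 2) z0) auto
      moreover have "0 \<le> 2 * (C1 + C2) * \<mu> powr (1 - 1 / \<alpha>) * L2norm e"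
        using C1(1) C2(1) by (intro mult_nonneg_nonneg L2norm_nonneg) auto
      ultimately show ?thesis
        by (intro exI[of _ "\<lambda>x. 0"]) (simp add: square_integrable_def agrees_on_def L2norm_def)
    qed
  qed
qed

theorem theorem5:
  fixes \<Omega> K\<^sub>1 N :: "(real ^ 'd) set" and \<beta> :: "real ^ 'd \<Rightarrow> complex" and \<alpha> :: real
  assumes "1 / 2 < \<alpha>" and "\<alpha> < 1"
    and "C11_domain \<Omega>" and "bounded \<Omega>"
    and "compact K\<^sub>1" and "K\<^sub>1 \<subseteq> \<Omega>"
    and "test_function \<Omega> \<beta>"
    and "\<forall>x\<in>K\<^sub>1. \<beta> x = 1"
    and "open N" and "K\<^sub>1 \<subseteq> N" and "N \<subseteq> \<Omega>" and "\<forall>x. x \<notin> N \<longrightarrow> \<beta> x = 0"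
  shows "\<exists>C::real. \<forall>(\<mu>::real) (e :: real ^ 'd \<Rightarrow> complex).
           dirichlet_eigenfunction \<alpha> \<Omega> \<mu> e \<longrightarrow>
           (\<exists>g. square_integrable g \<and> agrees_on UNIV (commutator \<beta> \<alpha> e) g \<and>
                L2norm g \<le> C * \<mu> powr (1 - 1 / \<alpha>) * L2norm e)"
proof -
  have a: "0 < \<alpha>" using assms(1) by simp
  obtain c where c: "c > 0" "\<And>\<xi> :: real ^ 'd.
    (\<integral>h. (1 - cis (h \<bullet> \<xi>)) * of_real (c * norm h powr (- (real DIM(real ^ 'd) + \<alpha>))) \<partial>lborel) = of_real (norm \<xi> powr \<alpha>)"
    by (rule fractional_symbol[OF a assms(2)], rule that)
  interpret frac_kernel \<alpha> c "\<lambda>h :: real ^ 'd. c * norm h powr (- (real DIM(real ^ 'd) + \<alpha>))"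
    by (rule frac_kernel.intro[OF a assms(2) c(1) refl c(2)])
  show ?thesis by (rule commutator_estimate[OF assms(1,3,4,7)])
qed

end
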